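(* Let $G$ be a sofic group with sofic approximation $\Sigma$, and let $G$ act freely by simplicial automorphisms on a simplicial complex $L$. Let $\mathbb{K}$ be a finite field and let $\delta^i:C^{i-1}(L,\mathbb{K})\to C^i(L,\mathbb{K})$ be the coboundary map. Let $p\ge1$ and suppose the action of $G$ on the $p$-skeleton of $L$ is cocompact. If $\mathrm{Im}(\delta^p)=\ker(\delta^{p+1})$, or equivalently $H^p(L,\mathbb{K})=0$, then $$h^\Sigma_{\mathrm{top}}(G\curvearrowright C^{p-1}(L,\mathbb{K}))+\beta^p_{(2)}(L:G)\cdot\log|\mathbb{K}|\le h^\Sigma_{\mathrm{top}}(G\curvearrowright\ker(\delta^p))+h^\Sigma_{\mathrm{top}}(G\curvearrowright\mathrm{Im}(\delta^p)).$$
   Context: Cochains: $C^i(L,\mathbb{K})$ is the group of all simplicial $i$-cochains of $L$ with coefficients in $\mathbb{K}$, with the topology of pointwise convergence ($\mathbb{K}$ discrete) and the natural $G$-action; $\ker(\delta^p)\subseteq C^{p-1}(L,\mathbb{K})$ and $\mathrm{Im}(\delta^p)\subseteq C^p(L,\mathbb{K})$ are closed $G$-invariant subgroups. The action on $L$ is free in the sense that it is free on the geometric realization (no nontrivial element maps a simplex to itself). Sofic approximation: A sofic approximation to a countable group $G$ is a sequence $\Sigma=(\sigma_n:G\to\mathrm{Sym}(D_n))$ of maps (not necessarily homomorphisms), $D_n$ finite sets with $|D_n|\to\infty$, $\sigma_n(1_G)=\mathrm{id}$, such that $|\{i\in D_n:\sigma_n(g)(i)\ne i\}|/|D_n|\to1$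 for all $g\ne1_G$, and $|\{i\in D_n:\sigma_n(g)\circ\sigma_n(h)(i)=\sigma_n(gh)(i)\}|/|D_n|\to1$ for all $g,h\in G$. $G$ is sofic if it admits one. Topological sofic entropy: Let $G\curvearrowright X$ be a continuous action on a compact metrizable space. Let $\rho$ be a continuous pseudo-metric on $X$ that is generating (for $x\ne y$ there is $g\in G$ with $\rho(g\cdot x,g\cdot y)>0$). For $\phi,\phi':D_n\to X$ let $\rho_2(\phi,\phi')=\bigl(\frac1{|D_n|}\sum_{i}\rho(\phi(i),\phi'(i))^2\bigr)^{1/2}$ and $\rho_\infty(\phi,\phi')=\max_i\rho(\phi(i),\phi'(i))$. For finite $F\subseteq G$, $\delta>0$ let $\mathrm{Map}(\rho,F,\delta,\sigma_n)=\{\phi:D_n\to X:\rho_2(\phi\circ\sigma_n(f),f\cdot\phi)<\delta\ \forall f\in F\}$, and let $N_\kappa(\cdot,\rho_\infty)$ be the maximum cardinality of a subset whose distinct elements satisfy $\rho_\infty(\phi,\phi')\ge\kappa$. Then $$h^\Sigma_{\mathrm{top}}(G\curvearrowright X)=\sup_{\kappa>0}\inf_{\delta>0}\inf_{F}\limsup_{n\to\infty}\frac1{|D_n|}\log N_\kappa(\mathrm{Map}(\rho,F,\delta,\sigma_n),\rho_\infty)$$ ($F$ ranging over finite subsets of $G$, $\log 0=-\infty$); this is independent of $\rho$. $\ell^2$-Betti numbers of an action: If $G$ acts freely and cocompactly on a simplicial complex $L$, let $C^p_{(2)}(L)$ be the Hilbert space of square-summable complex $p$-cochains, $\delta^{p+1}_{(2)}:C^p_{(2)}(L)\to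 C^{p+1}_{(2)}(L)$ the coboundary operator, $\overline H^p_{(2)}(L)=\ker\delta^{p+1}_{(2)}/\overline{\mathrm{Im}\,\delta^p_{(2)}}$, and $\beta^p_{(2)}(L:G)=\dim_G\overline H^p_{(2)}(L)$ (von Neumann dimension). For a free, not necessarily cocompact action write $L=\bigcup_iL_i$ as an increasing union of a sequence of $G$-invariant cocompact subcomplexes and set $\beta^p_{(2)}(L:G)=\lim_{i}\lim_{j\ge i}\dim_G\overline{\mathrm{Im}}(\overline H^p_{(2)}(L_j)\to\overline H^p_{(2)}(L_i))$ (maps induced by restriction of cochains; increasing limit in $i$ of decreasing limits in $j$; independent of the exhaustion). *)

theory Defs
  imports
    "HOL-Analysis.Analysis"
    "HOL-Algebra.Group_Action"
    "HOL-Combinatorics.Permutations"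
begin

section \<open>Sofic approximations and topological sofic entropy\<close>

definition sofic_approximation ::
  "('g, 'm) monoid_scheme \<Rightarrow> (nat \<Rightarrow> 'd set) \<Rightarrow> (nat \<Rightarrow> 'g \<Rightarrow> 'd \<Rightarrow> 'd) \<Rightarrow> bool" where
  "sofic_approximation G D \<sigma> \<longleftrightarrow>
     (\<forall>n. finite (D n)) \<and>
     filterlim (\<lambda>n. card (D n)) at_top sequentially \<and>
     (\<forall>n. \<forall>g \<in> carrier G. \<sigma> n g permutes D n) \<and>
     (\<forall>n. \<sigma> n \<one>\<^bsub>G\<^esub> = id) \<and>
     (\<forall>g \<in> carrier G. g \<noteq> \<one>\<^bsub>G\<^esub> \<longrightarrow>
        (\<lambda>n. real (card {i \<in> D n. \<sigma> n g i \<noteq> i}) / real (card (D n))) \<longlonglongrightarrow> 1) \<and>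
     (\<forall>g \<in> carrier G. \<forall>h \<in> carrier G.
        (\<lambda>n. real (card {i \<in> D n. \<sigma> n g (\<sigma> n h i) = \<sigma> n (g \<otimes>\<^bsub>G\<^esub> h) i}) / real (card (D n)))
          \<longlonglongrightarrow> 1)"

definition generating_pseudometric ::
  "('g, 'm) monoid_scheme \<Rightarrow> 'x topology \<Rightarrow> ('g \<Rightarrow> 'x \<Rightarrow> 'x) \<Rightarrow> ('x \<Rightarrow> 'x \<Rightarrow> real) \<Rightarrow> bool" where
  "generating_pseudometric G X \<alpha> \<rho> \<longleftrightarrow>
     (\<forall>x \<in> topspace X. \<rho> x x = 0) \<and>
     (\<forall>x \<in> topspace X. \<forall>y \<in> topspace X. 0 \<le> \<rho> x y \<and> \<rho> x y = \<rho> y x) \<and>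
     (\<forall>x \<in> topspace X. \<forall>y \<in> topspace X. \<forall>z \<in> topspace X. \<rho> x z \<le> \<rho> x y + \<rho> y z) \<and>
     continuous_map (prod_topology X X) euclideanreal (\<lambda>(x, y). \<rho> x y) \<and>
     (\<forall>x \<in> topspace X. \<forall>y \<in> topspace X. x \<noteq> y \<longrightarrow> (\<exists>g \<in> carrier G. \<rho> (\<alpha> g x) (\<alpha> g y) > 0))"

definition rho_2 :: "('x \<Rightarrow> 'x \<Rightarrow> real) \<Rightarrow> 'd set \<Rightarrow> ('d \<Rightarrow> 'x) \<Rightarrow> ('d \<Rightarrow> 'x) \<Rightarrow> real" where
  "rho_2 \<rho> A \<phi> \<psi> = sqrt ((\<Sum>i\<in>A. (\<rho> (\<phi> i) (\<psi> i))\<^sup>2) / real (card A))"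

definition rho_inf :: "('x \<Rightarrow> 'x \<Rightarrow> real) \<Rightarrow> 'd set \<Rightarrow> ('d \<Rightarrow> 'x) \<Rightarrow> ('d \<Rightarrow> 'x) \<Rightarrow> real" where
  "rho_inf \<rho> A \<phi> \<psi> = Max ((\<lambda>i. \<rho> (\<phi> i) (\<psi> i)) ` A)"

text \<open>Maps \<open>A \<rightarrow> X\<close> are extensional, so that distinct elements differ at a point of \<open>A\<close>; \<open>s\<close> is
  a single stage \<open>\<sigma> n\<close> of a sofic approximation.\<close>

definition approx_equivariant_maps ::
  "'x topology \<Rightarrow> ('g \<Rightarrow> 'x \<Rightarrow> 'x) \<Rightarrow> ('x \<Rightarrow> 'x \<Rightarrow> real) \<Rightarrow> 'g set \<Rightarrow> real \<Rightarrow>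
   'd set \<Rightarrow> ('g \<Rightarrow> 'd \<Rightarrow> 'd) \<Rightarrow> ('d \<Rightarrow> 'x) set" where
  "approx_equivariant_maps X \<alpha> \<rho> F \<delta> A s =
     {\<phi> \<in> A \<rightarrow>\<^sub>E topspace X. \<forall>f \<in> F. rho_2 \<rho> A (\<lambda>i. \<phi> (s f i)) (\<lambda>i. \<alpha> f (\<phi> i)) < \<delta>}"

definition separation_number :: "real \<Rightarrow> ('y \<Rightarrow> 'y \<Rightarrow> real) \<Rightarrow> 'y set \<Rightarrow> enat" where
  "separation_number \<kappa> d M =
     (SUP S \<in> {S. finite S \<and> S \<subseteq> M \<and> pairwise (\<lambda>x y. d x y \<ge> \<kappa>) S}. enat (card S))"

definition log_enat :: "enat \<Rightarrow> ereal" where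
  "log_enat N = (case N of enat m \<Rightarrow> if m = 0 then -\<infinity> else ereal (ln (real m)) | \<infinity> \<Rightarrow> \<infinity>)"

definition sofic_entropy_wrt ::
  "('x \<Rightarrow> 'x \<Rightarrow> real) \<Rightarrow> ('g, 'm) monoid_scheme \<Rightarrow> (nat \<Rightarrow> 'd set) \<Rightarrow> (nat \<Rightarrow> 'g \<Rightarrow> 'd \<Rightarrow> 'd) \<Rightarrow>
   'x topology \<Rightarrow> ('g \<Rightarrow> 'x \<Rightarrow> 'x) \<Rightarrow> ereal" where
  "sofic_entropy_wrt \<rho> G D \<sigma> X \<alpha> =
     (SUP \<kappa> \<in> {0<..}. INF \<delta> \<in> {0<..}. INF F \<in> {F. finite F \<and> F \<subseteq> carrier G}.
        limsup (\<lambda>n. log_enat (separation_number \<kappa> (rho_inf \<rho> (D n))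
                       (approx_equivariant_maps X \<alpha> \<rho> F \<delta> (D n) (\<sigma> n)))
                     / ereal (real (card (D n)))))"

text \<open>For a continuous action on a compact metrizable space the value does not depend on the
  choice of the continuous generating pseudo-metric.\<close>

definition sofic_entropy ::
  "('g, 'm) monoid_scheme \<Rightarrow> (nat \<Rightarrow> 'd set) \<Rightarrow> (nat \<Rightarrow> 'g \<Rightarrow> 'd \<Rightarrow> 'd) \<Rightarrow>
   'x topology \<Rightarrow> ('g \<Rightarrow> 'x \<Rightarrow> 'x) \<Rightarrow> ereal" where
  "sofic_entropy G D \<sigma> X \<alpha> =
     sofic_entropy_wrt (SOME \<rho>. generating_pseudometric G X \<alpha> \<rho>) G D \<sigma> X \<alpha>"


section \<open>Free simplicial actions\<close>

text \<open>A complex is given by its set of nonempty simplices; its vertex set is the union of these.\<close>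

definition abstract_complex :: "'v set set \<Rightarrow> bool" where
  "abstract_complex L \<longleftrightarrow>
     (\<forall>s \<in> L. finite s \<and> s \<noteq> {}) \<and> (\<forall>s \<in> L. \<forall>t. t \<subseteq> s \<and> t \<noteq> {} \<longrightarrow> t \<in> L)"

definition skeleton :: "nat \<Rightarrow> 'v set set \<Rightarrow> 'v set set" where
  "skeleton p L = {s \<in> L. card s \<le> p + 1}"

text \<open>Freeness is freeness on the geometric realization: no nontrivial group element maps a simplex
  onto itself.\<close>

definition free_simplicial_action ::
  "('g, 'm) monoid_scheme \<Rightarrow> 'v set set \<Rightarrow> ('g \<Rightarrow> 'v \<Rightarrow> 'v) \<Rightarrow> bool" where
  "free_simplicial_action G L act \<longleftrightarrow>
     abstract_complex L \<and> group_action G (\<Union>L) act \<and>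
     (\<forall>g \<in> carrier G. \<forall>s \<in> L. act g ` s \<in> L) \<and>
     (\<forall>g \<in> carrier G. \<forall>s \<in> L. g \<noteq> \<one>\<^bsub>G\<^esub> \<longrightarrow> act g ` s \<noteq> s)"

definition cocompact_on ::
  "('g, 'm) monoid_scheme \<Rightarrow> 'v set set \<Rightarrow> ('g \<Rightarrow> 'v \<Rightarrow> 'v) \<Rightarrow> bool" where
  "cocompact_on G L act \<longleftrightarrow> (\<exists>T. finite T \<and> T \<subseteq> L \<and> L = (\<Union>g \<in> carrier G. (\<lambda>s. act g ` s) ` T))"


section \<open>Cochains\<close>

definition ordered_simplices :: "'v set set \<Rightarrow> nat \<Rightarrow> 'v list set" where
  "ordered_simplices L p = {xs. length xs = p + 1 \<and> distinct xs \<and> set xs \<in> L}"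

text \<open>A \<open>p\<close>-cochain is an alternating function of ordered \<open>p\<close>-simplices, extended by \<open>0\<close>.\<close>

definition cochains :: "'v set set \<Rightarrow> nat \<Rightarrow> ('v list \<Rightarrow> 'k::comm_ring_1) set" where
  "cochains L p =
     {f. (\<forall>xs. xs \<notin> ordered_simplices L p \<longrightarrow> f xs = 0) \<and>
         (\<forall>xs \<in> ordered_simplices L p. \<forall>\<pi>. \<pi> permutes {..<length xs} \<longrightarrow>
            f (permute_list \<pi> xs) = of_int (sign \<pi>) * f xs)}"

text \<open>The map \<open>coboundary L i\<close> goes from degree \<open>i - 1\<close> to degree \<open>i\<close>. For \<open>i = 0\<close> the truncated
  subtraction makes it a map on \<open>C\<^sup>0\<close>, but there it vanishes, since cochains are \<open>0\<close> on the empty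
  list; hence \<open>im_coboundary L 0\<close> is \<open>{0}\<close>, as it should be.\<close>

definition coboundary :: "'v set set \<Rightarrow> nat \<Rightarrow> ('v list \<Rightarrow> 'k::comm_ring_1) \<Rightarrow> 'v list \<Rightarrow> 'k" where
  "coboundary L i f =
     (\<lambda>xs. if xs \<in> ordered_simplices L i
           then \<Sum>j<length xs. (-1) ^ j * f (take j xs @ drop (Suc j) xs) else 0)"

definition ker_coboundary :: "'v set set \<Rightarrow> nat \<Rightarrow> ('v list \<Rightarrow> 'k::comm_ring_1) set" where
  "ker_coboundary L i = {f \<in> cochains L (i - 1). coboundary L i f = (\<lambda>_. 0)}"

definition im_coboundary :: "'v set set \<Rightarrow> nat \<Rightarrow> ('v list \<Rightarrow> 'k::comm_ring_1) set" where
  "im_coboundary L i = coboundary L i ` cochains L (i - 1)"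

definition cochain_action ::
  "('g, 'm) monoid_scheme \<Rightarrow> ('g \<Rightarrow> 'v \<Rightarrow> 'v) \<Rightarrow> 'v set set \<Rightarrow> nat \<Rightarrow>
   'g \<Rightarrow> ('v list \<Rightarrow> 'k::comm_ring_1) \<Rightarrow> 'v list \<Rightarrow> 'k" where
  "cochain_action G act L p g f =
     (\<lambda>xs. if xs \<in> ordered_simplices L p then f (map (act (inv\<^bsub>G\<^esub> g)) xs) else 0)"

definition pointwise_topology :: "('b \<Rightarrow> 'k) set \<Rightarrow> ('b \<Rightarrow> 'k) topology" where
  "pointwise_topology S = subtopology (product_topology (\<lambda>_. discrete_topology UNIV) UNIV) S"


section \<open>Hilbert modules and von Neumann dimension\<close>

text \<open>A complex Hilbert space with a linear isometric action of a group. Only the norm is recorded: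
  it determines the inner product, and linear isometries preserve inner products.\<close>

record ('g, 'h) hilbert_module =
  hcarrier :: "'h set"
  hadd :: "'h \<Rightarrow> 'h \<Rightarrow> 'h"
  hscale :: "complex \<Rightarrow> 'h \<Rightarrow> 'h"
  hnorm :: "'h \<Rightarrow> real"
  hact :: "'g \<Rightarrow> 'h \<Rightarrow> 'h"

definition hsub :: "('g, 'h) hilbert_module \<Rightarrow> 'h set \<Rightarrow> ('g, 'h) hilbert_module" where
  "hsub H S = H\<lparr>hcarrier := S\<rparr>"

definition hclosure :: "('g, 'h) hilbert_module \<Rightarrow> 'h set \<Rightarrow> 'h set" where
  "hclosure H S = {x \<in> hcarrier H. \<forall>e>0. \<exists>y \<in> S. hnorm H (hadd H x (hscale H (-1) y)) < e}"

text \<open>The quotient by a closed invariant subspace, with the quotient norm. In \<open>hscale\<close> the subspace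
  \<open>B\<close> is added so that the scalar \<open>0\<close> yields the zero coset \<open>B\<close> and not \<open>{0}\<close>.\<close>

definition hquot :: "('g, 'h) hilbert_module \<Rightarrow> 'h set \<Rightarrow> ('g, 'h set) hilbert_module" where
  "hquot H B =
     \<lparr> hcarrier = (\<lambda>x. hadd H x ` B) ` hcarrier H,
       hadd = (\<lambda>X Y. {hadd H x y | x y. x \<in> X \<and> y \<in> Y}),
       hscale = (\<lambda>c X. {hadd H (hscale H c x) b | x b. x \<in> X \<and> b \<in> B}),
       hnorm = (\<lambda>X. Inf (hnorm H ` X)),
       hact = (\<lambda>g X. hact H g ` X) \<rparr>"

definition square_summable :: "('b \<Rightarrow> complex) \<Rightarrow> bool" where
  "square_summable f \<longleftrightarrow> (\<lambda>x. (cmod (f x))\<^sup>2) summable_on UNIV"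

definition l2_inner :: "('b \<Rightarrow> complex) \<Rightarrow> ('b \<Rightarrow> complex) \<Rightarrow> complex" where
  "l2_inner f g = (\<Sum>\<^sub>\<infinity>x. f x * cnj (g x))"

text \<open>The Hilbert sum of countably many copies of \<open>\<ell>\<^sup>2(G)\<close>, realized as \<open>\<ell>\<^sup>2(G \<times> \<nat>)\<close>, with the left
  regular representation.\<close>

definition regular_module ::
  "('g, 'm) monoid_scheme \<Rightarrow> ('g, 'g \<times> nat \<Rightarrow> complex) hilbert_module" where
  "regular_module G =
     \<lparr> hcarrier = {f. square_summable f \<and> (\<forall>h i. h \<notin> carrier G \<longrightarrow> f (h, i) = 0)},
       hadd = (\<lambda>f g x. f x + g x),
       hscale = (\<lambda>c f x. c * f x),
       hnorm = (\<lambda>f. sqrt (\<Sum>\<^sub>\<infinity>x. (cmod (f x))\<^sup>2)),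
       hact = (\<lambda>g f (h, i). if h \<in> carrier G then f (inv\<^bsub>G\<^esub> g \<otimes>\<^bsub>G\<^esub> h, i) else 0) \<rparr>"

definition equivariant_isometry ::
  "('g, 'm) monoid_scheme \<Rightarrow> ('g, 'h) hilbert_module \<Rightarrow> ('g, 'h2) hilbert_module \<Rightarrow>
   ('h \<Rightarrow> 'h2) \<Rightarrow> bool" where
  "equivariant_isometry G H H' J \<longleftrightarrow>
     J \<in> hcarrier H \<rightarrow> hcarrier H' \<and>
     (\<forall>x \<in> hcarrier H. \<forall>y \<in> hcarrier H. J (hadd H x y) = hadd H' (J x) (J y)) \<and>
     (\<forall>c. \<forall>x \<in> hcarrier H. J (hscale H c x) = hscale H' c (J x)) \<and>
     (\<forall>x \<in> hcarrier H. hnorm H' (J x) = hnorm H x) \<and>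
     (\<forall>g \<in> carrier G. \<forall>x \<in> hcarrier H. J (hact H g x) = hact H' g (J x))"

definition l2_proj :: "('b \<Rightarrow> complex) set \<Rightarrow> ('b \<Rightarrow> complex) \<Rightarrow> 'b \<Rightarrow> complex" where
  "l2_proj M e = (THE y. y \<in> M \<and> (\<forall>z \<in> M. l2_inner (\<lambda>x. e x - y x) z = 0))"

text \<open>The von Neumann trace of the orthogonal projection onto a closed invariant subspace of
  \<open>regular_module G\<close>.\<close>

definition projection_trace :: "('g, 'm) monoid_scheme \<Rightarrow> ('g \<times> nat \<Rightarrow> complex) set \<Rightarrow> ereal" where
  "projection_trace G M =
     (\<Sum>i. let e = (\<lambda>x. if x = (\<one>\<^bsub>G\<^esub>, i) then 1 else 0) in ereal (Re (l2_inner (l2_proj M e) e)))"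

text \<open>The dimension of a Hilbert module that embeds into \<open>regular_module G\<close>; the trace does not
  depend on the embedding.\<close>

definition vn_dim :: "('g, 'm) monoid_scheme \<Rightarrow> ('g, 'h) hilbert_module \<Rightarrow> ereal" where
  "vn_dim G H =
     projection_trace G ((SOME J. equivariant_isometry G H (regular_module G) J) ` hcarrier H)"


section \<open>\<open>\<ell>\<^sup>2\<close>-Betti numbers\<close>

text \<open>In the norm each simplex is counted once, while it has \<open>(p + 1)!\<close> orderings.\<close>

definition l2_cochains ::
  "('g, 'm) monoid_scheme \<Rightarrow> ('g \<Rightarrow> 'v \<Rightarrow> 'v) \<Rightarrow> 'v set set \<Rightarrow> nat \<Rightarrow>
   ('g, 'v list \<Rightarrow> complex) hilbert_module" where
  "l2_cochains G act L p =
     \<lparr> hcarrier = {f \<in> cochains L p. square_summable f},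
       hadd = (\<lambda>f g x. f x + g x),
       hscale = (\<lambda>c f x. c * f x),
       hnorm = (\<lambda>f. sqrt ((\<Sum>\<^sub>\<infinity>x. (cmod (f x))\<^sup>2) / fact (p + 1))),
       hact = cochain_action G act L p \<rparr>"

definition l2_cocycles ::
  "('g, 'm) monoid_scheme \<Rightarrow> ('g \<Rightarrow> 'v \<Rightarrow> 'v) \<Rightarrow> 'v set set \<Rightarrow> nat \<Rightarrow> ('v list \<Rightarrow> complex) set" where
  "l2_cocycles G act L p =
     {f \<in> hcarrier (l2_cochains G act L p). coboundary L (p + 1) f = (\<lambda>_. 0)}"

definition l2_coboundaries_closure ::
  "('g, 'm) monoid_scheme \<Rightarrow> ('g \<Rightarrow> 'v \<Rightarrow> 'v) \<Rightarrow> 'v set set \<Rightarrow> nat \<Rightarrow> ('v list \<Rightarrow> complex) set" where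
  "l2_coboundaries_closure G act L p =
     hclosure (l2_cochains G act L p) (coboundary L p ` hcarrier (l2_cochains G act L (p - 1)))"

definition reduced_l2_cohomology ::
  "('g, 'm) monoid_scheme \<Rightarrow> ('g \<Rightarrow> 'v \<Rightarrow> 'v) \<Rightarrow> 'v set set \<Rightarrow> nat \<Rightarrow>
   ('g, ('v list \<Rightarrow> complex) set) hilbert_module" where
  "reduced_l2_cohomology G act L p =
     hquot (hsub (l2_cochains G act L p) (l2_cocycles G act L p)) (l2_coboundaries_closure G act L p)"

definition restrict_cochain ::
  "'v set set \<Rightarrow> nat \<Rightarrow> ('v list \<Rightarrow> complex) \<Rightarrow> 'v list \<Rightarrow> complex" where
  "restrict_cochain L p f = (\<lambda>xs. if xs \<in> ordered_simplices L p then f xs else 0)"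

text \<open>The map to the reduced cohomology of a subcomplex \<open>L'\<close> induced by restriction of cochains: a
  coset is sent to the coset spanned by the restrictions of its elements.\<close>

definition l2_restriction ::
  "('g, 'm) monoid_scheme \<Rightarrow> ('g \<Rightarrow> 'v \<Rightarrow> 'v) \<Rightarrow> 'v set set \<Rightarrow> nat \<Rightarrow>
   ('v list \<Rightarrow> complex) set \<Rightarrow> ('v list \<Rightarrow> complex) set" where
  "l2_restriction G act L' p X =
     {(\<lambda>xs. restrict_cochain L' p f xs + b xs) | f b.
        f \<in> X \<and> b \<in> l2_coboundaries_closure G act L' p}"

definition l2_restriction_image ::
  "('g, 'm) monoid_scheme \<Rightarrow> ('g \<Rightarrow> 'v \<Rightarrow> 'v) \<Rightarrow> nat \<Rightarrow> 'v set set \<Rightarrow> 'v set set \<Rightarrow>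
   ('g, ('v list \<Rightarrow> complex) set) hilbert_module" where
  "l2_restriction_image G act p L L' =
     (let H' = reduced_l2_cohomology G act L' p in
      hsub H' (hclosure H' (l2_restriction G act L' p ` hcarrier (reduced_l2_cohomology G act L p))))"

definition cocompact_exhaustion ::
  "('g, 'm) monoid_scheme \<Rightarrow> 'v set set \<Rightarrow> ('g \<Rightarrow> 'v \<Rightarrow> 'v) \<Rightarrow> (nat \<Rightarrow> 'v set set) \<Rightarrow> bool" where
  "cocompact_exhaustion G L act E \<longleftrightarrow>
     (\<forall>i. abstract_complex (E i) \<and> E i \<subseteq> L \<and>
          (\<forall>g \<in> carrier G. \<forall>s \<in> E i. act g ` s \<in> E i) \<and> cocompact_on G (E i) act) \<and>
     incseq E \<and> (\<Union>i. E i) = L"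

text \<open>The inner limit ignores the finitely many \<open>j < i\<close>, for which there is no restriction map. The
  value does not depend on the exhaustion. If the action on \<open>L\<close> is cocompact, every exhaustion is
  eventually constant, and the value is the dimension of the reduced cohomology of \<open>L\<close>.\<close>

definition l2_betti ::
  "('g, 'm) monoid_scheme \<Rightarrow> 'v set set \<Rightarrow> ('g \<Rightarrow> 'v \<Rightarrow> 'v) \<Rightarrow> nat \<Rightarrow> ereal" where
  "l2_betti G L act p =
     (let E = (SOME E. cocompact_exhaustion G L act E) in
      lim (\<lambda>i. lim (\<lambda>j. vn_dim G (l2_restriction_image G act p (E j) (E i)))))"

end

theory Submission
  imports Defs "Jordan_Normal_Form.Spectral_Radius"
begin

text \<open>Let \<open>m\<close> and \<open>m'\<close> be the numbers of \<open>G\<close>-orbits of simplices of dimensions \<open>p - 1\<close> and \<open>p\<close>. Choosing a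
representative of each orbit, a cochain of degree \<open>p - 1\<close> or \<open>p\<close> becomes a function on \<open>G \<times> {..<m}\<close> or
\<open>G \<times> {..<m'}\<close>, and coboundary maps become matrices over the integral group ring (\<open>gop_crd\<close>). The
theorem follows from three bounds; entropies are measured in units of \<open>ln CARD('k)\<close>.

(1) The entropy of the cochains is at most \<open>m\<close>: an approximately equivariant map is determined, up to
few errors, by the \<open>m\<close> values of its cochains on the representatives (\<open>entropy_upper_bound\<close>).

(2) Replacing group elements by permutations of \<open>D n\<close> turns a coboundary matrix into a finite integral
matrix, its sofic model. Away from few points, kernel vectors of the model over \<open>'k\<close> pull back to functions
that satisfy any given finite set of cocycle equations. By compactness they can then be corrected to cocycles, so
the nullity of the model over \<open>'k\<close> bounds the entropy of \<open>ker \<delta>\<close> from below (\<open>entropy_lower_bound\<close>).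

(3) The rank over \<open>'k\<close> of an integral matrix \<open>X\<close> is at most its rank over the reals, and for \<open>\<parallel>X\<parallel>\<^sup>2 \<le> R\<close> the
latter is read off from the trace of \<open>(1 - X\<^sup>T X / R)^N\<close>: this counts the kernel exactly, and the positive
eigenvalues contribute little, since they have product at least \<open>1\<close> and hence few of them are small.
This is the argument of Lueck's approximation theorem (\<open>damped_trace_le\<close>). Traces of powers are local, so for models they
converge to traces over the group ring (\<open>trace_lower_bound\<close>).

It remains to compare group traces with the Betti number. Let \<open>d\<close>, \<open>d'\<close> be the coboundary matrices into and out of
degree \<open>p\<close>. A harmonic cochain is fixed by every power of \<open>1 - d d\<^sup>* / R - d'\<^sup>* d' / R\<close>. As
\<open>d' d = 0\<close>, that power plus the identity is the sum of the damped powers of the two summands, so the dimension of the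
harmonic cochains plus \<open>m'\<close> is at most the sum of the two traces (\<open>harmonic_trace_le\<close>). Reduced cohomology
is isometric to harmonic cochains, and since the action on the \<open>p\<close>-skeleton is cocompact, the Betti number is a decreasing limit of the
dimensions for finitely many orbits of \<open>(p + 1)\<close>-simplices (\<open>l2_betti_bound\<close>). So with
\<open>\<tau>\<^sub>1\<close> and \<open>\<tau>\<^sub>2\<close> the two traces, \<open>ker \<delta>\<^sup>p\<close> has entropy at least about \<open>m - (m' - \<tau>\<^sub>1)\<close>, the
kernel of \<open>\<delta>\<close> in degree \<open>p\<close>, which is \<open>im \<delta>\<^sup>p\<close> by exactness, at least about \<open>\<tau>\<^sub>2\<close>, and
\<open>\<tau>\<^sub>1 + \<tau>\<^sub>2 \<ge> \<beta> + m'\<close>. The errors vanish as the exponent \<open>N\<close> grows.\<close>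

section \<open>Spectra of integral matrices\<close>

lemma mat_mult_diag_sum:
  fixes A B :: "'a::comm_ring_1 mat"
  assumes "A \<in> carrier_mat n m" "B \<in> carrier_mat m k" "i < n" "j < k"
  shows "(A * B) $$ (i,j) = (\<Sum>l<m. A $$ (i,l) * B $$ (l,j))"
  using assms by (auto simp: scalar_prod_def lessThan_atLeast0)

lemma upper_triangular_mult:
  fixes A B :: "'a::comm_ring_1 mat"
  assumes A: "A \<in> carrier_mat n n" "upper_triangular A"
    and B: "B \<in> carrier_mat n n" "upper_triangular B"
  shows "upper_triangular (A * B)"
    and "i < n ==> (A * B) $$ (i,i) = A $$ (i,i) * B $$ (i,i)"
proof -
  show "upper_triangular (A * B)"
  proof
    fix i j assume ij: "j < i" "i < dim_row (A * B)"
    have "(A * B) $$ (i,j) = (\<Sum>l<n. A $$ (i,l) * B $$ (l,j))"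
      using ij mat_mult_diag_sum[OF A(1) B(1), of i j] A B by auto
    also have "... = 0"
    proof (intro sum.neutral ballI)
      fix l assume "l \<in> {..<n}"
      then show "A $$ (i,l) * B $$ (l,j) = 0"
	using ij A B upper_triangularD[OF A(2), of l i] upper_triangularD[OF B(2), of j l]
	by (cases "l < i") auto
    qed
    finally show "(A * B) $$ (i,j) = 0" .
  qed
  show "(A * B) $$ (i,i) = A $$ (i,i) * B $$ (i,i)" if i: "i < n"
  proof -
    have "(A * B) $$ (i,i) = (\<Sum>l<n. A $$ (i,l) * B $$ (l,i))"
      using i A B by (intro mat_mult_diag_sum) auto
    also have "... = (\<Sum>l<n. if l = i then A $$ (i,i) * B $$ (i,i) else 0)"
    proof (intro sum.cong refl)
      fix l assume "l \<in> {..<n}"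
      then show "A $$ (i,l) * B $$ (l,i) = (if l = i then A $$ (i,i) * B $$ (i,i) else 0)"
	using i A B upper_triangularD[OF A(2), of l i] upper_triangularD[OF B(2), of i l]
	by (cases "l < i"; cases "l = i") auto
    qed
    finally show ?thesis using i by simp
  qed
qed

lemma upper_triangular_pow:
  fixes A :: "'a::comm_ring_1 mat"
  assumes A: "A \<in> carrier_mat n n" "upper_triangular A"
  shows "upper_triangular (A ^\<^sub>m k) \<and> (\<forall>i<n. (A ^\<^sub>m k) $$ (i,i) = A $$ (i,i) ^ k)"
proof (induction k)
  case 0
  then show ?case using A by auto
next
  case (Suc k)
  have "A ^\<^sub>m k \<in> carrier_mat n n" using A by simp
  then show ?case
    using Suc upper_triangular_mult[of "A ^\<^sub>m k" n A] A by (auto simp: mult.commute)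
qed

lemma trace_similar:
  fixes B P Q :: "'a::comm_ring_1 mat"
  assumes B: "B \<in> carrier_mat n n" and P: "P \<in> carrier_mat n n" and Q: "Q \<in> carrier_mat n n"
    and QP: "Q * P = 1\<^sub>m n"
  shows "(\<Sum>i<n. (P * B * Q) $$ (i,i)) = (\<Sum>i<n. B $$ (i,i))"
proof -
  have "(\<Sum>i<n. (P * B * Q) $$ (i,i)) = (\<Sum>i<n. \<Sum>k<n. (\<Sum>j<n. P $$ (i,j) * B $$ (j,k)) * Q $$ (k,i))"
  proof (intro sum.cong refl)
    fix i assume i: "i \<in> {..<n}"
    have PB: "P * B \<in> carrier_mat n n" using P B by auto
    show "(P * B * Q) $$ (i,i) = (\<Sum>k<n. (\<Sum>j<n. P $$ (i,j) * B $$ (j,k)) * Q $$ (k,i))"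
      using i mat_mult_diag_sum[OF PB Q, of i i] mat_mult_diag_sum[OF P B, of i] by simp
  qed
  also have "... = (\<Sum>i<n. \<Sum>k<n. \<Sum>j<n. P $$ (i,j) * B $$ (j,k) * Q $$ (k,i))"
    by (simp add: sum_distrib_right)
  also have "... = (\<Sum>k<n. \<Sum>i<n. \<Sum>j<n. P $$ (i,j) * B $$ (j,k) * Q $$ (k,i))"
    by (rule sum.swap)
  also have "... = (\<Sum>k<n. \<Sum>j<n. \<Sum>i<n. P $$ (i,j) * B $$ (j,k) * Q $$ (k,i))"
    by (intro sum.cong refl sum.swap)
  also have "... = (\<Sum>k<n. \<Sum>j<n. B $$ (j,k) * (\<Sum>i<n. Q $$ (k,i) * P $$ (i,j)))"
    by (simp add: sum_distrib_left mult_ac)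
  also have "... = (\<Sum>k<n. \<Sum>j<n. B $$ (j,k) * (if k = j then 1 else 0))"
  proof (intro sum.cong refl)
    fix k j assume kj: "k \<in> {..<n}" "j \<in> {..<n}"
    show "B $$ (j,k) * (\<Sum>i<n. Q $$ (k,i) * P $$ (i,j)) = B $$ (j,k) * (if k = j then 1 else 0)"
      using mat_mult_diag_sum[OF Q P, of k j] kj QP by simp
  qed
  also have "... = (\<Sum>k<n. B $$ (k,k))"
    by (intro sum.cong refl) (simp add: if_distrib cong: if_cong)
  finally show ?thesis .
qed

lemma wide_matrix_kernel:
  fixes A :: "'a::field mat"
  assumes A: "A \<in> carrier_mat n m" and nm: "n < m"
  shows "\<exists>v \<in> carrier_vec m. v \<noteq> 0\<^sub>v m \<and> A *\<^sub>v v = 0\<^sub>v n"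
proof -
  define C where "C = mat\<^sub>r m m (\<lambda>i. if i = n then 0\<^sub>v m else if i < n then row A i else 0\<^sub>v m)"
  have C: "C \<in> carrier_mat m m" unfolding C_def by simp
  have "det C = 0"
    unfolding C_def by (rule det_row_0[OF nm]) (use A in auto)
  then obtain v where v: "v \<in> carrier_vec m" "v \<noteq> 0\<^sub>v m" "C *\<^sub>v v = 0\<^sub>v m"
    using det_0_iff_vec_prod_zero_field[OF C] by blast
  have "A *\<^sub>v v = 0\<^sub>v n"
  proof (rule eq_vecI)
    fix i assume i: "i < dim_vec (0\<^sub>v n :: 'a vec)"
    have "row C i = row A i" unfolding C_def using i nm A by (subst row_mat_of_row_fun) auto
    then have "vec_index (C *\<^sub>v v) i = vec_index (A *\<^sub>v v) i"
      using i A C nm by auto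
    then show "vec_index (A *\<^sub>v v) i = vec_index (0\<^sub>v n) i" using v(3) i nm by simp
  qed (use A in auto)
  then show ?thesis using v by blast
qed

lemma coeff_prod_roots_zeros_first:
  fixes bs :: "'a::idom list"
  assumes "0 \<notin> set bs"
  shows "coeff (\<Prod>a\<leftarrow>replicate z 0 @ bs. [:- a, 1:]) z = (\<Prod>a\<leftarrow>bs. - a)"
proof -
  have 1: "(\<Prod>a\<leftarrow>replicate z 0 @ bs. [:- a, 1:]) = monom 1 z * (\<Prod>a\<leftarrow>bs. [:- a, 1:])"
    by (induction z) (auto simp: monom_0 monom_Suc one_poly_def)
  have 2: "coeff (\<Prod>a\<leftarrow>bs. [:- a, 1:]) 0 = (\<Prod>a\<leftarrow>bs. - a)"
    by (induction bs) (auto simp: coeff_mult)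
  show ?thesis unfolding 1 2[symmetric] by (simp add: coeff_monom_mult)
qed

lemma zeros_first:
  fixes as :: "'a::idom list"
  shows "(\<Prod>a\<leftarrow>as. [:- a, 1:]) =
    (\<Prod>a\<leftarrow>replicate (length (filter (\<lambda>a. a = 0) as)) 0 @ filter (\<lambda>a. a \<noteq> 0) as. [:- a, 1:])"
  by (induction as) (auto simp: mult.left_commute simp del: mult_pCons_left mult_pCons_right)

text \<open>The lowest nonzero coefficient of the characteristic polynomial is, up to sign, the product of the nonzero eigenvalues.
It is a nonzero integer, so this product is at least \<open>1\<close>.\<close>

lemma integral_psd_spectrum:
  fixes A :: "int mat" and Y :: "complex mat"
  defines "L \<equiv> map_mat of_int A"
  assumes A: "A \<in> carrier_mat c c" and Y: "Y \<in> carrier_mat c k"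
    and ker: "\<And>x. x \<in> carrier_vec c ==> L *\<^sub>v (L *\<^sub>v x) = 0\<^sub>v c ==> L *\<^sub>v x = 0\<^sub>v c"
    and ev: "\<And>a. eigenvalue L a ==> \<exists>r. a = complex_of_real r \<and> 0 \<le> r \<and> r \<le> R"
    and inj: "\<And>w. w \<in> carrier_vec k ==> L *\<^sub>v (Y *\<^sub>v w) = 0\<^sub>v c ==> w = 0\<^sub>v k"
  shows "\<exists>rs :: real list. length rs \<le> c \<and> k \<le> length rs \<and> (\<forall>r\<in>set rs. 0 < r \<and> r \<le> R) \<and>
    1 \<le> (\<Prod>r\<leftarrow>rs. r) \<and>
    (\<forall>N s. (\<Sum>i<c. ((1\<^sub>m c - s \<cdot>\<^sub>m L) ^\<^sub>m N) $$ (i,i)) =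
       of_nat (c - length rs) + (\<Sum>r\<leftarrow>rs. (1 - s * of_real r) ^ N))"
proof -
  have L: "L \<in> carrier_mat c c" using A unfolding L_def by simp
  obtain as0 where as0: "char_poly L = (\<Prod>a\<leftarrow>as0. [:- a, 1:])" "length as0 = c"
    using char_poly_factorized[OF L] by blast
  define z where "z = length (filter (\<lambda>a. a = 0) as0)"
  define bs where "bs = filter (\<lambda>a. a \<noteq> 0) as0"
  define as where "as = replicate z 0 @ bs"
  have cp: "char_poly L = (\<Prod>a\<leftarrow>as. [:- a, 1:])"
    unfolding as0 as_def z_def bs_def by (rule zeros_first)
  have len: "z + length bs = c"
    unfolding z_def bs_def using as0(2) sum_length_filter_compl[of "\<lambda>a. a = 0" as0] by simp
  obtain B P Q where sd: "schur_decomposition L as = (B, P, Q)"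
    by (metis prod_cases3)
  from schur_decomposition[OF L cp sd]
  have wit: "similar_mat_wit L B P Q" and ut: "upper_triangular B" and diag: "diag_mat B = as"
    by auto
  note W = similar_mat_witD2[OF L wit]
  have B: "B \<in> carrier_mat c c" and P: "P \<in> carrier_mat c c" and Q: "Q \<in> carrier_mat c c"
    and PQ: "P * Q = 1\<^sub>m c" and QP: "Q * P = 1\<^sub>m c" and LPBQ: "L = P * B * Q"
    using W by auto
  have Bii: "B $$ (i,i) = as ! i" if "i < c" for i
    using that diag B by (auto simp: diag_mat_def)
  have LP: "L * P = P * B"
  proof -
    have "L * P = (P * B) * (Q * P)" unfolding LPBQ using P B Q by (intro assoc_mult_mat) auto
    then show ?thesis using P B QP by (simp add: right_mult_one_mat[of _ c c])
  qed
  \<comment> \<open>The vanishing eigenvalues come first, so the corresponding columns of \<open>P\<close> span a space on which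
    \<open>L\<close> is nilpotent, and hence zero.\<close>
  have kerP: "L *\<^sub>v col P i = 0\<^sub>v c" if "i < z" for i
    using that
  proof (induction i rule: less_induct)
    case (less i)
    then have ic: "i < c" using len by simp
    have LPc: "L *\<^sub>v col P l = col (L * P) l" if "l < c" for l
      using that L P by (intro eq_vecI) auto
    have "L *\<^sub>v (L *\<^sub>v col P i) = L *\<^sub>v (P *\<^sub>v col B i)"
    proof -
      have "col (P * B) i = P *\<^sub>v col B i" using ic P B by (intro eq_vecI) auto
      then show ?thesis using LPc[OF ic] LP by simp
    qed
    also have "... = (L * P) *\<^sub>v col B i"
      using L P B by (intro assoc_mult_mat_vec[symmetric]) (auto simp: col_carrier_vec ic)
    also have "... = 0\<^sub>v c"
    proof (rule eq_vecI)
      fix j assume j: "j < dim_vec (0\<^sub>v c :: complex vec)"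
      have "vec_index ((L * P) *\<^sub>v col B i) j = (\<Sum>l<c. (L * P) $$ (j,l) * B $$ (l,i))"
      proof -
	have "vec_index (M *\<^sub>v col B i) j = (\<Sum>l<c. M $$ (j,l) * B $$ (l,i))"
	  if "M \<in> carrier_mat c c" for M
	  using that j ic B by (auto simp: scalar_prod_def lessThan_atLeast0)
	then show ?thesis using L P by simp
      qed
      also have "... = 0"
      proof (intro sum.neutral ballI)
	fix l assume l: "l \<in> {..<c}"
	consider "l < i" | "l = i" | "i < l" by linarith
	then show "(L * P) $$ (j,l) * B $$ (l,i) = 0"
	proof cases
	  case 1
	  then have "L *\<^sub>v col P l = 0\<^sub>v c" using less by simp
	  then have "col (L * P) l = 0\<^sub>v c" using LPc[of l] l by simp
	  moreover have "(L * P) $$ (j,l) = vec_index (col (L * P) l) j"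
	    using j l L P by (subst index_col) auto
	  ultimately show ?thesis using j by simp
	next
	  case 2
	  then show ?thesis using Bii[OF ic] less.prems by (simp add: as_def nth_append)
	next
	  case 3
	  then show ?thesis using upper_triangularD[OF ut, of i l] l B by auto
	qed
      qed
      finally show "vec_index ((L * P) *\<^sub>v col B i) j = vec_index (0\<^sub>v c) j" using j by simp
    qed (use L P in auto)
    finally show ?case using ker[of "col P i"] carrier_vecI[of "col P i" c] P by simp
  qed
  \<comment> \<open>The image of \<open>Y\<close> meets the kernel of \<open>L\<close> trivially, so the dimensions add up to at most \<open>c\<close>.\<close>
  have zk: "z + k \<le> c"
  proof (rule ccontr)
    assume "\<not> z + k \<le> c"
    define C where "C = mat c (z + k) (\<lambda>(i,j). if j < z then P $$ (i,j) else Y $$ (i,j - z))"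
    have C: "C \<in> carrier_mat c (z + k)" by (simp add: C_def)
    from wide_matrix_kernel[OF C] \<open>\<not> z + k \<le> c\<close>
    obtain v where v: "v \<in> carrier_vec (z + k)" "v \<noteq> 0\<^sub>v (z + k)" "C *\<^sub>v v = 0\<^sub>v c" by force
    define w where "w = vec k (\<lambda>j. vec_index v (z + j))"
    define u where "u = vec c (\<lambda>j. if j < z then vec_index v j else 0)"
    have w: "w \<in> carrier_vec k" and u: "u \<in> carrier_vec c" by (auto simp: w_def u_def)
    have Cv: "vec_index (P *\<^sub>v u) i + vec_index (Y *\<^sub>v w) i = vec_index (C *\<^sub>v v) i" if "i < c" for i
    proof -
      have "vec_index (C *\<^sub>v v) i = (\<Sum>j<z+k. C $$ (i,j) * vec_index v j)"
	using that C v(1) by (auto simp: scalar_prod_def lessThan_atLeast0)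
      also have "... = (\<Sum>j<z. C $$ (i,j) * vec_index v j) + (\<Sum>j<k. C $$ (i,z+j) * vec_index v (z+j))"
	by (induction k) (auto simp: add_ac)
      also have "(\<Sum>j<z. C $$ (i,j) * vec_index v j) = (\<Sum>j<z. P $$ (i,j) * vec_index u j)"
	using that len by (intro sum.cong) (auto simp: C_def u_def)
      also have "... = (\<Sum>j<c. P $$ (i,j) * vec_index u j)"
	using len by (intro sum.mono_neutral_left) (auto simp: u_def)
      also have "... = vec_index (P *\<^sub>v u) i"
	using that P u by (auto simp: scalar_prod_def lessThan_atLeast0)
      also have "(\<Sum>j<k. C $$ (i,z+j) * vec_index v (z+j)) = vec_index (Y *\<^sub>v w) i"
	using that Y w by (auto simp: scalar_prod_def lessThan_atLeast0 C_def w_def intro!: sum.cong)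
      finally show ?thesis by simp
    qed
    have YP: "Y *\<^sub>v w = - (P *\<^sub>v u)"
    proof (rule eq_vecI)
      fix i assume i: "i < dim_vec (- (P *\<^sub>v u))"
      then have ic: "i < c" using P by simp
      have "vec_index (P *\<^sub>v u) i + vec_index (Y *\<^sub>v w) i = 0"
	using Cv[OF ic] v(3) ic by simp
      then show "vec_index (Y *\<^sub>v w) i = vec_index (- (P *\<^sub>v u)) i"
	using i by (simp add: eq_neg_iff_add_eq_0 add.commute)
    qed (use P Y in auto)
    have LPu: "L *\<^sub>v (P *\<^sub>v u) = 0\<^sub>v c"
    proof -
      have "L *\<^sub>v (P *\<^sub>v u) = (L * P) *\<^sub>v u" using L P u by (intro assoc_mult_mat_vec[symmetric]) auto
      also have "... = 0\<^sub>v c"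
      proof (rule eq_vecI)
	fix j assume j: "j < dim_vec (0\<^sub>v c :: complex vec)"
	have "vec_index ((L * P) *\<^sub>v u) j = (\<Sum>l<c. (L * P) $$ (j,l) * vec_index u l)"
	proof -
	  have "vec_index (M *\<^sub>v u) j = (\<Sum>l<c. M $$ (j,l) * vec_index u l)"
	    if "M \<in> carrier_mat c c" for M
	    using that j u by (auto simp: scalar_prod_def lessThan_atLeast0)
	  then show ?thesis using L P by simp
	qed
	also have "... = 0"
	proof (intro sum.neutral ballI)
	  fix l assume l: "l \<in> {..<c}"
	  show "(L * P) $$ (j,l) * vec_index u l = 0"
	  proof (cases "l < z")
	    case True
	    have "col (L * P) l = L *\<^sub>v col P l" using l L P by (intro eq_vecI) auto
	    then have "col (L * P) l = 0\<^sub>v c" using kerP[OF True] by simp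
	    moreover have "(L * P) $$ (j,l) = vec_index (col (L * P) l) j"
	      using j l L P by (subst index_col) auto
	    ultimately show ?thesis using j by simp
	  qed (use l in \<open>simp add: u_def\<close>)
	qed
	finally show "vec_index ((L * P) *\<^sub>v u) j = vec_index (0\<^sub>v c) j" using j by simp
      qed (use L P in auto)
      finally show ?thesis .
    qed
    have Pu: "P *\<^sub>v u \<in> carrier_vec c" using P u by simp
    have "L *\<^sub>v (Y *\<^sub>v w) = 0\<^sub>v c"
    proof (rule eq_vecI)
      fix j assume j: "j < dim_vec (0\<^sub>v c :: complex vec)"
      have "vec_index (L *\<^sub>v (Y *\<^sub>v w)) j = - vec_index (L *\<^sub>v (P *\<^sub>v u)) j"
	unfolding YP using j L Pu by (auto simp: scalar_prod_def sum_negf)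
      then show "vec_index (L *\<^sub>v (Y *\<^sub>v w)) j = vec_index (0\<^sub>v c) j" using LPu j by simp
    qed (use L in auto)
    then have w0: "w = 0\<^sub>v k" using inj[OF w] by simp
    then have "Y *\<^sub>v w = 0\<^sub>v c" using Y by auto
    then have Pu0: "P *\<^sub>v u = 0\<^sub>v c" using v(3) P Cv by (intro eq_vecI) auto
    have "u = (Q * P) *\<^sub>v u" using QP u by simp
    also have "... = Q *\<^sub>v (P *\<^sub>v u)" using Q P u by (intro assoc_mult_mat_vec) auto
    also have "... = 0\<^sub>v c" using Pu0 Q by auto
    finally have u0: "u = 0\<^sub>v c" .
    have "v = 0\<^sub>v (z + k)"
    proof (rule eq_vecI)
      fix i assume i: "i < dim_vec (0\<^sub>v (z + k) :: complex vec)"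
      show "vec_index v i = vec_index (0\<^sub>v (z + k)) i"
      proof (cases "i < z")
	case True
	then have "vec_index v i = vec_index u i" using len by (simp add: u_def)
	then show ?thesis using u0 True len i by simp
      next
	case False
	then have zi: "z + (i - z) = i" "i - z < k" using i by auto
	then have "vec_index v i = vec_index w (i - z)" unfolding w_def by (simp only: index_vec zi)
	then show ?thesis using w0 False i by simp
      qed
    qed (use v in auto)
    then show False using v by simp
  qed
  have root: "eigenvalue L a" if "a \<in> set as" for a
  proof -
    have "poly (\<Prod>a\<leftarrow>as. [:- a, 1:]) a = 0"
      using that by (induction as) auto
    then show ?thesis using eigenvalue_root_char_poly[OF L] cp by simp
  qed
  define rs where "rs = map Re bs"
  have bs: "bs = map complex_of_real rs" "\<forall>r\<in>set rs. 0 < r \<and> r \<le> R"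
  proof -
    have *: "complex_of_real (Re b) = b \<and> 0 < Re b \<and> Re b \<le> R" if "b \<in> set bs" for b
    proof -
      have "eigenvalue L b" "b \<noteq> 0" using that root[of b] by (auto simp: as_def bs_def)
      then show ?thesis using ev[of b] by force
    qed
    then show "bs = map complex_of_real rs" unfolding rs_def map_map by (intro map_idI[symmetric]) auto
    show "\<forall>r\<in>set rs. 0 < r \<and> r \<le> R" unfolding rs_def using * by auto
  qed
  have prod: "1 \<le> (\<Prod>r\<leftarrow>rs. r)"
  proof -
    have "coeff (char_poly L) z = (\<Prod>a\<leftarrow>bs. - a)"
      unfolding cp as_def by (rule coeff_prod_roots_zeros_first) (simp add: bs_def)
    moreover have "char_poly L = map_poly of_int (char_poly A)"
      unfolding L_def by (rule of_int_hom.char_poly_hom[OF A])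
    ultimately have int: "(\<Prod>a\<leftarrow>bs. - a) = of_int (coeff (char_poly A) z)" by simp
    have pos: "0 < (\<Prod>r\<leftarrow>rs. r)" using bs(2) by (induction rs) auto
    have "norm (\<Prod>a\<leftarrow>bs. - a) = (\<Prod>r\<leftarrow>rs. r)"
      unfolding bs(1) using bs(2) by (induction rs) (auto simp: norm_mult)
    then have "(\<Prod>r\<leftarrow>rs. r) = \<bar>of_int (coeff (char_poly A) z)\<bar>" using int by simp
    moreover from this pos have "1 \<le> \<bar>coeff (char_poly A) z\<bar>" by (auto simp: abs_if split: if_splits)
    ultimately show ?thesis by (metis of_int_1_le_iff of_int_abs)
  qed
  have tr: "(\<Sum>i<c. ((1\<^sub>m c - s \<cdot>\<^sub>m L) ^\<^sub>m N) $$ (i,i)) =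
      of_nat (c - length rs) + (\<Sum>r\<leftarrow>rs. (1 - s * of_real r) ^ N)" for N s
  proof -
    let ?M = "1\<^sub>m c - s \<cdot>\<^sub>m L" and ?B = "1\<^sub>m c - s \<cdot>\<^sub>m B"
    have B': "?B \<in> carrier_mat c c" using B by auto
    have "?M = P * ?B * Q"
    proof -
      have "P * ?B = P * 1\<^sub>m c - P * (s \<cdot>\<^sub>m B)"
	using P B by (intro mult_minus_distrib_mat) auto
      also have "... = P - s \<cdot>\<^sub>m (P * B)" using P B by (simp add: mult_smult_distrib[OF P B])
      finally have "P * ?B * Q = (P - s \<cdot>\<^sub>m (P * B)) * Q" by simp
      also have "... = P * Q - (s \<cdot>\<^sub>m (P * B)) * Q"
	using P B Q by (intro minus_mult_distrib_mat) auto
      also have "... = ?M" using PQ P B Q by (simp add: mult_smult_assoc_mat[of "P * B" c c Q c] LPBQ)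
      finally show ?thesis by simp
    qed
    then have "similar_mat_wit ?M ?B P Q"
      using P Q B' PQ QP L by (intro similar_mat_witI[of _ _ c]) auto
    then have "?M ^\<^sub>m N = P * (?B ^\<^sub>m N) * Q" by (rule similar_mat_wit_pow_id)
    then have "(\<Sum>i<c. (?M ^\<^sub>m N) $$ (i,i)) = (\<Sum>i<c. (?B ^\<^sub>m N) $$ (i,i))"
      using trace_similar[of "?B ^\<^sub>m N" c P Q] P Q QP B' by simp
    also have "... = (\<Sum>i<c. (1 - s * as ! i) ^ N)"
    proof (intro sum.cong refl)
      fix i assume "i \<in> {..<c}"
      moreover have "upper_triangular ?B" using ut B by (auto simp: upper_triangular_def)
      ultimately show "(?B ^\<^sub>m N) $$ (i,i) = (1 - s * as ! i) ^ N"
	using upper_triangular_pow[OF B', of N] Bii B by auto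
    qed
    also have "... = (\<Sum>a\<leftarrow>as. (1 - s * a) ^ N)"
    proof -
      have "length as = c" using len by (simp add: as_def)
      then show ?thesis by (simp add: sum_list_sum_nth lessThan_atLeast0)
    qed
    also have "... = of_nat z + (\<Sum>r\<leftarrow>rs. (1 - s * of_real r) ^ N)"
      by (simp add: as_def bs(1) sum_list_replicate o_def)
    moreover have "z = c - length rs" using len by (simp add: rs_def)
    ultimately show ?thesis by simp
  qed
  show ?thesis
    using zk len bs(2) prod tr by (intro exI[of _ rs]) (auto simp: rs_def)
qed

section \<open>Traces of damped powers bound ranks over finite fields\<close>

text \<open>Either \<open>u\<close> is at least \<open>1 / sqrt N\<close> and the power is tiny, or \<open>- ln u\<close> is of order \<open>ln N\<close>.\<close>

lemma power_le_inverse_log: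
  fixes u :: real
  assumes u: "0 < u" "u \<le> 1" and N: "2 \<le> N"
  shows "(1 - u) ^ N \<le> 2 / ln (real N) * (1 - ln u)"
proof -
  have lnN: "0 < ln (real N)" using N by simp
  show ?thesis
  proof (cases "u \<ge> 1 / sqrt (real N)")
    case True
    have s0: "0 < sqrt (real N)" using N by simp
    have "(1 - u) ^ N \<le> exp (- u) ^ N"
      using u exp_ge_add_one_self[of "- u"] by (intro power_mono) auto
    also have "... = exp (- (real N * u))" by (simp add: exp_of_nat_mult[symmetric])
    also have "... \<le> exp (- sqrt (real N))"
    proof -
      have "sqrt (real N) = real N * (1 / sqrt (real N))" using N by (simp add: real_div_sqrt)
      also have "... \<le> real N * u" using True by (intro mult_left_mono) auto
      finally show ?thesis by simp
    qed
    also have "... \<le> 1 / sqrt (real N)"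
    proof -
      have "sqrt (real N) \<le> exp (sqrt (real N))" using exp_ge_add_one_self[of "sqrt (real N)"] by linarith
      then show ?thesis using s0 by (simp add: exp_minus divide_simps)
    qed
    also have "... \<le> 2 / ln (real N)"
    proof -
      have "ln (real N) = 2 * ln (sqrt (real N))" using N by (simp add: ln_sqrt)
      also have "... \<le> 2 * sqrt (real N)" using ln_bound[OF s0] by simp
      finally show ?thesis using s0 lnN by (simp add: field_simps)
    qed
    also have "... \<le> 2 / ln (real N) * (1 - ln u)"
      using u lnN by (simp add: field_simps)
    finally show ?thesis .
  next
    case False
    then have "u * sqrt (real N) < 1" using N by (simp add: field_simps)
    then have "ln (u * sqrt (real N)) < 0" using u N by (simp add: ln_less_zero_iff)
    then have "ln u + ln (real N) / 2 < 0" using u N by (simp add: ln_mult ln_sqrt)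
    then have "1 \<le> 2 / ln (real N) * (1 - ln u)" using lnN by (simp add: field_simps)
    moreover have "(1 - u) ^ N \<le> 1" using u by (intro power_le_one) auto
    ultimately show ?thesis by linarith
  qed
qed

definition gram :: "'i set => ('i => 'j => int) => 'j => 'j => int" where
  "gram I X j j' = (\<Sum>i\<in>I. X i j * X i j')"

text \<open>The operator \<open>1 - X\<^sup>T X / R\<close>.\<close>

definition damped :: "'i set => 'j set => ('i => 'j => int) => real => ('j => real) => 'j => real" where
  "damped I J X R f = (\<lambda>j. f j - (\<Sum>i\<in>I. of_int (X i j) * (\<Sum>j'\<in>J. of_int (X i j') * f j')) / R)"

lemma gram_apply:
  fixes f :: "'j => 'a::comm_ring_1"
  shows "(\<Sum>j'\<in>J. of_int (gram I X j j') * f j') =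
    (\<Sum>i\<in>I. of_int (X i j) * (\<Sum>j'\<in>J. of_int (X i j') * f j'))"
proof -
  have "(\<Sum>j'\<in>J. of_int (gram I X j j') * f j') =
      (\<Sum>j'\<in>J. \<Sum>i\<in>I. of_int (X i j) * (of_int (X i j') * f j'))"
    by (simp add: gram_def sum_distrib_right mult.assoc)
  also have "... = (\<Sum>i\<in>I. \<Sum>j'\<in>J. of_int (X i j) * (of_int (X i j') * f j'))"
    by (rule sum.swap)
  finally show ?thesis by (simp add: sum_distrib_left)
qed

lemma gram_sym: "gram I X j j' = gram I X j' j"
  by (simp add: gram_def mult.commute)

lemma gram_quadratic_form:
  fixes x :: "'j => complex"
  shows "(\<Sum>j\<in>J. cnj (x j) * (\<Sum>j'\<in>J. of_int (gram I X j j') * x j')) =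
    of_real (\<Sum>i\<in>I. (cmod (\<Sum>j\<in>J. of_int (X i j) * x j))\<^sup>2)"
proof -
  have "(\<Sum>j\<in>J. cnj (x j) * (\<Sum>j'\<in>J. of_int (gram I X j j') * x j')) =
      (\<Sum>j\<in>J. \<Sum>i\<in>I. (of_int (X i j) * cnj (x j)) * (\<Sum>j'\<in>J. of_int (X i j') * x j'))"
    unfolding gram_apply by (simp add: sum_distrib_left mult_ac)
  also have "... = (\<Sum>i\<in>I. \<Sum>j\<in>J. (of_int (X i j) * cnj (x j)) * (\<Sum>j'\<in>J. of_int (X i j') * x j'))"
    by (rule sum.swap)
  also have "... = (\<Sum>i\<in>I. cnj (\<Sum>j\<in>J. of_int (X i j) * x j) * (\<Sum>j'\<in>J. of_int (X i j') * x j'))"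
    by (simp add: sum_distrib_right)
  also have "... = of_real (\<Sum>i\<in>I. (cmod (\<Sum>j\<in>J. of_int (X i j) * x j))\<^sup>2)"
    unfolding of_real_sum complex_norm_square by (intro sum.cong refl) (simp add: mult.commute)
  finally show ?thesis .
qed

lemma gram_self_adjoint:
  fixes x y :: "'j => complex"
  shows "(\<Sum>j\<in>J. cnj (y j) * (\<Sum>j'\<in>J. of_int (gram I X j j') * x j')) =
    (\<Sum>j'\<in>J. cnj (\<Sum>j\<in>J. of_int (gram I X j' j) * y j) * x j')"
proof -
  have "(\<Sum>j\<in>J. cnj (y j) * (\<Sum>j'\<in>J. of_int (gram I X j j') * x j')) =
      (\<Sum>j\<in>J. \<Sum>j'\<in>J. of_int (gram I X j' j) * cnj (y j) * x j')"
    by (simp add: sum_distrib_left mult_ac gram_sym[of I X])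
  also have "... = (\<Sum>j'\<in>J. \<Sum>j\<in>J. of_int (gram I X j' j) * cnj (y j) * x j')"
    by (rule sum.swap)
  finally show ?thesis by (simp add: sum_distrib_right)
qed

lemma complex_norm_bound:
  fixes X :: "'i => 'j => int" and x :: "'j => complex"
  assumes bound: "\<And>z :: 'j => real. (\<Sum>i\<in>I. (\<Sum>j\<in>J. of_int (X i j) * z j)\<^sup>2) \<le> R * (\<Sum>j\<in>J. (z j)\<^sup>2)"
  shows "(\<Sum>i\<in>I. (cmod (\<Sum>j\<in>J. of_int (X i j) * x j))\<^sup>2) \<le> R * (\<Sum>j\<in>J. (cmod (x j))\<^sup>2)"
proof -
  have "(\<Sum>i\<in>I. (cmod (\<Sum>j\<in>J. of_int (X i j) * x j))\<^sup>2) =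
      (\<Sum>i\<in>I. (\<Sum>j\<in>J. of_int (X i j) * Re (x j))\<^sup>2) + (\<Sum>i\<in>I. (\<Sum>j\<in>J. of_int (X i j) * Im (x j))\<^sup>2)"
    by (simp add: cmod_power2 sum.distrib)
  also have "... \<le> R * (\<Sum>j\<in>J. (Re (x j))\<^sup>2) + R * (\<Sum>j\<in>J. (Im (x j))\<^sup>2)"
    by (intro add_mono bound)
  also have "... = R * (\<Sum>j\<in>J. (cmod (x j))\<^sup>2)"
    by (simp add: cmod_power2 sum.distrib distrib_left)
  finally show ?thesis .
qed

text \<open>The map \<open>Y\<close> shows that the rank of \<open>X\<close> is at least \<open>card J'\<close>. An eigenvalue \<open>r\<close> of the Gram matrix contributes
\<open>(1 - r / R)^N\<close> to the trace. Summing \<open>power_le_inverse_log\<close> over the positive eigenvalues, the terms \<open>- ln r\<close> have nonpositive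
sum, because the product of these eigenvalues is at least \<open>1\<close>.\<close>

lemma damped_trace_le:
  fixes X :: "'i => 'j => int" and Y :: "'j => 'l => int"
  assumes fin: "finite I" "finite J" "finite J'" and R: "1 \<le> R" and N: "2 \<le> N"
    and bound: "\<And>z :: 'j => real. (\<Sum>i\<in>I. (\<Sum>j\<in>J. of_int (X i j) * z j)\<^sup>2) \<le> R * (\<Sum>j\<in>J. (z j)\<^sup>2)"
    and inj: "\<And>w :: 'l => complex. (\<And>i. i \<in> I ==>
	(\<Sum>j\<in>J. of_int (X i j) * (\<Sum>l\<in>J'. of_int (Y j l) * w l)) = 0) ==> \<forall>l\<in>J'. w l = 0"
  shows "(\<Sum>j\<in>J. (damped I J X R ^^ N) (\<lambda>k. if k = j then 1 else 0) j)
    \<le> real (card J) - real (card J') + real (card J) * (2 * (1 + ln R) / ln (real N))"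
proof -
  define c where "c = card J"
  define k where "k = card J'"
  obtain \<beta> where \<beta>: "bij_betw \<beta> {..<c} J"
    using ex_bij_betw_nat_finite[OF fin(2)] unfolding c_def lessThan_atLeast0 by blast
  obtain \<gamma> where \<gamma>: "bij_betw \<gamma> {..<k} J'"
    using ex_bij_betw_nat_finite[OF fin(3)] unfolding k_def lessThan_atLeast0 by blast
  have \<beta>s: "\<exists>a<c. j = \<beta> a" if "j \<in> J" for j using \<beta> that by (auto simp: bij_betw_def)
  have \<gamma>s: "\<exists>a<k. l = \<gamma> a" if "l \<in> J'" for l using \<gamma> that by (auto simp: bij_betw_def)
  have \<beta>J: "\<beta> a \<in> J" if "a < c" for a using \<beta> that by (auto simp: bij_betw_def)
  have sumJ: "(\<Sum>j\<in>J. f j) = (\<Sum>a<c. f (\<beta> a))" for f :: "'j => 'x::comm_monoid_add"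
    by (rule sum.reindex_bij_betw[OF \<beta>, symmetric])
  have sumJ': "(\<Sum>l\<in>J'. f l) = (\<Sum>a<k. f (\<gamma> a))" for f :: "'l => 'x::comm_monoid_add"
    by (rule sum.reindex_bij_betw[OF \<gamma>, symmetric])
  define A where "A = mat c c (\<lambda>(a,b). gram I X (\<beta> a) (\<beta> b))"
  define L :: "complex mat" where "L = map_mat of_int A"
  define Ym :: "complex mat" where "Ym = mat c k (\<lambda>(a,b). of_int (Y (\<beta> a) (\<gamma> b)))"
  have A: "A \<in> carrier_mat c c" and Ym: "Ym \<in> carrier_mat c k" and L: "L \<in> carrier_mat c c"
    by (auto simp: A_def Ym_def L_def)
  define fn :: "complex vec => 'j => complex" where "fn x = (\<lambda>j. vec_index x (inv_into {..<c} \<beta> j))" for x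
  have fn: "fn x (\<beta> a) = vec_index x a" if "a < c" for x a
    using that \<beta> by (simp add: fn_def bij_betw_inv_into_left)
  have Lx: "vec_index (L *\<^sub>v x) a = (\<Sum>j\<in>J. of_int (gram I X (\<beta> a) j) * fn x j)"
    if "a < c" "x \<in> carrier_vec c" for x a
    using that unfolding sumJ
    by (auto simp: L_def A_def scalar_prod_def lessThan_atLeast0 fn intro!: sum.cong)
  have fnL: "fn (L *\<^sub>v x) j = (\<Sum>j'\<in>J. of_int (gram I X j j') * fn x j')"
    if "x \<in> carrier_vec c" "j \<in> J" for x j
  proof -
    obtain a where "a < c" "j = \<beta> a" using \<beta>s \<open>j \<in> J\<close> by blast
    then show ?thesis using Lx that by (simp add: fn)
  qed
  have fn0: "x = 0\<^sub>v c" if "x \<in> carrier_vec c" "\<And>j. j \<in> J ==> fn x j = 0" for x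
    proof (rule eq_vecI)
    fix a assume "a < dim_vec (0\<^sub>v c :: complex vec)"
    then show "vec_index x a = vec_index (0\<^sub>v c) a" using that(2)[of "\<beta> a"] fn[of a x] \<beta>J[of a] by simp
  qed (use that in auto)
  have Lc: "L *\<^sub>v x \<in> carrier_vec c" if "x \<in> carrier_vec c" for x using L that by auto
  have fnz: "fn (0\<^sub>v c) j = 0" if "j \<in> J" for j
  proof -
    obtain a where "a < c" "j = \<beta> a" using \<beta>s \<open>j \<in> J\<close> by blast
    then show ?thesis by (simp add: fn)
  qed
  have sq0: "\<forall>j\<in>J. f j = 0" if "(\<Sum>j\<in>J. cnj (f j) * f j) = 0" for f
  proof -
    have "complex_of_real (\<Sum>j\<in>J. (cmod (f j))\<^sup>2) = (\<Sum>j\<in>J. cnj (f j) * f j)"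
      unfolding of_real_sum complex_norm_square by (simp add: mult.commute)
    then have "(\<Sum>j\<in>J. (cmod (f j))\<^sup>2) = 0" using that of_real_eq_0_iff by metis
    then show ?thesis using fin by (simp add: sum_nonneg_eq_0_iff)
  qed
  have ker: "L *\<^sub>v x = 0\<^sub>v c" if x: "x \<in> carrier_vec c" and LL: "L *\<^sub>v (L *\<^sub>v x) = 0\<^sub>v c" for x
  proof -
    have "(\<Sum>j\<in>J. cnj (fn (L *\<^sub>v x) j) * fn (L *\<^sub>v x) j) =
	(\<Sum>j\<in>J. cnj (fn (L *\<^sub>v x) j) * (\<Sum>j'\<in>J. of_int (gram I X j j') * fn x j'))"
      using fnL[OF x] by simp
    also have "... = (\<Sum>j'\<in>J. cnj (fn (L *\<^sub>v (L *\<^sub>v x)) j') * fn x j')"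
      unfolding gram_self_adjoint using fnL[OF Lc[OF x]] by simp
    also have "... = 0" unfolding LL by (simp add: fnz)
    finally have "\<forall>j\<in>J. fn (L *\<^sub>v x) j = 0" by (rule sq0)
    then show ?thesis using fn0[OF Lc[OF x]] by blast
  qed
  have ev: "\<exists>r. a = complex_of_real r \<and> 0 \<le> r \<and> r \<le> R" if "eigenvalue L a" for a
  proof -
    obtain x where x: "x \<in> carrier_vec c" "x \<noteq> 0\<^sub>v c" "L *\<^sub>v x = a \<cdot>\<^sub>v x"
      using \<open>eigenvalue L a\<close> L unfolding eigenvalue_def eigenvector_def by auto
    define n where "n = (\<Sum>j\<in>J. (cmod (fn x j))\<^sup>2)"
    define q where "q = (\<Sum>i\<in>I. (cmod (\<Sum>j\<in>J. of_int (X i j) * fn x j))\<^sup>2)"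
    have "n \<noteq> 0"
    proof
      assume "n = 0"
      then have "\<forall>j\<in>J. fn x j = 0" unfolding n_def using fin by (simp add: sum_nonneg_eq_0_iff)
      then show False using fn0[OF x(1)] x(2) by blast
    qed
    then have n: "0 < n" using sum_nonneg[of J "\<lambda>j. (cmod (fn x j))\<^sup>2"] unfolding n_def by simp
    have "fn (L *\<^sub>v x) j = a * fn x j" if "j \<in> J" for j
    proof -
      obtain b where "b < c" "j = \<beta> b" using \<beta>s \<open>j \<in> J\<close> by blast
      then show ?thesis using x by (simp add: fn)
    qed
    then have "of_real q = (\<Sum>j\<in>J. cnj (fn x j) * (a * fn x j))"
      unfolding q_def gram_quadratic_form[symmetric] using fnL[OF x(1)] by simp
    also have "... = a * of_real n"
      unfolding n_def of_real_sum complex_norm_square by (simp add: sum_distrib_left mult_ac)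
    finally have a: "a = of_real (q / n)" using n by (simp add: field_simps)
    have "0 \<le> q" unfolding q_def by (intro sum_nonneg) auto
    moreover have "q \<le> R * n" unfolding q_def n_def by (rule complex_norm_bound[OF bound])
    ultimately show ?thesis using a n by (intro exI[of _ "q / n"]) (auto simp: field_simps)
  qed
  have injm: "w = 0\<^sub>v k" if w: "w \<in> carrier_vec k" and LY: "L *\<^sub>v (Ym *\<^sub>v w) = 0\<^sub>v c" for w
  proof -
    define g where "g = (\<lambda>l. vec_index w (inv_into {..<k} \<gamma> l))"
    have g: "g (\<gamma> b) = vec_index w b" if "b < k" for b
      using that \<gamma> by (simp add: g_def bij_betw_inv_into_left)
    have Yw: "fn (Ym *\<^sub>v w) j = (\<Sum>l\<in>J'. of_int (Y j l) * g l)" if "j \<in> J" for j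
    proof -
      obtain a where "a < c" "j = \<beta> a" using \<beta>s \<open>j \<in> J\<close> by blast
      then show ?thesis using w unfolding sumJ'
	by (auto simp: fn Ym_def scalar_prod_def lessThan_atLeast0 g intro!: sum.cong)
    qed
    have Yc: "Ym *\<^sub>v w \<in> carrier_vec c" using Ym w by auto
    have "of_real (\<Sum>i\<in>I. (cmod (\<Sum>j\<in>J. of_int (X i j) * fn (Ym *\<^sub>v w) j))\<^sup>2) = (0::complex)"
      unfolding gram_quadratic_form[symmetric] using fnL[OF Yc] LY fnz by simp
    then have "(\<Sum>i\<in>I. (cmod (\<Sum>j\<in>J. of_int (X i j) * fn (Ym *\<^sub>v w) j))\<^sup>2) = 0"
      using of_real_eq_0_iff by blast
    then have "\<forall>i\<in>I. (\<Sum>j\<in>J. of_int (X i j) * fn (Ym *\<^sub>v w) j) = 0"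
      using fin by (simp add: sum_nonneg_eq_0_iff)
    then have "\<forall>l\<in>J'. g l = 0" using Yw by (intro inj) (simp cong: sum.cong)
    moreover have "\<gamma> b \<in> J'" if "b < k" for b using \<gamma> that by (auto simp: bij_betw_def)
    ultimately have "vec_index w b = 0" if "b < k" for b using g that by metis
    then show ?thesis using w by (intro eq_vecI) auto
  qed
  obtain rs :: "real list" where rs: "length rs \<le> c" "k \<le> length rs" "\<forall>r\<in>set rs. 0 < r \<and> r \<le> R"
    "1 \<le> (\<Prod>r\<leftarrow>rs. r)"
    "\<And>N s. (\<Sum>i<c. ((1\<^sub>m c - s \<cdot>\<^sub>m L) ^\<^sub>m N) $$ (i,i)) =
       of_nat (c - length rs) + (\<Sum>r\<leftarrow>rs. (1 - s * of_real r) ^ N)"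
    using integral_psd_spectrum[OF A Ym, of R, folded L_def] ker ev injm by blast
  define M where "M = 1\<^sub>m c - complex_of_real (1 / R) \<cdot>\<^sub>m L"
  have M: "M \<in> carrier_mat c c" unfolding M_def using L by (intro minus_carrier_mat smult_carrier_mat)
  define emb where "emb f = vec c (\<lambda>a. complex_of_real (f (\<beta> a)))" for f
  have embM: "M *\<^sub>v emb f = emb (damped I J X R f)" for f
  proof (rule eq_vecI)
    fix a assume "a < dim_vec (emb (damped I J X R f))"
    then have a: "a < c" by (simp add: emb_def)
    have "vec_index (M *\<^sub>v emb f) a = (\<Sum>b<c. ((if a = b then 1 else 0) - complex_of_real (1 / R) * of_int (gram I X (\<beta> a) (\<beta> b))) * of_real (f (\<beta> b)))"
      using a by (auto simp: M_def L_def A_def emb_def scalar_prod_def lessThan_atLeast0 intro!: sum.cong)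
    also have "... = of_real (f (\<beta> a)) - complex_of_real (1 / R) * (\<Sum>b<c. of_int (gram I X (\<beta> a) (\<beta> b)) * of_real (f (\<beta> b)))"
      using a by (simp add: left_diff_distrib sum_subtractf sum_distrib_left mult.assoc if_distrib[of "\<lambda>x. x * _"] cong: if_cong)
    also have "(\<Sum>b<c. of_int (gram I X (\<beta> a) (\<beta> b)) * complex_of_real (f (\<beta> b))) =
	of_real (\<Sum>j\<in>J. of_int (gram I X (\<beta> a) j) * f j)"
      unfolding sumJ by simp
    also have "of_real (f (\<beta> a)) - complex_of_real (1 / R) * of_real (\<Sum>j\<in>J. of_int (gram I X (\<beta> a) j) * f j) =
	of_real (damped I J X R f (\<beta> a))"
      unfolding damped_def gram_apply by simp
    finally show "vec_index (M *\<^sub>v emb f) a = vec_index (emb (damped I J X R f)) a"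
      using a by (simp add: emb_def)
  qed (use M in \<open>auto simp: emb_def\<close>)
  have embN: "(M ^\<^sub>m N) *\<^sub>v emb f = emb ((damped I J X R ^^ N) f)" for f N
  proof (induction N arbitrary: f)
    case 0
    then show ?case using M by (auto simp: emb_def)
  next
    case (Suc N)
    have "emb f \<in> carrier_vec c" by (simp add: emb_def)
    then have "(M ^\<^sub>m Suc N) *\<^sub>v emb f = (M ^\<^sub>m N) *\<^sub>v (M *\<^sub>v emb f)"
      using M by (auto intro: assoc_mult_mat_vec)
    then show ?case using Suc embM by (simp add: funpow_swap1)
  qed
  have diag: "(M ^\<^sub>m N) $$ (a,a) = of_real ((damped I J X R ^^ N) (\<lambda>l. if l = \<beta> a then 1 else 0) (\<beta> a))"
    if a: "a < c" for a
  proof -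
    have MN: "M ^\<^sub>m N \<in> carrier_mat c c" using M by simp
    have inj\<beta>: "(\<beta> b = \<beta> a) = (b = a)" if "b < c" for b
      using \<beta> a that by (auto simp: bij_betw_def inj_on_def)
    have "vec_index ((M ^\<^sub>m N) *\<^sub>v emb (\<lambda>l. if l = \<beta> a then 1 else 0)) a = (\<Sum>b<c. (M ^\<^sub>m N) $$ (a,b) * (if b = a then 1 else 0))"
    proof -
      have "vec_index (M' *\<^sub>v emb (\<lambda>l. if l = \<beta> a then 1 else 0)) a = (\<Sum>b<c. M' $$ (a,b) * (if b = a then 1 else 0))"
	if "M' \<in> carrier_mat c c" for M'
	using a that inj\<beta> by (auto simp: emb_def scalar_prod_def lessThan_atLeast0 intro!: sum.cong)
      then show ?thesis using MN by blast
    qed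
    also have "... = (M ^\<^sub>m N) $$ (a,a)" using a by (simp add: if_distrib cong: if_cong)
    finally show ?thesis unfolding embN using a by (simp add: emb_def)
  qed
  have "complex_of_real (\<Sum>j\<in>J. (damped I J X R ^^ N) (\<lambda>k. if k = j then 1 else 0) j) =
      (\<Sum>a<c. (M ^\<^sub>m N) $$ (a,a))"
    unfolding sumJ using diag by simp
  also have "... = of_real (real (c - length rs) + (\<Sum>r\<leftarrow>rs. (1 - r / R) ^ N))"
  proof -
    have "(\<Sum>r\<leftarrow>xs. (1 - complex_of_real (1 / R) * of_real r) ^ N) = of_real (\<Sum>r\<leftarrow>xs. (1 - r / R) ^ N)" for xs
      by (induction xs) auto
    then show ?thesis unfolding M_def rs(5) by simp
  qed
  finally have tr: "(\<Sum>j\<in>J. (damped I J X R ^^ N) (\<lambda>k. if k = j then 1 else 0) j) =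
      real (c - length rs) + (\<Sum>r\<leftarrow>rs. (1 - r / R) ^ N)"
    using of_real_eq_iff by blast
  have lnN: "0 < ln (real N)" using N by simp
  have small: "(\<Sum>r\<leftarrow>rs. (1 - r / R) ^ N) \<le> real (length rs) * (2 * (1 + ln R) / ln (real N))"
  proof -
    have "(\<Sum>r\<leftarrow>rs. (1 - r / R) ^ N) \<le> (\<Sum>r\<leftarrow>rs. 2 / ln (real N) * (1 + ln R - ln r))"
    proof (rule sum_list_mono)
      fix r assume "r \<in> set rs"
      then have r: "0 < r" "r \<le> R" using rs by auto
      then have "(1 - r / R) ^ N \<le> 2 / ln (real N) * (1 - ln (r / R))"
	using R N by (intro power_le_inverse_log) auto
      then show "(1 - r / R) ^ N \<le> 2 / ln (real N) * (1 + ln R - ln r)"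
	using r R by (simp add: ln_div diff_diff_eq2 add.commute)
    qed
    also have "... = 2 / ln (real N) * (real (length rs) * (1 + ln R) - (\<Sum>r\<leftarrow>rs. ln r))"
    proof -
      have "(\<Sum>r\<leftarrow>xs. 1 + ln R - ln r) = real (length xs) * (1 + ln R) - (\<Sum>r\<leftarrow>xs. ln r)" for xs
	by (induction xs) (auto simp: algebra_simps)
      then show ?thesis unfolding sum_list_const_mult by simp
    qed
    also have "(\<Sum>r\<leftarrow>rs. ln r) = ln (\<Prod>r\<leftarrow>rs. r)"
    proof -
      have "(\<forall>r\<in>set xs. 0 < r) ==> (\<Sum>r\<leftarrow>xs. ln r) = ln (\<Prod>r\<leftarrow>xs. r) \<and> 0 < (\<Prod>r\<leftarrow>xs. r)" for xs :: "real list"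
	by (induction xs) (auto simp: ln_mult)
      then show ?thesis using rs(3) by blast
    qed
    also have "2 / ln (real N) * (real (length rs) * (1 + ln R) - ln (\<Prod>r\<leftarrow>rs. r)) \<le>
	2 / ln (real N) * (real (length rs) * (1 + ln R))"
      using rs(4) lnN by (intro mult_left_mono) auto
    finally show ?thesis by (simp add: field_simps)
  qed
  have "real (length rs) * (2 * (1 + ln R) / ln (real N)) \<le> real c * (2 * (1 + ln R) / ln (real N))"
    using rs(1) R lnN by (intro mult_right_mono) auto
  then show ?thesis
    using tr small rs(1,2) unfolding c_def[symmetric] k_def[symmetric] by (simp add: of_nat_diff)
qed

text \<open>An integral relation between the columns can be divided by the greatest common divisor of its coefficients; reduced modulo the
characteristic it is then a nontrivial relation over \<open>'k\<close>.\<close>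

lemma independent_real_if_independent_finite_field:
  fixes X :: "'i => 'l => int" and w :: "'l => complex"
  assumes fin: "finite I" "finite J"
    and indep: "\<And>z :: 'l => 'k::{field,finite}. (\<And>i. i \<in> I ==> (\<Sum>l\<in>J. of_int (X i l) * z l) = 0)
      ==> \<forall>l\<in>J. z l = 0"
    and w: "\<And>i. i \<in> I ==> (\<Sum>l\<in>J. of_int (X i l) * w l) = 0"
  shows "\<forall>l\<in>J. w l = 0"
proof (rule ccontr)
  assume nz: "\<not> (\<forall>l\<in>J. w l = 0)"
  define k where "k = card J"
  obtain \<gamma> where \<gamma>: "bij_betw \<gamma> {..<k} J"
    using ex_bij_betw_nat_finite[OF fin(2)] unfolding k_def lessThan_atLeast0 by blast
  have sumJ: "(\<Sum>l\<in>J. f l) = (\<Sum>a<k. f (\<gamma> a))" for f :: "'l => 'x::comm_monoid_add"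
    by (rule sum.reindex_bij_betw[OF \<gamma>, symmetric])
  have \<gamma>s: "\<exists>a<k. l = \<gamma> a" if "l \<in> J" for l using \<gamma> that by (auto simp: bij_betw_def)
  define A where "A = mat k k (\<lambda>(a,b). gram I X (\<gamma> a) (\<gamma> b))"
  have A: "A \<in> carrier_mat k k" by (simp add: A_def)
  define v where "v = vec k (\<lambda>a. w (\<gamma> a))"
  have "map_mat of_int A *\<^sub>v v = 0\<^sub>v k"
  proof (rule eq_vecI)
    fix a assume "a < dim_vec (0\<^sub>v k :: complex vec)"
    then have a: "a < k" by simp
    then have "vec_index (map_mat of_int A *\<^sub>v v) a = (\<Sum>l\<in>J. of_int (gram I X (\<gamma> a) l) * w l)"
      unfolding sumJ by (auto simp: A_def v_def scalar_prod_def lessThan_atLeast0 intro!: sum.cong)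
    then show "vec_index (map_mat of_int A *\<^sub>v v) a = vec_index (0\<^sub>v k) a"
      unfolding gram_apply using w a by simp
  qed (simp add: A_def)
  moreover have "v \<noteq> 0\<^sub>v k"
  proof
    assume "v = 0\<^sub>v k"
    then have "w (\<gamma> a) = 0" if "a < k" for a
      using that unfolding v_def by (metis index_vec index_zero_vec(1))
    then show False using nz \<gamma> by (auto simp: bij_betw_def)
  qed
  moreover have "v \<in> carrier_vec k" by (simp add: v_def)
  ultimately have "det (map_mat (of_int :: int => complex) A) = 0"
    using det_0_iff_vec_prod_zero_field[of "map_mat (of_int :: int => complex) A" k] A by auto
  then have "det A = 0" by (simp add: of_int_hom.hom_det)
  then obtain u where u: "u \<in> carrier_vec k" "u \<noteq> 0\<^sub>v k" "A *\<^sub>v u = 0\<^sub>v k"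
    using det_0_iff_vec_prod_zero[OF A] by blast
  define z where "z = (\<lambda>l. vec_index u (inv_into {..<k} \<gamma> l))"
  have z: "z (\<gamma> b) = vec_index u b" if "b < k" for b
    using that \<gamma> by (simp add: z_def bij_betw_inv_into_left)
  have "\<exists>l\<in>J. z l \<noteq> 0"
  proof (rule ccontr)
    assume "\<not> (\<exists>l\<in>J. z l \<noteq> 0)"
    moreover have "\<gamma> b \<in> J" if "b < k" for b using \<gamma> that by (auto simp: bij_betw_def)
    ultimately have "vec_index u b = 0" if "b < k" for b using z that by metis
    then have "u = 0\<^sub>v k" using u(1) by (intro eq_vecI) auto
    then show False using u by simp
  qed
  have Az: "(\<Sum>l'\<in>J. gram I X l l' * z l') = 0" if "l \<in> J" for l
  proof -
    obtain a where a: "a < k" "l = \<gamma> a" using \<gamma>s \<open>l \<in> J\<close> by blast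
    have "(\<Sum>l'\<in>J. gram I X l l' * z l') = vec_index (A *\<^sub>v u) a"
      using a u(1) unfolding sumJ by (auto simp: A_def z scalar_prod_def lessThan_atLeast0 intro!: sum.cong)
    then show ?thesis using u(3) a by simp
  qed
  have "(\<Sum>i\<in>I. (\<Sum>l\<in>J. X i l * z l)\<^sup>2) = (\<Sum>l\<in>J. z l * (\<Sum>l'\<in>J. gram I X l l' * z l'))"
  proof -
    have "(\<Sum>l\<in>J. z l * (\<Sum>l'\<in>J. gram I X l l' * z l')) =
	(\<Sum>l\<in>J. \<Sum>i\<in>I. X i l * z l * (\<Sum>l'\<in>J. X i l' * z l'))"
      using gram_apply[of I X _ z J] by (simp add: sum_distrib_left mult_ac)
    also have "... = (\<Sum>i\<in>I. \<Sum>l\<in>J. X i l * z l * (\<Sum>l'\<in>J. X i l' * z l'))" by (rule sum.swap)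
    finally show ?thesis by (simp add: sum_distrib_right power2_eq_square)
  qed
  also have "... = 0" using Az by simp
  finally have Xz: "(\<Sum>l\<in>J. X i l * z l) = 0" if "i \<in> I" for i
    using that fin by (simp add: sum_nonneg_eq_0_iff)
  \<comment> \<open>Divide the integral relation by its content.\<close>
  define g where "g = Gcd (z ` J)"
  have g0: "g \<noteq> 0" unfolding g_def using \<open>\<exists>l\<in>J. z l \<noteq> 0\<close> by (auto simp: Gcd_0_iff)
  define y where "y l = z l div g" for l
  have zg: "z l = g * y l" if "l \<in> J" for l
    using that by (simp add: y_def g_def)
  have "(\<Sum>l\<in>J. X i l * y l) = 0" if "i \<in> I" for i
  proof -
    have "g * (\<Sum>l\<in>J. X i l * y l) = (\<Sum>l\<in>J. X i l * z l)"
      using zg by (simp add: sum_distrib_left mult_ac cong: sum.cong)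
    then show ?thesis using Xz[OF that] g0 by simp
  qed
  then have "(\<Sum>l\<in>J. of_int (X i l) * (of_int (y l) :: 'k)) = 0" if "i \<in> I" for i
    using that by (metis (mono_tags, lifting) of_int_0 of_int_mult of_int_sum sum.cong)
  then have "\<forall>l\<in>J. (of_int (y l) :: 'k) = 0" by (rule indep)
  then have dvd: "int CHAR('k) dvd y l" if "l \<in> J" for l
    using that by (simp add: of_int_eq_0_iff_char_dvd)
  have "g * int CHAR('k) dvd Gcd (z ` J)"
    by (rule Gcd_greatest) (use zg dvd in auto)
  then have "int CHAR('k) dvd 1" using g0 unfolding g_def[symmetric]
    by (metis dvd_mult_cancel_left mult.right_neutral)
  moreover have "prime CHAR('k)" by (rule prime_CHAR_semidom) (rule finite_imp_CHAR_pos, simp)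
  ultimately show False by (simp add: prime_nat_iff)
qed

section \<open>Counting, and properties of most points\<close>

definition independent_columns :: "'k::field itself => 'i set => ('i => 'j => int) => 'j set => bool" where
  "independent_columns K I X J \<longleftrightarrow>
    (\<forall>z :: 'j => 'k. (\<forall>i\<in>I. (\<Sum>j\<in>J. of_int (X i j) * z j) = 0) --> (\<forall>j\<in>J. z j = 0))"

text \<open>For a maximal independent set \<open>J'\<close> of columns the coordinates outside \<open>J'\<close> can be prescribed freely.\<close>

lemma card_kernel_ge:
  fixes X :: "'i => 'j => int"
  assumes fin: "finite I" "finite J"
  obtains J' where "J' \<subseteq> J" "independent_columns TYPE('k::{field,finite}) I X J'"
    "CARD('k) ^ (card J - card J') \<le>
      card {y \<in> J \<rightarrow>\<^sub>E (UNIV :: 'k set). \<forall>i\<in>I. (\<Sum>j\<in>J. of_int (X i j) * y j) = 0}"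
proof -
  let ?Ind = "\<lambda>J'. J' \<subseteq> J \<and> independent_columns TYPE('k) I X J'"
  define \<C> where "\<C> = {J'. ?Ind J'}"
  have "finite \<C>" unfolding \<C>_def using fin(2) by (intro finite_subset[OF _ finite_Pow_iff[THEN iffD2]]) auto
  moreover have "{} \<in> \<C>" by (simp add: \<C>_def independent_columns_def)
  ultimately have "Max (card ` \<C>) \<in> card ` \<C>" by (intro Max_in) auto
  then obtain J' where J'': "J' \<in> \<C>" "card J' = Max (card ` \<C>)" by auto
  then have J': "?Ind J'" by (simp add: \<C>_def)
  have max: "card J'' \<le> card J'" if "?Ind J''" for J''
    unfolding J''(2) using that \<open>finite \<C>\<close> by (intro Max_ge) (auto simp: \<C>_def)
  have finJ': "finite J'" using J' fin finite_subset by blast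
  have "\<exists>c. \<forall>i\<in>I. (of_int (X i j) :: 'k) = (\<Sum>l\<in>J'. of_int (X i l) * c l)" if j: "j \<in> J - J'" for j
  proof -
    have "\<not> ?Ind (insert j J')" using max[of "insert j J'"] j finJ' by auto
    then obtain z :: "'j => 'k" where z: "\<forall>i\<in>I. (\<Sum>l\<in>insert j J'. of_int (X i l) * z l) = 0"
      "\<not> (\<forall>l\<in>insert j J'. z l = 0)"
      using j J' unfolding independent_columns_def by blast
    have z1: "of_int (X i j) * z j + (\<Sum>l\<in>J'. of_int (X i l) * z l) = 0" if "i \<in> I" for i
      using z(1) that j finJ' by simp
    have zj: "z j \<noteq> 0"
    proof
      assume 0: "z j = 0"
      then have "\<forall>l\<in>J'. z l = 0" using z1 J' unfolding independent_columns_def by simp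
      then show False using z(2) 0 by auto
    qed
    have "of_int (X i j) = (\<Sum>l\<in>J'. of_int (X i l) * (- z l / z j))" if "i \<in> I" for i
    proof -
      have "of_int (X i j) * z j = - (\<Sum>l\<in>J'. of_int (X i l) * z l)"
	using z1[OF that] by (simp add: eq_neg_iff_add_eq_0)
      then have "of_int (X i j) = - (\<Sum>l\<in>J'. of_int (X i l) * z l) / z j" using zj by (simp add: field_simps)
      then show ?thesis by (simp add: sum_divide_distrib sum_negf)
    qed
    then show ?thesis by (intro exI[of _ "\<lambda>l. - z l / z j"] ballI)
  qed
  then obtain c :: "'j => 'j => 'k" where
    c: "\<And>j i. j \<in> J - J' ==> i \<in> I ==> of_int (X i j) = (\<Sum>l\<in>J'. of_int (X i l) * c j l)"
    by metis
  define ext where "ext u = (\<lambda>j\<in>J. if j \<in> J' then - (\<Sum>j'\<in>J - J'. c j' j * u j') else u j)" for u :: "'j => 'k"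
  let ?U = "(J - J') \<rightarrow>\<^sub>E (UNIV :: 'k set)"
  let ?Ker = "{y \<in> J \<rightarrow>\<^sub>E (UNIV :: 'k set). \<forall>i\<in>I. (\<Sum>j\<in>J. of_int (X i j) * y j) = 0}"
  have "inj_on ext ?U"
  proof (rule inj_onI)
    fix u u' assume u: "u \<in> ?U" "u' \<in> ?U" "ext u = ext u'"
    show "u = u'"
    proof (rule PiE_ext[OF u(1,2)])
      fix j assume "j \<in> J - J'"
      then show "u j = u' j" using fun_cong[OF u(3), of j] by (simp add: ext_def)
    qed
  qed
  moreover have "ext ` ?U \<subseteq> ?Ker"
  proof clarsimp
    fix u assume "u \<in> ?U"
    show "ext u \<in> J \<rightarrow>\<^sub>E UNIV \<and> (\<forall>i\<in>I. (\<Sum>j\<in>J. of_int (X i j) * ext u j) = 0)"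
    proof (intro conjI ballI)
      show "ext u \<in> J \<rightarrow>\<^sub>E UNIV" by (simp add: ext_def)
      fix i assume i: "i \<in> I"
      have "(\<Sum>j\<in>J. of_int (X i j) * ext u j) =
	  (\<Sum>j\<in>J - J'. of_int (X i j) * ext u j) + (\<Sum>j\<in>J'. of_int (X i j) * ext u j)"
	using J' fin by (intro sum.subset_diff) auto
      also have "(\<Sum>j\<in>J'. of_int (X i j) * ext u j) = (\<Sum>l\<in>J'. \<Sum>j\<in>J - J'. - (of_int (X i l) * c j l * u j))"
	using J' by (intro sum.cong) (auto simp: ext_def sum_distrib_left sum_negf mult.assoc)
      also have "... = (\<Sum>j\<in>J - J'. \<Sum>l\<in>J'. - (of_int (X i l) * c j l * u j))" by (rule sum.swap)
      also have "... = - (\<Sum>j\<in>J - J'. of_int (X i j) * u j)"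
	using c[OF _ i] by (simp add: sum_negf sum_distrib_right)
      also have "(\<Sum>j\<in>J - J'. of_int (X i j) * ext u j) = (\<Sum>j\<in>J - J'. of_int (X i j) * u j)"
	by (intro sum.cong) (auto simp: ext_def)
      finally show "(\<Sum>j\<in>J. of_int (X i j) * ext u j) = 0" by simp
    qed
  qed
  moreover have "finite ?Ker"
    by (rule finite_subset[OF _ finite_PiE[OF fin(2), of "\<lambda>_. UNIV"]]) auto
  ultimately have "card ?U \<le> card ?Ker" by (meson card_inj_on_le)
  moreover have "card ?U = CARD('k) ^ (card J - card J')"
    using J' fin by (simp add: card_PiE card_Diff_subset finJ')
  ultimately show ?thesis using that[of J'] J' by simp
qed

text \<open>Weigh each exceptional value by \<open>t\<close>: a function with at most \<open>e * card A\<close> exceptions has weight at least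
\<open>t^(e * card A)\<close>, while all weights together sum to at most \<open>(1 + t * card \<Omega>)^(card A)\<close>.\<close>

lemma card_few_exceptions:
  assumes fin: "finite A" "finite \<Omega>" and \<omega>: "\<omega> \<in> \<Omega>" and t: "0 < t" "t \<le> 1"
  shows "real (card {u \<in> A \<rightarrow>\<^sub>E \<Omega>. real (card {v \<in> A. u v \<noteq> \<omega>}) \<le> e * real (card A)}) \<le>
    exp (real (card A) * (e * ln (1 / t) + t * real (card \<Omega>)))"
proof -
  let ?U = "{u \<in> A \<rightarrow>\<^sub>E \<Omega>. real (card {v \<in> A. u v \<noteq> \<omega>}) \<le> e * real (card A)}"
  define wt where "wt x = (if x = \<omega> then 1 else t)" for x
  have finU: "finite ?U" by (rule finite_subset[OF _ finite_PiE[OF fin(1), of "\<lambda>_. \<Omega>"]]) (use fin in auto)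
  have lower: "exp (- (e * real (card A) * ln (1 / t))) \<le> (\<Prod>v\<in>A. wt (u v))" if "u \<in> ?U" for u
  proof -
    have "(\<Prod>v\<in>A. wt (u v)) = (\<Prod>v\<in>{v \<in> A. u v \<noteq> \<omega>}. t)"
      unfolding wt_def using fin by (intro prod.mono_neutral_cong_right) auto
    also have "... = exp (- (real (card {v \<in> A. u v \<noteq> \<omega>}) * ln (1 / t)))"
    proof -
      have "t ^ m = exp (- (real m * ln (1 / t)))" for m
	using t exp_of_nat_mult[of m "ln t"] by (simp add: ln_div)
      then show ?thesis by simp
    qed
    finally have eq: "(\<Prod>v\<in>A. wt (u v)) = exp (- (real (card {v \<in> A. u v \<noteq> \<omega>}) * ln (1 / t)))" .
    have "real (card {v \<in> A. u v \<noteq> \<omega>}) * ln (1 / t) \<le> e * real (card A) * ln (1 / t)"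
      using that t by (intro mult_right_mono) (auto simp: ln_div)
    then show ?thesis unfolding eq by simp
  qed
  have "real (card ?U) * exp (- (e * real (card A) * ln (1 / t))) =
      (\<Sum>u\<in>?U. exp (- (e * real (card A) * ln (1 / t))))" by simp
  also have "... \<le> (\<Sum>u\<in>?U. \<Prod>v\<in>A. wt (u v))" by (rule sum_mono) (rule lower)
  also have "... \<le> (\<Sum>u\<in>A \<rightarrow>\<^sub>E \<Omega>. \<Prod>v\<in>A. wt (u v))"
    using fin t by (intro sum_mono2 finite_PiE) (auto simp: wt_def intro!: prod_nonneg)
  also have "... = (\<Prod>v\<in>A. \<Sum>x\<in>\<Omega>. wt x)"
    using fin by (intro prod_sum_PiE[symmetric]) auto
  also have "... \<le> (\<Prod>v\<in>A. exp (t * real (card \<Omega>)))"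
  proof (rule prod_mono, intro conjI)
    show "0 \<le> (\<Sum>x\<in>\<Omega>. wt x)" using t by (intro sum_nonneg) (auto simp: wt_def)
    have "(\<Sum>x\<in>\<Omega>. wt x) = 1 + (\<Sum>x\<in>\<Omega> - {\<omega>}. t)"
      using fin \<omega> by (subst sum.remove[of _ \<omega>]) (auto simp: wt_def intro!: sum.cong)
    also have "... \<le> 1 + t * real (card \<Omega>)"
      using fin \<omega> t by (auto simp: card_Diff_subset of_nat_diff field_simps)
    also have "... \<le> exp (t * real (card \<Omega>))" by (rule exp_ge_add_one_self)
    finally show "(\<Sum>x\<in>\<Omega>. wt x) \<le> exp (t * real (card \<Omega>))" .
  qed
  also have "... = exp (real (card A) * (t * real (card \<Omega>)))"
    by (simp add: exp_of_nat_mult)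
  finally have "real (card ?U) \<le> exp (real (card A) * (t * real (card \<Omega>))) * exp (e * real (card A) * ln (1 / t))"
    by (simp add: exp_minus field_simps)
  then show ?thesis by (simp add: exp_add[symmetric] algebra_simps)
qed

definition most :: "(nat => 'd set) => (nat => 'd => bool) => bool" where
  "most D P \<longleftrightarrow> (\<lambda>n. real (card {v \<in> D n. \<not> P n v}) / real (card (D n))) \<longlonglongrightarrow> 0"

lemma most_mono:
  assumes "most D P" and fin: "\<And>n. finite (D n)" and "\<And>n v. v \<in> D n ==> P n v ==> Q n v"
  shows "most D Q"
  unfolding most_def
proof (rule tendsto_sandwich[of "\<lambda>_. 0", OF always_eventually always_eventually])
  show "\<forall>n. real (card {v \<in> D n. \<not> Q n v}) / real (card (D n)) \<le> real (card {v \<in> D n. \<not> P n v}) / real (card (D n))"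
    using assms(3) fin by (intro allI divide_right_mono of_nat_mono card_mono) auto
qed (use assms(1) in \<open>auto simp: most_def\<close>)

lemma most_conj:
  assumes "most D P" "most D Q" and fin: "\<And>n. finite (D n)"
  shows "most D (\<lambda>n v. P n v \<and> Q n v)"
  unfolding most_def
proof (rule tendsto_sandwich[of "\<lambda>_. 0", OF always_eventually always_eventually])
  let ?b = "\<lambda>P n. real (card {v \<in> D n. \<not> P n v}) / real (card (D n))"
  show "\<forall>n. ?b (\<lambda>n v. P n v \<and> Q n v) n \<le> ?b P n + ?b Q n"
  proof
    fix n
    have "{v \<in> D n. \<not> (P n v \<and> Q n v)} = {v \<in> D n. \<not> P n v} \<union> {v \<in> D n. \<not> Q n v}" by auto
    then have "card {v \<in> D n. \<not> (P n v \<and> Q n v)} \<le> card {v \<in> D n. \<not> P n v} + card {v \<in> D n. \<not> Q n v}"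
      by (simp only: card_Un_le)
    then show "?b (\<lambda>n v. P n v \<and> Q n v) n \<le> ?b P n + ?b Q n"
      unfolding add_divide_distrib[symmetric] of_nat_add[symmetric] by (intro divide_right_mono of_nat_mono) auto
  qed
  show "(\<lambda>n. ?b P n + ?b Q n) \<longlonglongrightarrow> 0"
    using tendsto_add[of "?b P" 0 sequentially "?b Q" 0] assms(1,2) by (simp add: most_def)
qed auto

lemma most_True: "most D (\<lambda>_ _. True)"
  by (simp add: most_def)

lemma most_finite_ball:
  assumes "finite A" and "\<And>a. a \<in> A ==> most D (P a)" and fin: "\<And>n. finite (D n)"
  shows "most D (\<lambda>n v. \<forall>a\<in>A. P a n v)"
  using assms(1,2)
proof (induction A rule: finite_induct)
  case empty
  then show ?case using most_True by simp
next
  case (insert a A)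
  then show ?case using most_conj[of D "P a" "\<lambda>n v. \<forall>a\<in>A. P a n v"] fin by simp
qed

lemma most_eventually:
  assumes "most D P" "0 < e" and ne: "eventually (\<lambda>n. D n \<noteq> {}) sequentially" and fin: "\<And>n. finite (D n)"
  shows "eventually (\<lambda>n. real (card {v \<in> D n. \<not> P n v}) \<le> e * real (card (D n))) sequentially"
proof -
  have "eventually (\<lambda>n. real (card {v \<in> D n. \<not> P n v}) / real (card (D n)) < e) sequentially"
    using assms(1,2) unfolding most_def by (rule order_tendstoD(2))
  then show ?thesis using ne
    by eventually_elim (use fin in \<open>simp add: field_simps card_gt_0_iff\<close>)
qed

section \<open>Group ring matrices and their sofic models\<close>

text \<open>A matrix of integral combinations of right translations, as given by a matrix over the group ring; it commutes with left translation.\<close>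

definition gop :: "('g, 'm) monoid_scheme => 'a set => 'g set => ('r => 'a => 'g => int) =>
    ('g \<times> 'a => 'k::comm_ring_1) => 'g \<times> 'r => 'k" where
  "gop G T S a x = (\<lambda>(g,r). \<Sum>t\<in>T. \<Sum>h\<in>S. of_int (a r t h) * x (g \<otimes>\<^bsub>G\<^esub> h, t))"

definition gop_adj :: "('g, 'm) monoid_scheme => 'r set => 'g set => ('r => 'a => 'g => int) =>
    ('g \<times> 'r => 'k::comm_ring_1) => 'g \<times> 'a => 'k" where
  "gop_adj G V S a y = (\<lambda>(g,t). \<Sum>r\<in>V. \<Sum>h\<in>S. of_int (a r t h) * y (g \<otimes>\<^bsub>G\<^esub> inv\<^bsub>G\<^esub> h, r))"

text \<open>The sofic model of \<open>gop\<close>: the point \<open>v\<close> plays the role of the unit element, and \<open>s (inv h) v\<close> that of \<open>h\<close>.\<close>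

definition model_matrix :: "('g, 'm) monoid_scheme => 'g set => ('r => 'a => 'g => int) =>
    ('g => 'd => 'd) => 'd \<times> 'r => 'd \<times> 'a => int" where
  "model_matrix G S a s = (\<lambda>(v,r) (w,t). \<Sum>h\<in>S. if s (inv\<^bsub>G\<^esub> h) v = w then a r t h else 0)"

definition pullback :: "('g, 'm) monoid_scheme => ('g => 'd => 'd) => 'd => ('d \<times> 'a => 'k) => 'g \<times> 'a => 'k" where
  "pullback G s v x = (\<lambda>(g,t). x (s (inv\<^bsub>G\<^esub> g) v, t))"

lemma sum_Times: "sum f (A \<times> B) = (\<Sum>a\<in>A. \<Sum>b\<in>B. f (a,b))"
  by (simp add: sum.cartesian_product)

lemma model_matrix_row:
  fixes x :: "'d \<times> 'a => 'k::comm_ring_1"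
  assumes "finite A" "\<And>h. h \<in> S ==> s (inv\<^bsub>G\<^esub> h) v \<in> A"
  shows "(\<Sum>j\<in>A \<times> T. of_int (model_matrix G S a s (v,r) j) * x j) =
    (\<Sum>t\<in>T. \<Sum>h\<in>S. of_int (a r t h) * x (s (inv\<^bsub>G\<^esub> h) v, t))"
proof -
  have "(\<Sum>j\<in>A \<times> T. of_int (model_matrix G S a s (v,r) j) * x j) =
      (\<Sum>w\<in>A. \<Sum>t\<in>T. \<Sum>h\<in>S. if s (inv\<^bsub>G\<^esub> h) v = w then of_int (a r t h) * x (w,t) else 0)"
    unfolding sum_Times
  proof (intro sum.cong refl)
    fix w t
    show "of_int (model_matrix G S a s (v,r) (w,t)) * x (w,t) =
	(\<Sum>h\<in>S. if s (inv\<^bsub>G\<^esub> h) v = w then of_int (a r t h) * x (w,t) else 0)"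
      unfolding model_matrix_def case_prod_conv of_int_sum sum_distrib_right
      by (intro sum.cong refl) simp
  qed
  also have "... = (\<Sum>t\<in>T. \<Sum>w\<in>A. \<Sum>h\<in>S. if s (inv\<^bsub>G\<^esub> h) v = w then of_int (a r t h) * x (w,t) else 0)"
    by (rule sum.swap)
  also have "... = (\<Sum>t\<in>T. \<Sum>h\<in>S. \<Sum>w\<in>A. if s (inv\<^bsub>G\<^esub> h) v = w then of_int (a r t h) * x (w,t) else 0)"
    by (intro sum.cong refl sum.swap)
  also have "... = (\<Sum>t\<in>T. \<Sum>h\<in>S. of_int (a r t h) * x (s (inv\<^bsub>G\<^esub> h) v, t))"
    using assms by (intro sum.cong refl) simp
  finally show ?thesis .
qed

lemma model_matrix_col:
  fixes y :: "'d \<times> 'r => 'k::comm_ring_1"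
  assumes "finite A" "\<And>h. h \<in> S ==> u h \<in> A" "\<And>h v. h \<in> S ==> v \<in> A ==> s (inv\<^bsub>G\<^esub> h) v = w \<longleftrightarrow> v = u h"
  shows "(\<Sum>i\<in>A \<times> V. of_int (model_matrix G S a s i (w,t)) * y i) =
    (\<Sum>r\<in>V. \<Sum>h\<in>S. of_int (a r t h) * y (u h, r))"
proof -
  have "(\<Sum>i\<in>A \<times> V. of_int (model_matrix G S a s i (w,t)) * y i) =
      (\<Sum>v\<in>A. \<Sum>r\<in>V. \<Sum>h\<in>S. if v = u h then of_int (a r t h) * y (v,r) else 0)"
    unfolding sum_Times
  proof (intro sum.cong refl)
    fix v r assume "v \<in> A"
    then show "of_int (model_matrix G S a s (v,r) (w,t)) * y (v,r) =
	(\<Sum>h\<in>S. if v = u h then of_int (a r t h) * y (v,r) else 0)"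
      unfolding model_matrix_def case_prod_conv of_int_sum sum_distrib_right
      using assms(3) by (intro sum.cong refl) simp
  qed
  also have "... = (\<Sum>r\<in>V. \<Sum>v\<in>A. \<Sum>h\<in>S. if v = u h then of_int (a r t h) * y (v,r) else 0)"
    by (rule sum.swap)
  also have "... = (\<Sum>r\<in>V. \<Sum>h\<in>S. \<Sum>v\<in>A. if v = u h then of_int (a r t h) * y (v,r) else 0)"
    by (intro sum.cong refl sum.swap)
  also have "... = (\<Sum>r\<in>V. \<Sum>h\<in>S. of_int (a r t h) * y (u h, r))"
    using assms by (intro sum.cong refl) simp
  finally show ?thesis .
qed

text \<open>A bound for the squared operator norms of all models at once.\<close>

definition coeff_bound :: "'r set => 'a set => 'g set => ('r => 'a => 'g => int) => real" where
  "coeff_bound V T S a = real (card S) * (\<Sum>r\<in>V. \<Sum>t\<in>T. \<Sum>h\<in>S. (of_int (a r t h))\<^sup>2)"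

lemma model_matrix_norm:
  fixes z :: "'d \<times> 'a => real"
  assumes fin: "finite A" "finite T" "finite S" and perm: "\<And>h. h \<in> S ==> s (inv\<^bsub>G\<^esub> h) permutes A"
  shows "(\<Sum>i\<in>A \<times> V. (\<Sum>j\<in>A \<times> T. of_int (model_matrix G S a s i j) * z j)\<^sup>2) \<le>
    coeff_bound V T S a * (\<Sum>j\<in>A \<times> T. (z j)\<^sup>2)"
proof -
  define C where "C r = (\<Sum>t\<in>T. \<Sum>h\<in>S. (real_of_int (a r t h))\<^sup>2)" for r
  have C0: "0 \<le> C r" for r unfolding C_def by (intro sum_nonneg) auto
  have "(\<Sum>i\<in>A \<times> V. (\<Sum>j\<in>A \<times> T. of_int (model_matrix G S a s i j) * z j)\<^sup>2) =
      (\<Sum>v\<in>A. \<Sum>r\<in>V. (\<Sum>t\<in>T. \<Sum>h\<in>S. of_int (a r t h) * z (s (inv\<^bsub>G\<^esub> h) v, t))\<^sup>2)"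
    unfolding sum_Times[of _ A V]
  proof (intro sum.cong refl)
    fix v r assume v: "v \<in> A"
    have "s (inv\<^bsub>G\<^esub> h) v \<in> A" if "h \<in> S" for h using perm[OF that] v by (simp add: permutes_in_image)
    then have "(\<Sum>j\<in>A \<times> T. of_int (model_matrix G S a s (v,r) j) * z j) =
	(\<Sum>t\<in>T. \<Sum>h\<in>S. of_int (a r t h) * z (s (inv\<^bsub>G\<^esub> h) v, t))"
      by (intro model_matrix_row[where G = G and S = S and s = s] fin) auto
    then show "(\<Sum>j\<in>A \<times> T. of_int (model_matrix G S a s (v,r) j) * z j)\<^sup>2 =
      (\<Sum>t\<in>T. \<Sum>h\<in>S. of_int (a r t h) * z (s (inv\<^bsub>G\<^esub> h) v, t))\<^sup>2" by simp
  qed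
  also have "... \<le> (\<Sum>v\<in>A. \<Sum>r\<in>V. C r * (\<Sum>t\<in>T. \<Sum>h\<in>S. (z (s (inv\<^bsub>G\<^esub> h) v, t))\<^sup>2))"
  proof (intro sum_mono)
    fix v r
    show "(\<Sum>t\<in>T. \<Sum>h\<in>S. of_int (a r t h) * z (s (inv\<^bsub>G\<^esub> h) v, t))\<^sup>2 \<le>
	C r * (\<Sum>t\<in>T. \<Sum>h\<in>S. (z (s (inv\<^bsub>G\<^esub> h) v, t))\<^sup>2)"
      using Cauchy_Schwarz_ineq_sum[of "\<lambda>(t,h). real_of_int (a r t h)" "\<lambda>(t,h). z (s (inv\<^bsub>G\<^esub> h) v, t)" "T \<times> S"]
      by (simp add: C_def sum.cartesian_product case_prod_unfold)
  qed
  also have "... = (\<Sum>r\<in>V. C r) * (\<Sum>v\<in>A. \<Sum>t\<in>T. \<Sum>h\<in>S. (z (s (inv\<^bsub>G\<^esub> h) v, t))\<^sup>2)"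
    unfolding sum_product by (rule sum.swap)
  also have "(\<Sum>v\<in>A. \<Sum>t\<in>T. \<Sum>h\<in>S. (z (s (inv\<^bsub>G\<^esub> h) v, t))\<^sup>2) =
      (\<Sum>h\<in>S. \<Sum>t\<in>T. \<Sum>v\<in>A. (z (s (inv\<^bsub>G\<^esub> h) v, t))\<^sup>2)"
    by (subst sum.swap, subst sum.swap[of _ S A], subst sum.swap[of _ S T], simp add: sum.swap[of _ T A])
  also have "... = (\<Sum>h\<in>S. \<Sum>t\<in>T. \<Sum>v\<in>A. (z (v, t))\<^sup>2)"
  proof (rule sum.cong[OF refl], rule sum.cong[OF refl])
    fix h t assume "h \<in> S"
    then have "bij_betw (s (inv\<^bsub>G\<^esub> h)) A A" using perm permutes_imp_bij by blast
    then show "(\<Sum>v\<in>A. (z (s (inv\<^bsub>G\<^esub> h) v, t))\<^sup>2) = (\<Sum>v\<in>A. (z (v, t))\<^sup>2)"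
      by (rule sum.reindex_bij_betw[where g = "\<lambda>v. (z (v, t))\<^sup>2"])
  qed
  also have "... = real (card S) * (\<Sum>j\<in>A \<times> T. (z j)\<^sup>2)"
    unfolding sum_Times by (subst sum.swap) simp
  finally show ?thesis by (simp add: coeff_bound_def C_def mult_ac)
qed

lemma transpose_norm:
  fixes X :: "'i => 'j => int"
  assumes R: "0 \<le> R"
    and bound: "\<And>z :: 'j => real. (\<Sum>i\<in>I. (\<Sum>j\<in>J. of_int (X i j) * z j)\<^sup>2) \<le> R * (\<Sum>j\<in>J. (z j)\<^sup>2)"
  shows "(\<Sum>j\<in>J. (\<Sum>i\<in>I. of_int (X i j) * y i)\<^sup>2) \<le> R * (\<Sum>i\<in>I. (y i :: real)\<^sup>2)"
proof -
  define z where "z j = (\<Sum>i\<in>I. of_int (X i j) * y i)" for j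
  define q where "q = (\<Sum>j\<in>J. (z j)\<^sup>2)"
  have "q = (\<Sum>j\<in>J. \<Sum>i\<in>I. y i * (of_int (X i j) * z j))"
    unfolding q_def by (simp add: power2_eq_square z_def sum_distrib_right mult_ac)
  also have "... = (\<Sum>i\<in>I. \<Sum>j\<in>J. y i * (of_int (X i j) * z j))" by (rule sum.swap)
  also have "... = (\<Sum>i\<in>I. y i * (\<Sum>j\<in>J. of_int (X i j) * z j))" by (simp add: sum_distrib_left)
  finally have q: "q = ..." .
  have "q\<^sup>2 \<le> (\<Sum>i\<in>I. (y i)\<^sup>2) * (\<Sum>i\<in>I. (\<Sum>j\<in>J. of_int (X i j) * z j)\<^sup>2)"
    unfolding q by (rule Cauchy_Schwarz_ineq_sum)
  also have "... \<le> (\<Sum>i\<in>I. (y i)\<^sup>2) * (R * q)"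
    unfolding q_def by (intro mult_left_mono bound sum_nonneg) auto
  finally have *: "q * q \<le> (R * (\<Sum>i\<in>I. (y i)\<^sup>2)) * q" by (simp add: power2_eq_square mult_ac)
  have "0 \<le> q" unfolding q_def by (intro sum_nonneg) auto
  moreover have "0 \<le> R * (\<Sum>i\<in>I. (y i)\<^sup>2)" using R by (intro mult_nonneg_nonneg sum_nonneg) auto
  ultimately have "q \<le> R * (\<Sum>i\<in>I. (y i)\<^sup>2)" using * by (cases "q = 0") auto
  then show ?thesis by (simp add: q_def z_def)
qed

lemma damped_self_adjoint:
  "(\<Sum>j\<in>J. damped I J X R f j * g j) = (\<Sum>j\<in>J. f j * damped I J X R g j)"
proof -
  have *: "(\<Sum>j\<in>J. (\<Sum>i\<in>I. of_int (X i j) * (\<Sum>j'\<in>J. of_int (X i j') * f j')) * g j) =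
      (\<Sum>i\<in>I. (\<Sum>j\<in>J. of_int (X i j) * f j) * (\<Sum>j\<in>J. of_int (X i j) * g j))" for f g :: "'a => real"
  proof -
    define F where "F i = (\<Sum>j\<in>J. of_int (X i j) * f j)" for i
    have "(\<Sum>j\<in>J. (\<Sum>i\<in>I. of_int (X i j) * F i) * g j) = (\<Sum>j\<in>J. \<Sum>i\<in>I. F i * (of_int (X i j) * g j))"
      unfolding sum_distrib_right by (simp add: mult_ac)
    also have "... = (\<Sum>i\<in>I. \<Sum>j\<in>J. F i * (of_int (X i j) * g j))" by (rule sum.swap)
    finally show ?thesis by (simp add: F_def sum_distrib_left)
  qed
  have "(\<Sum>j\<in>J. damped I J X R f j * g j) = (\<Sum>j\<in>J. f j * g j) -
      (\<Sum>i\<in>I. (\<Sum>j\<in>J. of_int (X i j) * f j) * (\<Sum>j\<in>J. of_int (X i j) * g j)) / R"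
    unfolding *[of f g, symmetric] by (simp add: damped_def left_diff_distrib sum_subtractf sum_divide_distrib[of _ J])
  moreover have "(\<Sum>j\<in>J. damped I J X R g j * f j) = (\<Sum>j\<in>J. g j * f j) -
      (\<Sum>i\<in>I. (\<Sum>j\<in>J. of_int (X i j) * g j) * (\<Sum>j\<in>J. of_int (X i j) * f j)) / R"
    unfolding *[of g f, symmetric] by (simp add: damped_def left_diff_distrib sum_subtractf sum_divide_distrib[of _ J])
  ultimately show ?thesis by (simp add: mult.commute)
qed

text \<open>An even power of a self-adjoint operator is positive.\<close>

lemma damped_diag_nonneg:
  assumes "finite J" "j \<in> J"
  shows "0 \<le> (damped I J X R ^^ (2 * m)) (\<lambda>k. if k = j then 1 else 0) j"
proof -
  let ?e = "\<lambda>k. if k = j then 1 else (0::real)" and ?T = "damped I J X R"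
  have adj: "(\<Sum>k\<in>J. (?T ^^ m) f k * g k) = (\<Sum>k\<in>J. f k * (?T ^^ m) g k)" for f g m
    by (induction m arbitrary: f g) (auto simp: damped_self_adjoint funpow_swap1)
  have "(?T ^^ (2 * m)) ?e j = (\<Sum>k\<in>J. (?T ^^ m) ((?T ^^ m) ?e) k * ?e k)"
    using assms by (simp add: mult_2 funpow_add if_distrib cong: if_cong)
  also have "... = (\<Sum>k\<in>J. (?T ^^ m) ?e k * (?T ^^ m) ?e k)" by (rule adj)
  finally show ?thesis by (simp add: sum_nonneg)
qed

locale sofic_group = group G for G :: "('a, 'm) monoid_scheme" (structure) +
  fixes D :: "nat => 'd set" and \<sigma> :: "nat => 'a => 'd => 'd"
  assumes sofic: "sofic_approximation G D \<sigma>"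
begin

lemma finite_D [simp]: "finite (D n)"
  using sofic by (simp add: sofic_approximation_def)

lemma sigma_permutes: "g \<in> carrier G ==> \<sigma> n g permutes D n"
  using sofic by (simp add: sofic_approximation_def)

lemma sigma_in [simp]: "g \<in> carrier G ==> v \<in> D n ==> \<sigma> n g v \<in> D n"
  using sigma_permutes by (simp add: permutes_in_image)

lemma sigma_inj: "g \<in> carrier G ==> \<sigma> n g v = \<sigma> n g w \<longleftrightarrow> v = w"
  using permutes_inj[OF sigma_permutes] by (auto dest: injD)

lemma sigma_one [simp]: "\<sigma> n \<one> v = v"
  using sofic by (simp add: sofic_approximation_def)

lemma D_nonempty: "eventually (\<lambda>n. D n \<noteq> {}) sequentially"
proof -
  have "eventually (\<lambda>n. 1 \<le> card (D n)) sequentially"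
    using sofic unfolding sofic_approximation_def filterlim_at_top by blast
  then show ?thesis by eventually_elim auto
qed

lemma most_if_density_one:
  assumes "(\<lambda>n. real (card {i \<in> D n. P n i}) / real (card (D n))) \<longlonglongrightarrow> 1"
  shows "most D P"
proof -
  have "eventually (\<lambda>n. 1 - real (card {i \<in> D n. P n i}) / real (card (D n)) =
      real (card {i \<in> D n. \<not> P n i}) / real (card (D n))) sequentially"
    using D_nonempty
  proof eventually_elim
    case (elim n)
    have "{i \<in> D n. \<not> P n i} = D n - {i \<in> D n. P n i}" by auto
    then have "card {i \<in> D n. \<not> P n i} = card (D n) - card {i \<in> D n. P n i}"
      by (simp add: card_Diff_subset)
    moreover have "card {i \<in> D n. P n i} \<le> card (D n)" by (intro card_mono) auto
    moreover have "card (D n) > 0" using elim by (simp add: card_gt_0_iff)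
    ultimately show ?case using elim by (simp add: of_nat_diff diff_divide_distrib)
  qed
  moreover have "(\<lambda>n. 1 - real (card {i \<in> D n. P n i}) / real (card (D n))) \<longlonglongrightarrow> 1 - 1"
    by (intro tendsto_intros assms)
  ultimately show ?thesis unfolding most_def by (simp add: tendsto_cong)
qed

lemma most_mult:
  "g \<in> carrier G ==> h \<in> carrier G ==> most D (\<lambda>n v. \<sigma> n g (\<sigma> n h v) = \<sigma> n (g \<otimes> h) v)"
  using sofic by (intro most_if_density_one) (simp add: sofic_approximation_def)

lemma most_free: "g \<in> carrier G ==> g \<noteq> \<one> ==> most D (\<lambda>n v. \<sigma> n g v \<noteq> v)"
  using sofic by (intro most_if_density_one) (simp add: sofic_approximation_def)

lemma most_shift:
  assumes "most D P" "f \<in> carrier G"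
  shows "most D (\<lambda>n v. P n (\<sigma> n f v))"
proof -
  have "card {v \<in> D n. \<not> P n (\<sigma> n f v)} = card {v \<in> D n. \<not> P n v}" for n
  proof (rule bij_betw_same_card[of "\<sigma> n f"])
    have "bij_betw (\<sigma> n f) (D n) (D n)" using sigma_permutes[OF assms(2)] permutes_imp_bij by blast
    then have im: "\<sigma> n f ` D n = D n" "inj_on (\<sigma> n f) (D n)" by (auto simp: bij_betw_def)
    show "bij_betw (\<sigma> n f) {v \<in> D n. \<not> P n (\<sigma> n f v)} {v \<in> D n. \<not> P n v}"
      unfolding bij_betw_def
    proof
      show "inj_on (\<sigma> n f) {v \<in> D n. \<not> P n (\<sigma> n f v)}" using im(2) by (rule inj_on_subset) auto
      show "\<sigma> n f ` {v \<in> D n. \<not> P n (\<sigma> n f v)} = {v \<in> D n. \<not> P n v}"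
	using im(1) by (auto simp: assms(2))
    qed
  qed
  then show ?thesis using assms(1) by (simp add: most_def)
qed

lemmas most_mono_D = most_mono[OF _ finite_D]
lemmas most_conj_D = most_conj[OF _ _ finite_D]
lemmas most_finite_ball_D = most_finite_ball[OF _ _ finite_D]

text \<open>Near most points, the operators \<open>Q n\<close> on functions on \<open>D n\<close> agree with \<open>q\<close> under pullback.\<close>

definition models_op :: "'u set => (nat => ('d \<times> 'w => real) => 'd \<times> 'u => real) =>
    (('a \<times> 'w => real) => 'a \<times> 'u => real) => bool" where
  "models_op B Q q \<longleftrightarrow> (\<forall>g\<in>carrier G. \<forall>b\<in>B.
    most D (\<lambda>n v. \<forall>x. Q n x (\<sigma> n (inv g) v, b) = q (pullback G (\<sigma> n) v x) (g, b)))"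

text \<open>Each value of \<open>q x\<close> depends on finitely many values of \<open>x\<close>. This lets \<open>models_op\<close> pass to compositions.\<close>

definition finite_range :: "'u set => 'w set => (('a \<times> 'w => real) => 'a \<times> 'u => real) => bool" where
  "finite_range B C q \<longleftrightarrow> (\<forall>g\<in>carrier G. \<forall>b\<in>B. \<exists>W. finite W \<and> W \<subseteq> carrier G \<times> C \<and>
      (\<forall>x y. (\<forall>w\<in>W. x w = y w) --> q x (g,b) = q y (g,b)))"

lemma models_op_comp:
  assumes Q: "models_op B Q q" and Q': "models_op C Q' q'" and fin: "finite_range B C q"
  shows "models_op B (\<lambda>n x. Q n (Q' n x)) (\<lambda>x. q (q' x))"
  unfolding models_op_def
proof (intro ballI)
  fix g b assume gb: "g \<in> carrier G" "b \<in> B"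
  obtain W where W: "finite W" "W \<subseteq> carrier G \<times> C"
    "\<And>x y. (\<forall>w\<in>W. x w = y w) ==> q x (g,b) = q y (g,b)"
    using fin gb unfolding finite_range_def by meson
  have 1: "most D (\<lambda>n v. \<forall>x. Q n x (\<sigma> n (inv g) v, b) = q (pullback G (\<sigma> n) v x) (g, b))"
    using Q gb unfolding models_op_def by blast
  have 2: "most D (\<lambda>n v. \<forall>w\<in>W. \<forall>x. Q' n x (\<sigma> n (inv (fst w)) v, snd w) = q' (pullback G (\<sigma> n) v x) (fst w, snd w))"
    using W Q' unfolding models_op_def by (intro most_finite_ball_D) auto
  show "most D (\<lambda>n v. \<forall>x. Q n (Q' n x) (\<sigma> n (inv g) v, b) = q (q' (pullback G (\<sigma> n) v x)) (g, b))"
  proof (rule most_mono_D[OF most_conj_D[OF 1 2]])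
    fix n v assume "v \<in> D n" and A: "(\<forall>x. Q n x (\<sigma> n (inv g) v, b) = q (pullback G (\<sigma> n) v x) (g, b)) \<and>
	(\<forall>w\<in>W. \<forall>x. Q' n x (\<sigma> n (inv (fst w)) v, snd w) = q' (pullback G (\<sigma> n) v x) (fst w, snd w))"
    show "\<forall>x. Q n (Q' n x) (\<sigma> n (inv g) v, b) = q (q' (pullback G (\<sigma> n) v x)) (g, b)"
    proof
      fix x
      have "Q n (Q' n x) (\<sigma> n (inv g) v, b) = q (pullback G (\<sigma> n) v (Q' n x)) (g, b)" using A by blast
      also have "... = q (q' (pullback G (\<sigma> n) v x)) (g, b)"
      proof (rule W(3))
	show "\<forall>w\<in>W. pullback G (\<sigma> n) v (Q' n x) w = q' (pullback G (\<sigma> n) v x) w"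
	proof
	  fix w assume "w \<in> W"
	  then have "Q' n x (\<sigma> n (inv (fst w)) v, snd w) = q' (pullback G (\<sigma> n) v x) (fst w, snd w)" using A by blast
	  then show "pullback G (\<sigma> n) v (Q' n x) w = q' (pullback G (\<sigma> n) v x) w"
	    by (simp add: pullback_def case_prod_unfold)
	qed
      qed
      finally show "Q n (Q' n x) (\<sigma> n (inv g) v, b) = q (q' (pullback G (\<sigma> n) v x)) (g, b)" .
    qed
  qed
qed

lemma finite_range_comp:
  assumes q: "finite_range B C q" and q': "finite_range C E q'"
  shows "finite_range B E (\<lambda>x. q (q' x))"
  unfolding finite_range_def
proof (intro ballI)
  fix g b assume gb: "g \<in> carrier G" "b \<in> B"
  obtain W where W: "finite W" "W \<subseteq> carrier G \<times> C"
    "\<And>x y. (\<forall>w\<in>W. x w = y w) ==> q x (g,b) = q y (g,b)"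
    using q gb unfolding finite_range_def by meson
  have "\<forall>w\<in>W. \<exists>U. finite U \<and> U \<subseteq> carrier G \<times> E \<and> (\<forall>x y. (\<forall>w\<in>U. x w = y w) --> q' x w = q' y w)"
  proof
    fix w assume "w \<in> W"
    then have "fst w \<in> carrier G" "snd w \<in> C" using W(2) by auto
    with q' have "\<exists>U. finite U \<and> U \<subseteq> carrier G \<times> E \<and>
	(\<forall>x y. (\<forall>w\<in>U. x w = y w) --> q' x (fst w, snd w) = q' y (fst w, snd w))"
      unfolding finite_range_def by blast
    then show "\<exists>U. finite U \<and> U \<subseteq> carrier G \<times> E \<and> (\<forall>x y. (\<forall>w\<in>U. x w = y w) --> q' x w = q' y w)"
      by simp
  qed
  then obtain U where U: "\<And>w. w \<in> W ==> finite (U w) \<and> U w \<subseteq> carrier G \<times> E \<and>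
      (\<forall>x y. (\<forall>w\<in>U w. x w = y w) --> q' x w = q' y w)" by metis
  show "\<exists>W. finite W \<and> W \<subseteq> carrier G \<times> E \<and> (\<forall>x y. (\<forall>w\<in>W. x w = y w) --> q (q' x) (g, b) = q (q' y) (g, b))"
  proof (intro exI[of _ "\<Union>(U ` W)"] conjI allI impI)
    show "finite (\<Union>(U ` W))" using W U by auto
    show "\<Union>(U ` W) \<subseteq> carrier G \<times> E" using U by blast
    fix x y assume xy: "\<forall>w\<in>\<Union>(U ` W). x w = (y w :: real)"
    show "q (q' x) (g, b) = q (q' y) (g, b)"
    proof (rule W(3), intro ballI)
      fix w assume w: "w \<in> W"
      then have "\<forall>u\<in>U w. x u = y u" using xy by auto
      then show "q' x w = q' y w" using U[OF w] by blast
    qed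
  qed
qed

end

section \<open>Ranks of sofic models\<close>

definition damped_cols :: "('g, 'm) monoid_scheme => 'r set => 'a set => 'g set => ('r => 'a => 'g => int) =>
    real => ('g \<times> 'a => real) => 'g \<times> 'a => real" where
  "damped_cols G V T S a R x = (\<lambda>j. x j - gop_adj G V S a (gop G T S a x) j / R)"

definition damped_rows :: "('g, 'm) monoid_scheme => 'r set => 'a set => 'g set => ('r => 'a => 'g => int) =>
    real => ('g \<times> 'r => real) => 'g \<times> 'r => real" where
  "damped_rows G V T S a R x = (\<lambda>j. x j - gop G T S a (gop_adj G V S a x) j / R)"

definition unit_trace :: "('g, 'm) monoid_scheme => 'b set => (('g \<times> 'b => real) => 'g \<times> 'b => real) => real" where
  "unit_trace G B q = (\<Sum>b\<in>B. q (\<lambda>j. if j = (\<one>\<^bsub>G\<^esub>, b) then 1 else 0) (\<one>\<^bsub>G\<^esub>, b))"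

text \<open>The error term of \<open>damped_trace_le\<close> per coordinate, with exponent \<open>N = 2 * m\<close>.\<close>

definition trace_error :: "real => nat => real" where
  "trace_error R m = 2 * (1 + ln R) / ln (real (2 * m))"

context sofic_group
begin

lemma inv_mult_swap: "g \<in> carrier G ==> h \<in> carrier G ==> inv h \<otimes> inv g = inv (g \<otimes> h)"
  by (simp add: inv_mult_group)

lemma models_op_gop:
  assumes S: "finite S" "S \<subseteq> carrier G" and T: "finite T"
  shows "models_op V (\<lambda>n x j. \<Sum>j'\<in>D n \<times> T. of_int (model_matrix G S a (\<sigma> n) j j') * x j') (gop G T S a)"
  unfolding models_op_def
proof (intro ballI)
  fix g r assume g: "g \<in> carrier G" and "r \<in> V"
  have "most D (\<lambda>n v. \<forall>h\<in>S. \<sigma> n (inv h) (\<sigma> n (inv g) v) = \<sigma> n (inv h \<otimes> inv g) v)"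
    using S g by (intro most_finite_ball_D most_mult) auto
  then show "most D (\<lambda>n v. \<forall>x. (\<Sum>j'\<in>D n \<times> T. of_int (model_matrix G S a (\<sigma> n) (\<sigma> n (inv g) v, r) j') * x j') =
      (gop G T S a (pullback G (\<sigma> n) v x) (g, r) :: real))"
  proof (rule most_mono_D, intro allI)
    fix n v and x :: "_ => real" assume v: "v \<in> D n" and *: "\<forall>h\<in>S. \<sigma> n (inv h) (\<sigma> n (inv g) v) = \<sigma> n (inv h \<otimes> inv g) v"
    have "(\<Sum>j'\<in>D n \<times> T. of_int (model_matrix G S a (\<sigma> n) (\<sigma> n (inv g) v, r) j') * x j') =
	(\<Sum>t\<in>T. \<Sum>h\<in>S. of_int (a r t h) * x (\<sigma> n (inv h) (\<sigma> n (inv g) v), t))"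
      using S g v by (intro model_matrix_row[where A = "D n" and S = S and s = "\<sigma> n" and G = G
	  and v = "\<sigma> n (inv g) v" and a = a and r = r and T = T and x = x]) auto
    also have "... = gop G T S a (pullback G (\<sigma> n) v x) (g, r)"
      unfolding gop_def pullback_def case_prod_conv
      using * S g by (intro sum.cong refl) (auto simp: inv_mult_swap subset_iff)
    finally show "(\<Sum>j'\<in>D n \<times> T. of_int (model_matrix G S a (\<sigma> n) (\<sigma> n (inv g) v, r) j') * x j') =
	gop G T S a (pullback G (\<sigma> n) v x) (g, r)" .
  qed
qed

lemma models_op_gop_adj:
  assumes S: "finite S" "S \<subseteq> carrier G"
  shows "models_op T (\<lambda>n y j. \<Sum>i\<in>D n \<times> V. of_int (model_matrix G S a (\<sigma> n) i j) * y i) (gop_adj G V S a)"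
  unfolding models_op_def
proof (intro ballI)
  fix g t assume g: "g \<in> carrier G" and "t \<in> T"
  have "most D (\<lambda>n v. \<forall>h\<in>S. \<sigma> n (inv h) (\<sigma> n (h \<otimes> inv g) v) = \<sigma> n (inv h \<otimes> (h \<otimes> inv g)) v)"
    using S g by (intro most_finite_ball_D most_mult) auto
  then show "most D (\<lambda>n v. \<forall>y. (\<Sum>i\<in>D n \<times> V. of_int (model_matrix G S a (\<sigma> n) i (\<sigma> n (inv g) v, t)) * y i) =
      (gop_adj G V S a (pullback G (\<sigma> n) v y) (g, t) :: real))"
  proof (rule most_mono_D, intro allI)
    fix n v and y :: "_ => real" assume v: "v \<in> D n" and *: "\<forall>h\<in>S. \<sigma> n (inv h) (\<sigma> n (h \<otimes> inv g) v) = \<sigma> n (inv h \<otimes> (h \<otimes> inv g)) v"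
    have **: "\<sigma> n (inv h) (\<sigma> n (h \<otimes> inv g) v) = \<sigma> n (inv g) v" if "h \<in> S" for h
    proof -
      have "h \<in> carrier G" using S that by auto
      then have "inv h \<otimes> (h \<otimes> inv g) = inv g" using g by (simp add: m_assoc[symmetric])
      then show ?thesis using * that by simp
    qed
    have "(\<Sum>i\<in>D n \<times> V. of_int (model_matrix G S a (\<sigma> n) i (\<sigma> n (inv g) v, t)) * y i) =
	(\<Sum>r\<in>V. \<Sum>h\<in>S. of_int (a r t h) * y (\<sigma> n (h \<otimes> inv g) v, r))"
    proof (intro model_matrix_col[where A = "D n" and S = S and s = "\<sigma> n" and G = G and a = a and V = V
	  and w = "\<sigma> n (inv g) v" and u = "\<lambda>h. \<sigma> n (h \<otimes> inv g) v" and y = y])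
      fix h assume h: "h \<in> S"
      then have hc: "h \<in> carrier G" using S by auto
      then show "\<sigma> n (h \<otimes> inv g) v \<in> D n" using g v by simp
      fix w
      show "\<sigma> n (inv h) w = \<sigma> n (inv g) v \<longleftrightarrow> w = \<sigma> n (h \<otimes> inv g) v"
	using **[OF h] sigma_inj[of "inv h" n w "\<sigma> n (h \<otimes> inv g) v"] hc by simp
    qed simp
    also have "... = gop_adj G V S a (pullback G (\<sigma> n) v y) (g, t)"
      unfolding gop_adj_def pullback_def case_prod_conv
      using S g by (intro sum.cong refl) (auto simp: inv_mult_group subset_iff)
    finally show "(\<Sum>i\<in>D n \<times> V. of_int (model_matrix G S a (\<sigma> n) i (\<sigma> n (inv g) v, t)) * y i) =
	gop_adj G V S a (pullback G (\<sigma> n) v y) (g, t)" .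
  qed
qed

lemma finite_range_gop:
  assumes "finite S" "S \<subseteq> carrier G" "finite T"
  shows "finite_range V T (gop G T S a)"
  unfolding finite_range_def
proof (intro ballI)
  fix g r assume g: "g \<in> carrier G" and "r \<in> V"
  show "\<exists>W. finite W \<and> W \<subseteq> carrier G \<times> T \<and> (\<forall>x y. (\<forall>w\<in>W. x w = y w) --> gop G T S a x (g, r) = (gop G T S a y (g, r) :: real))"
  proof (intro exI[of _ "(\<lambda>h. g \<otimes> h) ` S \<times> T"] conjI allI impI)
    fix x y assume "\<forall>w\<in>(\<lambda>h. g \<otimes> h) ` S \<times> T. x w = (y w :: real)"
    then show "gop G T S a x (g, r) = gop G T S a y (g, r)"
      unfolding gop_def case_prod_conv by (intro sum.cong refl) auto
  qed (use assms g in auto)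
qed

lemma finite_range_gop_adj:
  assumes "finite S" "S \<subseteq> carrier G" "finite V"
  shows "finite_range T V (gop_adj G V S a)"
  unfolding finite_range_def
proof (intro ballI)
  fix g t assume g: "g \<in> carrier G" and "t \<in> T"
  show "\<exists>W. finite W \<and> W \<subseteq> carrier G \<times> V \<and> (\<forall>x y. (\<forall>w\<in>W. x w = y w) --> gop_adj G V S a x (g, t) = (gop_adj G V S a y (g, t) :: real))"
  proof (intro exI[of _ "(\<lambda>h. g \<otimes> inv h) ` S \<times> V"] conjI allI impI)
    fix x y assume "\<forall>w\<in>(\<lambda>h. g \<otimes> inv h) ` S \<times> V. x w = (y w :: real)"
    then show "gop_adj G V S a x (g, t) = gop_adj G V S a y (g, t)"
      unfolding gop_adj_def case_prod_conv by (intro sum.cong refl) auto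
  qed (use assms g in auto)
qed

lemma models_op_damping:
  assumes "models_op B Q q"
  shows "models_op B (\<lambda>n x j. x j - Q n x j / R) (\<lambda>x j. x j - q x j / R)"
  unfolding models_op_def
proof (intro ballI)
  fix g b assume gb: "g \<in> carrier G" "b \<in> B"
  show "most D (\<lambda>n v. \<forall>x. x (\<sigma> n (inv g) v, b) - Q n x (\<sigma> n (inv g) v, b) / R =
      pullback G (\<sigma> n) v x (g, b) - q (pullback G (\<sigma> n) v x) (g, b) / R)"
    using assms gb unfolding models_op_def by (elim ballE most_mono_D) (auto simp: pullback_def)
qed

lemma finite_range_damping:
  assumes "finite_range B B q"
  shows "finite_range B B (\<lambda>x j. x j - q x j / R)"
  unfolding finite_range_def
proof (intro ballI)
  fix g b assume gb: "g \<in> carrier G" "b \<in> B"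
  obtain W where W: "finite W" "W \<subseteq> carrier G \<times> B" "\<And>x y. (\<forall>w\<in>W. x w = y w) ==> q x (g,b) = q y (g,b)"
    using assms gb unfolding finite_range_def by meson
  show "\<exists>W. finite W \<and> W \<subseteq> carrier G \<times> B \<and> (\<forall>x y. (\<forall>w\<in>W. x w = y w) -->
      x (g, b) - q x (g, b) / R = y (g, b) - q y (g, b) / R)"
    using W(1,2) gb by (intro exI[of _ "insert (g,b) W"]) (auto simp: W(3))
qed

lemma models_op_funpow:
  assumes Q: "models_op B Q q" and q: "finite_range B B q"
  shows "models_op B (\<lambda>n. Q n ^^ N) (q ^^ N) \<and> finite_range B B (q ^^ N)"
proof (induction N)
  case 0
  have "models_op B (\<lambda>n x. x) (\<lambda>x. x)" by (simp add: models_op_def pullback_def most_True)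
  moreover have "finite_range B B (\<lambda>x. x)"
    unfolding finite_range_def
  proof (intro ballI)
    fix g b assume gb: "g \<in> carrier G" "b \<in> B"
    show "\<exists>W. finite W \<and> W \<subseteq> carrier G \<times> B \<and> (\<forall>x y. (\<forall>w\<in>W. x w = y w) --> x (g, b) = y (g, b))"
      using gb by (intro exI[of _ "{(g,b)}"]) auto
  qed
  ultimately show ?case by (simp add: id_def)
next
  case (Suc N)
  then show ?case using models_op_comp[OF Q _ q] finite_range_comp[OF q] by (auto simp: o_def)
qed

text \<open>Diagonal entries at most points equal the group trace by locality. The remaining ones are nonnegative, because the exponent is even.\<close>

lemma trace_lower_bound:
  assumes loc: "models_op B (\<lambda>n. damped (I n) (D n \<times> B) (X n) R) q" and q: "finite_range B B q"
    and B: "finite B" and e: "0 < e"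
  shows "eventually (\<lambda>n. real (card (D n)) * (unit_trace G B (q ^^ (2 * m)) - e) \<le>
      (\<Sum>j\<in>D n \<times> B. (damped (I n) (D n \<times> B) (X n) R ^^ (2 * m)) (\<lambda>k. if k = j then 1 else 0) j)) sequentially"
proof -
  let ?N = "2 * m" and ?\<delta> = "\<lambda>j k. if k = j then 1 else (0::real)"
  let ?Q = "\<lambda>n. damped (I n) (D n \<times> B) (X n) R"
  define \<tau> where "\<tau> b = (q ^^ ?N) (?\<delta> (\<one>, b)) (\<one>, b)" for b
  have loc': "models_op B (\<lambda>n. ?Q n ^^ ?N) (q ^^ ?N)" and fin': "finite_range B B (q ^^ ?N)"
    using models_op_funpow[OF loc q] by auto
  have "most D (\<lambda>n v. (?Q n ^^ ?N) (?\<delta> (v, b)) (v, b) = \<tau> b)" if b: "b \<in> B" for b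
  proof -
    obtain W where W: "finite W" "W \<subseteq> carrier G \<times> B"
	"\<And>x y. (\<forall>w\<in>W. x w = y w) ==> (q ^^ ?N) x (\<one>,b) = (q ^^ ?N) y (\<one>,b)"
      using fin' b one_closed unfolding finite_range_def by meson
    have 1: "most D (\<lambda>n v. \<forall>x. (?Q n ^^ ?N) x (\<sigma> n (inv \<one>) v, b) = (q ^^ ?N) (pullback G (\<sigma> n) v x) (\<one>, b))"
      using loc' b unfolding models_op_def by blast
    have 2: "most D (\<lambda>n v. \<forall>w\<in>{w \<in> W. fst w \<noteq> \<one>}. \<sigma> n (inv (fst w)) v \<noteq> v)"
      using W by (intro most_finite_ball_D most_free) (auto simp: inv_eq_1_iff)
    show ?thesis
    proof (rule most_mono_D[OF most_conj_D[OF 1 2]])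
      fix n v assume v: "v \<in> D n" and A: "(\<forall>x. (?Q n ^^ ?N) x (\<sigma> n (inv \<one>) v, b) = (q ^^ ?N) (pullback G (\<sigma> n) v x) (\<one>, b)) \<and>
	(\<forall>w\<in>{w \<in> W. fst w \<noteq> \<one>}. \<sigma> n (inv (fst w)) v \<noteq> v)"
      have "(?Q n ^^ ?N) (?\<delta> (v, b)) (v, b) = (q ^^ ?N) (pullback G (\<sigma> n) v (?\<delta> (v, b))) (\<one>, b)"
	using A by simp
      also have "... = \<tau> b"
	unfolding \<tau>_def by (rule W(3)) (use A in \<open>auto simp: pullback_def\<close>)
      finally show "(?Q n ^^ ?N) (?\<delta> (v, b)) (v, b) = \<tau> b" .
    qed
  qed
  then have "most D (\<lambda>n v. \<forall>b\<in>B. (?Q n ^^ ?N) (?\<delta> (v, b)) (v, b) = \<tau> b)"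
    by (intro most_finite_ball_D B)
  then have "eventually (\<lambda>n. real (card {v \<in> D n. \<not> (\<forall>b\<in>B. (?Q n ^^ ?N) (?\<delta> (v, b)) (v, b) = \<tau> b)}) \<le>
      e / (\<bar>sum \<tau> B\<bar> + 1) * real (card (D n))) sequentially"
    using e D_nonempty by (intro most_eventually) auto
  then show ?thesis
  proof eventually_elim
    case (elim n)
    define bad where "bad = {v \<in> D n. \<not> (\<forall>b\<in>B. (?Q n ^^ ?N) (?\<delta> (v, b)) (v, b) = \<tau> b)}"
    have bad: "bad \<subseteq> D n" "finite bad" by (auto simp: bad_def)
    have "sum \<tau> B * real (card bad) \<le> (\<bar>sum \<tau> B\<bar> + 1) * real (card bad)"
      by (intro mult_right_mono) auto
    also have "... \<le> (\<bar>sum \<tau> B\<bar> + 1) * (e / (\<bar>sum \<tau> B\<bar> + 1) * real (card (D n)))"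
      using elim unfolding bad_def by (intro mult_left_mono) auto
    also have "... = e * real (card (D n))" by (simp add: field_simps add_nonneg_eq_0_iff)
    finally have small: "sum \<tau> B * real (card bad) \<le> e * real (card (D n))" .
    have "real (card (D n)) * (sum \<tau> B - e) \<le> real (card (D n - bad)) * sum \<tau> B"
      using small bad card_mono[OF finite_D bad(1)] by (simp add: card_Diff_subset of_nat_diff algebra_simps)
    also have "... = (\<Sum>v\<in>D n - bad. \<Sum>b\<in>B. (?Q n ^^ ?N) (?\<delta> (v, b)) (v, b))"
    proof -
      have "(\<Sum>v\<in>D n - bad. \<Sum>b\<in>B. (?Q n ^^ ?N) (?\<delta> (v, b)) (v, b)) = (\<Sum>v\<in>D n - bad. sum \<tau> B)"
	by (intro sum.cong refl) (auto simp: bad_def)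
      then show ?thesis by simp
    qed
    also have "... \<le> (\<Sum>v\<in>D n. \<Sum>b\<in>B. (?Q n ^^ ?N) (?\<delta> (v, b)) (v, b))"
      using B by (intro sum_mono2 sum_nonneg damped_diag_nonneg) auto
    also have "... = (\<Sum>j\<in>D n \<times> B. (?Q n ^^ ?N) (?\<delta> j) j)" by (simp add: sum_Times)
    finally show ?case by (simp add: unit_trace_def \<tau>_def)
  qed
qed

lemma models_op_damped_cols:
  assumes "finite S" "S \<subseteq> carrier G" "finite T" "finite V"
  shows "models_op T (\<lambda>n. damped (D n \<times> V) (D n \<times> T) (model_matrix G S a (\<sigma> n)) R) (damped_cols G V T S a R)"
    "finite_range T T (damped_cols G V T S a R)"
proof -
  have "models_op T (\<lambda>n x. (\<lambda>y j. \<Sum>i\<in>D n \<times> V. of_int (model_matrix G S a (\<sigma> n) i j) * y i)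
      ((\<lambda>x j. \<Sum>j'\<in>D n \<times> T. of_int (model_matrix G S a (\<sigma> n) j j') * x j') x))
      (\<lambda>x. gop_adj G V S a (gop G T S a x))"
    by (rule models_op_comp[where C = V and Q = "\<lambda>n y j. \<Sum>i\<in>D n \<times> V. of_int (model_matrix G S a (\<sigma> n) i j) * y i"
	  and Q' = "\<lambda>n x j. \<Sum>j'\<in>D n \<times> T. of_int (model_matrix G S a (\<sigma> n) j j') * x j'"])
      (use assms in \<open>auto intro!: models_op_gop_adj models_op_gop finite_range_gop_adj\<close>)
  from models_op_damping[OF this, of R]
  show "models_op T (\<lambda>n. damped (D n \<times> V) (D n \<times> T) (model_matrix G S a (\<sigma> n)) R) (damped_cols G V T S a R)"
    by (simp add: damped_def[abs_def] damped_cols_def[abs_def])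
  show "finite_range T T (damped_cols G V T S a R)"
    unfolding damped_cols_def[abs_def] using assms
    by (intro finite_range_damping finite_range_comp[OF finite_range_gop_adj finite_range_gop]) auto
qed

lemma models_op_damped_rows:
  assumes "finite S" "S \<subseteq> carrier G" "finite T" "finite V"
  shows "models_op V (\<lambda>n. damped (D n \<times> T) (D n \<times> V) (\<lambda>i j. model_matrix G S a (\<sigma> n) j i) R) (damped_rows G V T S a R)"
    "finite_range V V (damped_rows G V T S a R)"
proof -
  have "models_op V (\<lambda>n x. (\<lambda>x j. \<Sum>j'\<in>D n \<times> T. of_int (model_matrix G S a (\<sigma> n) j j') * x j')
      ((\<lambda>y j. \<Sum>i\<in>D n \<times> V. of_int (model_matrix G S a (\<sigma> n) i j) * y i) x))
      (\<lambda>x. gop G T S a (gop_adj G V S a x))"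
    by (rule models_op_comp[where C = T and Q' = "\<lambda>n y j. \<Sum>i\<in>D n \<times> V. of_int (model_matrix G S a (\<sigma> n) i j) * y i"
	  and Q = "\<lambda>n x j. \<Sum>j'\<in>D n \<times> T. of_int (model_matrix G S a (\<sigma> n) j j') * x j'"])
      (use assms in \<open>auto intro!: models_op_gop_adj models_op_gop finite_range_gop\<close>)
  from models_op_damping[OF this, of R]
  show "models_op V (\<lambda>n. damped (D n \<times> T) (D n \<times> V) (\<lambda>i j. model_matrix G S a (\<sigma> n) j i) R) (damped_rows G V T S a R)"
    by (simp add: damped_def[abs_def] damped_rows_def[abs_def])
  show "finite_range V V (damped_rows G V T S a R)"
    unfolding damped_rows_def[abs_def] using assms
    by (intro finite_range_damping finite_range_comp[OF finite_range_gop finite_range_gop_adj]) auto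
qed

lemma model_norm:
  assumes "finite S" "S \<subseteq> carrier G" "finite T" and R: "coeff_bound V T S a \<le> R"
  shows "(\<Sum>i\<in>D n \<times> V. (\<Sum>j\<in>D n \<times> T. of_int (model_matrix G S a (\<sigma> n) i j) * z j)\<^sup>2) \<le> R * (\<Sum>j\<in>D n \<times> T. (z j :: real)\<^sup>2)"
proof -
  have "(\<Sum>i\<in>D n \<times> V. (\<Sum>j\<in>D n \<times> T. of_int (model_matrix G S a (\<sigma> n) i j) * z j)\<^sup>2) \<le>
      coeff_bound V T S a * (\<Sum>j\<in>D n \<times> T. (z j)\<^sup>2)"
    using assms by (intro model_matrix_norm sigma_permutes) auto
  also have "... \<le> R * (\<Sum>j\<in>D n \<times> T. (z j)\<^sup>2)"
    by (intro mult_right_mono R sum_nonneg) auto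
  finally show ?thesis .
qed

lemma rank_le_trace_cols:
  assumes S: "finite S" "S \<subseteq> carrier G" and T: "finite T" and V: "finite V"
    and R: "coeff_bound V T S a \<le> R" "1 \<le> R" and m: "1 \<le> m" and e: "0 < e"
  shows "eventually (\<lambda>n. \<forall>J' \<subseteq> D n \<times> T. independent_columns TYPE('k::{field,finite}) (D n \<times> V) (model_matrix G S a (\<sigma> n)) J' -->
      real (card J') \<le> real (card (D n)) *
	(real (card T) - unit_trace G T (damped_cols G V T S a R ^^ (2 * m)) + real (card T) * trace_error R m + e)) sequentially"
  using trace_lower_bound[OF models_op_damped_cols[OF S T V, where a = a and R = R] T e, where m = m]
proof eventually_elim
  case (elim n)
  show ?case
  proof (intro allI impI)
    fix J' assume J': "J' \<subseteq> D n \<times> T"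
      and indep: "independent_columns TYPE('k) (D n \<times> V) (model_matrix G S a (\<sigma> n)) J'"
    have finJ': "finite J'" using J' T by (meson finite_D finite_SigmaI finite_subset)
    have "(\<Sum>j\<in>D n \<times> T. (damped (D n \<times> V) (D n \<times> T) (model_matrix G S a (\<sigma> n)) R ^^ (2 * m)) (\<lambda>k. if k = j then 1 else 0) j)
	\<le> real (card (D n \<times> T)) - real (card J') + real (card (D n \<times> T)) * (2 * (1 + ln R) / ln (real (2 * m)))"
    proof (rule damped_trace_le[where Y = "\<lambda>j l. if l = j then 1 else 0"])
      fix w
      assume w: "\<And>i. i \<in> D n \<times> V ==> (\<Sum>j\<in>D n \<times> T. of_int (model_matrix G S a (\<sigma> n) i j) * (\<Sum>l\<in>J'. of_int (if l = j then 1 else 0) * w l)) = (0 :: complex)"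
      have Y: "(\<Sum>l\<in>J'. of_int (if l = j then 1 else 0) * w l) = (if j \<in> J' then w j else 0)" for j
      proof -
	have "(\<Sum>l\<in>J'. of_int (if l = j then 1 else 0) * w l) = (\<Sum>l\<in>J'. if l = j then w l else 0)"
	  by (intro sum.cong refl) simp
	then show ?thesis using finJ' by simp
      qed
      have "(\<Sum>l\<in>J'. of_int (model_matrix G S a (\<sigma> n) i l) * w l) = 0" if "i \<in> D n \<times> V" for i
      proof -
	have "(\<Sum>l\<in>J'. of_int (model_matrix G S a (\<sigma> n) i l) * w l) =
	    (\<Sum>j\<in>D n \<times> T. of_int (model_matrix G S a (\<sigma> n) i j) * (\<Sum>l\<in>J'. of_int (if l = j then 1 else 0) * w l))"
	  unfolding Y using J' T by (intro sum.mono_neutral_cong_left) auto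
	then show ?thesis using w[OF that] by simp
      qed
      then show "\<forall>l\<in>J'. w l = 0"
	by (rule independent_real_if_independent_finite_field[of "D n \<times> V" J' "model_matrix G S a (\<sigma> n)", where 'k='k, rotated 3])
	  (use finJ' V indep in \<open>auto simp: independent_columns_def\<close>)
    qed (use S T V R m finJ' in \<open>auto intro!: model_norm simp del: sum.cartesian_product\<close>)
    then show "real (card J') \<le> real (card (D n)) *
	(real (card T) - unit_trace G T (damped_cols G V T S a R ^^ (2 * m)) + real (card T) * trace_error R m + e)"
      using elim by (simp add: trace_error_def card_cartesian_product algebra_simps)
  qed
qed

text \<open>Here \<open>damped_trace_le\<close> is applied to the transposed model; the independent columns themselves form the map \<open>Y\<close>.\<close>

lemma rank_le_trace_rows:
  assumes S: "finite S" "S \<subseteq> carrier G" and T: "finite T" and V: "finite V"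
    and R: "coeff_bound V T S a \<le> R" "1 \<le> R" and m: "1 \<le> m" and e: "0 < e"
  shows "eventually (\<lambda>n. \<forall>J' \<subseteq> D n \<times> T. independent_columns TYPE('k::{field,finite}) (D n \<times> V) (model_matrix G S a (\<sigma> n)) J' -->
      real (card J') \<le> real (card (D n)) *
	(real (card V) - unit_trace G V (damped_rows G V T S a R ^^ (2 * m)) + real (card V) * trace_error R m + e)) sequentially"
  using trace_lower_bound[OF models_op_damped_rows[OF S T V, where a = a and R = R] V e, where m = m]
proof eventually_elim
  case (elim n)
  let ?X = "model_matrix G S a (\<sigma> n)"
  show ?case
  proof (intro allI impI)
    fix J' assume J': "J' \<subseteq> D n \<times> T"
      and indep: "independent_columns TYPE('k) (D n \<times> V) ?X J'"
    have finJ': "finite J'" using J' T by (meson finite_D finite_SigmaI finite_subset)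
    have "(\<Sum>j\<in>D n \<times> V. (damped (D n \<times> T) (D n \<times> V) (\<lambda>i j. ?X j i) R ^^ (2 * m)) (\<lambda>k. if k = j then 1 else 0) j)
	\<le> real (card (D n \<times> V)) - real (card J') + real (card (D n \<times> V)) * (2 * (1 + ln R) / ln (real (2 * m)))"
    proof (rule damped_trace_le[where Y = ?X])
      fix w
      assume w: "\<And>i. i \<in> D n \<times> T ==> (\<Sum>j\<in>D n \<times> V. of_int (?X j i) * (\<Sum>l\<in>J'. of_int (?X j l) * w l)) = (0 :: complex)"
      define u where "u j = (\<Sum>l\<in>J'. of_int (?X j l) * w l)" for j
      have "of_real (\<Sum>j\<in>D n \<times> V. (cmod (u j))\<^sup>2) = (\<Sum>j\<in>D n \<times> V. u j * cnj (u j))"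
	unfolding of_real_sum complex_norm_square ..
      also have "... = (\<Sum>j\<in>D n \<times> V. \<Sum>l\<in>J'. cnj (w l) * (of_int (?X j l) * u j))"
      proof (intro sum.cong refl)
	fix j
	have "cnj (u j) = (\<Sum>l\<in>J'. cnj (w l) * of_int (?X j l))" by (simp add: u_def mult.commute)
	then show "u j * cnj (u j) = (\<Sum>l\<in>J'. cnj (w l) * (of_int (?X j l) * u j))"
	  by (simp add: sum_distrib_left mult_ac)
      qed
      also have "... = (\<Sum>l\<in>J'. \<Sum>j\<in>D n \<times> V. cnj (w l) * (of_int (?X j l) * u j))" by (rule sum.swap)
      also have "... = (\<Sum>l\<in>J'. cnj (w l) * (\<Sum>j\<in>D n \<times> V. of_int (?X j l) * u j))"
	by (simp only: sum_distrib_left)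
      also have "... = 0" using w J' unfolding u_def[symmetric] by (intro sum.neutral) auto
      finally have "(\<Sum>j\<in>D n \<times> V. (cmod (u j))\<^sup>2) = 0" using of_real_eq_0_iff by blast
      then have "u j = 0" if "j \<in> D n \<times> V" for j
	using that V by (subst (asm) sum_nonneg_eq_0_iff) auto
      then show "\<forall>l\<in>J'. w l = 0" unfolding u_def
	by (rule independent_real_if_independent_finite_field[of "D n \<times> V" J' ?X, where 'k='k, rotated 3])
	  (use finJ' V indep in \<open>auto simp: independent_columns_def\<close>)
    next
      fix z :: "_ => real"
      show "(\<Sum>i\<in>D n \<times> T. (\<Sum>j\<in>D n \<times> V. of_int (?X j i) * z j)\<^sup>2) \<le> R * (\<Sum>j\<in>D n \<times> V. (z j)\<^sup>2)"
	using R by (intro transpose_norm[OF _ model_norm[OF S T]]) auto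
    qed (use T V R m finJ' in auto)
    then show "real (card J') \<le> real (card (D n)) *
	(real (card V) - unit_trace G V (damped_rows G V T S a R ^^ (2 * m)) + real (card V) * trace_error R m + e)"
      using elim by (simp add: trace_error_def card_cartesian_product algebra_simps)
  qed
qed

end

section \<open>Square-summable functions and projections\<close>

definition sqn :: "('b => complex) => real" where
  "sqn f = (\<Sum>\<^sub>\<infinity>x. (cmod (f x))\<^sup>2)"

lemma square_summable_zero [simp]: "square_summable (\<lambda>_. 0)"
  by (simp add: square_summable_def)

lemma cmod_add_power2_le: "(cmod (a + b))\<^sup>2 \<le> 2 * (cmod a)\<^sup>2 + 2 * (cmod b)\<^sup>2"
proof -
  have "(cmod (a + b))\<^sup>2 \<le> (cmod a + cmod b)\<^sup>2" by (intro power_mono norm_triangle_ineq) auto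
  also have "... \<le> 2 * (cmod a)\<^sup>2 + 2 * (cmod b)\<^sup>2"
    using zero_le_power2[of "cmod a - cmod b"] by (simp add: power2_sum power2_diff)
  finally show ?thesis .
qed

lemma square_summable_add:
  assumes "square_summable f" "square_summable g"
  shows "square_summable (\<lambda>x. f x + g x)"
  unfolding square_summable_def
proof (rule summable_on_comparison_test)
  show "(\<lambda>x. 2 * (cmod (f x))\<^sup>2 + 2 * (cmod (g x))\<^sup>2) summable_on UNIV"
    using assms unfolding square_summable_def by (intro summable_on_add summable_on_cmult_right)
qed (auto intro: cmod_add_power2_le)

lemma square_summable_scale:
  assumes "square_summable f"
  shows "square_summable (\<lambda>x. c * f x)"
  using assms unfolding square_summable_def
  by (simp add: norm_mult power_mult_distrib summable_on_cmult_right)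

lemma square_summable_diff:
  assumes "square_summable f" "square_summable g"
  shows "square_summable (\<lambda>x. f x - g x)"
  using square_summable_add[OF assms(1) square_summable_scale[OF assms(2), of "-1"]] by simp

lemma sqn_nonneg [simp]: "0 \<le> sqn f"
  unfolding sqn_def by (intro infsum_nonneg) auto

lemma sqn_zero [simp]: "sqn (\<lambda>_. 0) = 0"
  by (simp add: sqn_def)

lemma sqn_scale: "sqn (\<lambda>x. c * f x) = (cmod c)\<^sup>2 * sqn f"
  unfolding sqn_def by (simp add: norm_mult power_mult_distrib infsum_cmult_right')

lemma sqn_minus_commute: "sqn (\<lambda>x. f x - g x) = sqn (\<lambda>x. g x - f x)"
  unfolding sqn_def by (simp add: norm_minus_commute)

lemma sqn_eq_0D:
  assumes "square_summable f" "sqn f = 0"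
  shows "f x = 0"
  using nonneg_infsum_le_0D[of "\<lambda>x. (cmod (f x))\<^sup>2" UNIV x] assms
  by (simp add: square_summable_def sqn_def)

lemma sum_le_sqn:
  assumes "square_summable f" "finite F"
  shows "(\<Sum>x\<in>F. (cmod (f x))\<^sup>2) \<le> sqn f"
  using assms unfolding sqn_def square_summable_def by (intro finite_sum_le_infsum) auto

lemma point_le_sqn: "square_summable f ==> (cmod (f x))\<^sup>2 \<le> sqn f"
  using sum_le_sqn[of f "{x}"] by simp

lemma square_summableI_bounded:
  assumes "\<And>F. finite F ==> (\<Sum>x\<in>F. (cmod (f x))\<^sup>2) \<le> C"
  shows "square_summable f" "sqn f \<le> C"
proof -
  show s: "square_summable f" unfolding square_summable_def
    by (rule nonneg_bdd_above_summable_on) (auto intro!: bdd_aboveI[of _ C] assms)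
  show "sqn f \<le> C" using s assms unfolding sqn_def square_summable_def by (intro infsum_le_finite_sums) auto
qed

lemma inner_summable:
  assumes "square_summable f" "square_summable g"
  shows "(\<lambda>x. f x * cnj (g x)) summable_on UNIV"
proof -
  have "(\<lambda>x. norm (f x * cnj (g x))) summable_on UNIV"
  proof (rule summable_on_comparison_test)
    show "(\<lambda>x. (cmod (f x))\<^sup>2 + (cmod (g x))\<^sup>2) summable_on UNIV"
      using assms unfolding square_summable_def by (intro summable_on_add)
    fix x
    have "2 * (cmod (f x) * cmod (g x)) \<le> (cmod (f x))\<^sup>2 + (cmod (g x))\<^sup>2"
      using zero_le_power2[of "cmod (f x) - cmod (g x)"] by (simp add: power2_diff)
    moreover have "0 \<le> cmod (f x) * cmod (g x)" by simp
    ultimately show "norm (f x * cnj (g x)) \<le> (cmod (f x))\<^sup>2 + (cmod (g x))\<^sup>2"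
      unfolding norm_mult complex_mod_cnj by linarith
  qed auto
  then show ?thesis by (rule abs_summable_summable)
qed

lemma inner_add_left:
  assumes "square_summable f" "square_summable g" "square_summable h"
  shows "l2_inner (\<lambda>x. f x + g x) h = l2_inner f h + l2_inner g h"
  unfolding l2_inner_def distrib_right using assms by (intro infsum_add inner_summable)

lemma inner_scale_left: "l2_inner (\<lambda>x. c * f x) h = c * l2_inner f h"
  unfolding l2_inner_def mult.assoc by (rule infsum_cmult_right')

lemma inner_diff_left:
  assumes "square_summable f" "square_summable g" "square_summable h"
  shows "l2_inner (\<lambda>x. f x - g x) h = l2_inner f h - l2_inner g h"
  using inner_add_left[OF assms(1) square_summable_scale[OF assms(2), of "-1"] assms(3)]
    inner_scale_left[of "-1" g h] by simp

lemma inner_cnj: "cnj (l2_inner f g) = l2_inner g f"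
  unfolding l2_inner_def infsum_cnj[symmetric] by (simp add: mult.commute)

lemma inner_self:
  assumes "square_summable f"
  shows "l2_inner f f = of_real (sqn f)"
proof -
  have "((\<lambda>x. (cmod (f x))\<^sup>2) has_sum sqn f) UNIV"
    using assms unfolding square_summable_def sqn_def by (rule has_sum_infsum)
  then have "((\<lambda>x. complex_of_real ((cmod (f x))\<^sup>2)) has_sum of_real (sqn f)) UNIV"
    by (rule has_sum_of_real)
  then show ?thesis unfolding l2_inner_def complex_norm_square by (rule infsumI)
qed

lemma inner_add_right:
  assumes "square_summable f" "square_summable g" "square_summable h"
  shows "l2_inner h (\<lambda>x. f x + g x) = l2_inner h f + l2_inner h g"
  using arg_cong[OF inner_add_left[OF assms], of cnj] by (simp add: inner_cnj)

lemma inner_scale_right: "l2_inner h (\<lambda>x. c * f x) = cnj c * l2_inner h f"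
  using arg_cong[OF inner_scale_left[of c f h], of cnj] by (simp add: inner_cnj)

lemma inner_zero [simp]: "l2_inner (\<lambda>_. 0) h = 0" "l2_inner h (\<lambda>_. 0) = 0"
  by (simp_all add: l2_inner_def)

lemma sqn_add:
  assumes "square_summable f" "square_summable g"
  shows "sqn (\<lambda>x. f x + g x) = sqn f + sqn g + 2 * Re (l2_inner f g)"
proof -
  have "complex_of_real (sqn (\<lambda>x. f x + g x)) = l2_inner (\<lambda>x. f x + g x) (\<lambda>x. f x + g x)"
    by (rule inner_self[OF square_summable_add[OF assms], symmetric])
  also have "... = l2_inner f f + l2_inner g g + (l2_inner f g + l2_inner g f)"
    using assms by (simp add: inner_add_left inner_add_right square_summable_add)
  also have "... = of_real (sqn f) + of_real (sqn g) + (l2_inner f g + cnj (l2_inner f g))"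
    using assms by (simp add: inner_self inner_cnj)
  also have "... = of_real (sqn f + sqn g + 2 * Re (l2_inner f g))" by (simp add: complex_add_cnj)
  finally show ?thesis using of_real_eq_iff by blast
qed

lemma sqn_diff:
  assumes "square_summable f" "square_summable g"
  shows "sqn (\<lambda>x. f x - g x) = sqn f + sqn g - 2 * Re (l2_inner f g)"
  using sqn_add[OF assms(1) square_summable_scale[OF assms(2), of "-1"]] sqn_scale[of "-1" g]
    inner_scale_right[of f "-1" g] by simp

lemma sqn_add_le:
  assumes "square_summable f" "square_summable g"
  shows "sqn (\<lambda>x. f x + g x) \<le> 2 * sqn f + 2 * sqn g"
  using sqn_add[OF assms] sqn_diff[OF assms] sqn_nonneg[of "\<lambda>x. f x - g x"] by linarith

lemma sqn_diff_triangle: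
  assumes "square_summable f" "square_summable g" "square_summable h"
  shows "sqn (\<lambda>x. f x - h x) \<le> 2 * sqn (\<lambda>x. f x - g x) + 2 * sqn (\<lambda>x. g x - h x)"
  using sqn_add_le[OF square_summable_diff[OF assms(1,2)] square_summable_diff[OF assms(2,3)]] by simp

lemma two_Re_inner_le:
  assumes "square_summable f" "square_summable g"
  shows "2 * Re (l2_inner f g) \<le> sqn f + sqn g"
  using sqn_diff[OF assms] sqn_nonneg[of "\<lambda>x. f x - g x"] by linarith

lemma polarization:
  assumes "square_summable f" "square_summable g"
  shows "l2_inner f g = of_real ((sqn (\<lambda>x. f x + g x) - sqn f - sqn g) / 2) +
    \<i> * of_real ((sqn (\<lambda>x. f x + \<i> * g x) - sqn f - sqn g) / 2)"
proof (rule complex_eqI)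
  have "Re (l2_inner f (\<lambda>x. \<i> * g x)) = Im (l2_inner f g)" by (simp add: inner_scale_right)
  then show "Im (l2_inner f g) = Im (of_real ((sqn (\<lambda>x. f x + g x) - sqn f - sqn g) / 2) +
      \<i> * of_real ((sqn (\<lambda>x. f x + \<i> * g x) - sqn f - sqn g) / 2))"
    using sqn_add[OF assms(1) square_summable_scale[OF assms(2), of \<i>]] sqn_scale[of \<i> g] by simp
qed (use sqn_add[OF assms] in simp)

definition point_mass :: "'b => 'b => complex" where
  "point_mass b = (\<lambda>x. if x = b then 1 else 0)"

lemma inner_point_mass: "l2_inner f (point_mass b) = f b"
proof -
  have "l2_inner f (point_mass b) = (\<Sum>\<^sub>\<infinity>x\<in>{b}. f x)"
    unfolding l2_inner_def by (intro infsum_cong_neutral) (auto simp: point_mass_def)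
  then show ?thesis by simp
qed

lemma square_summable_finite:
  assumes "finite {x. f x \<noteq> 0}"
  shows "square_summable f"
  unfolding square_summable_def
  by (rule summable_on_cong_neutral[THEN iffD1, OF _ _ _ summable_on_finite[OF assms]]) auto

lemma square_summable_point_mass: "square_summable (point_mass b)"
  by (rule square_summable_finite) (simp add: point_mass_def)

text \<open>The rate in the Cauchy condition is the one that minimizing sequences for \<open>1 / Suc n\<close> satisfy.\<close>

lemma l2_complete:
  assumes y: "\<And>n. square_summable (y n)"
    and cauchy: "\<And>n m. sqn (\<lambda>x. y n x - y m x) \<le> C / real (Suc n) + C / real (Suc m)"
  obtains l where "square_summable l" "\<And>n. sqn (\<lambda>x. y n x - l x) \<le> C / real (Suc n)"
    "\<And>x. (\<lambda>n. y n x) \<longlonglongrightarrow> l x"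
proof -
  have C: "0 \<le> C" using cauchy[of 0 0] sqn_nonneg[of "\<lambda>x. y 0 x - y 0 x"] by simp
  have "Cauchy (\<lambda>n. y n x)" for x
  proof (rule metric_CauchyI)
    fix e :: real assume e: "0 < e"
    obtain N where N: "2 * C / e\<^sup>2 < real N" using reals_Archimedean2 by blast
    show "\<exists>M. \<forall>m\<ge>M. \<forall>n\<ge>M. dist (y m x) (y n x) < e"
    proof (intro exI[of _ N] allI impI)
      fix m n assume mn: "N \<le> m" "N \<le> n"
      have "(cmod (y m x - y n x))\<^sup>2 \<le> sqn (\<lambda>x. y m x - y n x)"
	by (rule point_le_sqn[OF square_summable_diff[OF y y]])
      also have "... \<le> C / real (Suc m) + C / real (Suc n)" by (rule cauchy)
      also have "... \<le> C / real (Suc N) + C / real (Suc N)"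
	using mn C by (intro add_mono divide_left_mono) auto
      also have "... < e\<^sup>2"
      proof -
	have "2 * C < real N * e\<^sup>2" using N e by (simp add: pos_divide_less_eq)
	also have "... \<le> e\<^sup>2 * real (Suc N)" by (simp add: algebra_simps)
	finally have "2 * C / real (Suc N) < e\<^sup>2" by (simp add: pos_divide_less_eq)
	then show ?thesis by simp
      qed
      finally show "dist (y m x) (y n x) < e"
	using e by (simp add: dist_norm power_less_imp_less_base)
    qed
  qed
  then have conv: "convergent (\<lambda>n. y n x)" for x by (simp add: Cauchy_convergent)
  define l where "l x = lim (\<lambda>n. y n x)" for x
  have l: "(\<lambda>n. y n x) \<longlonglongrightarrow> l x" for x
    unfolding l_def using conv by (simp add: convergent_LIMSEQ_iff)
  have bound: "(\<Sum>x\<in>F. (cmod (y n x - l x))\<^sup>2) \<le> C / real (Suc n)" if "finite F" for F n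
  proof (rule LIMSEQ_le)
    show "(\<lambda>m. \<Sum>x\<in>F. (cmod (y n x - y m x))\<^sup>2) \<longlonglongrightarrow> (\<Sum>x\<in>F. (cmod (y n x - l x))\<^sup>2)"
      by (intro tendsto_intros l)
    show "(\<lambda>m. C / real (Suc n) + C / real (Suc m)) \<longlonglongrightarrow> C / real (Suc n)"
      using tendsto_add[OF tendsto_const[of "C / real (Suc n)"] tendsto_mult_right_zero[OF LIMSEQ_inverse_real_of_nat, of C]]
      by (simp add: divide_inverse)
    show "\<exists>N. \<forall>m\<ge>N. (\<Sum>x\<in>F. (cmod (y n x - y m x))\<^sup>2) \<le> C / real (Suc n) + C / real (Suc m)"
      using sum_le_sqn[OF square_summable_diff[OF y y] that] cauchy order_trans by blast
  qed
  have b: "square_summable (\<lambda>x. y n x - l x)" "sqn (\<lambda>x. y n x - l x) \<le> C / real (Suc n)" for n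
    using square_summableI_bounded[OF bound[where n = n]] by auto
  have "square_summable (\<lambda>x. y 0 x - (y 0 x - l x))" by (intro square_summable_diff y b)
  then have "square_summable l" by simp
  then show ?thesis using that b l by blast
qed

definition closed_subspace :: "('b => complex) set => bool" where
  "closed_subspace M \<longleftrightarrow> (\<lambda>_. 0) \<in> M \<and> (\<forall>f\<in>M. square_summable f) \<and>
    (\<forall>f\<in>M. \<forall>g\<in>M. (\<lambda>x. f x + g x) \<in> M) \<and> (\<forall>c. \<forall>f\<in>M. (\<lambda>x. c * f x) \<in> M) \<and>
    (\<forall>f. square_summable f --> (\<forall>e>0. \<exists>y\<in>M. sqn (\<lambda>x. f x - y x) < e) --> f \<in> M)"

lemma closed_subspaceD:
  assumes "closed_subspace M"
  shows "(\<lambda>_. 0) \<in> M" "f \<in> M ==> square_summable f" "f \<in> M ==> g \<in> M ==> (\<lambda>x. f x + g x) \<in> M"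
    "f \<in> M ==> (\<lambda>x. c * f x) \<in> M" "f \<in> M ==> g \<in> M ==> (\<lambda>x. f x - g x) \<in> M"
    "square_summable f ==> (\<And>e. 0 < e ==> \<exists>y\<in>M. sqn (\<lambda>x. f x - y x) < e) ==> f \<in> M"
proof -
  show *: "(\<lambda>_. 0) \<in> M" "f \<in> M ==> square_summable f" "f \<in> M ==> g \<in> M ==> (\<lambda>x. f x + g x) \<in> M" for f g
    using assms by (auto simp: closed_subspace_def)
  show **: "f \<in> M ==> (\<lambda>x. c * f x) \<in> M" for c f
    using assms by (auto simp: closed_subspace_def)
  show "f \<in> M ==> g \<in> M ==> (\<lambda>x. f x - g x) \<in> M" using *(3)[of f "\<lambda>x. (-1) * g x"] **[of g "-1"] by simp
  show "square_summable f ==> (\<And>e. 0 < e ==> \<exists>y\<in>M. sqn (\<lambda>x. f x - y x) < e) ==> f \<in> M"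
    using assms by (auto simp: closed_subspace_def)
qed

lemma closed_subspace_limit:
  assumes M: "closed_subspace M" and y: "\<And>n. y n \<in> M" and l: "square_summable l"
    and lim: "\<And>n. sqn (\<lambda>x. y n x - l x) \<le> C / real (Suc n)"
  shows "l \<in> M"
proof (rule closed_subspaceD(6)[OF M l])
  fix e :: real assume e: "0 < e"
  obtain N where N: "C / e < real N" using reals_Archimedean2 by blast
  have "sqn (\<lambda>x. l x - y N x) \<le> C / real (Suc N)" using lim[of N] sqn_minus_commute[of l "y N"] by simp
  also have "... < e" 
  proof -
    have "C < real N * e" using N e by (simp add: pos_divide_less_eq)
    also have "... \<le> e * real (Suc N)" using e by (simp add: algebra_simps)
    finally show ?thesis by (simp add: pos_divide_less_eq)
  qed
  finally show "\<exists>y\<in>M. sqn (\<lambda>x. l x - y x) < e" using y by blast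
qed

lemma projection_exists:
  assumes M: "closed_subspace M" and e: "square_summable e"
  shows "\<exists>y\<in>M. \<forall>z\<in>M. l2_inner (\<lambda>x. e x - y x) z = 0"
proof -
  note MD = closed_subspaceD[OF M]
  define d where "d = Inf ((\<lambda>y. sqn (\<lambda>x. e x - y x)) ` M)"
  have bdd: "bdd_below ((\<lambda>y. sqn (\<lambda>x. e x - y x)) ` M)" by (rule bdd_belowI[of _ 0]) auto
  have d: "d \<le> sqn (\<lambda>x. e x - y x)" if "y \<in> M" for y
    unfolding d_def using that bdd by (intro cInf_lower) auto
  have "\<exists>y\<in>M. sqn (\<lambda>x. e x - y x) < d + 1 / real (Suc n)" for n
  proof -
    have "Inf ((\<lambda>y. sqn (\<lambda>x. e x - y x)) ` M) < d + 1 / real (Suc n)" unfolding d_def by simp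
    then show ?thesis using MD(1) bdd by (subst (asm) cInf_less_iff) auto
  qed
  then obtain y where y: "\<And>n. y n \<in> M" "\<And>n. sqn (\<lambda>x. e x - y n x) < d + 1 / real (Suc n)" by metis
  have ysq: "square_summable (y n)" for n using MD(2) y(1) by blast
  have "sqn (\<lambda>x. y n x - y m x) \<le> 2 / real (Suc n) + 2 / real (Suc m)" for n m
  proof -
    let ?a = "\<lambda>x. e x - y n x" and ?b = "\<lambda>x. e x - y m x"
    have ab: "square_summable ?a" "square_summable ?b" using e ysq by (auto intro: square_summable_diff)
    have A: "sqn (\<lambda>x. ?a x - ?b x) = 2 * sqn ?a + 2 * sqn ?b - sqn (\<lambda>x. ?a x + ?b x)"
      using sqn_add[OF ab] sqn_diff[OF ab] by linarith
    have B: "sqn (\<lambda>x. ?a x + ?b x) = 4 * sqn (\<lambda>x. e x - (1/2) * (y n x + y m x))"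
    proof -
      have "(\<lambda>x. ?a x + ?b x) = (\<lambda>x. 2 * (e x - (1/2) * (y n x + y m x)))" by (auto simp: field_simps)
      then show ?thesis using sqn_scale[of 2 "\<lambda>x. e x - (1/2) * (y n x + y m x)"] by simp
    qed
    have E: "d \<le> sqn (\<lambda>x. e x - (1/2) * (y n x + y m x))"
      by (intro d MD(4)[of "\<lambda>x. y n x + y m x" "1/2"] MD(3) y)
    have "sqn (\<lambda>x. ?a x - ?b x) \<le> 2 / real (Suc n) + 2 / real (Suc m)"
    proof -
      have "2 / real (Suc n) = 2 * (1 / real (Suc n))" for n by simp
      with A B E y(2)[of n] y(2)[of m] show ?thesis by linarith
    qed
    moreover have "sqn (\<lambda>x. ?a x - ?b x) = sqn (\<lambda>x. y n x - y m x)"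
      using sqn_minus_commute[of "y n" "y m"] by (simp add: algebra_simps)
    ultimately show ?thesis by simp
  qed
  then obtain l where l: "square_summable l" "\<And>n. sqn (\<lambda>x. y n x - l x) \<le> 2 / real (Suc n)"
    "\<And>x. (\<lambda>n. y n x) \<longlonglongrightarrow> l x"
    by (rule l2_complete[of y 2, OF ysq]) blast
  have lM: "l \<in> M" by (rule closed_subspace_limit[OF M y(1) l(1,2)])
  have el: "square_summable (\<lambda>x. e x - l x)" using e l by (intro square_summable_diff)
  have ld: "sqn (\<lambda>x. e x - l x) \<le> d"
  proof (rule square_summableI_bounded(2))
    fix F :: "'a set" assume F: "finite F"
    show "(\<Sum>x\<in>F. (cmod (e x - l x))\<^sup>2) \<le> d"
    proof (rule LIMSEQ_le)
      show "(\<lambda>n. \<Sum>x\<in>F. (cmod (e x - y n x))\<^sup>2) \<longlonglongrightarrow> (\<Sum>x\<in>F. (cmod (e x - l x))\<^sup>2)"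
	by (intro tendsto_intros l)
      show "(\<lambda>n. d + 1 / real (Suc n)) \<longlonglongrightarrow> d"
	using tendsto_add[OF tendsto_const[of d] LIMSEQ_inverse_real_of_nat] by (simp add: divide_inverse)
      show "\<exists>N. \<forall>n\<ge>N. (\<Sum>x\<in>F. (cmod (e x - y n x))\<^sup>2) \<le> d + 1 / real (Suc n)"
	using sum_le_sqn[OF square_summable_diff[OF e ysq] F] y(2) by (meson less_imp_le order_trans)
    qed
  qed
  have "l2_inner (\<lambda>x. e x - l x) z = 0" if z: "z \<in> M" for z
  proof (rule ccontr)
    assume nz: "l2_inner (\<lambda>x. e x - l x) z \<noteq> 0"
    define a where "a = l2_inner (\<lambda>x. e x - l x) z"
    define s where "s = 1 / (sqn z + 1)"
    have s: "0 < s" "s * sqn z < 1" using sqn_nonneg[of z] unfolding s_def by (auto simp: divide_simps simp del: sqn_nonneg)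
    have zs: "square_summable z" by (rule MD(2)[OF z])
    have "d \<le> sqn (\<lambda>x. e x - (l x + (of_real s * a) * z x))"
      by (rule d[OF MD(3)[OF lM MD(4)[OF z]]])
    also have "... = sqn (\<lambda>x. (e x - l x) - (of_real s * a) * z x)" by (simp add: algebra_simps)
    also have "... = sqn (\<lambda>x. e x - l x) + (cmod (of_real s * a))\<^sup>2 * sqn z - 2 * Re (cnj (of_real s * a) * a)"
      by (subst sqn_diff[OF el square_summable_scale[OF zs]]) (simp add: sqn_scale inner_scale_right a_def)
    also have "Re (cnj (of_real s * a) * a) = s * (cmod a)\<^sup>2"
      by (simp add: cmod_power2) (simp add: power2_eq_square algebra_simps)
    also have "(cmod (of_real s * a))\<^sup>2 = s\<^sup>2 * (cmod a)\<^sup>2" using s by (simp add: norm_mult power_mult_distrib)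
    finally have "2 * (s * (cmod a)\<^sup>2) \<le> s\<^sup>2 * (cmod a)\<^sup>2 * sqn z" using ld by linarith
    also have "... = (s * (cmod a)\<^sup>2) * (s * sqn z)" by (simp add: power2_eq_square)
    also have "... \<le> (s * (cmod a)\<^sup>2) * 1" using s by (intro mult_left_mono) auto
    finally have "s * (cmod a)\<^sup>2 \<le> 0" by simp
    moreover have "0 < s * (cmod a)\<^sup>2" using s nz unfolding a_def by simp
    ultimately show False by simp
  qed
  then show ?thesis using lM by blast
qed

lemma projection_unique:
  assumes M: "closed_subspace M" and e: "square_summable e"
    and y: "y \<in> M" "\<And>z. z \<in> M ==> l2_inner (\<lambda>x. e x - y x) z = 0"
  shows "l2_proj M e = y"
  unfolding l2_proj_def
proof (rule the_equality)
  fix y' assume y': "y' \<in> M \<and> (\<forall>z\<in>M. l2_inner (\<lambda>x. e x - y' x) z = 0)"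
  note MD = closed_subspaceD[OF M]
  let ?z = "\<lambda>x. y x - y' x"
  have y'M: "y' \<in> M" using y' by simp
  have z: "?z \<in> M" by (rule MD(5)[OF y(1) y'M])
  have sq: "square_summable y" "square_summable y'" using MD(2)[OF y(1)] MD(2)[OF y'M] by auto
  have "l2_inner ?z ?z = l2_inner (\<lambda>x. (e x - y' x) - (e x - y x)) ?z" by simp
  also have "... = 0"
    using y y' z by (subst inner_diff_left) (auto intro!: square_summable_diff sq e)
  finally have "sqn ?z = 0" using inner_self[OF square_summable_diff[OF sq]] by simp
  then have z0: "?z x = 0" for x by (rule sqn_eq_0D[OF square_summable_diff[OF sq]])
  have "y' x = y x" for x using z0[of x] by simp
  then show "y' = y" by (rule ext)
qed (use y in blast)

lemma projection:
  assumes M: "closed_subspace M" and e: "square_summable e"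
  shows "l2_proj M e \<in> M" "z \<in> M ==> l2_inner (l2_proj M e) z = l2_inner e z"
proof -
  obtain y where y: "y \<in> M" "\<And>z. z \<in> M ==> l2_inner (\<lambda>x. e x - y x) z = 0"
    using projection_exists[OF assms] by blast
  have P: "l2_proj M e = y" by (rule projection_unique[OF assms y])
  then show "l2_proj M e \<in> M" using y by simp
  assume z: "z \<in> M"
  have "l2_inner (\<lambda>x. e x - y x) z = l2_inner e z - l2_inner y z"
    using closed_subspaceD(2)[OF M] y z e by (intro inner_diff_left) auto
  then show "l2_inner (l2_proj M e) z = l2_inner e z" using P y z by simp
qed

lemma projection_sqn:
  assumes M: "closed_subspace M" and e: "square_summable e"
  shows "l2_inner (l2_proj M e) e = of_real (sqn (l2_proj M e))"
proof -
  have "of_real (sqn (l2_proj M e)) = l2_inner (l2_proj M e) (l2_proj M e)"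
    by (rule inner_self[symmetric, OF closed_subspaceD(2)[OF M projection(1)[OF assms]]])
  also have "... = l2_inner e (l2_proj M e)"
    by (rule projection(2)[OF assms projection(1)[OF assms]])
  finally have "cnj (l2_inner e (l2_proj M e)) = of_real (sqn (l2_proj M e))"
    using complex_cnj_complex_of_real by metis
  then show ?thesis unfolding inner_cnj .
qed

text \<open>The projection to \<open>M\<close> factors through the projection to the larger space.\<close>

lemma projection_mono:
  assumes M: "closed_subspace M" and N: "closed_subspace N" and MN: "M \<subseteq> N" and e: "square_summable e"
  shows "sqn (l2_proj M e) \<le> sqn (l2_proj N e)"
proof -
  let ?p = "l2_proj M e" and ?q = "l2_proj N e"
  have p: "?p \<in> M" "?q \<in> N" by (rule projection(1)[OF M e], rule projection(1)[OF N e])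
  have "l2_inner ?p ?p = l2_inner e ?p" by (rule projection(2)[OF M e p(1)])
  also have "... = l2_inner ?q ?p" by (rule projection(2)[OF N e, symmetric]) (use p MN in auto)
  finally have "sqn ?p = Re (l2_inner ?q ?p)"
    using inner_self[OF closed_subspaceD(2)[OF M p(1)]] Re_complex_of_real by metis
  then show ?thesis
    using two_Re_inner_le[OF closed_subspaceD(2)[OF N p(2)] closed_subspaceD(2)[OF M p(1)]] by linarith
qed

section \<open>Invariant subspaces and their traces\<close>

lemma ennreal_sqn:
  assumes "square_summable f"
  shows "ennreal (sqn f) = (\<integral>\<^sup>+x. ennreal ((cmod (f x))\<^sup>2) \<partial>count_space UNIV)"
proof -
  have "Infinite_Sum.abs_summable_on (\<lambda>x. (cmod (f x))\<^sup>2) UNIV"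
    using assms by (simp add: square_summable_def)
  then have "Infinite_Set_Sum.abs_summable_on (\<lambda>x. (cmod (f x))\<^sup>2) UNIV"
    by (simp only: abs_summable_equivalent)
  then show ?thesis unfolding sqn_def by (simp add: nn_integral_conv_infsetsum infsetsum_infsum)
qed

definition invariant_subspace :: "('g, 'm) monoid_scheme => ('g \<times> nat => complex) set => bool" where
  "invariant_subspace G M \<longleftrightarrow> closed_subspace M \<and> M \<subseteq> hcarrier (regular_module G) \<and>
    (\<forall>g\<in>carrier G. \<forall>f\<in>M. hact (regular_module G) g f \<in> M)"

definition gvec :: "('g, 'm) monoid_scheme => nat => 'g \<times> nat => complex" where
  "gvec G i = point_mass (\<one>\<^bsub>G\<^esub>, i)"

lemma square_summable_gvec [simp]: "square_summable (gvec G i)"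
  by (simp add: gvec_def square_summable_point_mass)

lemma projection_trace_eq:
  assumes "closed_subspace M"
  shows "projection_trace G M = (\<Sum>i. ereal (sqn (l2_proj M (gvec G i))))"
proof -
  have "(\<lambda>x. if x = (\<one>\<^bsub>G\<^esub>, i) then 1 else 0) = gvec G i" for i
    by (simp add: gvec_def point_mass_def fun_eq_iff)
  then show ?thesis
    unfolding projection_trace_def Let_def using projection_sqn[OF assms square_summable_gvec[of G]] by simp
qed

context group
begin

lemma hact_regular: "hact (regular_module G) g f = (\<lambda>(h,i). if h \<in> carrier G then f (inv g \<otimes> h, i) else 0)"
  by (simp add: regular_module_def)

lemma hcarrier_regular: "f \<in> hcarrier (regular_module G) \<longleftrightarrow> square_summable f \<and> (\<forall>h i. h \<notin> carrier G --> f (h,i) = 0)"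
  by (simp add: regular_module_def)

lemma shift_bij:
  assumes g: "g \<in> carrier G"
  shows "bij_betw (\<lambda>(h,i). (if h \<in> carrier G then inv g \<otimes> h else h, i)) (UNIV :: ('a \<times> nat) set) UNIV"
proof (rule bij_betw_byWitness[where f' = "\<lambda>(h,i). (if h \<in> carrier G then g \<otimes> h else h, i)"])
  show "\<forall>a\<in>UNIV. (\<lambda>(h, i). (if h \<in> carrier G then g \<otimes> h else h, i)) ((\<lambda>(h, i). (if h \<in> carrier G then inv g \<otimes> h else h, i)) a) = a"
    using g by (auto simp: m_assoc[symmetric])
  show "\<forall>a'\<in>UNIV. (\<lambda>(h, i). (if h \<in> carrier G then inv g \<otimes> h else h, i)) ((\<lambda>(h, i). (if h \<in> carrier G then g \<otimes> h else h, i)) a') = a'"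
    using g by (auto simp: m_assoc[symmetric])
qed auto

lemma inner_shift:
  assumes g: "g \<in> carrier G" and h: "h \<in> hcarrier (regular_module G)"
  shows "l2_inner (hact (regular_module G) g f) h = l2_inner f (hact (regular_module G) (inv g) h)"
proof -
  let ?s = "\<lambda>(h,i). (if h \<in> carrier G then inv g \<otimes> h else h, i :: nat)"
  have "l2_inner f (hact (regular_module G) (inv g) h) =
      (\<Sum>\<^sub>\<infinity>x. (\<lambda>x. f x * cnj (hact (regular_module G) (inv g) h x)) (?s x))"
    unfolding l2_inner_def by (rule infsum_reindex_bij_betw[OF shift_bij[OF g], symmetric])
  also have "... = l2_inner (hact (regular_module G) g f) h"
    unfolding l2_inner_def using g h by (intro infsum_cong) (auto simp: hact_regular m_assoc[symmetric] hcarrier_regular)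
  finally show ?thesis by simp
qed

lemma hact_hcarrier:
  assumes g: "g \<in> carrier G" and f: "f \<in> hcarrier (regular_module G)"
  shows "hact (regular_module G) g f \<in> hcarrier (regular_module G)"
    and "sqn (hact (regular_module G) g f) = sqn f"
proof -
  let ?s = "\<lambda>(h,i). (if h \<in> carrier G then inv g \<otimes> h else h, i :: nat)"
  have eq: "hact (regular_module G) g f x = f (?s x)" for x
    using f by (auto simp: hact_regular hcarrier_regular split: prod.splits)
  have "(\<lambda>x. (cmod (f (?s x)))\<^sup>2) summable_on UNIV"
    using f summable_on_reindex_bij_betw[OF shift_bij[OF g], of "\<lambda>x. (cmod (f x))\<^sup>2"]
    by (simp add: hcarrier_regular square_summable_def)
  then show "hact (regular_module G) g f \<in> hcarrier (regular_module G)"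
    unfolding hcarrier_regular square_summable_def eq[symmetric]
    by (intro conjI) (assumption, simp add: hact_regular)
  show "sqn (hact (regular_module G) g f) = sqn f"
    unfolding sqn_def eq by (rule infsum_reindex_bij_betw[OF shift_bij[OF g], of "\<lambda>x. (cmod (f x))\<^sup>2"])
qed

lemma projection_shift:
  assumes M: "invariant_subspace G M" and g: "g \<in> carrier G"
  shows "l2_proj M (point_mass (g,i)) = hact (regular_module G) g (l2_proj M (gvec G i))"
proof -
  have cM: "closed_subspace M" and sub: "M \<subseteq> hcarrier (regular_module G)"
    and inv: "\<And>g f. g \<in> carrier G ==> f \<in> M ==> hact (regular_module G) g f \<in> M"
    using M by (auto simp: invariant_subspace_def)
  let ?P = "l2_proj M (gvec G i)" and ?gP = "hact (regular_module G) g (l2_proj M (gvec G i))"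
  have P: "?P \<in> M" by (rule projection(1)[OF cM square_summable_gvec])
  have gP: "?gP \<in> M" by (rule inv[OF g P])
  show ?thesis
  proof (rule projection_unique[OF cM square_summable_point_mass gP])
    fix z assume z: "z \<in> M"
    have zc: "z \<in> hcarrier (regular_module G)" using z sub by auto
    have gz: "hact (regular_module G) (inv g) z \<in> M" using inv z g by simp
    have "l2_inner ?gP z = l2_inner ?P (hact (regular_module G) (inv g) z)" by (rule inner_shift[OF g zc])
    also have "... = l2_inner (gvec G i) (hact (regular_module G) (inv g) z)"
      by (rule projection(2)[OF cM square_summable_gvec gz])
    also have "... = cnj (hact (regular_module G) (inv g) z (\<one>, i))"
      unfolding gvec_def by (subst inner_cnj[symmetric]) (simp add: inner_point_mass)
    also have "... = cnj (z (g,i))" using g by (simp add: hact_regular)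
    also have "... = l2_inner (point_mass (g,i)) z"
      by (subst inner_cnj[symmetric]) (simp add: inner_point_mass)
    finally have "l2_inner ?gP z = l2_inner (point_mass (g,i)) z" .
    then show "l2_inner (\<lambda>x. point_mass (g, i) x - ?gP x) z = 0"
      using closed_subspaceD(2)[OF cM gP] closed_subspaceD(2)[OF cM z]
      by (subst inner_diff_left) (auto intro: square_summable_point_mass)
  qed
qed

definition inv_total :: "'a => 'a" where
  "inv_total g = (if g \<in> carrier G then inv g else g)"

lemma inv_total_bij: "bij_betw inv_total UNIV UNIV"
  by (rule bij_betw_byWitness[where f' = inv_total]) (auto simp: inv_total_def)

text \<open>The squared norm of the projection of a basis vector can be computed with either basis: expanding the projections of the two
families of basis vectors in each other gives the same double sum, in which translation invariance permits to exchange the two roles.\<close>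

lemma projection_trace_isometry:
  assumes N: "invariant_subspace G N" and N': "invariant_subspace G N'"
    and U: "U ` N = N'" and add: "\<And>f h. f \<in> N ==> h \<in> N ==> U (\<lambda>x. f x + h x) = (\<lambda>x. U f x + U h x)"
    and scale: "\<And>c f. f \<in> N ==> U (\<lambda>x. c * f x) = (\<lambda>x. c * U f x)"
    and iso: "\<And>f. f \<in> N ==> sqn (U f) = sqn f"
    and equi: "\<And>g f. g \<in> carrier G ==> f \<in> N ==> U (hact (regular_module G) g f) = hact (regular_module G) g (U f)"
  shows "projection_trace G N = projection_trace G N'"
proof -
  have cN: "closed_subspace N" and cN': "closed_subspace N'"
    and sub: "N \<subseteq> hcarrier (regular_module G)" "N' \<subseteq> hcarrier (regular_module G)"
    using N N' by (auto simp: invariant_subspace_def)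
  have UN: "U f \<in> N'" if "f \<in> N" for f using U that by auto
  have sq: "square_summable f" if "f \<in> N" for f using closed_subspaceD(2)[OF cN that] .
  have sq': "square_summable f" if "f \<in> N'" for f using closed_subspaceD(2)[OF cN' that] .
  have inner: "l2_inner (U f) (U h) = l2_inner f h" if "f \<in> N" "h \<in> N" for f h
  proof -
    have ih: "(\<lambda>x. \<i> * h x) \<in> N" by (rule closed_subspaceD(4)[OF cN that(2)])
    have 1: "sqn (\<lambda>x. U f x + U h x) = sqn (\<lambda>x. f x + h x)"
      using iso[OF closed_subspaceD(3)[OF cN that]] add[OF that] by simp
    have 2: "sqn (\<lambda>x. U f x + \<i> * U h x) = sqn (\<lambda>x. f x + \<i> * h x)"
      using iso[OF closed_subspaceD(3)[OF cN that(1) ih]] add[OF that(1) ih] scale[OF that(2), of \<i>] by simp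
    show ?thesis
      unfolding polarization[OF sq'[OF UN[OF that(1)]] sq'[OF UN[OF that(2)]]] polarization[OF sq[OF that(1)] sq[OF that(2)]] 1 2
      by (simp add: iso that)
  qed
  define P where "P k = l2_proj N (gvec G k)" for k
  define P' where "P' i = l2_proj N' (gvec G i)" for i
  have P: "P k \<in> N" and P': "P' k \<in> N'" for k
    unfolding P_def P'_def by (rule projection(1)[OF cN square_summable_gvec], rule projection(1)[OF cN' square_summable_gvec])
  define b where "b i g k = ennreal ((cmod (U (P k) (g,i)))\<^sup>2)" for i g k
  have key: "ennreal (sqn (P' i)) = (\<integral>\<^sup>+k. \<integral>\<^sup>+g. b i g k \<partial>count_space UNIV \<partial>count_space UNIV)" for i
  proof -
    obtain w where w: "w \<in> N" "U w = P' i" using U P' by (metis imageE)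
    have wg: "w (g,k) = cnj (U (P k) (inv g, i))" if g: "g \<in> carrier G" for g k
    proof -
      have gP: "hact (regular_module G) g (P k) \<in> N" using N P g by (auto simp: invariant_subspace_def)
      have "cnj (w (g,k)) = l2_inner (point_mass (g,k)) w"
	by (subst inner_cnj[symmetric]) (simp add: inner_point_mass)
      also have "... = l2_inner (l2_proj N (point_mass (g,k))) w"
	by (rule projection(2)[OF cN square_summable_point_mass w(1), symmetric])
      also have "... = l2_inner (U (hact (regular_module G) g (P k))) (P' i)"
	unfolding projection_shift[OF N g] P_def[symmetric] using inner[OF gP w(1)] w(2) by simp
      also have "... = cnj (l2_inner (P' i) (U (hact (regular_module G) g (P k))))" by (simp add: inner_cnj)
      also have "l2_inner (P' i) (U (hact (regular_module G) g (P k))) = l2_inner (gvec G i) (U (hact (regular_module G) g (P k)))"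
	unfolding P'_def by (rule projection(2)[OF cN' square_summable_gvec UN[OF gP]])
      also have "cnj (l2_inner (gvec G i) (U (hact (regular_module G) g (P k)))) = U (hact (regular_module G) g (P k)) (\<one>, i)"
	by (simp add: inner_cnj gvec_def inner_point_mass)
      also have "... = U (P k) (inv g, i)" using equi[OF g P] g by (simp add: hact_regular)
      finally show ?thesis by (metis complex_cnj_cnj)
    qed
    have w0: "w (g,k) = 0" if "g \<notin> carrier G" for g k using w(1) sub that by (auto simp: hcarrier_regular)
    have U0: "U (P k) (g,i) = 0" if "g \<notin> carrier G" for g k using UN[OF P[of k]] sub that by (auto simp: hcarrier_regular)
    have "sqn (P' i) = sqn w" using iso[OF w(1)] w(2) by simp
    then have "ennreal (sqn (P' i)) = (\<integral>\<^sup>+x. ennreal ((cmod (w x))\<^sup>2) \<partial>count_space UNIV)"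
      using ennreal_sqn[OF sq[OF w(1)]] by simp
    also have "... = (\<integral>\<^sup>+k. \<integral>\<^sup>+g. ennreal ((cmod (w (g,k)))\<^sup>2) \<partial>count_space UNIV \<partial>count_space UNIV)"
      by (rule nn_integral_snd_count_space[symmetric])
    also have "... = (\<integral>\<^sup>+k. \<integral>\<^sup>+g. b i (inv_total g) k \<partial>count_space UNIV \<partial>count_space UNIV)"
      by (intro nn_integral_cong) (auto simp: b_def inv_total_def wg w0 U0)
    also have "... = (\<integral>\<^sup>+k. \<integral>\<^sup>+g. b i g k \<partial>count_space UNIV \<partial>count_space UNIV)"
      by (intro nn_integral_cong nn_integral_bij_count_space[OF inv_total_bij])
    finally show ?thesis .
  qed
  have "(\<Sum>i. ennreal (sqn (P' i))) = (\<integral>\<^sup>+i. \<integral>\<^sup>+k. \<integral>\<^sup>+g. b i g k \<partial>count_space UNIV \<partial>count_space UNIV \<partial>count_space UNIV)"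
    unfolding nn_integral_count_space_nat[symmetric] key ..
  also have "... = (\<integral>\<^sup>+k. \<integral>\<^sup>+i. \<integral>\<^sup>+g. b i g k \<partial>count_space UNIV \<partial>count_space UNIV \<partial>count_space UNIV)"
    using nn_integral_fst_count_space[of "\<lambda>(i,k). \<integral>\<^sup>+g. b i g k \<partial>count_space UNIV"]
      nn_integral_snd_count_space[of "\<lambda>(i,k). \<integral>\<^sup>+g. b i g k \<partial>count_space UNIV"] by simp
  also have "... = (\<integral>\<^sup>+k. ennreal (sqn (P k)) \<partial>count_space UNIV)"
  proof (intro nn_integral_cong)
    fix k
    have "(\<integral>\<^sup>+i. \<integral>\<^sup>+g. b i g k \<partial>count_space UNIV \<partial>count_space UNIV) = (\<integral>\<^sup>+x. ennreal ((cmod (U (P k) x))\<^sup>2) \<partial>count_space UNIV)"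
      unfolding b_def by (rule nn_integral_snd_count_space)
    also have "... = ennreal (sqn (P k))" using ennreal_sqn[OF sq'[OF UN[OF P]]] iso[OF P] by simp
    finally show "(\<integral>\<^sup>+i. \<integral>\<^sup>+g. b i g k \<partial>count_space UNIV \<partial>count_space UNIV) = ennreal (sqn (P k))" .
  qed
  finally have eq: "(\<Sum>i. ennreal (sqn (P' i))) = (\<Sum>k. ennreal (sqn (P k)))"
    unfolding nn_integral_count_space_nat .
  have conv: "(\<Sum>i. ereal (sqn (p i))) = enn2ereal (\<Sum>i. ennreal (sqn (p i)))" for p :: "nat => 'a \<times> nat => complex"
    unfolding suminf_enn2ereal[symmetric] by simp
  show ?thesis
    unfolding projection_trace_eq[OF cN] projection_trace_eq[OF cN'] P_def[symmetric] P'_def[symmetric] conv eq ..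
qed

text \<open>An isometric image of a closed subspace is closed, since it is complete.\<close>

lemma closed_subspace_isometric_image:
  assumes N: "closed_subspace N" and add: "\<And>f h. f \<in> N ==> h \<in> N ==> U (\<lambda>x. f x + h x) = (\<lambda>x. U f x + U h x)"
    and scale: "\<And>c f. f \<in> N ==> U (\<lambda>x. c * f x) = (\<lambda>x. c * U f x)"
    and iso: "\<And>f. f \<in> N ==> sqn (U f) = sqn f" and sq: "\<And>f. f \<in> N ==> square_summable (U f)"
  shows "closed_subspace (U ` N)"
  unfolding closed_subspace_def
proof (intro conjI ballI allI impI)
  note ND = closed_subspaceD[OF N]
  have diff: "U (\<lambda>x. f x - h x) = (\<lambda>x. U f x - U h x)" if "f \<in> N" "h \<in> N" for f h
    using add[OF that(1) ND(4)[OF that(2), of "-1"]] scale[OF that(2), of "-1"] by simp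
  have "U (\<lambda>x. 0 * 0) = (\<lambda>x. 0 * U (\<lambda>_. 0) x)" by (rule scale[OF ND(1), of 0])
  then show "(\<lambda>_. 0) \<in> U ` N" using ND(1) by (intro image_eqI[of _ _ "\<lambda>_. 0"]) auto
  show "square_summable f" if "f \<in> U ` N" for f using that sq by auto
  show "(\<lambda>x. f x + g x) \<in> U ` N" if "f \<in> U ` N" "g \<in> U ` N" for f g
    using that add ND(3) by (auto simp: image_iff) (metis (no_types, lifting))
  show "(\<lambda>x. c * f x) \<in> U ` N" if "f \<in> U ` N" for c f
    using that scale ND(4) by (auto simp: image_iff) (metis (no_types, lifting))
  fix f assume f: "square_summable f" and app: "\<forall>e>0. \<exists>y\<in>U ` N. sqn (\<lambda>x. f x - y x) < e"
  have "\<exists>y\<in>N. sqn (\<lambda>x. f x - U y x) < 1 / real (Suc n)" for n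
    using app[rule_format, of "1 / real (Suc n)"] by auto
  then obtain y where y: "\<And>n. y n \<in> N" "\<And>n. sqn (\<lambda>x. f x - U (y n) x) < 1 / real (Suc n)" by metis
  have "sqn (\<lambda>x. y n x - y m x) \<le> 2 / real (Suc n) + 2 / real (Suc m)" for n m
  proof -
    have "sqn (\<lambda>x. y n x - y m x) = sqn (\<lambda>x. U (y n) x - U (y m) x)"
      using iso[OF ND(5)[OF y(1)[of n] y(1)[of m]]] diff[OF y(1)[of n] y(1)[of m]] by simp
    also have "... \<le> 2 * sqn (\<lambda>x. U (y n) x - f x) + 2 * sqn (\<lambda>x. f x - U (y m) x)"
      by (rule sqn_diff_triangle[OF sq[OF y(1)] f sq[OF y(1)]])
    also have "... \<le> 2 * (1 / real (Suc n)) + 2 * (1 / real (Suc m))"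
      using y(2)[of n] y(2)[of m] sqn_minus_commute[of f "U (y n)"] by (intro add_mono mult_left_mono) auto
    finally show ?thesis by simp
  qed
  then obtain l where l: "square_summable l" "\<And>n. sqn (\<lambda>x. y n x - l x) \<le> 2 / real (Suc n)"
    by (rule l2_complete[of y 2, OF ND(2)[OF y(1)]]) blast
  have lN: "l \<in> N" by (rule closed_subspace_limit[OF N y(1) l])
  have "sqn (\<lambda>x. f x - U l x) \<le> 6 / real (Suc n)" for n
  proof -
    have "sqn (\<lambda>x. f x - U l x) \<le> 2 * sqn (\<lambda>x. f x - U (y n) x) + 2 * sqn (\<lambda>x. U (y n) x - U l x)"
      by (rule sqn_diff_triangle[OF f sq[OF y(1)] sq[OF lN]])
    also have "sqn (\<lambda>x. U (y n) x - U l x) = sqn (\<lambda>x. y n x - l x)"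
      using iso[OF ND(5)[OF y(1)[of n] lN]] diff[OF y(1)[of n] lN] by simp
    also have "2 * sqn (\<lambda>x. f x - U (y n) x) + 2 * sqn (\<lambda>x. y n x - l x) \<le> 2 * (1 / real (Suc n)) + 2 * (2 / real (Suc n))"
      using y(2)[of n] l(2)[of n] by (intro add_mono mult_left_mono) auto
    finally show ?thesis by simp
  qed
  moreover have "(\<lambda>n. 6 / real (Suc n)) \<longlonglongrightarrow> 0"
    using tendsto_mult_right_zero[OF LIMSEQ_inverse_real_of_nat, of 6] by (simp add: divide_inverse)
  ultimately have "sqn (\<lambda>x. f x - U l x) \<le> 0" by (intro LIMSEQ_le_const) auto
  then have "sqn (\<lambda>x. f x - U l x) = 0" using sqn_nonneg[of "\<lambda>x. f x - U l x"] by linarith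
  then have z: "f x - U l x = 0" for x by (rule sqn_eq_0D[OF square_summable_diff[OF f sq[OF lN]]])
  have "f = U l" using z by (intro ext) simp
  then show "f \<in> U ` N" using lN by blast
qed

end

section \<open>Harmonic functions and damped powers\<close>

lemma gop_diff3:
  "gop G T S a (\<lambda>j. x j + y j - z j) p = gop G T S a x p + gop G T S a y p - gop G T S a z p"
  by (cases p) (simp add: gop_def algebra_simps sum.distrib sum_subtractf)

lemma gop_adj_diff3:
  "gop_adj G V S a (\<lambda>j. x j + y j - z j) p = gop_adj G V S a x p + gop_adj G V S a y p - gop_adj G V S a z p"
  by (cases p) (simp add: gop_adj_def algebra_simps sum.distrib sum_subtractf)

lemma gop_Re: "gop G T S a (\<lambda>j. Re (f j)) p = Re (gop G T S a f p)"
  by (cases p) (simp add: gop_def)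

lemma gop_adj_Re: "gop_adj G V S a (\<lambda>j. Re (f j)) p = Re (gop_adj G V S a f p)"
  by (cases p) (simp add: gop_adj_def)

context group
begin

definition eq_on_group :: "'u set => ('a \<times> 'u => 'k) => ('a \<times> 'u => 'k) => bool" where
  "eq_on_group B x y \<longleftrightarrow> (\<forall>g\<in>carrier G. \<forall>b\<in>B. x (g,b) = y (g,b))"

definition fsupp :: "'u set => ('a \<times> 'u => real) => bool" where
  "fsupp B e \<longleftrightarrow> finite {p \<in> carrier G \<times> B. e p \<noteq> 0}"

text \<open>A bilinear pairing that only needs the second argument to be finitely supported on \<open>G \<times> B\<close>.\<close>

definition pairing :: "'u set => ('a \<times> 'u => real) => ('a \<times> 'u => real) => real" where
  "pairing B x e = (\<Sum>p \<in> {p \<in> carrier G \<times> B. e p \<noteq> 0}. x p * e p)"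

lemma pairing_superset:
  assumes "finite W" "W \<subseteq> carrier G \<times> B" "\<And>p. p \<in> carrier G \<times> B ==> e p \<noteq> 0 ==> p \<in> W"
  shows "pairing B x e = (\<Sum>p\<in>W. x p * e p)"
  unfolding pairing_def using assms by (intro sum.mono_neutral_left) auto

lemma pairing_cong:
  assumes "eq_on_group B x x'" "eq_on_group B e e'"
  shows "pairing B x e = pairing B x' e'"
proof -
  have "{p \<in> carrier G \<times> B. e p \<noteq> 0} = {p \<in> carrier G \<times> B. e' p \<noteq> 0}"
    using assms(2) by (auto simp: eq_on_group_def)
  then show ?thesis
    unfolding pairing_def using assms by (intro sum.cong) (auto simp: eq_on_group_def)
qed

lemma gop_cong:
  assumes "eq_on_group T x y" "S \<subseteq> carrier G"
  shows "eq_on_group V (gop G T S a x) (gop G T S a y)"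
  using assms unfolding eq_on_group_def gop_def by (auto intro!: sum.cong)

lemma gop_adj_cong:
  assumes "eq_on_group V x y" "S \<subseteq> carrier G"
  shows "eq_on_group T (gop_adj G V S a x) (gop_adj G V S a y)"
  using assms unfolding eq_on_group_def gop_adj_def by (auto intro!: sum.cong)

lemma gop_adjoint:
  assumes S: "finite S" "S \<subseteq> carrier G" and T: "finite T" and V: "finite V" and e: "fsupp V e"
  shows "fsupp T (gop_adj G V S a e)" "pairing V (gop G T S a x) e = pairing T x (gop_adj G V S a e)"
proof -
  define A where "A = fst ` {p \<in> carrier G \<times> V. e p \<noteq> 0}"
  have A: "finite A" "A \<subseteq> carrier G" using e unfolding A_def fsupp_def by auto
  have eA: "e (g,r) = 0" if "g \<in> carrier G" "r \<in> V" "g \<notin> A" for g r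
    using that by (force simp: A_def)
  define K where "K = (\<Union>h\<in>S. (\<lambda>g. g \<otimes> h) ` A)"
  have K: "finite K" "K \<subseteq> carrier G" using A S by (auto simp: K_def)
  have zero: "e (k \<otimes> inv h, r) = 0" if "k \<in> carrier G" "h \<in> S" "r \<in> V" "k \<notin> (\<lambda>g. g \<otimes> h) ` A" for k h r
  proof (rule eA)
    have h: "h \<in> carrier G" using that S by auto
    show "k \<otimes> inv h \<in> carrier G" using that h by simp
    show "k \<otimes> inv h \<notin> A"
    proof
      assume "k \<otimes> inv h \<in> A"
      moreover have "k = (k \<otimes> inv h) \<otimes> h" using that h by (simp add: m_assoc)
      ultimately show False using that(4) by blast
    qed
  qed (use that in auto)
  have supp: "gop_adj G V S a e (k,t) = 0" if "k \<in> carrier G" "k \<notin> K" for k t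
    unfolding gop_adj_def case_prod_conv
    using that zero by (intro sum.neutral ballI) (auto simp: K_def)
  have KT: "p \<in> K \<times> T" if "p \<in> carrier G \<times> T" "gop_adj G V S a e p \<noteq> 0" for p
    using that supp by (cases p) auto
  have finKT: "finite (K \<times> T)" using K T by simp
  show "fsupp T (gop_adj G V S a e)"
    unfolding fsupp_def by (rule finite_subset[OF _ finKT]) (use KT in auto)
  have "pairing V (gop G T S a x) e = (\<Sum>p\<in>A \<times> V. gop G T S a x p * e p)"
    using A V eA by (intro pairing_superset) auto
  also have "... = (\<Sum>g\<in>A. \<Sum>r\<in>V. \<Sum>t\<in>T. \<Sum>h\<in>S. of_int (a r t h) * (x (g \<otimes> h, t) * e (g,r)))"
    unfolding sum_Times gop_def case_prod_conv sum_distrib_right by (simp add: mult.assoc)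
  also have "... = (\<Sum>r\<in>V. \<Sum>g\<in>A. \<Sum>t\<in>T. \<Sum>h\<in>S. of_int (a r t h) * (x (g \<otimes> h, t) * e (g,r)))"
    by (rule sum.swap)
  also have "... = (\<Sum>r\<in>V. \<Sum>t\<in>T. \<Sum>g\<in>A. \<Sum>h\<in>S. of_int (a r t h) * (x (g \<otimes> h, t) * e (g,r)))"
    by (rule sum.cong[OF refl], rule sum.swap)
  also have "... = (\<Sum>r\<in>V. \<Sum>t\<in>T. \<Sum>h\<in>S. \<Sum>g\<in>A. of_int (a r t h) * (x (g \<otimes> h, t) * e (g,r)))"
    by (rule sum.cong[OF refl], rule sum.cong[OF refl], rule sum.swap)
  also have "... = (\<Sum>r\<in>V. \<Sum>t\<in>T. \<Sum>h\<in>S. \<Sum>k\<in>K. of_int (a r t h) * (x (k, t) * e (k \<otimes> inv h, r)))"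
  proof (rule sum.cong[OF refl], rule sum.cong[OF refl], rule sum.cong[OF refl])
    fix r t h assume rth: "r \<in> V" "t \<in> T" "h \<in> S"
    have h: "h \<in> carrier G" using rth S by auto
    have inj: "inj_on (\<lambda>g. g \<otimes> h) A" using A h by (intro inj_onI) (auto simp: subset_iff)
    have "(\<Sum>k\<in>K. of_int (a r t h) * (x (k, t) * e (k \<otimes> inv h, r))) =
	(\<Sum>k\<in>(\<lambda>g. g \<otimes> h) ` A. of_int (a r t h) * (x (k, t) * e (k \<otimes> inv h, r)))"
      using K zero rth by (intro sum.mono_neutral_right) (auto simp: K_def)
    also have "... = (\<Sum>g\<in>A. of_int (a r t h) * (x (g \<otimes> h, t) * e ((g \<otimes> h) \<otimes> inv h, r)))"
      by (simp add: sum.reindex[OF inj])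
    also have "... = (\<Sum>g\<in>A. of_int (a r t h) * (x (g \<otimes> h, t) * e (g, r)))"
      using A h by (intro sum.cong refl) (auto simp: m_assoc subset_iff)
    finally show "(\<Sum>g\<in>A. of_int (a r t h) * (x (g \<otimes> h, t) * e (g, r))) =
	(\<Sum>k\<in>K. of_int (a r t h) * (x (k, t) * e (k \<otimes> inv h, r)))" by simp
  qed
  also have "... = (\<Sum>r\<in>V. \<Sum>t\<in>T. \<Sum>k\<in>K. \<Sum>h\<in>S. of_int (a r t h) * (x (k, t) * e (k \<otimes> inv h, r)))"
    by (rule sum.cong[OF refl], rule sum.cong[OF refl], rule sum.swap)
  also have "... = (\<Sum>r\<in>V. \<Sum>k\<in>K. \<Sum>t\<in>T. \<Sum>h\<in>S. of_int (a r t h) * (x (k, t) * e (k \<otimes> inv h, r)))"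
    by (rule sum.cong[OF refl], rule sum.swap)
  also have "... = (\<Sum>k\<in>K. \<Sum>r\<in>V. \<Sum>t\<in>T. \<Sum>h\<in>S. of_int (a r t h) * (x (k, t) * e (k \<otimes> inv h, r)))"
    by (rule sum.swap)
  also have "... = (\<Sum>k\<in>K. \<Sum>t\<in>T. \<Sum>r\<in>V. \<Sum>h\<in>S. of_int (a r t h) * (x (k, t) * e (k \<otimes> inv h, r)))"
    by (rule sum.cong[OF refl], rule sum.swap)
  also have "... = (\<Sum>p\<in>K \<times> T. x p * gop_adj G V S a e p)"
    unfolding sum_Times gop_adj_def case_prod_conv sum_distrib_left by (simp add: mult_ac)
  also have "... = pairing T x (gop_adj G V S a e)"
    using K T KT finKT by (intro pairing_superset[symmetric]) auto
  finally show "pairing V (gop G T S a x) e = pairing T x (gop_adj G V S a e)" .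
qed

text \<open>The transpose of a group matrix is again a group matrix, so adjunction holds in both directions.\<close>

lemma gop_adj_as_gop:
  assumes S: "S \<subseteq> carrier G"
  shows "gop_adj G V S a = gop G V ((\<lambda>h. inv h) ` S) (\<lambda>t r h. a r t (inv h))"
    "gop G T S a = gop_adj G T ((\<lambda>h. inv h) ` S) (\<lambda>t r h. a r t (inv h))"
proof -
  have inj: "inj_on (\<lambda>h. inv h) S" using S inv_inj by (meson inj_on_subset)
  have sum: "(\<Sum>h\<in>(\<lambda>h. inv h) ` S. f h) = (\<Sum>h\<in>S. f (inv h))" for f :: "'a => 'z::comm_monoid_add"
    by (simp add: sum.reindex[OF inj])
  show "gop_adj G V S a = gop G V ((\<lambda>h. inv h) ` S) (\<lambda>t r h. a r t (inv h))"
    unfolding gop_adj_def gop_def sum using S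
    by (intro ext) (auto intro!: sum.cong simp: subset_iff)
  show "gop G T S a = gop_adj G T ((\<lambda>h. inv h) ` S) (\<lambda>t r h. a r t (inv h))"
    unfolding gop_adj_def gop_def sum using S
    by (intro ext) (auto intro!: sum.cong simp: subset_iff)
qed

lemma gop_adjoint':
  assumes S: "finite S" "S \<subseteq> carrier G" and T: "finite T" and V: "finite V" and e: "fsupp T e"
  shows "fsupp V (gop G T S a e)" "pairing T (gop_adj G V S a x) e = pairing V x (gop G T S a e)"
proof -
  have S': "finite ((\<lambda>h. inv h) ` S)" "(\<lambda>h. inv h) ` S \<subseteq> carrier G" using S by auto
  show "fsupp V (gop G T S a e)" "pairing T (gop_adj G V S a x) e = pairing V x (gop G T S a e)"
    unfolding gop_adj_as_gop[OF S(2)] using gop_adjoint[OF S' V T e] by auto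
qed

lemma pairing_diff_left: "pairing B (\<lambda>j. x j - y j / R) e = pairing B x e - pairing B y e / R"
  by (simp add: pairing_def left_diff_distrib sum_subtractf sum_divide_distrib)

lemma pairing_diff_right:
  assumes "fsupp B e" "fsupp B e'"
  shows "fsupp B (\<lambda>j. e j - e' j / R)" "pairing B x (\<lambda>j. e j - e' j / R) = pairing B x e - pairing B x e' / R"
proof -
  let ?W = "{p \<in> carrier G \<times> B. e p \<noteq> 0} \<union> {p \<in> carrier G \<times> B. e' p \<noteq> 0}"
  have W: "finite ?W" using assms by (simp add: fsupp_def)
  show "fsupp B (\<lambda>j. e j - e' j / R)"
    unfolding fsupp_def by (rule finite_subset[OF _ W]) auto
  have "pairing B x (\<lambda>j. e j - e' j / R) = (\<Sum>p\<in>?W. x p * (e p - e' p / R))"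
    by (rule pairing_superset[OF W]) auto
  also have "... = (\<Sum>p\<in>?W. x p * e p) - (\<Sum>p\<in>?W. x p * e' p) / R"
    by (simp add: right_diff_distrib sum_subtractf sum_divide_distrib)
  also have "(\<Sum>p\<in>?W. x p * e p) = pairing B x e" by (rule pairing_superset[OF W, symmetric]) auto
  also have "(\<Sum>p\<in>?W. x p * e' p) = pairing B x e'" by (rule pairing_superset[OF W, symmetric]) auto
  finally show "pairing B x (\<lambda>j. e j - e' j / R) = pairing B x e - pairing B x e' / R" .
qed

lemma pairing_unit:
  assumes "g \<in> carrier G" "b \<in> B"
  shows "fsupp B (\<lambda>j. if j = (g,b) then 1 else 0)" "pairing B x (\<lambda>j. if j = (g,b) then 1 else 0) = x (g,b)"
proof -
  have "{p \<in> carrier G \<times> B. (if p = (g,b) then 1 else (0::real)) \<noteq> 0} = {(g,b)}" using assms by auto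
  then show "fsupp B (\<lambda>j. if j = (g,b) then 1 else 0)" "pairing B x (\<lambda>j. if j = (g,b) then 1 else 0) = x (g,b)"
    by (simp_all add: fsupp_def pairing_def)
qed

end

text \<open>Two composable matrices over the group ring with product zero.\<close>

locale harmonic_setting = group G for G (structure) +
  fixes T' :: "'t set" and T :: "nat set" and V :: "'v set" and S1 S2 :: "'a set"
    and a1 :: "nat => 't => 'a => int" and a2 :: "'v => nat => 'a => int" and R :: real
  assumes fin: "finite T'" "finite T" "finite V" "finite S1" "finite S2"
    and S: "S1 \<subseteq> carrier G" "S2 \<subseteq> carrier G"
    and complex: "\<And>x :: 'a \<times> 't => real. eq_on_group V (gop G T S2 a2 (gop G T' S1 a1 x)) (\<lambda>_. 0)"
begin

abbreviation d1 where "d1 x \<equiv> gop G T' S1 a1 (x :: _ => real)"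
abbreviation d1' where "d1' x \<equiv> gop_adj G T S1 a1 (x :: _ => real)"
abbreviation d2 where "d2 x \<equiv> gop G T S2 a2 (x :: _ => real)"
abbreviation d2' where "d2' x \<equiv> gop_adj G V S2 a2 (x :: _ => real)"

lemma adj1: "fsupp T e ==> fsupp T' (d1' e)" "fsupp T e ==> pairing T (d1 x) e = pairing T' x (d1' e)"
  using gop_adjoint[OF fin(4) S(1) fin(1,2)] by auto
lemma adj1': "fsupp T' y ==> fsupp T (d1 y)" "fsupp T' y ==> pairing T' (d1' z) y = pairing T z (d1 y)"
  using gop_adjoint'[OF fin(4) S(1) fin(1,2)] by auto
lemma adj2: "fsupp V y ==> fsupp T (d2' y)" "fsupp V y ==> pairing V (d2 z) y = pairing T z (d2' y)"
  using gop_adjoint[OF fin(5) S(2) fin(2,3)] by auto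
lemma adj2': "fsupp T e ==> fsupp V (d2 e)" "fsupp T e ==> pairing T (d2' x) e = pairing V x (d2 e)"
  using gop_adjoint'[OF fin(5) S(2) fin(2,3)] by auto

lemma d1'_d2': "eq_on_group T' (d1' (d2' y)) (\<lambda>_. 0)"
  unfolding eq_on_group_def
proof (intro ballI)
  fix g t assume gt: "g \<in> carrier G" "t \<in> T'"
  let ?e = "\<lambda>j. if j = (g,t) then 1 else (0::real)"
  note e = pairing_unit[OF gt]
  have "d1' (d2' y) (g,t) = pairing T' (d1' (d2' y)) ?e" by (simp add: e)
  also have "... = pairing T (d2' y) (d1 ?e)" by (rule adj1'(2)[OF e(1)])
  also have "... = pairing V y (d2 (d1 ?e))" by (rule adj2'(2)[OF adj1'(1)[OF e(1)]])
  also have "... = pairing V y (\<lambda>_. 0)"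
    by (rule pairing_cong[OF _ complex]) (simp add: eq_on_group_def)
  also have "... = 0" by (simp add: pairing_def)
  finally show "d1' (d2' y) (g,t) = 0" .
qed

lemma eq_on_groupD: "eq_on_group B x y ==> p \<in> carrier G \<times> B ==> x p = y p"
  by (auto simp: eq_on_group_def)

abbreviation T1 where "T1 \<equiv> damped_rows G T T' S1 a1 R"
abbreviation T2 where "T2 \<equiv> damped_cols G V T S2 a2 R"
text \<open>The damped Laplacian, which fixes harmonic functions.\<close>

definition TT where "TT x = (\<lambda>j. x j - d1 (d1' x) j / R - d2' (d2 x) j / R)"

lemma zero_ops:
  "eq_on_group T (d1 (\<lambda>_. 0)) (\<lambda>_. 0)" "eq_on_group T (d2' (\<lambda>_. 0)) (\<lambda>_. 0)"
  by (auto simp: eq_on_group_def gop_def gop_adj_def)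

lemma eq_on_group_trans: "eq_on_group B x y ==> eq_on_group B y z ==> eq_on_group B x z"
  by (auto simp: eq_on_group_def)

lemma lap_prod_zero:
  "eq_on_group T (d1 (d1' (d2' y))) (\<lambda>_. 0)" "eq_on_group T (d2' (d2 (d1 y'))) (\<lambda>_. 0)"
  using eq_on_group_trans[OF gop_cong[OF d1'_d2' S(1)] zero_ops(1)]
    eq_on_group_trans[OF gop_adj_cong[OF complex S(2)] zero_ops(2)] by auto

lemma lap_diff:
  "d1 (d1' (\<lambda>j. x j + y j - z j)) p = d1 (d1' x) p + d1 (d1' y) p - d1 (d1' z) p"
  "d2' (d2 (\<lambda>j. x j + y j - z j)) p = d2' (d2 x) p + d2' (d2 y) p - d2' (d2 z) p"
  using gop_diff3[of G T' S1 a1 "d1' x" "d1' y" "d1' z" p] gop_adj_diff3[of G V S2 a2 "d2 x" "d2 y" "d2 z" p]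
  by (simp_all add: gop_diff3[abs_def] gop_adj_diff3[abs_def])

lemma scale_inv: "d1 (d1' (\<lambda>j. x j - u j / R)) p = d1 (d1' x) p - d1 (d1' u) p / R"
  "d2' (d2 (\<lambda>j. x j - u j / R)) p = d2' (d2 x) p - d2' (d2 u) p / R"
  by (cases p, simp add: gop_def gop_adj_def right_diff_distrib sum_subtractf sum_divide_distrib sum_distrib_left)+

lemma lap_funpow:
  "eq_on_group T (d2' (d2 ((T1 ^^ N) x))) (d2' (d2 x))"
  "eq_on_group T (d1 (d1' ((T2 ^^ N) x))) (d1 (d1' x))"
proof -
  show "eq_on_group T (d2' (d2 ((T1 ^^ N) x))) (d2' (d2 x))"
  proof (induction N)
    case (Suc N)
    show ?case unfolding eq_on_group_def
    proof (intro ballI)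
      fix g t assume gt: "g \<in> carrier G" "t \<in> T"
      have step: "(T1 ^^ Suc N) x = (\<lambda>j. (T1 ^^ N) x j - d1 (d1' ((T1 ^^ N) x)) j / R)"
	by (simp add: damped_rows_def[of _ _ _ _ _ _ "(T1 ^^ N) x"])
      show "d2' (d2 ((T1 ^^ Suc N) x)) (g,t) = d2' (d2 x) (g,t)"
	using eq_on_groupD[OF Suc, of "(g,t)"] eq_on_groupD[OF lap_prod_zero(2), of "(g,t)"] gt
	unfolding step scale_inv(2) by simp
    qed
  qed (simp add: eq_on_group_def)
  show "eq_on_group T (d1 (d1' ((T2 ^^ N) x))) (d1 (d1' x))"
  proof (induction N)
    case (Suc N)
    show ?case unfolding eq_on_group_def
    proof (intro ballI)
      fix g t assume gt: "g \<in> carrier G" "t \<in> T"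
      have step: "(T2 ^^ Suc N) x = (\<lambda>j. (T2 ^^ N) x j - d2' (d2 ((T2 ^^ N) x)) j / R)"
	by (simp add: damped_cols_def[of _ _ _ _ _ _ "(T2 ^^ N) x"])
      show "d1 (d1' ((T2 ^^ Suc N) x)) (g,t) = d1 (d1' x) (g,t)"
	using eq_on_groupD[OF Suc, of "(g,t)"] eq_on_groupD[OF lap_prod_zero(1), of "(g,t)"] gt
	unfolding step scale_inv(1) by simp
    qed
  qed (simp add: eq_on_group_def)
qed

lemma TT_cong: "eq_on_group T x y ==> eq_on_group T (TT x) (TT y)"
  using gop_cong[OF gop_adj_cong[OF _ S(1)] S(1), of T x y T T' a1 a1] gop_adj_cong[OF gop_cong[OF _ S(2)] S(2), of T x y T V a2 a2]
  unfolding TT_def by (simp add: eq_on_group_def)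

lemma TT_funpow: "eq_on_group T ((TT ^^ N) x) (\<lambda>j. (T1 ^^ N) x j + (T2 ^^ N) x j - x j)"
proof (induction N)
  case (Suc N)
  let ?X = "(T1 ^^ N) x" and ?Y = "(T2 ^^ N) x"
  have "eq_on_group T ((TT ^^ Suc N) x) (TT (\<lambda>j. ?X j + ?Y j - x j))"
    using TT_cong[OF Suc] by simp
  moreover have "eq_on_group T (TT (\<lambda>j. ?X j + ?Y j - x j)) (\<lambda>j. (T1 ^^ Suc N) x j + (T2 ^^ Suc N) x j - x j)"
    unfolding eq_on_group_def
  proof (intro ballI)
    fix g t assume gt: "g \<in> carrier G" "t \<in> T"
    have step: "(T1 ^^ Suc N) x = (\<lambda>j. ?X j - d1 (d1' ?X) j / R)" "(T2 ^^ Suc N) x = (\<lambda>j. ?Y j - d2' (d2 ?Y) j / R)"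
      by (simp_all add: damped_rows_def[of _ _ _ _ _ _ ?X] damped_cols_def[of _ _ _ _ _ _ ?Y])
    show "TT (\<lambda>j. ?X j + ?Y j - x j) (g,t) = (T1 ^^ Suc N) x (g,t) + (T2 ^^ Suc N) x (g,t) - x (g,t)"
      using eq_on_groupD[OF lap_funpow(1), of "(g,t)" N x] eq_on_groupD[OF lap_funpow(2), of "(g,t)" N x] gt
      unfolding step TT_def lap_diff by (simp add: diff_divide_distrib add_divide_distrib)
  qed
  ultimately show ?case by (rule eq_on_group_trans)
qed (simp add: eq_on_group_def)

lemma TT_self_adjoint:
  assumes e: "fsupp T e"
  shows "fsupp T (TT e)" "pairing T (TT x) e = pairing T x (TT e)"
proof -
  have f1: "fsupp T (d1 (d1' e))" by (rule adj1'(1)[OF adj1(1)[OF e]])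
  have f2: "fsupp T (d2' (d2 e))" by (rule adj2(1)[OF adj2'(1)[OF e]])
  have p1: "pairing T (d1 (d1' x)) e = pairing T x (d1 (d1' e))"
    unfolding adj1(2)[OF e] by (rule adj1'(2)[OF adj1(1)[OF e]])
  have p2: "pairing T (d2' (d2 x)) e = pairing T x (d2' (d2 e))"
    unfolding adj2'(2)[OF e] by (rule adj2(2)[OF adj2'(1)[OF e]])
  show "fsupp T (TT e)"
    unfolding TT_def by (rule pairing_diff_right(1)[OF pairing_diff_right(1)[OF e f1] f2])
  show "pairing T (TT x) e = pairing T x (TT e)"
    unfolding TT_def pairing_diff_left pairing_diff_right(2)[OF pairing_diff_right(1)[OF e f1] f2]
      pairing_diff_right(2)[OF e f1] p1 p2 ..
qed

lemma TT_pow_adjoint: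
  assumes e: "fsupp T e"
  shows "fsupp T ((TT ^^ N) e)" "pairing T ((TT ^^ N) x) e = pairing T x ((TT ^^ N) e)"
proof -
  have "fsupp T ((TT ^^ N) e) \<and> (\<forall>x. pairing T ((TT ^^ N) x) e = pairing T x ((TT ^^ N) e))"
  proof (induction N)
    case (Suc N)
    have "pairing T ((TT ^^ Suc N) x) e = pairing T x ((TT ^^ Suc N) e)" for x
    proof -
      have "pairing T ((TT ^^ Suc N) x) e = pairing T ((TT ^^ N) (TT x)) e" by (simp add: funpow_swap1)
      also have "... = pairing T (TT x) ((TT ^^ N) e)" using Suc by simp
      also have "... = pairing T x (TT ((TT ^^ N) e))" using TT_self_adjoint(2) Suc by blast
      finally show ?thesis by simp
    qed
    then show ?case using TT_self_adjoint(1) Suc by simp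
  qed (use e in simp)
  then show "fsupp T ((TT ^^ N) e)" "pairing T ((TT ^^ N) x) e = pairing T x ((TT ^^ N) e)" by auto
qed

text \<open>A harmonic function is fixed by every power of \<open>TT\<close>, so pairing its projection with a basis
  vector can be computed after smoothing the basis vector.\<close>

lemma harmonic_trace_le:
  assumes M: "closed_subspace M"
    and harm1: "\<And>f. f \<in> M ==> eq_on_group T' (gop_adj G T S1 a1 f) (\<lambda>_. 0)"
    and harm2: "\<And>f. f \<in> M ==> eq_on_group V (gop G T S2 a2 f) (\<lambda>_. 0)"
  shows "(\<Sum>i\<in>T. sqn (l2_proj M (gvec G i))) + real (card T) \<le>
    unit_trace G T (T1 ^^ (2 * m)) + unit_trace G T (T2 ^^ (2 * m))"
proof -
  have main: "sqn (l2_proj M (gvec G i)) + 1 \<le>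
      (T1 ^^ (2 * m)) (\<lambda>j. if j = (\<one>,i) then 1 else 0) (\<one>,i) + (T2 ^^ (2 * m)) (\<lambda>j. if j = (\<one>,i) then 1 else 0) (\<one>,i)"
    if i: "i \<in> T" for i
  proof -
    define P where "P = l2_proj M (gvec G i)"
    have P: "P \<in> M" unfolding P_def by (rule projection(1)[OF M square_summable_gvec])
    have Psq: "square_summable P" by (rule closed_subspaceD(2)[OF M P])
    define x where "x = (\<lambda>j. Re (P j))"
    let ?e = "\<lambda>j. if j = (\<one>,i) then 1 else (0::real)"
    note e = pairing_unit[OF one_closed i]
    have "eq_on_group T' (d1' x) (\<lambda>_. 0)" "eq_on_group V (d2 x) (\<lambda>_. 0)"
      using harm1[OF P] harm2[OF P] unfolding x_def eq_on_group_def gop_Re gop_adj_Re by auto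
    then have "eq_on_group T (d1 (d1' x)) (\<lambda>_. 0)" "eq_on_group T (d2' (d2 x)) (\<lambda>_. 0)"
      using eq_on_group_trans[OF gop_cong[OF _ S(1)] zero_ops(1)] eq_on_group_trans[OF gop_adj_cong[OF _ S(2)] zero_ops(2)]
      by blast+
    then have "eq_on_group T (TT x) x" by (simp add: eq_on_group_def TT_def)
    then have TTx: "eq_on_group T ((TT ^^ N) x) x" for N
    proof (induction N)
      case (Suc N)
      then show ?case using eq_on_group_trans[OF TT_cong[of "(TT ^^ N) x" x]] by simp
    qed (simp add: eq_on_group_def)
    define w where "w = (TT ^^ m) ?e"
    have w: "fsupp T w" unfolding w_def by (rule TT_pow_adjoint(1)[OF e(1)])
    let ?W = "{p \<in> carrier G \<times> T. w p \<noteq> 0}"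
    have W: "finite ?W" using w by (simp add: fsupp_def)
    have "complex_of_real (sqn P) = P (\<one>,i)"
      using projection_sqn[OF M square_summable_gvec[of G i]] unfolding P_def[symmetric]
      by (simp add: gvec_def inner_point_mass)
    then have "sqn P = x (\<one>,i)" unfolding x_def by (metis Re_complex_of_real)
    also have "... = pairing T x ?e" by (simp add: e)
    also have "... = pairing T ((TT ^^ m) x) ?e"
      by (rule pairing_cong) (use TTx[of m] in \<open>auto simp: eq_on_group_def\<close>)
    also have "... = pairing T x w" unfolding w_def by (rule TT_pow_adjoint(2)[OF e(1)])
    also have "... \<le> (\<Sum>p\<in>?W. ((x p)\<^sup>2 + (w p)\<^sup>2) / 2)"
      unfolding pairing_def
    proof (rule sum_mono)
      fix p show "x p * w p \<le> ((x p)\<^sup>2 + (w p)\<^sup>2) / 2"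
	using zero_le_power2[of "x p - w p"] by (simp add: power2_diff)
    qed
    also have "... = ((\<Sum>p\<in>?W. (x p)\<^sup>2) + (\<Sum>p\<in>?W. (w p)\<^sup>2)) / 2"
      by (simp add: sum_divide_distrib[symmetric] sum.distrib)
    finally have le: "sqn P \<le> ((\<Sum>p\<in>?W. (x p)\<^sup>2) + (\<Sum>p\<in>?W. (w p)\<^sup>2)) / 2" .
    have xP: "(\<Sum>p\<in>?W. (x p)\<^sup>2) \<le> sqn P"
    proof -
      have "(\<Sum>p\<in>?W. (x p)\<^sup>2) \<le> (\<Sum>p\<in>?W. (cmod (P p))\<^sup>2)"
	unfolding x_def by (intro sum_mono) (simp add: cmod_power2)
      then show ?thesis using sum_le_sqn[OF Psq W] by linarith
    qed
    have "(\<Sum>p\<in>?W. (w p)\<^sup>2) = pairing T w w"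
      by (simp add: pairing_def power2_eq_square)
    also have "... = pairing T ((TT ^^ m) w) ?e"
      unfolding w_def by (rule TT_pow_adjoint(2)[OF e(1), symmetric])
    also have "... = (TT ^^ (2 * m)) ?e (\<one>,i)"
      by (simp add: e w_def mult_2 funpow_add)
    finally have ww: "(\<Sum>p\<in>?W. (w p)\<^sup>2) = (TT ^^ (2 * m)) ?e (\<one>,i)" .
    have half: "s \<le> z" if "b = z" "s \<le> (a + b) / 2" "a \<le> s" for s a b z :: real
      using that by simp
    have "sqn P \<le> (TT ^^ (2 * m)) ?e (\<one>,i)" by (rule half[OF ww le xP])
    also have "... = (T1 ^^ (2 * m)) ?e (\<one>,i) + (T2 ^^ (2 * m)) ?e (\<one>,i) - 1"
      using eq_on_groupD[OF TT_funpow, of "(\<one>,i)" "2 * m" ?e] i by simp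
    finally show ?thesis unfolding P_def by linarith
  qed
  have "(\<Sum>i\<in>T. sqn (l2_proj M (gvec G i))) + real (card T) = (\<Sum>i\<in>T. sqn (l2_proj M (gvec G i)) + 1)"
    by (simp add: sum.distrib)
  also have "... \<le> unit_trace G T (T1 ^^ (2 * m)) + unit_trace G T (T2 ^^ (2 * m))"
    unfolding unit_trace_def sum.distrib[symmetric] by (rule sum_mono) (rule main)
  finally show ?thesis .
qed

end

section \<open>Cochains in coordinates\<close>

definition del :: "nat => 'v list => 'v list" where
  "del k s = take k s @ drop (Suc k) s"

lemma length_del [simp]: "k < length s ==> length (del k s) = length s - 1"
  by (auto simp: del_def)

lemma nth_del: "k < length s ==> i < length s - 1 ==> del k s ! i = s ! (if i < k then i else Suc i)"
  by (auto simp: del_def nth_append min_def)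

lemma del_map: "del k (map f s) = map f (del k s)"
  by (simp add: del_def take_map drop_map)

lemma set_del_subset: "set (del k s) \<subseteq> set s"
  by (auto simp: del_def dest: in_set_takeD in_set_dropD)

lemma distinct_del: "distinct s ==> distinct (del k s)"
  unfolding del_def by (auto simp: distinct_append set_take_disj_set_drop_if_distinct)

text \<open>The simplicial identity behind \<open>\<delta> \<circ> \<delta> = 0\<close>.\<close>

lemma del_del:
  assumes "k \<le> j" "j < length s - 1"
  shows "del j (del k s) = del k (del (Suc j) s)"
  by (rule nth_equalityI) (use assms in \<open>auto simp: nth_del\<close>)

lemma coboundary_del:
  "coboundary L i f s = (if s \<in> ordered_simplices L i then \<Sum>j<length s. (-1) ^ j * f (del j s) else 0)"
  by (simp add: coboundary_def del_def)

lemma alternating_double_sum: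
  fixes F :: "nat => nat => 'k::comm_ring_1"
  assumes "\<And>j k. j \<le> k ==> k < n ==> F j k = F (Suc k) j"
  shows "(\<Sum>j<Suc n. \<Sum>k<n. (-1) ^ (j + k) * F j k) = 0"
proof -
  let ?U = "{(j,k). j \<le> k \<and> k < n}" and ?D = "{(j,k). k < j \<and> j < Suc n}"
  let ?t = "\<lambda>(j,k). (-1) ^ (j + k) * F j k"
  have fin: "finite ?U" "finite ?D"
    by (rule finite_subset[of _ "{..<Suc n} \<times> {..<Suc n}"]; auto)+
  have un: "{..<Suc n} \<times> {..<n} = ?U \<union> ?D" by auto
  have sgn: "- ((-1) ^ (a + b - Suc 0)) = (-1 :: 'k) ^ (a + b)" if "b < a" for a b
    using that by (cases a) auto
  have "(\<Sum>p\<in>?D. ?t p) = (\<Sum>p\<in>?U. - ?t p)"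
    by (rule sum.reindex_bij_witness[of _ "\<lambda>(j,k). (Suc k, j)" "\<lambda>(j,k). (k, j - 1)"])
      (auto simp: assms add.commute sgn simp flip: mult_minus_left)
  then have "(\<Sum>p\<in>?U \<union> ?D. ?t p) = 0"
    using fin by (subst sum.union_disjoint) (auto simp: sum_negf)
  then show ?thesis unfolding un[symmetric] sum.cartesian_product .
qed

lemma coboundary_coboundary:
  fixes f :: "'v list => 'k::comm_ring_1"
  assumes L: "abstract_complex L"
  shows "coboundary L (Suc (Suc q)) (coboundary L (Suc q) f) = (\<lambda>_. 0)"
proof
  fix s
  show "coboundary L (Suc (Suc q)) (coboundary L (Suc q) f) s = 0"
  proof (cases "s \<in> ordered_simplices L (Suc (Suc q))")
    case True
    then have len: "length s = Suc (Suc (Suc q))" by (simp add: ordered_simplices_def)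
    have face: "del j s \<in> ordered_simplices L (Suc q)" if "j < length s" for j
    proof -
      have "set (del j s) \<noteq> {}" using that len by (metis Suc_neq_Zero diff_Suc_1 length_del list.size(3) set_empty)
      then show ?thesis using True L that set_del_subset[of j s] len
	unfolding abstract_complex_def ordered_simplices_def by (auto simp: distinct_del)
    qed
    have "coboundary L (Suc (Suc q)) (coboundary L (Suc q) f) s =
	(\<Sum>j<length s. (-1) ^ j * coboundary L (Suc q) f (del j s))"
      using True by (simp only: coboundary_del if_True)
    also have "... = (\<Sum>j<Suc (Suc (Suc q)). \<Sum>k<Suc (Suc q). (-1) ^ (j + k) * f (del k (del j s)))"
    proof (rule sum.cong)
      fix j assume j: "j \<in> {..<Suc (Suc (Suc q))}"
      then have jl: "j < length s" using len by simp
      then have "coboundary L (Suc q) f (del j s) = (\<Sum>k<Suc (Suc q). (-1) ^ k * f (del k (del j s)))"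
	using face[OF jl] len by (simp add: coboundary_del del: sum.lessThan_Suc)
      then show "(-1) ^ j * coboundary L (Suc q) f (del j s) = (\<Sum>k<Suc (Suc q). (-1) ^ (j + k) * f (del k (del j s)))"
	by (simp only: sum_distrib_left power_add mult.assoc)
    qed (simp add: len)
    also have "... = 0"
      by (rule alternating_double_sum) (use len in \<open>simp add: del_del\<close>)
    finally show ?thesis .
  qed (simp add: coboundary_del)
qed

lemma cochainsD:
  "f \<in> cochains L q ==> s \<notin> ordered_simplices L q ==> f s = 0"
  "f \<in> cochains L q ==> s \<in> ordered_simplices L q ==> \<pi> permutes {..<length s} ==>
    f (permute_list \<pi> s) = of_int (sign \<pi>) * f s"
  by (simp_all add: cochains_def)

lemma ordered_simplices_permute:
  assumes "\<pi> permutes {..<length s}"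
  shows "permute_list \<pi> s \<in> ordered_simplices L q \<longleftrightarrow> s \<in> ordered_simplices L q"
  using assms by (simp add: ordered_simplices_def)

lemma coboundary_cochain:
  fixes f :: "'v list => 'k::comm_ring_1"
  assumes L: "abstract_complex L" and f: "f \<in> cochains L q"
  shows "coboundary L (Suc q) f \<in> cochains L (Suc q)"
  unfolding cochains_def
proof (intro CollectI conjI ballI allI impI)
  fix s \<pi> assume s: "s \<in> ordered_simplices L (Suc q)" and pi: "\<pi> permutes {..<length s}"
  have len: "length s = Suc (Suc q)" using s by (simp add: ordered_simplices_def)
  have pi': "\<pi> permutes {0..<Suc (Suc q)}" using pi len by (simp add: lessThan_atLeast0)
  have face: "del j s \<in> ordered_simplices L q" if "j < length s" for j
  proof -
    have "set (del j s) \<noteq> {}" using that len by (metis Suc_neq_Zero diff_Suc_1 length_del list.size(3) set_empty)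
    then show ?thesis using s L that set_del_subset[of j s] len
      unfolding abstract_complex_def ordered_simplices_def by (auto simp: distinct_del)
  qed
  have face_term: "(-1) ^ i * f (del i (permute_list \<pi> s)) = of_int (sign \<pi>) * ((-1) ^ \<pi> i * f (del (\<pi> i) s))"
    if i: "i < Suc (Suc q)" for i
  proof -
    define j where "j = \<pi> i"
    have j: "j < Suc (Suc q)" unfolding j_def using pi' i permutes_in_image[OF pi', of i] by simp
    obtain p where p: "p permutes {0..<Suc q}" "\<pi> = permutation_insert i j p"
      using permutation_fix[OF i j] pi' j_def by blast
    have p': "p permutes {..<length (del j s)}" using p(1) j len by (simp add: lessThan_atLeast0)
    have "del i (permute_list \<pi> s) = permute_list p (del j s)"
    proof (rule nth_equalityI)
      show "length (del i (permute_list \<pi> s)) = length (permute_list p (del j s))" using i j len by simp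
      fix k assume "k < length (del i (permute_list \<pi> s))"
      then have k: "k < Suc q" using i len by simp
      then have pk: "p k < Suc q" using permutes_in_image[OF p(1), of k] by simp
      have "del i (permute_list \<pi> s) ! k = s ! \<pi> (if k < i then k else Suc k)"
	using i k len pi by (simp add: nth_del permute_list_nth)
      also have "\<pi> (if k < i then k else Suc k) = (if p k < j then p k else Suc (p k))"
	unfolding p(2) permutation_insert_expand by auto
      also have "s ! ... = permute_list p (del j s) ! k"
	using pk k j len p' by (simp add: nth_del permute_list_nth)
      finally show "del i (permute_list \<pi> s) ! k = permute_list p (del j s) ! k" .
    qed
    then have "f (del i (permute_list \<pi> s)) = of_int (sign p) * f (del j s)"
      using cochainsD(2)[OF f face p'] j len by simp
    moreover have "sign \<pi> = (-1) ^ (i + j) * sign p"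
      unfolding p(2) using signof_permutation_insert[OF p(1) i j, where 'a=int] by simp
    moreover have "(-1) ^ (i + j) * (-1) ^ j = ((-1) ^ i :: 'k)"
      by (simp add: power_add mult.assoc flip: power_mult_distrib)
    ultimately show ?thesis unfolding j_def[symmetric] by (simp add: power_add mult_ac)
  qed
  have "coboundary L (Suc q) f (permute_list \<pi> s) = (\<Sum>i<Suc (Suc q). of_int (sign \<pi>) * ((-1) ^ \<pi> i * f (del (\<pi> i) s)))"
    using s pi len face_term by (simp add: coboundary_del ordered_simplices_permute del: sum.lessThan_Suc)
  also have "... = of_int (sign \<pi>) * (\<Sum>i<Suc (Suc q). (-1) ^ \<pi> i * f (del (\<pi> i) s))" by (simp only: sum_distrib_left)
  also have "(\<Sum>i<Suc (Suc q). (-1) ^ \<pi> i * f (del (\<pi> i) s)) = (\<Sum>j<Suc (Suc q). (-1) ^ j * f (del j s))"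
    by (rule sum.reindex_bij_betw[of \<pi> _ _ "\<lambda>j. (-1) ^ j * f (del j s)"]) (use pi len permutes_imp_bij in metis)
  also have "... = coboundary L (Suc q) f s" using s len by (simp add: coboundary_del del: sum.lessThan_Suc)
  finally show "coboundary L (Suc q) f (permute_list \<pi> s) = of_int (sign \<pi>) * coboundary L (Suc q) f s" .
qed (simp add: coboundary_del)

locale free_complex = group G for G (structure) +
  fixes L :: "'v set set" and act :: "'a => 'v => 'v"
  assumes free: "free_simplicial_action G L act"
begin

lemma complex: "abstract_complex L" and action: "group_action G (\<Union>L) act"
  and act_simplex: "g \<in> carrier G ==> s \<in> L ==> act g ` s \<in> L"
  and act_free: "g \<in> carrier G ==> s \<in> L ==> act g ` s = s ==> g = \<one>"
  using free by (auto simp: free_simplicial_action_def)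

lemma act_mult: "g \<in> carrier G ==> h \<in> carrier G ==> x \<in> \<Union>L ==> act (g \<otimes> h) x = act g (act h x)"
  using group_action.composition_rule[OF action] by blast

lemma act_one: "x \<in> \<Union>L ==> act \<one> x = x"
  using group_action.id_eq_one[OF action] by (metis restrict_apply')

lemma act_inj: "g \<in> carrier G ==> inj_on (act g) (\<Union>L)"
  using group_action.inj_prop[OF action] by blast

lemma ord_set: "s \<in> ordered_simplices L q ==> set s \<in> L" "s \<in> ordered_simplices L q ==> set s \<subseteq> \<Union>L"
  "s \<in> ordered_simplices L q ==> length s = Suc q" "s \<in> ordered_simplices L q ==> distinct s"
  by (auto simp: ordered_simplices_def)

lemma ord_act:
  assumes g: "g \<in> carrier G" and s: "s \<in> ordered_simplices L q"
  shows "map (act g) s \<in> ordered_simplices L q"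
  using s act_simplex[OF g ord_set(1)[OF s]] inj_on_subset[OF act_inj[OF g] ord_set(2)[OF s]]
  by (simp add: ordered_simplices_def distinct_map)

lemma map_act_mult:
  assumes "g \<in> carrier G" "h \<in> carrier G" "s \<in> ordered_simplices L q"
  shows "map (act g) (map (act h) s) = map (act (g \<otimes> h)) s"
  using act_mult[OF assms(1,2)] ord_set(2)[OF assms(3)] by (auto simp: subset_iff)

lemma map_act_one: "s \<in> ordered_simplices L q ==> map (act \<one>) s = s"
  using act_one ord_set(2) by (intro map_idI) blast

lemma ord_face:
  assumes s: "s \<in> ordered_simplices L (Suc q)" and j: "j < length s"
  shows "del j s \<in> ordered_simplices L q"
proof -
  have "set (del j s) \<noteq> {}" using j ord_set(3)[OF s] by (metis Suc_neq_Zero diff_Suc_1 length_del list.size(3) set_empty)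
  then show ?thesis using s complex j set_del_subset[of j s] ord_set(3)[OF s]
    unfolding abstract_complex_def ordered_simplices_def by (auto simp: distinct_del)
qed

end

text \<open>The list \<open>ts\<close> contains one ordered simplex from each orbit of \<open>q\<close>-simplices.\<close>

locale simplex_reps = free_complex +
  fixes q :: nat and ts :: "'c list list"
  assumes reps_ord: "\<And>i. i < length ts ==> ts ! i \<in> ordered_simplices L q"
    and reps_cover: "\<And>s. s \<in> L ==> card s = Suc q ==> \<exists>g\<in>carrier G. \<exists>i<length ts. s = act g ` set (ts ! i)"
    and reps_unique: "\<And>g i j. g \<in> carrier G ==> i < length ts ==> j < length ts ==>
      act g ` set (ts ! i) = set (ts ! j) ==> i = j"
begin

definition basic :: "'a => nat => 'c list" where
  "basic g i = map (act g) (ts ! i)"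

lemma basic_ord: "g \<in> carrier G ==> i < length ts ==> basic g i \<in> ordered_simplices L q"
  unfolding basic_def by (intro ord_act reps_ord)

lemma basic_act: "g \<in> carrier G ==> h \<in> carrier G ==> i < length ts ==> map (act g) (basic h i) = basic (g \<otimes> h) i"
  unfolding basic_def by (rule map_act_mult[OF _ _ reps_ord])

text \<open>As the action is free, every ordered simplex is a unique translate of a unique representative, with its vertices permuted in a
unique way (\<open>coord_unique\<close>).\<close>

definition is_coord :: "'c list => 'a => nat => (nat => nat) => bool" where
  "is_coord s g i \<pi> \<longleftrightarrow> g \<in> carrier G \<and> i < length ts \<and> \<pi> permutes {..<Suc q} \<and> s = permute_list \<pi> (basic g i)"

lemma coord_exists:
  assumes s: "s \<in> ordered_simplices L q"
  shows "\<exists>g i \<pi>. is_coord s g i \<pi>"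
proof -
  have "card (set s) = Suc q" using ord_set[OF s] by (simp add: distinct_card)
  then obtain g i where gi: "g \<in> carrier G" "i < length ts" "set s = act g ` set (ts ! i)"
    using reps_cover[OF ord_set(1)[OF s]] by blast
  have "set s = set (basic g i)" using gi by (simp add: basic_def)
  moreover have "distinct s" "distinct (basic g i)" using ord_set(4) s basic_ord gi by blast+
  ultimately have "mset s = mset (basic g i)" by (simp add: set_eq_iff_mset_eq_distinct)
  then obtain \<pi> where "\<pi> permutes {..<length (basic g i)}" "permute_list \<pi> (basic g i) = s"
    by (rule mset_eq_permutation)
  then have "is_coord s g i \<pi>" using gi ord_set(3)[OF basic_ord[OF gi(1,2)]] by (simp add: is_coord_def)
  then show ?thesis by blast
qed

lemma coord_unique:
  assumes "is_coord s g i \<pi>" "is_coord s h j \<rho>"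
  shows "g = h" "i = j" "\<pi> = \<rho>"
proof -
  have a: "g \<in> carrier G" "i < length ts" "\<pi> permutes {..<Suc q}" "s = permute_list \<pi> (basic g i)"
    and b: "h \<in> carrier G" "j < length ts" "\<rho> permutes {..<Suc q}" "s = permute_list \<rho> (basic h j)"
    using assms by (auto simp: is_coord_def)
  have la: "length (basic g i) = Suc q" "length (basic h j) = Suc q"
    using ord_set(3) basic_ord a b by blast+
  have "set s = set (basic g i)" "set s = set (basic h j)"
    using a(3,4) b(3,4) la set_permute_list by metis+
  then have "set s = act g ` set (ts ! i)" "set s = act h ` set (ts ! j)"
    by (simp_all add: basic_def)
  then have eq: "act g ` set (ts ! i) = act h ` set (ts ! j)" by simp
  have "act (inv h \<otimes> g) ` set (ts ! i) = act (inv h) ` act g ` set (ts ! i)"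
    unfolding image_image using a b ord_set(2)[OF reps_ord[OF a(2)]]
    by (intro image_cong refl act_mult) auto
  also have "... = act (inv h \<otimes> h) ` set (ts ! j)"
    unfolding eq image_image using a b ord_set(2)[OF reps_ord[OF b(2)]]
    by (intro image_cong refl act_mult[symmetric]) auto
  also have "... = set (ts ! j)"
    using b ord_set(2)[OF reps_ord[OF b(2)]] by (simp add: act_one subset_iff cong: image_cong)
  finally have eq2: "act (inv h \<otimes> g) ` set (ts ! i) = set (ts ! j)" .
  then show ij: "i = j" using reps_unique[of "inv h \<otimes> g" i j] a b by simp
  have "inv h \<otimes> g = \<one>"
    using act_free[of "inv h \<otimes> g" "set (ts ! i)"] eq2 ij a b ord_set(1)[OF reps_ord[OF a(2)]] by simp
  then show gh: "g = h" using a b by (metis inv_equality inv_inv inv_closed)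
  show "\<pi> = \<rho>"
  proof
    fix k show "\<pi> k = \<rho> k"
    proof (cases "k < Suc q")
      case True
      have "basic g i ! \<pi> k = basic g i ! \<rho> k"
	using a(3,4) b(3,4) la True unfolding gh ij by (metis permute_list_nth)
      moreover have "\<pi> k < Suc q" "\<rho> k < Suc q"
	using True permutes_in_image[OF a(3)] permutes_in_image[OF b(3)] by auto
      ultimately show ?thesis
	using nth_eq_iff_index_eq[OF ord_set(4)[OF basic_ord[OF a(1,2)]]] la by auto
    qed (use permutes_not_in[OF a(3)] permutes_not_in[OF b(3)] in auto)
  qed
qed

definition coord :: "'c list => 'a \<times> nat \<times> (nat => nat)" where
  "coord s = (SOME (g,i,\<pi>). is_coord s g i \<pi>)"

definition cpos :: "'c list => 'a \<times> nat" where
  "cpos s = (fst (coord s), fst (snd (coord s)))"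

definition csgn :: "'c list => int" where
  "csgn s = sign (snd (snd (coord s)))"

lemma coord_eq:
  assumes "is_coord s g i \<pi>"
  shows "cpos s = (g,i)" "csgn s = sign \<pi>"
proof -
  have "(\<lambda>(g,i,\<pi>). is_coord s g i \<pi>) (coord s)"
    unfolding coord_def by (rule someI[of _ "(g,i,\<pi>)"]) (use assms in simp)
  then have "is_coord s (fst (coord s)) (fst (snd (coord s))) (snd (snd (coord s)))" by (simp add: case_prod_unfold)
  from coord_unique[OF this assms] show "cpos s = (g,i)" "csgn s = sign \<pi>"
    by (simp_all add: cpos_def csgn_def)
qed

lemma coord_cases:
  assumes "s \<in> ordered_simplices L q"
  obtains g i \<pi> where "is_coord s g i \<pi>" "cpos s = (g,i)" "csgn s = sign \<pi>"
  using coord_exists[OF assms] coord_eq by blast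

lemma is_coord_basic: "g \<in> carrier G ==> i < length ts ==> is_coord (basic g i) g i id"
  by (simp add: is_coord_def permutes_id)

lemma is_coord_ord: "is_coord s g i \<pi> ==> s \<in> ordered_simplices L q"
  using basic_ord ord_set(3) unfolding is_coord_def by (metis ordered_simplices_permute)

lemma is_coord_permute:
  assumes c: "is_coord s g i \<pi>" and r: "\<rho> permutes {..<Suc q}"
  shows "is_coord (permute_list \<rho> s) g i (\<pi> \<circ> \<rho>)"
proof -
  have len: "length (basic g i) = Suc q" using c basic_ord ord_set(3) unfolding is_coord_def by blast
  show ?thesis using c r permute_list_compose[of \<rho> "basic g i" \<pi>] len
    by (auto simp: is_coord_def intro: permutes_compose)
qed

lemma is_coord_act:
  assumes c: "is_coord s g i \<pi>" and h: "h \<in> carrier G"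
  shows "is_coord (map (act h) s) (h \<otimes> g) i \<pi>"
proof -
  have len: "length (basic g i) = Suc q" using c basic_ord ord_set(3) unfolding is_coord_def by blast
  then show ?thesis using c h basic_act[of h g i] permute_list_map[of \<pi> "basic g i" "act h"]
    by (simp add: is_coord_def)
qed

lemma cochain_at:
  fixes f :: "'c list => 'k::comm_ring_1"
  assumes f: "f \<in> cochains L q" and c: "is_coord s g i \<pi>"
  shows "f s = of_int (sign \<pi>) * f (basic g i)"
proof -
  have b: "basic g i \<in> ordered_simplices L q" using c basic_ord by (simp add: is_coord_def)
  then show ?thesis using c cochainsD(2)[OF f b] ord_set(3)[OF b] by (simp add: is_coord_def)
qed

definition crd :: "('c list => 'k::comm_ring_1) => 'a \<times> nat => 'k" where
  "crd f = (\<lambda>(g,i). if g \<in> carrier G \<and> i < length ts then f (basic g i) else 0)"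

definition ext :: "('a \<times> nat => 'k::comm_ring_1) => 'c list => 'k" where
  "ext x s = (if s \<in> ordered_simplices L q then of_int (csgn s) * x (cpos s) else 0)"

lemma ext_cochain: "ext x \<in> cochains L q"
  unfolding cochains_def
proof (intro CollectI conjI ballI allI impI)
  fix s \<rho> assume s: "s \<in> ordered_simplices L q" and r: "\<rho> permutes {..<length s}"
  have r': "\<rho> permutes {..<Suc q}" using r ord_set(3)[OF s] by simp
  obtain g i \<pi> where c: "is_coord s g i \<pi>" "cpos s = (g,i)" "csgn s = sign \<pi>" by (rule coord_cases[OF s])
  note c' = coord_eq[OF is_coord_permute[OF c(1) r']]
  have "sign (\<pi> \<circ> \<rho>) = sign \<pi> * sign \<rho>"
    using c(1) r' by (intro sign_compose) (auto simp: is_coord_def permutation_permutes)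
  then show "ext x (permute_list \<rho> s) = of_int (sign \<rho>) * ext x s"
    using s c c' r by (simp add: ext_def ordered_simplices_permute mult_ac)
qed (simp add: ext_def)

lemma ext_basic: "g \<in> carrier G ==> i < length ts ==> ext x (basic g i) = x (g,i)"
  using coord_eq[OF is_coord_basic] basic_ord by (simp add: ext_def)

lemma crd_ext: "g \<in> carrier G ==> i < length ts ==> crd (ext x) (g,i) = x (g,i)"
  by (simp add: crd_def ext_basic)

lemma cochain_eqI:
  fixes f f' :: "'c list => 'k::comm_ring_1"
  assumes "f \<in> cochains L q" "f' \<in> cochains L q" "\<And>g i. g \<in> carrier G ==> i < length ts ==> f (basic g i) = f' (basic g i)"
  shows "f = f'"
proof
  fix s show "f s = f' s"
  proof (cases "s \<in> ordered_simplices L q")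
    case True
    then obtain g i \<pi> where c: "is_coord s g i \<pi>" by (rule coord_cases)
    then show ?thesis using cochain_at[OF assms(1) c] cochain_at[OF assms(2) c] assms(3)[of g i] by (simp add: is_coord_def)
  qed (use assms in \<open>simp add: cochainsD(1)\<close>)
qed

lemma ext_crd: "f \<in> cochains L q ==> ext (crd f) = f"
  by (rule cochain_eqI[OF ext_cochain]) (auto simp: ext_basic crd_def)

lemma crd_action:
  assumes g: "g \<in> carrier G"
  shows "crd (cochain_action G act L q g f) = (\<lambda>(h,i). if h \<in> carrier G then crd f (inv g \<otimes> h, i) else 0)"
proof (intro ext prod.case_distrib, clarify)
  fix h i
  show "crd (cochain_action G act L q g f) (h,i) = (if h \<in> carrier G then crd f (inv g \<otimes> h, i) else 0)"
    using g basic_ord[of h i] basic_act[of "inv g" h i]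
    by (auto simp: crd_def cochain_action_def)
qed

text \<open>The group ring coefficients of the row of the coboundary matrix that belongs to the simplex \<open>s\<close>.\<close>

definition bcoef :: "'c list => nat => 'a => int" where
  "bcoef s i h = (\<Sum>k<length s. if cpos (del k s) = (h,i) then (-1) ^ k * csgn (del k s) else 0)"

definition bsupp :: "'c list => 'a set" where
  "bsupp s = (\<lambda>k. fst (cpos (del k s))) ` {..<length s}"

lemma bsupp: "finite (bsupp s)" "s \<in> ordered_simplices L (Suc q) ==> bsupp s \<subseteq> carrier G"
proof -
  show "finite (bsupp s)" by (simp add: bsupp_def)
  assume s: "s \<in> ordered_simplices L (Suc q)"
  show "bsupp s \<subseteq> carrier G"
  proof
    fix h assume "h \<in> bsupp s"
    then obtain k where k: "k < length s" "h = fst (cpos (del k s))" by (auto simp: bsupp_def)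
    obtain g i \<pi> where "is_coord (del k s) g i \<pi>" "cpos (del k s) = (g,i)"
      using coord_cases[OF ord_face[OF s k(1)]] by metis
    then show "h \<in> carrier G" using k by (simp add: is_coord_def)
  qed
qed

lemma coboundary_coord:
  fixes f :: "'c list => 'k::comm_ring_1"
  assumes f: "f \<in> cochains L q" and s: "s \<in> ordered_simplices L (Suc q)" and g: "g \<in> carrier G"
    and S: "finite S" "bsupp s \<subseteq> S"
  shows "coboundary L (Suc q) f (map (act g) s) =
    (\<Sum>i<length ts. \<Sum>h\<in>S. of_int (bcoef s i h) * f (basic (g \<otimes> h) i))"
proof -
  have face_term: "(-1) ^ k * f (del k (map (act g) s)) =
      (\<Sum>i<length ts. \<Sum>h\<in>S. of_int (if cpos (del k s) = (h,i) then (-1) ^ k * csgn (del k s) else 0) * f (basic (g \<otimes> h) i))"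
    if k: "k < length s" for k
  proof -
    obtain h i \<pi> where c: "is_coord (del k s) h i \<pi>" "cpos (del k s) = (h,i)" "csgn (del k s) = sign \<pi>"
      by (rule coord_cases[OF ord_face[OF s k]])
    have hS: "h \<in> S" using S c(2) k by (force simp: bsupp_def)
    have i: "i < length ts" using c by (simp add: is_coord_def)
    have "(\<Sum>i'<length ts. \<Sum>h'\<in>S. of_int (if cpos (del k s) = (h',i') then (-1) ^ k * csgn (del k s) else 0) * f (basic (g \<otimes> h') i')) =
	(\<Sum>i'<length ts. \<Sum>h'\<in>S. if i' = i then (if h' = h then (-1) ^ k * of_int (sign \<pi>) * f (basic (g \<otimes> h) i) else 0) else 0)"
      by (intro sum.cong refl) (auto simp: c)
    also have "... = (\<Sum>i'<length ts. if i' = i then (\<Sum>h'\<in>S. (if h' = h then (-1) ^ k * of_int (sign \<pi>) * f (basic (g \<otimes> h) i) else 0)) else 0)"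
      by (intro sum.cong refl) auto
    also have "... = (-1) ^ k * (of_int (sign \<pi>) * f (basic (g \<otimes> h) i))"
      using i hS S by (simp add: mult.assoc)
    also have "of_int (sign \<pi>) * f (basic (g \<otimes> h) i) = f (del k (map (act g) s))"
      unfolding del_map using cochain_at[OF f is_coord_act[OF c(1) g]] by simp
    finally show ?thesis by simp
  qed
  have "coboundary L (Suc q) f (map (act g) s) = (\<Sum>k<length s. (-1) ^ k * f (del k (map (act g) s)))"
    using ord_act[OF g s] by (simp add: coboundary_del)
  also have "... = (\<Sum>k<length s. \<Sum>i<length ts. \<Sum>h\<in>S. of_int (if cpos (del k s) = (h,i) then (-1) ^ k * csgn (del k s) else 0) * f (basic (g \<otimes> h) i))"
    by (rule sum.cong[OF refl], rule face_term) simp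
  also have "... = (\<Sum>i<length ts. \<Sum>k<length s. \<Sum>h\<in>S. of_int (if cpos (del k s) = (h,i) then (-1) ^ k * csgn (del k s) else 0) * f (basic (g \<otimes> h) i))"
    by (rule sum.swap)
  also have "... = (\<Sum>i<length ts. \<Sum>h\<in>S. \<Sum>k<length s. of_int (if cpos (del k s) = (h,i) then (-1) ^ k * csgn (del k s) else 0) * f (basic (g \<otimes> h) i))"
    by (rule sum.cong[OF refl], rule sum.swap)
  also have "... = (\<Sum>i<length ts. \<Sum>h\<in>S. of_int (bcoef s i h) * f (basic (g \<otimes> h) i))"
    unfolding bcoef_def of_int_sum sum_distrib_right ..
  finally show ?thesis .
qed

lemma gop_crd:
  fixes f :: "'c list => 'k::comm_ring_1"
  assumes f: "f \<in> cochains L q" and s: "A r \<in> ordered_simplices L (Suc q)" and g: "g \<in> carrier G"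
    and S: "finite S" "bsupp (A r) \<subseteq> S" "S \<subseteq> carrier G"
  shows "gop G {..<length ts} S (\<lambda>r. bcoef (A r)) (crd f) (g,r) = coboundary L (Suc q) f (map (act g) (A r))"
  unfolding coboundary_coord[OF f s g S(1,2)] gop_def case_prod_conv
  using g S(3) by (intro sum.cong refl) (auto simp: crd_def subset_iff)

lemma sqn_crd:
  assumes f: "f \<in> cochains L q"
  shows "square_summable f \<longleftrightarrow> square_summable (crd f)"
    "square_summable f ==> sqn f = fact (Suc q) * sqn (crd f)"
proof -
  let ?A = "carrier G \<times> {..<length ts}" and ?P = "{\<pi>. \<pi> permutes {..<Suc q}}"
  let ?F = "\<lambda>(g,i). (cmod (f (basic g i)))\<^sup>2"
  let ?b = "\<lambda>((g,i),\<pi>). permute_list \<pi> (basic g i)"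
  have bij: "bij_betw ?b (?A \<times> ?P) (ordered_simplices L q)"
    unfolding bij_betw_def
  proof
    show "inj_on ?b (?A \<times> ?P)"
      by (intro inj_onI) (auto dest: coord_unique[unfolded is_coord_def, rotated 0] simp: is_coord_def
	intro: coord_unique[of "permute_list _ (basic _ _)"])
    show "?b ` (?A \<times> ?P) = ordered_simplices L q"
    proof (intro equalityI subsetI)
      fix s assume "s \<in> ?b ` (?A \<times> ?P)"
      then show "s \<in> ordered_simplices L q" using is_coord_ord by (auto simp: is_coord_def)
    next
      fix s assume "s \<in> ordered_simplices L q"
      then obtain g i \<pi> where "is_coord s g i \<pi>" by (rule coord_cases)
      then show "s \<in> ?b ` (?A \<times> ?P)" by (intro image_eqI[of _ _ "((g,i),\<pi>)"]) (auto simp: is_coord_def)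
    qed
  qed
  have val: "(cmod (f (?b x)))\<^sup>2 = (\<lambda>(a,\<pi>). ?F a) x" if "x \<in> ?A \<times> ?P" for x
  proof -
    obtain g i \<pi> where x: "x = ((g,i),\<pi>)" "is_coord (?b x) g i \<pi>" using \<open>x \<in> ?A \<times> ?P\<close> by (fastforce simp: is_coord_def)
    then show ?thesis using cochain_at[OF f x(2)] by (simp add: norm_mult sign_def)
  qed
  have hs: "((\<lambda>s. (cmod (f s))\<^sup>2) has_sum c) UNIV \<longleftrightarrow> ((\<lambda>(a,\<pi>). ?F a) has_sum c) (?A \<times> ?P)" for c
  proof -
    have "((\<lambda>s. (cmod (f s))\<^sup>2) has_sum c) UNIV \<longleftrightarrow> ((\<lambda>s. (cmod (f s))\<^sup>2) has_sum c) (ordered_simplices L q)"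
      by (rule has_sum_cong_neutral) (auto simp: cochainsD(1)[OF f])
    also have "... \<longleftrightarrow> ((\<lambda>x. (cmod (f (?b x)))\<^sup>2) has_sum c) (?A \<times> ?P)"
      by (rule has_sum_reindex_bij_betw[OF bij, symmetric])
    also have "... \<longleftrightarrow> ((\<lambda>(a,\<pi>). ?F a) has_sum c) (?A \<times> ?P)"
      by (rule has_sum_cong) (rule val)
    finally show ?thesis .
  qed
  have cs: "((\<lambda>x. (cmod (crd f x))\<^sup>2) has_sum c) UNIV \<longleftrightarrow> (?F has_sum c) ?A" for c
    by (rule has_sum_cong_neutral) (auto simp: crd_def split: if_splits)
  have fac: "((\<lambda>\<pi>. ?F a) has_sum (fact (Suc q) * ?F a)) ?P" for a
  proof -
    have "(\<Sum>\<pi>\<in>?P. ?F a) = fact (Suc q) * ?F a"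
      using card_permutations[of "{..<Suc q}" "Suc q"] by (simp del: fact_Suc)
    then show ?thesis using has_sum_finite[OF finite_permutations[OF finite_lessThan[of "Suc q"]], of "\<lambda>_. ?F a"] by (simp only:)
  qed
  have up: "((\<lambda>(a,\<pi>). ?F a) has_sum (fact (Suc q) * c)) (?A \<times> ?P)" if "(?F has_sum c) ?A" for c
  proof -
    have g: "((\<lambda>a. fact (Suc q) * ?F a) has_sum (fact (Suc q) * c)) ?A"
      by (rule has_sum_cmult_right[OF that])
    show ?thesis
      by (rule has_sum_SigmaI[OF _ g summable_on_SigmaI[OF _ has_sum_imp_summable[OF g]]])
	(use fac in \<open>auto simp: case_prod_unfold\<close>)
  qed
  have sum1: "square_summable f" if sc: "square_summable (crd f)"
  proof -
    obtain c where "((\<lambda>x. (cmod (crd f x))\<^sup>2) has_sum c) UNIV"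
      using sc unfolding square_summable_def summable_on_def by blast
    then have "(?F has_sum c) ?A" by (simp only: cs)
    then have "((\<lambda>s. (cmod (f s))\<^sup>2) has_sum (fact (Suc q) * c)) UNIV" using up hs by blast
    then show ?thesis unfolding square_summable_def by (rule has_sum_imp_summable)
  qed
  have sum2: "square_summable (crd f)" if sf: "square_summable f"
  proof -
    have sub: "(\<lambda>s. (cmod (f s))\<^sup>2) summable_on (case_prod basic) ` ?A"
      using sf unfolding square_summable_def by (rule summable_on_subset) auto
    have inj: "inj_on (case_prod basic) ?A"
    proof (rule inj_onI)
      fix x y assume xy: "x \<in> ?A" "y \<in> ?A" "case_prod basic x = case_prod basic y"
      have "is_coord (case_prod basic x) (fst x) (snd x) id" "is_coord (case_prod basic y) (fst y) (snd y) id"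
	using xy(1,2) is_coord_basic by (auto simp: case_prod_unfold)
      then show "x = y" using coord_unique(1,2) xy(3) prod_eq_iff by metis
    qed
    have "((\<lambda>s. (cmod (f s))\<^sup>2) \<circ> case_prod basic) summable_on ?A"
      using sub summable_on_reindex[OF inj] by blast
    then have "?F summable_on ?A" by (simp add: case_prod_unfold o_def)
    then obtain c where "(?F has_sum c) ?A" unfolding summable_on_def by blast
    then have "((\<lambda>x. (cmod (crd f x))\<^sup>2) has_sum c) UNIV" by (simp only: cs)
    then show ?thesis unfolding square_summable_def by (rule has_sum_imp_summable)
  qed
  show "square_summable f \<longleftrightarrow> square_summable (crd f)" using sum1 sum2 by blast
  show "sqn f = fact (Suc q) * sqn (crd f)" if "square_summable f"
  proof -
    have "((\<lambda>x. (cmod (crd f x))\<^sup>2) has_sum sqn (crd f)) UNIV"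
      using sum2[OF that] unfolding square_summable_def sqn_def by (rule has_sum_infsum)
    then have "((\<lambda>s. (cmod (f s))\<^sup>2) has_sum (fact (Suc q) * sqn (crd f))) UNIV"
      using up hs cs by blast
    then show ?thesis unfolding sqn_def by (rule infsumI)
  qed
qed

end

section \<open>The topology of cochain spaces\<close>

abbreviation ptop :: "('b => 'k) topology" where
  "ptop \<equiv> product_topology (\<lambda>_. discrete_topology UNIV) UNIV"

definition cyl :: "'b set => ('b => 'k) => ('b => 'k) set" where
  "cyl W g = {f. \<forall>w\<in>W. f w = g w}"

lemma openin_ptop_iff:
  "openin ptop U \<longleftrightarrow> (\<forall>g\<in>U. \<exists>W. finite W \<and> cyl W g \<subseteq> U)"
proof
  assume U: "openin ptop U"
  show "\<forall>g\<in>U. \<exists>W. finite W \<and> cyl W g \<subseteq> U"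
  proof
    fix g assume "g \<in> U"
    then obtain B where B: "finite {i. B i \<noteq> UNIV}" "g \<in> Pi\<^sub>E UNIV B" "Pi\<^sub>E UNIV B \<subseteq> U"
      using U unfolding openin_product_topology_alt by auto
    have sub: "cyl {i. B i \<noteq> UNIV} g \<subseteq> Pi\<^sub>E UNIV B"
    proof
      fix f assume f: "f \<in> cyl {i. B i \<noteq> UNIV} g"
      have "f i \<in> B i" for i using f B(2) by (cases "B i = UNIV") (auto simp: cyl_def)
      then show "f \<in> Pi\<^sub>E UNIV B" by auto
    qed
    show "\<exists>W. finite W \<and> cyl W g \<subseteq> U"
      by (intro exI conjI) (rule B(1), rule order_trans[OF sub B(3)])
  qed
next
  assume *: "\<forall>g\<in>U. \<exists>W. finite W \<and> cyl W g \<subseteq> U"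
  show "openin ptop U"
    unfolding openin_product_topology_alt
  proof
    fix g assume "g \<in> U"
    from bspec[OF * this] obtain W where W: "finite W" "cyl W g \<subseteq> U" by (elim exE conjE)
    let ?B = "\<lambda>i. if i \<in> W then {g i} else UNIV"
    have "{i \<in> UNIV. ?B i \<noteq> topspace (discrete_topology UNIV)} \<subseteq> W" by auto
    then have "finite {i \<in> UNIV. ?B i \<noteq> topspace (discrete_topology UNIV)}" using W finite_subset by blast
    moreover have "Pi\<^sub>E UNIV ?B \<subseteq> U" using W(2)
    proof (intro subset_trans[OF _ W(2)] subsetI)
      fix f assume "f \<in> Pi\<^sub>E UNIV ?B"
      then have fB: "f w \<in> ?B w" for w by (rule PiE_mem) simp
      have "f w = g w" if "w \<in> W" for w using fB[of w] that by simp
      then show "f \<in> cyl W g" by (simp add: cyl_def)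
    qed
    moreover have "g \<in> Pi\<^sub>E UNIV ?B" by auto
    ultimately show "\<exists>B. finite {i \<in> UNIV. B i \<noteq> topspace (discrete_topology UNIV)} \<and>
	(\<forall>i\<in>UNIV. openin (discrete_topology UNIV) (B i)) \<and> g \<in> Pi\<^sub>E UNIV B \<and> Pi\<^sub>E UNIV B \<subseteq> U"
      by (intro exI[of _ ?B]) auto
  qed
qed

lemma openin_finite_support:
  assumes "finite W" "\<And>f f'. \<forall>w\<in>W. f w = f' w ==> f \<in> U ==> f' \<in> U"
  shows "openin ptop U"
  unfolding openin_ptop_iff
proof (intro ballI exI[of _ W] conjI assms(1))
  fix g assume "g \<in> U"
  then show "cyl W g \<subseteq> U" using assms(2)[of g] by (auto simp: cyl_def)
qed

lemma openin_cyl: "finite W ==> openin ptop (cyl W g)"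
  by (rule openin_finite_support) (auto simp: cyl_def)

lemma topspace_pointwise [simp]: "topspace (pointwise_topology C) = C"
  by (simp add: pointwise_topology_def)

lemma compact_pointwise:
  fixes C :: "('b => 'k::finite) set"
  assumes "closedin ptop C"
  shows "compact_space (pointwise_topology C)"
proof -
  have "compact_space (ptop :: ('b => 'k) topology)"
    by (simp add: compact_space_product_topology compact_space_discrete_topology)
  then have "compactin ptop C" using assms closedin_compact_space by blast
  then show ?thesis unfolding pointwise_topology_def by (rule compact_space_subtopology)
qed

lemma compact_pointwise_cover:
  fixes C :: "('b => 'k::finite) set"
  assumes C: "closedin ptop C" and op: "\<And>U. U \<in> \<U> ==> openin ptop U" and cov: "C \<subseteq> \<Union>\<U>"
  obtains \<F> where "finite \<F>" "\<F> \<subseteq> \<U>" "C \<subseteq> \<Union>\<F>"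
proof -
  have "compact_space (ptop :: ('b => 'k) topology)"
    by (simp add: compact_space_product_topology compact_space_discrete_topology)
  then have "compactin ptop C" using C closedin_compact_space by blast
  then have "\<exists>\<F>. finite \<F> \<and> \<F> \<subseteq> \<U> \<and> C \<subseteq> \<Union>\<F>"
    by (rule compactinD[OF _ _ cov]) (rule op)
  then show ?thesis using that by (elim exE conjE)
qed

lemma closedin_finite_violation:
  assumes "\<And>f. f \<notin> C ==> \<exists>W. finite W \<and> cyl W f \<inter> C = {}"
  shows "closedin ptop C"
proof -
  have "openin ptop (- C)" unfolding openin_ptop_iff using assms by blast
  then show ?thesis by (simp add: closedin_def Compl_eq_Diff_UNIV)
qed

lemma closed_cochains: "closedin ptop (cochains L q :: ('v list => 'k::comm_ring_1) set)"
proof (rule closedin_finite_violation)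
  fix f :: "'v list => 'k" assume "f \<notin> cochains L q"
  then consider s where "s \<notin> ordered_simplices L q" "f s \<noteq> 0"
    | s \<pi> where "s \<in> ordered_simplices L q" "\<pi> permutes {..<length s}" "f (permute_list \<pi> s) \<noteq> of_int (sign \<pi>) * f s"
    unfolding cochains_def by blast
  then show "\<exists>W. finite W \<and> cyl W f \<inter> cochains L q = {}"
  proof cases
    case 1
    then show ?thesis by (intro exI[of _ "{s}"]) (auto simp: cyl_def cochains_def)
  next
    case 2
    then show ?thesis by (intro exI[of _ "{s, permute_list \<pi> s}"]) (auto simp: cyl_def cochains_def)
  qed
qed

lemma coboundary_dep:
  assumes "\<forall>w\<in>(\<lambda>k. del k s) ` {..<length s}. f w = f' w"
  shows "coboundary L i f s = coboundary L i f' s"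
  using assms by (auto simp: coboundary_del intro!: sum.cong)

lemma closed_ker_coboundary: "closedin ptop (ker_coboundary L (Suc q) :: ('v list => 'k::comm_ring_1) set)"
proof (rule closedin_finite_violation)
  fix f :: "'v list => 'k" assume "f \<notin> ker_coboundary L (Suc q)"
  then consider "f \<notin> cochains L q" | s where "coboundary L (Suc q) f s \<noteq> 0"
    unfolding ker_coboundary_def by auto
  then show "\<exists>W. finite W \<and> cyl W f \<inter> ker_coboundary L (Suc q) = {}"
  proof cases
    case 1
    have "openin ptop (- (cochains L q :: ('v list => 'k) set))"
      using closed_cochains[of L q] by (simp add: closedin_def Compl_eq_Diff_UNIV)
    then obtain W where "finite W" "cyl W f \<subseteq> - cochains L q"
      using 1 unfolding openin_ptop_iff by blast
    then show ?thesis by (intro exI[of _ W]) (auto simp: ker_coboundary_def)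
  next
    case 2
    have "coboundary L (Suc q) f' s \<noteq> 0" if "f' \<in> cyl ((\<lambda>k. del k s) ` {..<length s}) f" for f'
      using that 2 coboundary_dep[of s f' f L "Suc q"] by (simp add: cyl_def)
    then show ?thesis by (intro exI[of _ "(\<lambda>k. del k s) ` {..<length s}"]) (force simp: ker_coboundary_def)
  qed
qed

text \<open>A continuous pseudometric on a compact space of cochains is small on pairs that agree on a large finite set of simplices.\<close>

lemma window:
  fixes C :: "('b => 'k::finite) set"
  assumes C: "closedin ptop C" and gen: "generating_pseudometric G (pointwise_topology C) \<alpha> \<rho>" and k: "0 < \<kappa>"
  obtains W where "finite W" "\<And>f f'. f \<in> C ==> f' \<in> C ==> \<forall>w\<in>W. f w = f' w ==> \<rho> f f' < \<kappa>"
proof -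
  let ?X = "pointwise_topology C"
  have r0: "\<rho> f f = 0" if "f \<in> C" for f using gen that by (simp add: generating_pseudometric_def)
  have cont: "continuous_map (prod_topology ?X ?X) euclideanreal (\<lambda>(x, y). \<rho> x y)"
    using gen by (simp add: generating_pseudometric_def)
  have op: "openin (prod_topology ?X ?X) {p \<in> C \<times> C. (case p of (x,y) => \<rho> x y) \<in> {..<\<kappa>}}"
    using openin_continuous_map_preimage[OF cont, of "{..<\<kappa>}"] by simp
  have "\<exists>W. finite W \<and> (\<forall>x\<in>C \<inter> cyl W f. \<forall>y\<in>C \<inter> cyl W f. \<rho> x y < \<kappa>)" if f: "f \<in> C" for f
  proof -
    have "(f,f) \<in> {p \<in> C \<times> C. (case p of (x,y) => \<rho> x y) \<in> {..<\<kappa>}}" using f r0[OF f] k by simp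
    from op[unfolded openin_prod_topology_alt, rule_format, OF this]
    obtain U V where UV: "openin ?X U" "openin ?X V" "f \<in> U" "f \<in> V"
      "U \<times> V \<subseteq> {p \<in> C \<times> C. (case p of (x,y) => \<rho> x y) \<in> {..<\<kappa>}}"
      by (elim exE conjE)
    have opX: "\<exists>W. finite W \<and> C \<inter> cyl W f \<subseteq> U" if U: "openin ?X U" "f \<in> U" for U
    proof -
      obtain U' where U': "openin ptop U'" "U = U' \<inter> C"
	using U(1) unfolding pointwise_topology_def openin_subtopology by blast
      have "f \<in> U'" using U' U(2) by simp
      from bspec[OF iffD1[OF openin_ptop_iff U'(1)] this]
      obtain W where "finite W" "cyl W f \<subseteq> U'" by (elim exE conjE)
      then show ?thesis using U'(2) by (intro exI[of _ W]) auto
    qed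
    obtain W1 where W1: "finite W1" "C \<inter> cyl W1 f \<subseteq> U" using opX[OF UV(1,3)] by blast
    obtain W2 where W2: "finite W2" "C \<inter> cyl W2 f \<subseteq> V" using opX[OF UV(2,4)] by blast
    show ?thesis
    proof (intro exI[of _ "W1 \<union> W2"] conjI ballI)
      show "finite (W1 \<union> W2)" using W1 W2 by simp
      fix x y assume "x \<in> C \<inter> cyl (W1 \<union> W2) f" "y \<in> C \<inter> cyl (W1 \<union> W2) f"
      then have "x \<in> U" "y \<in> V" using W1(2) W2(2) by (auto simp: cyl_def)
      then show "\<rho> x y < \<kappa>" using UV(5) by auto
    qed
  qed
  then obtain W where W: "\<And>f. f \<in> C ==> finite (W f)"
    "\<And>f x y. f \<in> C ==> x \<in> C \<inter> cyl (W f) f ==> y \<in> C \<inter> cyl (W f) f ==> \<rho> x y < \<kappa>" by metis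
  have opW: "openin ptop U" if "U \<in> (\<lambda>f. cyl (W f) f) ` C" for U
  proof -
    obtain f where f: "f \<in> C" "U = cyl (W f) f" using \<open>U \<in> (\<lambda>f. cyl (W f) f) ` C\<close> by blast
    show ?thesis unfolding f(2) by (rule openin_cyl[OF W(1)[OF f(1)]])
  qed
  have self: "f \<in> cyl (W f) f" for f by (simp add: cyl_def)
  have cov: "C \<subseteq> \<Union>((\<lambda>f. cyl (W f) f) ` C)" using self by blast
  obtain \<F> where F: "finite \<F>" "\<F> \<subseteq> (\<lambda>f. cyl (W f) f) ` C" "C \<subseteq> \<Union>\<F>"
    by (rule compact_pointwise_cover[OF C opW cov])
  obtain C0 where C0: "finite C0" "C0 \<subseteq> C" "\<F> = (\<lambda>f. cyl (W f) f) ` C0"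
    using finite_subset_image[OF F(1,2)] by blast
  show ?thesis
  proof (rule that[of "\<Union>(W ` C0)"])
    show "finite (\<Union>(W ` C0))" using C0 W by auto
    fix f f' assume ff': "f \<in> C" "f' \<in> C" "\<forall>w\<in>\<Union>(W ` C0). f w = f' w"
    obtain f0 where f0: "f0 \<in> C0" "f \<in> cyl (W f0) f0" using ff'(1) F(3) C0(3) by auto
    have "f' \<in> cyl (W f0) f0" using f0 ff'(3) by (auto simp: cyl_def)
    then show "\<rho> f f' < \<kappa>" using W(2)[of f0 f f'] f0 C0 ff' by auto
  qed
qed

lemma rho_bounded:
  fixes C :: "('b => 'k::finite) set"
  assumes C: "closedin ptop C" and gen: "generating_pseudometric G (pointwise_topology C) \<alpha> \<rho>"
  obtains B where "0 < B" "\<And>f f'. f \<in> C ==> f' \<in> C ==> \<rho> f f' \<le> B"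
proof -
  let ?X = "pointwise_topology C"
  have cont: "continuous_map (prod_topology ?X ?X) euclideanreal (\<lambda>(x, y). \<rho> x y)"
    using gen by (simp add: generating_pseudometric_def)
  have "compactin (prod_topology ?X ?X) (topspace (prod_topology ?X ?X))"
  proof -
    have "compact_space (prod_topology ?X ?X)"
      using compact_pointwise[OF C] by (simp add: compact_space_prod_topology)
    then show ?thesis by (simp add: compact_space_def)
  qed
  then have "compactin euclideanreal ((\<lambda>(x, y). \<rho> x y) ` (C \<times> C))"
    using image_compactin[OF _ cont] by simp
  then have "bounded ((\<lambda>(x, y). \<rho> x y) ` (C \<times> C))" by (simp add: compactin_euclidean_iff compact_imp_bounded)
  then obtain B where "\<And>z. z \<in> (\<lambda>(x, y). \<rho> x y) ` (C \<times> C) ==> norm z \<le> B" "0 < B"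
    unfolding bounded_pos by blast
  then show ?thesis by (intro that[of B]) force+
qed

context simplex_reps
begin

abbreviation \<alpha> where "\<alpha> \<equiv> cochain_action G act L q"

lemma action_window:
  assumes "\<forall>w\<in>(\<lambda>s. map (act (inv g)) s) ` W. f w = f' w"
  shows "\<forall>w\<in>W. \<alpha> g f w = \<alpha> g f' w"
  using assms by (auto simp: cochain_action_def)

text \<open>Generation and compactness: cochains that differ on \<open>W0\<close> are separated uniformly by finitely many group elements.\<close>

lemma separation_window:
  fixes C :: "('c list => 'k::{comm_ring_1,finite}) set"
  assumes C: "closedin ptop C" and gen: "generating_pseudometric G (pointwise_topology C) \<alpha> \<rho>"
    and inv: "\<And>g f. g \<in> carrier G ==> f \<in> C ==> \<alpha> g f \<in> C" and W0: "finite W0"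
  obtains F \<eta> where "finite F" "F \<subseteq> carrier G" "0 < \<eta>"
    "\<And>f f'. f \<in> C ==> f' \<in> C ==> \<exists>w\<in>W0. f w \<noteq> f' w ==> \<exists>h\<in>F. \<eta> \<le> \<rho> (\<alpha> h f) (\<alpha> h f')"
proof -
  have tri: "\<rho> x z \<le> \<rho> x y + \<rho> y z" "\<rho> x y = \<rho> y x" if "x \<in> C" "y \<in> C" "z \<in> C" for x y z
    using gen that unfolding generating_pseudometric_def topspace_pointwise by blast+
  let ?P = "\<lambda>f f' W h e. finite W \<and> h \<in> carrier G \<and> 0 < e \<and>
      (\<forall>x\<in>C \<inter> cyl W f. \<forall>y\<in>C \<inter> cyl W f'. (\<exists>w\<in>W0. x w \<noteq> y w) --> e \<le> \<rho> (\<alpha> h x) (\<alpha> h y))"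
  have loc: "\<exists>W h e. ?P f f' W h e" if ff': "f \<in> C" "f' \<in> C" for f f'
  proof (cases "\<forall>w\<in>W0. f w = f' w")
    case True
    then have "?P f f' W0 \<one> 1" using W0 by (auto simp: cyl_def)
    then show ?thesis by blast
  next
    case False
    then have "f \<noteq> f'" by auto
    then obtain h where h: "h \<in> carrier G" "0 < \<rho> (\<alpha> h f) (\<alpha> h f')"
      using gen ff' unfolding generating_pseudometric_def topspace_pointwise by blast
    define e where "e = \<rho> (\<alpha> h f) (\<alpha> h f') / 3"
    have e: "0 < e" using h by (simp add: e_def)
    obtain W where W: "finite W" "\<And>f f'. f \<in> C ==> f' \<in> C ==> \<forall>w\<in>W. f w = f' w ==> \<rho> f f' < e"
      using window[OF C gen e] by blast
    let ?W = "(\<lambda>s. map (act (inv h)) s) ` W"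
    have "e \<le> \<rho> (\<alpha> h x) (\<alpha> h y)" if x: "x \<in> C \<inter> cyl ?W f" and y: "y \<in> C \<inter> cyl ?W f'" for x y
    proof -
      have C4: "\<alpha> h x \<in> C" "\<alpha> h y \<in> C" "\<alpha> h f \<in> C" "\<alpha> h f' \<in> C" using inv h x y ff' by auto
      have "\<rho> (\<alpha> h f) (\<alpha> h x) < e"
	using x by (intro W(2) C4 action_window) (auto simp: cyl_def)
      moreover have "\<rho> (\<alpha> h y) (\<alpha> h f') < e"
	using y by (intro W(2) C4 action_window) (auto simp: cyl_def)
      moreover have "\<rho> (\<alpha> h f) (\<alpha> h f') \<le> \<rho> (\<alpha> h f) (\<alpha> h x) + (\<rho> (\<alpha> h x) (\<alpha> h y) + \<rho> (\<alpha> h y) (\<alpha> h f'))"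
	using tri(1)[of "\<alpha> h f" "\<alpha> h x" "\<alpha> h f'"] tri(1)[of "\<alpha> h x" "\<alpha> h y" "\<alpha> h f'"] C4 by linarith
      ultimately show ?thesis unfolding e_def by linarith
    qed
    then have "?P f f' ?W h e" using W h e by auto
    then show ?thesis by blast
  qed
  then obtain W h e where whe: "\<And>f f'. f \<in> C ==> f' \<in> C ==> ?P f f' (W f f') (h f f') (e f f')" by metis
  let ?X = "pointwise_topology C"
  let ?U = "\<lambda>p. (C \<inter> cyl (W (fst p) (snd p)) (fst p)) \<times> (C \<inter> cyl (W (fst p) (snd p)) (snd p))"
  have "compactin (prod_topology ?X ?X) (C \<times> C)"
  proof -
    have "compact_space (prod_topology ?X ?X)"
      using compact_pointwise[OF C] by (simp add: compact_space_prod_topology)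
    then show ?thesis by (simp add: compact_space_def)
  qed
  note comp = this
  have opU: "openin (prod_topology ?X ?X) (?U p)" if "p \<in> C \<times> C" for p
  proof -
    have "finite (W (fst p) (snd p))" using whe[of "fst p" "snd p"] that by auto
    then have "openin ?X (C \<inter> cyl (W (fst p) (snd p)) f)" for f
      unfolding pointwise_topology_def openin_subtopology
      by (intro exI[of _ "cyl (W (fst p) (snd p)) f"] conjI openin_cyl) auto
    then show ?thesis by (simp add: openin_prod_Times_iff)
  qed
  have opU': "openin (prod_topology ?X ?X) U" if "U \<in> ?U ` (C \<times> C)" for U
  proof -
    obtain p where p: "p \<in> C \<times> C" "U = ?U p" using \<open>U \<in> ?U ` (C \<times> C)\<close> by blast
    show ?thesis unfolding p(2) by (rule opU[OF p(1)])
  qed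
  have covU: "C \<times> C \<subseteq> \<Union>(?U ` (C \<times> C))"
  proof
    fix p assume "p \<in> C \<times> C"
    then have "p \<in> ?U p" by (auto simp: cyl_def)
    then show "p \<in> \<Union>(?U ` (C \<times> C))" using \<open>p \<in> C \<times> C\<close> by blast
  qed
  have "\<exists>\<F>. finite \<F> \<and> \<F> \<subseteq> ?U ` (C \<times> C) \<and> C \<times> C \<subseteq> \<Union>\<F>"
    by (rule compactinD[OF comp _ covU]) (rule opU')
  then obtain \<F> where F: "finite \<F>" "\<F> \<subseteq> ?U ` (C \<times> C)" "C \<times> C \<subseteq> \<Union>\<F>"
    by (elim exE conjE)
  obtain P0 where P0: "finite P0" "P0 \<subseteq> C \<times> C" "\<F> = ?U ` P0"
    using finite_subset_image[OF F(1,2)] by blast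
  define \<eta> where "\<eta> = Min (insert 1 ((\<lambda>p. e (fst p) (snd p)) ` P0))"
  show ?thesis
  proof (rule that[of "(\<lambda>p. h (fst p) (snd p)) ` P0" \<eta>])
    show "finite ((\<lambda>p. h (fst p) (snd p)) ` P0)" "(\<lambda>p. h (fst p) (snd p)) ` P0 \<subseteq> carrier G"
      using P0 whe by auto
    show "0 < \<eta>" unfolding \<eta>_def using P0 whe by (subst Min_gr_iff) auto
    fix f f' assume ff': "f \<in> C" "f' \<in> C" "\<exists>w\<in>W0. f w \<noteq> f' w"
    then obtain p where p: "p \<in> P0" "(f,f') \<in> ?U p"
    proof -
      have "(f,f') \<in> \<Union>\<F>" using F(3) ff'(1,2) by (rule subsetD[OF _ SigmaI])
      then show ?thesis using that unfolding P0(3) by (elim UnionE imageE) simp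
    qed
    have pC: "fst p \<in> C" "snd p \<in> C" using p P0 by auto
    have "e (fst p) (snd p) \<le> \<rho> (\<alpha> (h (fst p) (snd p)) f) (\<alpha> (h (fst p) (snd p)) f')"
      using whe[OF pC] p(2) ff'(3) by auto
    moreover have "\<eta> \<le> e (fst p) (snd p)" unfolding \<eta>_def using P0 p by (intro Min_le) auto
    ultimately show "\<exists>h\<in>(\<lambda>p. h (fst p) (snd p)) ` P0. \<eta> \<le> \<rho> (\<alpha> h f) (\<alpha> h f')"
      using p by (intro bexI[of _ "h (fst p) (snd p)"]) auto
  qed
qed

text \<open>If for every finite set of cocycle equations some solution could not be changed into a cocycle outside \<open>W\<close>, compactness would give a
cocycle that agrees with no cocycle on \<open>W\<close>.\<close>

lemma extension_window:
  assumes W: "finite W"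
  obtains V where "finite V" "V \<subseteq> ordered_simplices L (Suc q)"
    "\<And>f :: 'c list => 'k::{comm_ring_1,finite}. f \<in> cochains L q ==> \<forall>s\<in>V. coboundary L (Suc q) f s = 0 ==>
      \<exists>f'\<in>ker_coboundary L (Suc q). \<forall>w\<in>W. f' w = f w"
proof -
  let ?K = "ker_coboundary L (Suc q) :: ('c list => 'k) set"
  let ?A = "{f. \<exists>f'\<in>?K. \<forall>w\<in>W. f' w = f w}"
  let ?O = "\<lambda>s. {f :: 'c list => 'k. coboundary L (Suc q) f s \<noteq> 0}"
  let ?\<Lambda> = "ordered_simplices L (Suc q)"
  have opA: "openin ptop ?A"
    by (rule openin_finite_support[OF W]) force
  have opO: "openin ptop (?O s)" for s
  proof (rule openin_finite_support[of "(\<lambda>k. del k s) ` {..<length s}"])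
    fix f f' :: "'c list => 'k"
    assume "\<forall>w\<in>(\<lambda>k. del k s) ` {..<length s}. f w = f' w" "f \<in> ?O s"
    then show "f' \<in> ?O s" using coboundary_dep[of s f f' L "Suc q"] by simp
  qed simp
  have opU: "openin ptop U" if "U \<in> insert ?A (?O ` ?\<Lambda>)" for U
    using that opA opO by (elim insertE imageE) simp_all
  have cov: "cochains L q \<subseteq> \<Union>(insert ?A (?O ` ?\<Lambda>))"
  proof
    fix f :: "'c list => 'k" assume f: "f \<in> cochains L q"
    show "f \<in> \<Union>(insert ?A (?O ` ?\<Lambda>))"
    proof (cases "\<exists>s\<in>?\<Lambda>. coboundary L (Suc q) f s \<noteq> 0")
      case False
      then have "coboundary L (Suc q) f = (\<lambda>_. 0)" by (auto simp: coboundary_del)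
      then have "f \<in> ?K" using f by (simp add: ker_coboundary_def)
      then show ?thesis by auto
    qed auto
  qed
  obtain \<F> where F: "finite \<F>" "\<F> \<subseteq> insert ?A (?O ` ?\<Lambda>)" "cochains L q \<subseteq> \<Union>\<F>"
    by (rule compact_pointwise_cover[OF closed_cochains opU cov])
  have fin: "finite (\<F> - {?A})" and sub: "\<F> - {?A} \<subseteq> ?O ` ?\<Lambda>" using F by auto
  obtain V where V: "finite V" "V \<subseteq> ?\<Lambda>" "\<F> - {?A} = ?O ` V"
    using finite_subset_image[OF fin sub] by (elim exE conjE) (rule that)
  show ?thesis
  proof (rule that[OF V(1,2)])
    fix f :: "'c list => 'k" assume f: "f \<in> cochains L q" "\<forall>s\<in>V. coboundary L (Suc q) f s = 0"
    have "f \<in> \<Union>\<F>" using F(3) f(1) by (rule subsetD)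
    then obtain U where U: "U \<in> \<F>" "f \<in> U" by (rule UnionE)
    have "U = ?A"
    proof (rule ccontr)
      assume "U \<noteq> ?A"
      then have "U \<in> ?O ` V" using U(1) V(3)[symmetric] by simp
      then show False using U(2) f(2) by auto
    qed
    then have "f \<in> ?A" using U(2) by simp
    then show "\<exists>f'\<in>?K. \<forall>w\<in>W. f' w = f w" by simp
  qed
qed

lemma action_cochain:
  fixes f :: "'c list => 'k::comm_ring_1"
  assumes g: "g \<in> carrier G" and f: "f \<in> cochains L q"
  shows "\<alpha> g f \<in> cochains L q"
  unfolding cochains_def
proof (intro CollectI conjI ballI allI impI)
  fix s \<pi> assume s: "s \<in> ordered_simplices L q" and pi: "\<pi> permutes {..<length s}"
  have "map (act (inv g)) s \<in> ordered_simplices L q" using g s by (intro ord_act) auto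
  from cochainsD(2)[OF f this] show "\<alpha> g f (permute_list \<pi> s) = of_int (sign \<pi>) * \<alpha> g f s"
    using s pi by (simp add: cochain_action_def ordered_simplices_permute permute_list_map[symmetric])
qed (simp add: cochain_action_def)

lemma coboundary_action:
  fixes f :: "'c list => 'k::comm_ring_1"
  assumes g: "g \<in> carrier G" and s: "s \<in> ordered_simplices L (Suc q)"
  shows "coboundary L (Suc q) (\<alpha> g f) s = coboundary L (Suc q) f (map (act (inv g)) s)"
proof -
  have "coboundary L (Suc q) (\<alpha> g f) s = (\<Sum>k<length s. (-1) ^ k * f (map (act (inv g)) (del k s)))"
    using s ord_face[OF s] by (simp add: coboundary_del cochain_action_def)
  also have "... = coboundary L (Suc q) f (map (act (inv g)) s)"
    using ord_act[OF inv_closed[OF g] s] by (simp add: coboundary_del del_map)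
  finally show ?thesis .
qed

lemma action_ker:
  fixes f :: "'c list => 'k::comm_ring_1"
  assumes g: "g \<in> carrier G" and f: "f \<in> ker_coboundary L (Suc q)"
  shows "\<alpha> g f \<in> ker_coboundary L (Suc q)"
proof -
  have "coboundary L (Suc q) (\<alpha> g f) s = 0" for s
  proof (cases "s \<in> ordered_simplices L (Suc q)")
    case True
    then show ?thesis using coboundary_action[OF g True, of f] f by (simp add: ker_coboundary_def)
  qed (simp add: coboundary_def)
  then show ?thesis using action_cochain[OF g, of f] f by (simp add: ker_coboundary_def fun_eq_iff)
qed

text \<open>The discrete pseudometric of the values on the representatives; translates of these determine a cochain.\<close>

lemma generating_exists:
  fixes C :: "('c list => 'k::{comm_ring_1,finite}) set"
  assumes C: "C \<subseteq> cochains L q"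
  shows "generating_pseudometric G (pointwise_topology C) \<alpha> (\<lambda>f f'. if \<forall>w\<in>set ts. f w = f' w then 0 else 1)"
  unfolding generating_pseudometric_def topspace_pointwise
proof (intro conjI ballI impI)
  let ?r = "\<lambda>f f'. if \<forall>w\<in>set ts. f w = f' w then 0 else (1::real)"
  let ?X = "pointwise_topology C"
  show "continuous_map (prod_topology ?X ?X) euclideanreal (\<lambda>(x, y). ?r x y)"
    unfolding continuous_map_def
  proof (intro conjI allI impI)
    fix U :: "real set" assume "openin euclideanreal U"
    show "openin (prod_topology ?X ?X) {p \<in> topspace (prod_topology ?X ?X). (case p of (x,y) => ?r x y) \<in> U}"
      unfolding openin_prod_topology_alt
    proof (intro allI impI)
      fix x y assume xy: "(x, y) \<in> {p \<in> topspace (prod_topology ?X ?X). (case p of (x,y) => ?r x y) \<in> U}"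
      have "openin ?X (cyl (set ts) z \<inter> C)" for z
	unfolding pointwise_topology_def openin_subtopology using openin_cyl[of "set ts" z] by blast
      moreover have "(cyl (set ts) x \<inter> C) \<times> (cyl (set ts) y \<inter> C) \<subseteq>
	  {p \<in> topspace (prod_topology ?X ?X). (case p of (x,y) => ?r x y) \<in> U}"
	using xy by (auto simp: cyl_def)
      ultimately show "\<exists>V W. openin ?X V \<and> openin ?X W \<and> x \<in> V \<and> y \<in> W \<and>
	  V \<times> W \<subseteq> {p \<in> topspace (prod_topology ?X ?X). (case p of (x,y) => ?r x y) \<in> U}"
	using xy by (intro exI[of _ "cyl (set ts) x \<inter> C"] exI[of _ "cyl (set ts) y \<inter> C"]) (auto simp: cyl_def)
    qed
  qed auto
  fix x y assume xy: "x \<in> C" "y \<in> C" "x \<noteq> y"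
  obtain g i where gi: "g \<in> carrier G" "i < length ts" "x (basic g i) \<noteq> y (basic g i)"
    using cochain_eqI[of x y] xy C by blast
  have "\<alpha> (inv g) x (ts ! i) \<noteq> \<alpha> (inv g) y (ts ! i)"
    using gi reps_ord[OF gi(2)] by (simp add: cochain_action_def basic_def)
  then have "\<not> (\<forall>w\<in>set ts. \<alpha> (inv g) x w = \<alpha> (inv g) y w)" using gi(2) nth_mem by blast
  then show "\<exists>g\<in>carrier G. 0 < ?r (\<alpha> g x) (\<alpha> g y)" using gi by (intro bexI[of _ "inv g"]) auto
qed auto

end

section \<open>Upper bound for the entropy\<close>

lemma log_enat_separation_le:
  assumes "\<And>S. finite S ==> S \<subseteq> M ==> pairwise (\<lambda>x y. d x y \<ge> \<kappa>) S ==> real (card S) \<le> B" and "1 \<le> B"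
  shows "log_enat (separation_number \<kappa> d M) \<le> ereal (ln B)"
proof -
  have "separation_number \<kappa> d M \<le> enat (nat \<lfloor>B\<rfloor>)"
    unfolding separation_number_def by (rule SUP_least) (use assms(1) le_nat_floor in auto)
  then obtain m where m: "separation_number \<kappa> d M = enat m" "m \<le> nat \<lfloor>B\<rfloor>"
    by (cases "separation_number \<kappa> d M") auto
  have "real m \<le> B" using m(2) assms(2) by linarith
  then show ?thesis unfolding m(1) log_enat_def by auto
qed

lemma log_enat_separation_ge:
  assumes "finite S" "S \<subseteq> M" "pairwise (\<lambda>x y. d x y \<ge> \<kappa>) S" "0 < card S"
  shows "ereal (ln (real (card S))) \<le> log_enat (separation_number \<kappa> d M)"
proof -
  have "enat (card S) \<le> separation_number \<kappa> d M"
    unfolding separation_number_def by (rule SUP_upper) (use assms in simp)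
  then show ?thesis using assms(4) by (cases "separation_number \<kappa> d M") (auto simp: log_enat_def)
qed

lemma rho_2_chebyshev:
  assumes "rho_2 \<rho> A x y < \<delta>" "finite A" "A \<noteq> {}" "0 < c"
  shows "real (card {v \<in> A. c \<le> \<rho> (x v) (y v)}) \<le> \<delta>\<^sup>2 / c\<^sup>2 * real (card A)"
proof -
  define Z where "Z = (\<Sum>i\<in>A. (\<rho> (x i) (y i))\<^sup>2)"
  have dA: "0 < real (card A)" using assms by (simp add: card_gt_0_iff)
  have Z0: "0 \<le> Z / real (card A)" unfolding Z_def by (intro divide_nonneg_nonneg sum_nonneg) auto
  have "sqrt (Z / real (card A)) < \<delta>" using assms(1) by (simp add: rho_2_def Z_def)
  then have "(sqrt (Z / real (card A)))\<^sup>2 < \<delta>\<^sup>2" using Z0 by (intro power_strict_mono) auto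
  then have Z: "Z < \<delta>\<^sup>2 * real (card A)" using Z0 dA by (simp add: pos_divide_less_eq)
  have "real (card {v \<in> A. c \<le> \<rho> (x v) (y v)}) * c\<^sup>2 = (\<Sum>v\<in>{v \<in> A. c \<le> \<rho> (x v) (y v)}. c\<^sup>2)" by simp
  also have "... \<le> (\<Sum>v\<in>{v \<in> A. c \<le> \<rho> (x v) (y v)}. (\<rho> (x v) (y v))\<^sup>2)"
    using assms(4) by (intro sum_mono power_mono) auto
  also have "... \<le> Z" unfolding Z_def using assms(2) by (intro sum_mono2) auto
  finally have "real (card {v \<in> A. c \<le> \<rho> (x v) (y v)}) * c\<^sup>2 \<le> \<delta>\<^sup>2 * real (card A)" using Z by linarith
  then show ?thesis using assms(4) by (simp add: pos_le_divide_eq)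
qed

lemma card_UN_le_const:
  assumes "finite I" "\<And>i. i \<in> I ==> real (card (B i)) \<le> c"
  shows "real (card (\<Union>i\<in>I. B i)) \<le> real (card I) * c"
proof -
  have "real (card (\<Union>i\<in>I. B i)) \<le> real (\<Sum>i\<in>I. card (B i))"
    using card_UN_le[OF assms(1), of B] by (simp only: of_nat_le_iff)
  also have "... \<le> (\<Sum>i\<in>I. c)" unfolding of_nat_sum by (rule sum_mono) (rule assms(2))
  finally show ?thesis by simp
qed

locale entropy_setting = sofic_group G D \<sigma> + simplex_reps G L act q ts
  for G (structure) and D :: "nat => 'e set" and \<sigma> and L :: "'c set set" and act q ts
begin

lemma card_shift:
  assumes "f \<in> carrier G"
  shows "card {v \<in> D n. P (\<sigma> n f v)} = card {v \<in> D n. P v}"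
proof (rule bij_betw_same_card[of "\<sigma> n f"])
  have "bij_betw (\<sigma> n f) (D n) (D n)" using sigma_permutes[OF assms] permutes_imp_bij by blast
  then have im: "\<sigma> n f ` D n = D n" "inj_on (\<sigma> n f) (D n)" by (auto simp: bij_betw_def)
  show "bij_betw (\<sigma> n f) {v \<in> D n. P (\<sigma> n f v)} {v \<in> D n. P v}"
    unfolding bij_betw_def
  proof
    show "inj_on (\<sigma> n f) {v \<in> D n. P (\<sigma> n f v)}" using im(2) by (rule inj_on_subset) auto
    show "\<sigma> n f ` {v \<in> D n. P (\<sigma> n f v)} = {v \<in> D n. P v}" using im(1) by (auto simp: assms)
  qed
qed

text \<open>Record for \<open>\<phi>\<close> the values of \<open>\<phi> v\<close> on the representatives, which costs \<open>length ts\<close> symbols per point, and at the few points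
where \<open>\<phi>\<close> is far from equivariant also the restriction of \<open>\<phi> v\<close> to the window \<open>W\<close>. This record determines \<open>\<phi>\<close> up to \<open>\<kappa>\<close>.\<close>

lemma entropy_upper_bound:
  fixes C :: "('c list => 'k::{field,finite}) set"
  assumes C: "closedin ptop C" "C \<subseteq> cochains L q" and gen: "generating_pseudometric G (pointwise_topology C) \<alpha> \<rho>"
    and inv: "\<And>g f. g \<in> carrier G ==> f \<in> C ==> \<alpha> g f \<in> C"
  shows "sofic_entropy_wrt \<rho> G D \<sigma> (pointwise_topology C) \<alpha> \<le> ereal (real (length ts) * ln (real CARD('k)))"
  unfolding sofic_entropy_wrt_def
proof (rule SUP_least)
  fix \<kappa> :: real assume "\<kappa> \<in> {0<..}"
  then have \<kappa>: "0 < \<kappa>" by simp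
  let ?X = "pointwise_topology C" and ?m = "length ts"
  let ?h = "\<lambda>F \<delta> n. log_enat (separation_number \<kappa> (rho_inf \<rho> (D n)) (approx_equivariant_maps ?X \<alpha> \<rho> F \<delta> (D n) (\<sigma> n))) / ereal (real (card (D n)))"
  have tri: "\<rho> x z \<le> \<rho> x y + \<rho> y z" "\<rho> x y = \<rho> y x" if "x \<in> C" "y \<in> C" "z \<in> C" for x y z
    using gen that unfolding generating_pseudometric_def topspace_pointwise by blast+
  obtain W where W: "finite W" "\<And>f f'. f \<in> C ==> f' \<in> C ==> \<forall>w\<in>W. f w = f' w ==> \<rho> f f' < \<kappa>"
    using window[OF C(1) gen \<kappa>] by blast
  obtain F0 \<eta> where F0: "finite F0" "F0 \<subseteq> carrier G" and \<eta>: "0 < \<eta>"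
    and sep: "\<And>f f'. f \<in> C ==> f' \<in> C ==> \<exists>w\<in>set ts. f w \<noteq> f' w ==> \<exists>h\<in>F0. \<eta> \<le> \<rho> (\<alpha> h f) (\<alpha> h f')"
    using separation_window[OF C(1) gen inv finite_set[of ts]] by blast
  \<comment> \<open>The translations that carry the simplices of \<open>W\<close> to the representatives.\<close>
  define E0 where "E0 = (\<lambda>w. inv (fst (cpos w))) ` (W \<inter> ordered_simplices L q)"
  have cW: "fst (cpos w) \<in> carrier G \<and> snd (cpos w) < ?m" if w: "w \<in> ordered_simplices L q" for w
  proof -
    obtain g i \<pi> where "is_coord w g i \<pi>" "cpos w = (g,i)" "csgn w = sign \<pi>" by (rule coord_cases[OF w])
    then show ?thesis by (simp add: is_coord_def)
  qed
  have E0: "finite E0" "E0 \<subseteq> carrier G" using W cW by (auto simp: E0_def)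
  define FE where "FE = F0 \<times> E0"
  have FE: "finite FE" "\<And>h g. (h,g) \<in> FE ==> h \<in> F0 \<and> g \<in> E0 \<and> h \<in> carrier G \<and> g \<in> carrier G"
    using F0 E0 by (auto simp: FE_def)
  define F where "F = F0 \<union> (\<lambda>(h,g). h \<otimes> g) ` FE"
  have F: "finite F" "F \<subseteq> carrier G" using F0 FE by (auto simp: F_def)
  define \<Omega> where "\<Omega> = insert None (Some ` (W \<rightarrow>\<^sub>E (UNIV :: 'k set)))"
  have \<Omega>: "finite \<Omega>" unfolding \<Omega>_def using W(1) by (simp add: finite_PiE)
  show "(INF \<delta>\<in>{0<..}. INF F\<in>{F. finite F \<and> F \<subseteq> carrier G}. limsup (?h F \<delta>)) \<le> ereal (real ?m * ln (real CARD('k)))"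
  proof (rule ereal_le_epsilon2)
    fix e :: real assume e: "0 < e"
    define t where "t = min 1 (e / (2 * (real (card \<Omega>) + 1)))"
    have t: "0 < t" "t \<le> 1" using e unfolding t_def by (auto intro!: divide_pos_pos add_nonneg_pos)
    have t1: "t * real (card \<Omega>) \<le> e / 2"
    proof -
      have "t * real (card \<Omega>) \<le> e / (2 * (real (card \<Omega>) + 1)) * real (card \<Omega>)"
	unfolding t_def by (intro mult_right_mono) auto
      also have "... = e / 2 * (real (card \<Omega>) / (real (card \<Omega>) + 1))" by simp
      also have "... \<le> e / 2 * 1" using e by (intro mult_left_mono) auto
      finally show ?thesis by simp
    qed
    have lt: "0 \<le> ln (1 / t)" using t by (simp add: ln_div)
    define \<epsilon> where "\<epsilon> = e / (2 * (ln (1 / t) + 1))"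
    have \<epsilon>: "0 < \<epsilon>" using e lt unfolding \<epsilon>_def by (intro divide_pos_pos) auto
    have \<epsilon>1: "\<epsilon> * ln (1 / t) \<le> e / 2"
    proof -
      have "\<epsilon> * ln (1 / t) = e / 2 * (ln (1 / t) / (ln (1 / t) + 1))" unfolding \<epsilon>_def by simp
      also have "... \<le> e / 2 * 1" using e lt by (intro mult_left_mono) auto
      finally show ?thesis by simp
    qed
    define \<delta> where "\<delta> = (\<eta> / 2) * sqrt (\<epsilon> / (4 * (real (card FE) + 1)))"
    have \<delta>: "0 < \<delta>" using \<eta> \<epsilon> unfolding \<delta>_def by (intro mult_pos_pos real_sqrt_gt_zero divide_pos_pos add_nonneg_pos) auto
    have \<delta>2: "\<delta>\<^sup>2 / (\<eta> / 2)\<^sup>2 = \<epsilon> / (4 * (real (card FE) + 1))"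
      using \<eta> \<epsilon> unfolding \<delta>_def power_mult_distrib by (simp add: real_sqrt_pow2)
    have "most D (\<lambda>n v. \<forall>p\<in>FE. \<sigma> n (fst p) (\<sigma> n (snd p) v) = \<sigma> n (fst p \<otimes> snd p) v)"
      using FE by (intro most_finite_ball_D most_mult) auto
    then have ev: "eventually (\<lambda>n. real (card {v \<in> D n. \<not> (\<forall>p\<in>FE. \<sigma> n (fst p) (\<sigma> n (snd p) v) = \<sigma> n (fst p \<otimes> snd p) v)})
	\<le> \<epsilon> / 2 * real (card (D n))) sequentially"
      using \<epsilon> D_nonempty by (intro most_eventually) auto
    have "limsup (?h F \<delta>) \<le> ereal (real ?m * ln (real CARD('k)) + e)"
    proof (rule Limsup_bounded)
      show "eventually (\<lambda>n. ?h F \<delta> n \<le> ereal (real ?m * ln (real CARD('k)) + e)) sequentially"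
	using ev D_nonempty
      proof eventually_elim
	case (elim n)
	define d where "d = real (card (D n))"
	have d: "0 < d" using elim(2) by (simp add: d_def card_gt_0_iff)
	let ?M = "approx_equivariant_maps ?X \<alpha> \<rho> F \<delta> (D n) (\<sigma> n)"
	define SB where "SB = {v \<in> D n. \<not> (\<forall>p\<in>FE. \<sigma> n (fst p) (\<sigma> n (snd p) v) = \<sigma> n (fst p \<otimes> snd p) v)}"
	define Bd where "Bd \<phi> f = {v \<in> D n. \<eta> / 2 \<le> \<rho> (\<phi> (\<sigma> n f v)) (\<alpha> f (\<phi> v))}" for \<phi> :: "_ => 'c list => 'k" and f
	define good where "good \<phi> v \<longleftrightarrow> v \<notin> SB \<and> (\<forall>p\<in>FE. v \<notin> Bd \<phi> (fst p \<otimes> snd p) \<and> \<sigma> n (snd p) v \<notin> Bd \<phi> (fst p))" for \<phi> v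
	have M: "\<phi> v \<in> C" if "\<phi> \<in> ?M" "v \<in> D n" for \<phi> v
	  using that by (auto simp: approx_equivariant_maps_def)
	have cB: "real (card (Bd \<phi> f)) \<le> \<epsilon> / (4 * (real (card FE) + 1)) * d" if "\<phi> \<in> ?M" "f \<in> F" for \<phi> f
	proof -
	  have "rho_2 \<rho> (D n) (\<lambda>i. \<phi> (\<sigma> n f i)) (\<lambda>i. \<alpha> f (\<phi> i)) < \<delta>"
	    using that by (simp add: approx_equivariant_maps_def)
	  from rho_2_chebyshev[OF this finite_D elim(2), of "\<eta> / 2"] \<eta> show ?thesis
	    unfolding \<delta>2 Bd_def d_def by simp
	qed
	have few: "real (card {v \<in> D n. \<not> good \<phi> v}) \<le> \<epsilon> * d" if phi: "\<phi> \<in> ?M" for \<phi>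
	proof -
	  let ?b = "\<epsilon> / (4 * (real (card FE) + 1)) * d"
	  let ?U1 = "\<Union>p\<in>FE. Bd \<phi> (fst p \<otimes> snd p)" and ?U2 = "\<Union>p\<in>FE. {v \<in> D n. \<sigma> n (snd p) v \<in> Bd \<phi> (fst p)}"
	  have u1: "real (card ?U1) \<le> real (card FE) * ?b"
	    by (rule card_UN_le_const[OF FE(1)]) (rule cB[OF phi], force simp: F_def)
	  have u2: "real (card ?U2) \<le> real (card FE) * ?b"
	  proof (rule card_UN_le_const[OF FE(1)])
	    fix p assume p: "p \<in> FE"
	    have "card {v \<in> D n. \<sigma> n (snd p) v \<in> Bd \<phi> (fst p)} = card {v \<in> D n. v \<in> Bd \<phi> (fst p)}"
	      by (rule card_shift) (use FE(2)[of "fst p" "snd p"] p in auto)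
	    also have "{v \<in> D n. v \<in> Bd \<phi> (fst p)} = Bd \<phi> (fst p)" by (auto simp: Bd_def)
	    finally show "real (card {v \<in> D n. \<sigma> n (snd p) v \<in> Bd \<phi> (fst p)}) \<le> ?b"
	      using cB[OF phi, of "fst p"] FE(2)[of "fst p" "snd p"] p by (simp add: F_def)
	  qed
	  have half: "real (card FE) * ?b \<le> \<epsilon> / 4 * d"
	  proof -
	    have "real (card FE) * ?b = (\<epsilon> / 4 * d) * (real (card FE) / (real (card FE) + 1))" by simp
	    also have "... \<le> (\<epsilon> / 4 * d) * 1" using \<epsilon> d by (intro mult_left_mono) auto
	    finally show ?thesis by simp
	  qed
	  have fin: "finite SB" "finite ?U1" "finite ?U2" using FE(1) by (auto simp: SB_def Bd_def)
	  have "{v \<in> D n. \<not> good \<phi> v} \<subseteq> SB \<union> (?U1 \<union> ?U2)" by (auto simp: good_def)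
	  then have "card {v \<in> D n. \<not> good \<phi> v} \<le> card (SB \<union> (?U1 \<union> ?U2))"
	    using fin by (intro card_mono) auto
	  also have "... \<le> card SB + (card ?U1 + card ?U2)"
	    using card_Un_le[of SB "?U1 \<union> ?U2"] card_Un_le[of ?U1 ?U2] by linarith
	  finally have "real (card {v \<in> D n. \<not> good \<phi> v}) \<le> real (card SB) + (real (card ?U1) + real (card ?U2))"
	    by (simp only: of_nat_le_iff of_nat_add[symmetric])
	  moreover have "real (card SB) \<le> \<epsilon> / 2 * d" using elim(1) by (simp add: SB_def d_def)
	  ultimately show ?thesis using u1 u2 half by linarith
	qed
	have det: "\<phi> v w = of_int (csgn w) * \<phi> (\<sigma> n (inv (fst (cpos w))) v) (ts ! snd (cpos w))"
	  if phi: "\<phi> \<in> ?M" and v: "v \<in> D n" "good \<phi> v" and w: "w \<in> W" "w \<in> ordered_simplices L q" for \<phi> v w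
	proof -
	  define g where "g = inv (fst (cpos w))"
	  have g: "g \<in> E0" "g \<in> carrier G" using w E0 by (auto simp: E0_def g_def)
	  have gv: "\<sigma> n g v \<in> D n" using g v by simp
	  have "\<forall>s\<in>set ts. \<phi> (\<sigma> n g v) s = \<alpha> g (\<phi> v) s"
	  proof (rule ccontr)
	    assume "\<not> (\<forall>s\<in>set ts. \<phi> (\<sigma> n g v) s = \<alpha> g (\<phi> v) s)"
	    then obtain h where h: "h \<in> F0" "\<eta> \<le> \<rho> (\<alpha> h (\<phi> (\<sigma> n g v))) (\<alpha> h (\<alpha> g (\<phi> v)))"
	      using sep[OF M[OF phi gv] inv[OF g(2) M[OF phi v(1)]]] by blast
	    have hc: "h \<in> carrier G" using h F0 by auto
	    have hg: "(h,g) \<in> FE" using h g by (simp add: FE_def)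
	    have comp: "\<alpha> h (\<alpha> g (\<phi> v)) = \<alpha> (h \<otimes> g) (\<phi> v)"
	    proof
	      fix s
	      show "\<alpha> h (\<alpha> g (\<phi> v)) s = \<alpha> (h \<otimes> g) (\<phi> v) s"
	      proof (cases "s \<in> ordered_simplices L q")
		case True
		have "map (act (inv g)) (map (act (inv h)) s) = map (act (inv (h \<otimes> g))) s"
		  using map_act_mult[of "inv g" "inv h" s q] True hc g by (simp add: inv_mult_group)
		moreover have "map (act (inv h)) s \<in> ordered_simplices L q" using ord_act True hc by simp
		ultimately show ?thesis using True by (simp only: cochain_action_def if_True)
	      qed (simp add: cochain_action_def)
	    qed
	    have eq: "\<sigma> n h (\<sigma> n g v) = \<sigma> n (h \<otimes> g) v" using v hg by (force simp: good_def SB_def)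
	    have 1: "\<rho> (\<phi> (\<sigma> n (h \<otimes> g) v)) (\<alpha> (h \<otimes> g) (\<phi> v)) < \<eta> / 2"
	      using v hg by (force simp: good_def Bd_def not_le)
	    have 2: "\<rho> (\<phi> (\<sigma> n h (\<sigma> n g v))) (\<alpha> h (\<phi> (\<sigma> n g v))) < \<eta> / 2"
	      using v hg gv by (force simp: good_def Bd_def not_le)
	    have c: "\<phi> (\<sigma> n (h \<otimes> g) v) \<in> C" "\<alpha> h (\<phi> (\<sigma> n g v)) \<in> C" "\<alpha> (h \<otimes> g) (\<phi> v) \<in> C"
	      using M phi v g hc gv inv by auto
	    have "\<eta> \<le> \<rho> (\<alpha> h (\<phi> (\<sigma> n g v))) (\<alpha> (h \<otimes> g) (\<phi> v))" using h(2) by (simp only: comp)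
	    also have "... \<le> \<rho> (\<alpha> h (\<phi> (\<sigma> n g v))) (\<phi> (\<sigma> n (h \<otimes> g) v)) + \<rho> (\<phi> (\<sigma> n (h \<otimes> g) v)) (\<alpha> (h \<otimes> g) (\<phi> v))"
	      by (rule tri(1)[OF c(2,1,3)])
	    also have "\<rho> (\<alpha> h (\<phi> (\<sigma> n g v))) (\<phi> (\<sigma> n (h \<otimes> g) v)) < \<eta> / 2"
	      using 2 tri(2)[OF c(2,1,1)] unfolding eq by simp
	    finally show False using 1 by linarith
	  qed
	  moreover have i: "snd (cpos w) < ?m" using cW w by blast
	  ultimately have "\<phi> (\<sigma> n g v) (ts ! snd (cpos w)) = \<alpha> g (\<phi> v) (ts ! snd (cpos w))" by simp
	  also have "... = \<phi> v (basic (fst (cpos w)) (snd (cpos w)))"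
	    using reps_ord[OF i] cW[OF w(2)] by (simp add: cochain_action_def g_def basic_def)
	  finally have a: "\<phi> (\<sigma> n g v) (ts ! snd (cpos w)) = \<phi> v (basic (fst (cpos w)) (snd (cpos w)))" .
	  obtain g' i' \<pi> where c: "is_coord w g' i' \<pi>" "cpos w = (g',i')" "csgn w = sign \<pi>" by (rule coord_cases[OF w(2)])
	  have "\<phi> v \<in> cochains L q" using M[OF phi v(1)] C(2) by auto
	  from cochain_at[OF this c(1)] show ?thesis using a c by (simp add: g_def)
	qed
	define code1 where "code1 \<phi> = (\<lambda>v\<in>D n. if good \<phi> v then None else Some (restrict (\<phi> v) W))" for \<phi>
	define code2 where "code2 \<phi> = (\<lambda>p\<in>D n \<times> {..<?m}. \<phi> (fst p) (ts ! snd p))" for \<phi> :: "_ => 'c list => 'k"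
	let ?U = "{u \<in> D n \<rightarrow>\<^sub>E \<Omega>. real (card {v \<in> D n. u v \<noteq> None}) \<le> \<epsilon> * real (card (D n))}"
	let ?V = "(D n \<times> {..<?m}) \<rightarrow>\<^sub>E (UNIV :: 'k set)"
	define B where "B = exp (d * (\<epsilon> * ln (1 / t) + t * real (card \<Omega>) + real ?m * ln (real CARD('k))))"
	have K: "1 \<le> CARD('k)" by (simp add: Suc_le_eq card_gt_0_iff)
	have cV: "real (card ?V) = exp (d * (real ?m * ln (real CARD('k))))"
	proof -
	  have "real (card ?V) = real CARD('k) ^ (card (D n) * ?m)"
	    by (simp add: card_PiE card_cartesian_product)
	  also have "... = exp (real (card (D n) * ?m) * ln (real CARD('k)))"
	    using K by (subst exp_of_nat_mult) auto
	  finally show ?thesis by (simp add: d_def mult.assoc)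
	qed
	have "log_enat (separation_number \<kappa> (rho_inf \<rho> (D n)) ?M) \<le> ereal (ln B)"
	proof (rule log_enat_separation_le)
	  fix S assume S: "finite S" "S \<subseteq> ?M" "pairwise (\<lambda>x y. rho_inf \<rho> (D n) x y \<ge> \<kappa>) S"
	  have "inj_on (\<lambda>\<phi>. (code1 \<phi>, code2 \<phi>)) S"
	  proof (rule inj_onI, rule ccontr)
	    fix \<phi> \<phi>' assume p: "\<phi> \<in> S" "\<phi>' \<in> S" "(code1 \<phi>, code2 \<phi>) = (code1 \<phi>', code2 \<phi>')" "\<phi> \<noteq> \<phi>'"
	    have pM: "\<phi> \<in> ?M" "\<phi>' \<in> ?M" using p S by auto
	    have cc: "code1 \<phi> v = code1 \<phi>' v" "code2 \<phi> x = code2 \<phi>' x" for v x using p(3) by auto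
	    have "\<rho> (\<phi> v) (\<phi>' v) < \<kappa>" if v: "v \<in> D n" for v
	    proof (rule W(2)[OF M[OF pM(1) v] M[OF pM(2) v]], rule ballI)
	      fix w assume w: "w \<in> W"
	      show "\<phi> v w = \<phi>' v w"
	      proof (cases "w \<in> ordered_simplices L q")
		case False
		have "\<phi> v \<in> cochains L q" "\<phi>' v \<in> cochains L q" using M pM v C(2) by auto
		then show ?thesis using cochainsD(1) False by metis
	      next
		case True
		show ?thesis
		proof (cases "good \<phi> v")
		  case g: True
		  then have g': "good \<phi>' v" using cc(1)[of v] v by (auto simp: code1_def split: if_splits)
		  have "(\<sigma> n (inv (fst (cpos w))) v, snd (cpos w)) \<in> D n \<times> {..<?m}"
		    using cW[OF True] v by simp
		  then show ?thesis
		    using det[OF pM(1) v g w True] det[OF pM(2) v g' w True]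
		      cc(2)[of "(\<sigma> n (inv (fst (cpos w))) v, snd (cpos w))"] by (simp add: code2_def)
		next
		  case g: False
		  then have "restrict (\<phi> v) W = restrict (\<phi>' v) W"
		    using cc(1)[of v] v by (auto simp: code1_def split: if_splits)
		  then show ?thesis using w by (metis restrict_apply')
		qed
	      qed
	    qed
	    then have "rho_inf \<rho> (D n) \<phi> \<phi>' < \<kappa>"
	      unfolding rho_inf_def using elim(2) by (subst Max_less_iff) auto
	    moreover have "\<kappa> \<le> rho_inf \<rho> (D n) \<phi> \<phi>'" using S(3) p by (auto simp: pairwise_def)
	    ultimately show False by simp
	  qed
	  moreover have "(\<lambda>\<phi>. (code1 \<phi>, code2 \<phi>)) ` S \<subseteq> ?U \<times> ?V"
	  proof (rule image_subsetI)
	    fix \<phi> assume "\<phi> \<in> S"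
	    then have pM: "\<phi> \<in> ?M" using S by auto
	    have "code1 \<phi> \<in> D n \<rightarrow>\<^sub>E \<Omega>" by (auto simp: code1_def \<Omega>_def)
	    moreover have "{v \<in> D n. code1 \<phi> v \<noteq> None} = {v \<in> D n. \<not> good \<phi> v}" by (auto simp: code1_def)
	    moreover have "code2 \<phi> \<in> ?V" by (simp add: code2_def)
	    ultimately show "(code1 \<phi>, code2 \<phi>) \<in> ?U \<times> ?V" using few[OF pM] by (simp add: d_def)
	  qed
	  moreover have finUV: "finite (?U \<times> ?V)"
	  proof -
	    have "finite ?U" by (rule finite_subset[OF _ finite_PiE[OF finite_D[of n], of "\<lambda>_. \<Omega>"]]) (use \<Omega> in auto)
	    then show ?thesis by (simp add: finite_PiE)
	  qed
	  ultimately have "card S \<le> card (?U \<times> ?V)" by (meson card_inj_on_le)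
	  then have "real (card S) \<le> real (card ?U) * real (card ?V)"
	    unfolding card_cartesian_product by (simp only: of_nat_le_iff of_nat_mult[symmetric])
	  also have "... \<le> exp (real (card (D n)) * (\<epsilon> * ln (1 / t) + t * real (card \<Omega>))) * real (card ?V)"
	    by (intro mult_right_mono card_few_exceptions) (use \<Omega> t in \<open>auto simp: \<Omega>_def\<close>)
	  also have "... = B" unfolding cV B_def d_def[symmetric] by (simp add: exp_add[symmetric] algebra_simps)
	  finally show "real (card S) \<le> B" .
	next
	  have "0 \<le> d * (\<epsilon> * ln (1 / t) + t * real (card \<Omega>) + real ?m * ln (real CARD('k)))"
	    using d \<epsilon> lt t K by (intro mult_nonneg_nonneg add_nonneg_nonneg) auto
	  then show "1 \<le> B" by (simp add: B_def)
	qed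
	then have "?h F \<delta> n \<le> ereal (ln B) / ereal d"
	  unfolding d_def[symmetric] using d by (intro ereal_divide_right_mono) auto
	also have "... = ereal (\<epsilon> * ln (1 / t) + t * real (card \<Omega>) + real ?m * ln (real CARD('k)))"
	  using d by (simp add: B_def)
	also have "... \<le> ereal (real ?m * ln (real CARD('k)) + e)" using \<epsilon>1 t1 by simp
	finally show ?case .
      qed
    qed
    moreover have "(INF \<delta>\<in>{0<..}. INF F\<in>{F. finite F \<and> F \<subseteq> carrier G}. limsup (?h F \<delta>)) \<le> limsup (?h F \<delta>)"
      using \<delta> F by (intro INF_lower2[of \<delta>] INF_lower) auto
    ultimately show "(INF \<delta>\<in>{0<..}. INF F\<in>{F. finite F \<and> F \<subseteq> carrier G}. limsup (?h F \<delta>)) \<le>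
	ereal (real ?m * ln (real CARD('k))) + ereal e"
      by (simp add: order_trans)
  qed
qed

end

section \<open>Lower bound for the entropy of cocycles\<close>

lemma ratio_le_one: "0 \<le> (r :: real) ==> r / (r + 1) \<le> 1"
  by (simp add: divide_le_eq)

context entropy_setting
begin

text \<open>The kernel over \<open>'k\<close> of the sofic model of the rows \<open>A r\<close> of the coboundary matrix.\<close>

definition cocycle_models :: "nat => 'r set => ('r => 'c list) => 'a set => ('e \<times> nat => 'k::field) set" where
  "cocycle_models n V A S = {y \<in> (D n \<times> {..<length ts}) \<rightarrow>\<^sub>E UNIV.
     \<forall>i\<in>D n \<times> V. (\<Sum>j\<in>D n \<times> {..<length ts}. of_int (model_matrix G S (\<lambda>r. bcoef (A r)) (\<sigma> n) i j) * y j) = 0}"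

lemma pullback_cocycle_at:
  fixes y :: "'e \<times> nat => 'k::field"
  assumes y: "y \<in> cocycle_models n V A S" and v: "v \<in> D n" and r: "r \<in> V" and Ar: "A r \<in> ordered_simplices L (Suc q)"
    and S: "finite S" "S \<subseteq> carrier G" "bsupp (A r) \<subseteq> S" and g: "g \<in> carrier G"
    and mult: "\<forall>h\<in>S. \<sigma> n (inv h) (\<sigma> n (inv g) v) = \<sigma> n (inv (g \<otimes> h)) v"
  shows "coboundary L (Suc q) (ext (pullback G (\<sigma> n) v y)) (map (act g) (A r)) = 0"
proof -
  let ?f = "ext (pullback G (\<sigma> n) v y)" and ?u = "\<sigma> n (inv g) v"
  have u: "?u \<in> D n" using g v by simp
  have "coboundary L (Suc q) ?f (map (act g) (A r)) = gop G {..<length ts} S (\<lambda>r. bcoef (A r)) (crd ?f) (g,r)"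
    by (rule gop_crd[where A = A and r = r, OF ext_cochain Ar g S(1) S(3) S(2), symmetric])
  also have "... = (\<Sum>t<length ts. \<Sum>h\<in>S. of_int (bcoef (A r) t h) * y (\<sigma> n (inv h) ?u, t))"
    unfolding gop_def prod.case
  proof (intro sum.cong refl)
    fix t h assume t: "t \<in> {..<length ts}" and h: "h \<in> S"
    have "crd ?f (g \<otimes> h, t) = y (\<sigma> n (inv (g \<otimes> h)) v, t)"
      using t h g S(2) by (subst crd_ext) (auto simp: pullback_def)
    then show "of_int (bcoef (A r) t h) * crd ?f (g \<otimes> h, t) = of_int (bcoef (A r) t h) * y (\<sigma> n (inv h) ?u, t)"
      using mult h by simp
  qed
  also have "... = (\<Sum>j\<in>D n \<times> {..<length ts}. of_int (model_matrix G S (\<lambda>r. bcoef (A r)) (\<sigma> n) (?u,r) j) * y j)"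
    by (rule model_matrix_row[symmetric]) (use u S(2) in \<open>auto intro!: sigma_in\<close>)
  also have "... = 0" using y u r unfolding cocycle_models_def by blast
  finally show ?thesis .
qed

lemma ext_pullback_reps:
  assumes "i < length ts" "v \<in> D n"
  shows "ext (pullback G (\<sigma> n) v y) (ts ! i) = y (v, i)"
proof -
  have "basic \<one> i = ts ! i" unfolding basic_def by (rule map_act_one) (rule reps_ord[OF assms(1)])
  then show ?thesis using ext_basic[of \<one> i "pullback G (\<sigma> n) v y"] assms(1) by (simp add: pullback_def sigma_one)
qed

lemma ext_pullback_shift:
  assumes w: "w \<in> ordered_simplices L q" and f: "f \<in> carrier G"
    and mult: "\<sigma> n (inv (fst (cpos w))) (\<sigma> n f v) = \<sigma> n (inv (fst (cpos w)) \<otimes> f) v"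
  shows "ext (pullback G (\<sigma> n) (\<sigma> n f v) y) w = ext (pullback G (\<sigma> n) v y) (map (act (inv f)) w)"
proof -
  obtain g i \<pi> where c: "is_coord w g i \<pi>" "cpos w = (g,i)" "csgn w = sign \<pi>" by (rule coord_cases[OF w])
  have g: "g \<in> carrier G" using c(1) by (simp add: is_coord_def)
  have fw: "map (act (inv f)) w \<in> ordered_simplices L q" using ord_act w f by simp
  note c' = coord_eq[OF is_coord_act[OF c(1) inv_closed[OF f]]]
  have "inv (inv f \<otimes> g) = inv g \<otimes> f" using f g by (simp add: inv_mult_group)
  then show ?thesis using mult w fw c c' by (simp add: ext_def pullback_def)
qed

text \<open>Forgetting the values at the bad points identifies at most \<open>CARD('k)\<close> to the number of bad coordinates many elements.\<close>

lemma cocycle_models_pigeonhole: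
  fixes Y :: "('e \<times> nat => 'k::{field,finite}) set"
  assumes Y: "Y \<subseteq> (D n \<times> {..<m}) \<rightarrow>\<^sub>E UNIV"
  obtains Z where "Z \<subseteq> Y" "inj_on (\<lambda>y. restrict y ({v \<in> D n. P v} \<times> {..<m})) Z"
    "card Y \<le> card Z * CARD('k) ^ (m * card {v \<in> D n. \<not> P v})"
proof -
  let ?G = "{v \<in> D n. P v} \<times> {..<m}" and ?B = "{v \<in> D n. \<not> P v} \<times> {..<m}"
  let ?R = "\<lambda>y :: 'e \<times> nat => 'k. restrict y ?G"
  have finY: "finite Y" using Y by (rule finite_subset) (simp add: finite_PiE)
  obtain Z where Z: "Z \<subseteq> Y" "inj_on ?R Z" "?R ` Y = ?R ` Z"
    using subset_image_inj[of "?R ` Y" ?R Y] by auto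
  have "inj_on (\<lambda>y. (?R y, restrict y ?B)) Y"
  proof (rule inj_onI)
    fix y y' assume y: "y \<in> Y" "y' \<in> Y" "(?R y, restrict y ?B) = (?R y', restrict y' ?B)"
    show "y = y'"
    proof (rule PiE_ext[of _ "D n \<times> {..<m}" "\<lambda>_. UNIV"])
      fix j assume j: "j \<in> D n \<times> {..<m}"
      have "?R y j = ?R y' j" "restrict y ?B j = restrict y' ?B j" using y(3) by auto
      then show "y j = y' j" using j by (auto split: if_splits)
    qed (use y Y in auto)
  qed
  moreover have rB: "restrict y ?B \<in> ?B \<rightarrow>\<^sub>E UNIV" for y :: "'e \<times> nat => 'k" by (simp add: restrict_PiE_iff)
  moreover have "(\<lambda>y. (?R y, restrict y ?B)) ` Y \<subseteq> ?R ` Y \<times> (?B \<rightarrow>\<^sub>E (UNIV :: 'k set))"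
    by (intro image_subsetI SigmaI imageI rB)
  moreover have "finite (?R ` Y \<times> (?B \<rightarrow>\<^sub>E (UNIV :: 'k set)))" using finY by (simp add: finite_PiE)
  ultimately have "card Y \<le> card (?R ` Y \<times> (?B \<rightarrow>\<^sub>E (UNIV :: 'k set)))" by (meson card_inj_on_le)
  also have "... = card Z * CARD('k) ^ (m * card {v \<in> D n. \<not> P v})"
    unfolding Z(3) card_cartesian_product card_image[OF Z(2)] by (simp add: card_PiE card_cartesian_product mult.commute)
  finally show ?thesis using that Z by blast
qed

lemma separation_transfer:
  fixes a :: real
  assumes tri: "\<And>x y z. x \<in> C ==> y \<in> C ==> z \<in> C ==> \<rho> x z \<le> \<rho> x y + \<rho> y z"
    and sym: "\<And>x y. x \<in> C ==> y \<in> C ==> \<rho> x y = \<rho> y x"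
    and C: "x \<in> C" "x' \<in> C" "y \<in> C" "y' \<in> C"
    and "3 * a \<le> \<rho> x y" "\<rho> x' x < a" "\<rho> y' y < a"
  shows "a \<le> \<rho> x' y'"
proof -
  have "\<rho> x y \<le> \<rho> x x' + \<rho> x' y" "\<rho> x' y \<le> \<rho> x' y' + \<rho> y' y" "\<rho> x x' = \<rho> x' x"
    using tri sym C by blast+
  then show ?thesis using assms(7-9) by linarith
qed

lemma rho_2_less:
  assumes A: "finite A" "A \<noteq> {}" and \<delta>: "0 < \<delta>" and B: "0 < B"
    and good: "\<And>v. v \<in> A ==> P v ==> 0 \<le> \<rho> (x v) (y v) \<and> \<rho> (x v) (y v) \<le> \<delta> / 2"
    and bad: "\<And>v. v \<in> A ==> 0 \<le> \<rho> (x v) (y v) \<and> \<rho> (x v) (y v) \<le> B"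
    and few: "real (card {v \<in> A. \<not> P v}) \<le> t * real (card A)" and t: "t * B\<^sup>2 \<le> \<delta>\<^sup>2 / 4"
  shows "rho_2 \<rho> A x y < \<delta>"
proof -
  have dA: "0 < real (card A)" using A by (simp add: card_gt_0_iff)
  have "(\<Sum>v\<in>A. (\<rho> (x v) (y v))\<^sup>2) \<le> (\<Sum>v\<in>A. (\<delta> / 2)\<^sup>2 + (if \<not> P v then B\<^sup>2 else 0))"
  proof (rule sum_mono)
    fix v assume v: "v \<in> A"
    show "(\<rho> (x v) (y v))\<^sup>2 \<le> (\<delta> / 2)\<^sup>2 + (if \<not> P v then B\<^sup>2 else 0)"
    proof (cases "P v")
      case True
      then show ?thesis using good[OF v] by (simp add: power_mono)
    next
      case False
      have "(\<rho> (x v) (y v))\<^sup>2 \<le> B\<^sup>2" using bad[OF v] by (intro power_mono) auto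
      moreover have "0 \<le> (\<delta> / 2)\<^sup>2" by (rule zero_le_power2)
      moreover have "(if \<not> P v then B\<^sup>2 else 0) = B\<^sup>2" using False by simp
      ultimately show ?thesis by linarith
    qed
  qed
  also have "... = real (card A) * (\<delta> / 2)\<^sup>2 + (\<Sum>v\<in>A. if \<not> P v then B\<^sup>2 else 0)"
    by (simp add: sum.distrib)
  also have "(\<Sum>v\<in>A. if \<not> P v then B\<^sup>2 else 0) = real (card {v \<in> A. \<not> P v}) * B\<^sup>2"
    using A by (simp add: sum.inter_filter[symmetric])
  also have "... \<le> t * real (card A) * B\<^sup>2" using few by (rule mult_right_mono) simp
  also have "... = real (card A) * (t * B\<^sup>2)" by simp
  also have "... \<le> real (card A) * (\<delta>\<^sup>2 / 4)" using t by (intro mult_left_mono) auto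
  also have "real (card A) * (\<delta> / 2)\<^sup>2 + real (card A) * (\<delta>\<^sup>2 / 4) = real (card A) * (\<delta>\<^sup>2 / 2)"
    by (simp add: power2_eq_square field_simps)
  also have "... < real (card A) * \<delta>\<^sup>2" using dA \<delta> by (intro mult_strict_left_mono) auto
  finally have "(\<Sum>v\<in>A. (\<rho> (x v) (y v))\<^sup>2) / real (card A) < \<delta>\<^sup>2"
    using dA by (simp add: pos_divide_less_eq mult.commute)
  then show ?thesis unfolding rho_2_def using \<delta> by (intro real_less_lsqrt) auto
qed

text \<open>The equations of the rows in \<open>V\<close>, translated and up to sign, include the cocycle equations at all simplices of \<open>V0\<close>.\<close>

definition covers_coboundaries :: "'r set => ('r => 'c list) => 'a set => 'c list set => bool" where
  "covers_coboundaries V A S V0 \<longleftrightarrow> finite V \<and> finite S \<and> S \<subseteq> carrier G \<and>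
     (\<forall>r\<in>V. A r \<in> ordered_simplices L (Suc q) \<and> bsupp (A r) \<subseteq> S) \<and>
     (\<forall>s\<in>V0. \<exists>r\<in>V. \<exists>g\<in>carrier G. \<exists>\<pi>. \<pi> permutes {..<length (A r)} \<and> s = permute_list \<pi> (map (act g) (A r)))"

lemma pullback_cocycle_on:
  assumes cov: "covers_coboundaries V A S V0" and V0: "finite V0"
  obtains P where "finite P" "P \<subseteq> carrier G"
    "\<And>n v (y :: 'e \<times> nat => 'k::field). y \<in> cocycle_models n V A S ==> v \<in> D n ==>
       \<forall>p\<in>P \<times> S. \<sigma> n (inv (snd p)) (\<sigma> n (inv (fst p)) v) = \<sigma> n (inv (fst p \<otimes> snd p)) v ==>
       \<forall>s\<in>V0. coboundary L (Suc q) (ext (pullback G (\<sigma> n) v y)) s = 0"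
proof -
  have S: "finite S" "S \<subseteq> carrier G" using cov by (auto simp: covers_coboundaries_def)
  have "\<forall>s\<in>V0. \<exists>g\<in>carrier G. \<exists>r\<in>V. \<exists>\<pi>. \<pi> permutes {..<length (A r)} \<and> s = permute_list \<pi> (map (act g) (A r))"
    using cov unfolding covers_coboundaries_def by blast
  then obtain gs where gs: "\<And>s. s \<in> V0 ==> gs s \<in> carrier G"
    "\<And>s. s \<in> V0 ==> \<exists>r\<in>V. \<exists>\<pi>. \<pi> permutes {..<length (A r)} \<and> s = permute_list \<pi> (map (act (gs s)) (A r))"
    by (metis bchoice)
  show ?thesis
  proof (rule that[of "gs ` V0"])
    show "finite (gs ` V0)" "gs ` V0 \<subseteq> carrier G" using V0 gs(1) by auto
    fix n v and y :: "'e \<times> nat => 'k"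
    assume y: "y \<in> cocycle_models n V A S" and v: "v \<in> D n"
      and mult: "\<forall>p\<in>gs ` V0 \<times> S. \<sigma> n (inv (snd p)) (\<sigma> n (inv (fst p)) v) = \<sigma> n (inv (fst p \<otimes> snd p)) v"
    let ?f = "ext (pullback G (\<sigma> n) v y)"
    show "\<forall>s\<in>V0. coboundary L (Suc q) ?f s = 0"
    proof
      fix s assume s: "s \<in> V0"
      obtain r \<pi> where r: "r \<in> V" "\<pi> permutes {..<length (A r)}" "s = permute_list \<pi> (map (act (gs s)) (A r))"
	using gs(2)[OF s] by blast
      have Ar: "A r \<in> ordered_simplices L (Suc q)" "bsupp (A r) \<subseteq> S"
	using cov r(1) by (auto simp: covers_coboundaries_def)
      have "\<forall>h\<in>S. \<sigma> n (inv h) (\<sigma> n (inv (gs s)) v) = \<sigma> n (inv (gs s \<otimes> h)) v"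
	using mult s by force
      then have 0: "coboundary L (Suc q) ?f (map (act (gs s)) (A r)) = 0"
	by (rule pullback_cocycle_at[OF y v r(1) Ar(1) S Ar(2) gs(1)[OF s]])
      have o: "map (act (gs s)) (A r) \<in> ordered_simplices L (Suc q)" by (rule ord_act[OF gs(1)[OF s] Ar(1)])
      have c: "coboundary L (Suc q) ?f \<in> cochains L (Suc q)" by (rule coboundary_cochain[OF complex ext_cochain])
      have pi: "\<pi> permutes {..<length (map (act (gs s)) (A r))}" using r(2) by simp
      have "coboundary L (Suc q) ?f s = of_int (sign \<pi>) * coboundary L (Suc q) ?f (map (act (gs s)) (A r))"
	using cochainsD(2)[OF c o pi] by (simp only: r(3)[symmetric])
      then show "coboundary L (Suc q) ?f s = 0" by (simp add: 0)
    qed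
  qed
qed

text \<open>For a kernel vector \<open>y\<close> let \<open>\<phi> y v\<close> be a cocycle that agrees on \<open>W\<close> with the pullback of \<open>y\<close> at \<open>v\<close>. It exists at good
points, where \<open>y\<close> is recovered from it. The maps \<open>\<phi> y\<close> are approximately equivariant, and two of them are separated if the
vectors differ at a good point.\<close>

lemma entropy_lower_bound:
  fixes \<rho> :: "('c list => 'k::{field,finite}) => ('c list => 'k) => real" and c :: real
  assumes gen: "generating_pseudometric G (pointwise_topology (ker_coboundary L (Suc q) :: ('c list => 'k) set)) \<alpha> \<rho>"
    and models: "\<And>V0. finite V0 ==> V0 \<subseteq> ordered_simplices L (Suc q) ==>
      \<exists>(V :: 'r set) A S. covers_coboundaries V A S V0 \<and>
	(\<forall>\<epsilon>>0. eventually (\<lambda>n. real (card (D n)) * ((c - \<epsilon>) * ln (real CARD('k)))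
	  \<le> ln (real (card (cocycle_models n V A S :: ('e \<times> nat => 'k) set)))) sequentially)"
  shows "ereal (c * ln (real CARD('k))) \<le>
    sofic_entropy_wrt \<rho> G D \<sigma> (pointwise_topology (ker_coboundary L (Suc q) :: ('c list => 'k) set)) \<alpha>"
proof -
  let ?C = "ker_coboundary L (Suc q) :: ('c list => 'k) set"
  let ?X = "pointwise_topology ?C" and ?m = "length ts" and ?l = "ln (real CARD('k))" and ?\<Lambda> = "ordered_simplices L q"
  note C = closed_ker_coboundary[of L q]
  have l0: "0 \<le> ?l" by (simp add: Suc_le_eq card_gt_0_iff)
  have r1: "\<rho> x x = 0" "0 \<le> \<rho> x y" "\<rho> x y = \<rho> y x" if "x \<in> ?C" "y \<in> ?C" for x y
    using gen that unfolding generating_pseudometric_def topspace_pointwise by blast+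
  have tri: "\<rho> x z \<le> \<rho> x y + \<rho> y z" if "x \<in> ?C" "y \<in> ?C" "z \<in> ?C" for x y z
    using gen that unfolding generating_pseudometric_def topspace_pointwise by blast
  obtain B where B: "0 < B" "\<And>f f'. f \<in> ?C ==> f' \<in> ?C ==> \<rho> f f' \<le> B" using rho_bounded[OF C gen] by blast
  obtain F0 \<eta> where F0: "finite F0" "F0 \<subseteq> carrier G" and \<eta>: "0 < \<eta>"
    and sep: "\<And>f f'. f \<in> ?C ==> f' \<in> ?C ==> \<exists>w\<in>set ts. f w \<noteq> f' w ==> \<exists>h\<in>F0. \<eta> \<le> \<rho> (\<alpha> h f) (\<alpha> h f')"
    using separation_window[OF C gen action_ker finite_set[of ts]] by blast
  \<comment> \<open>One third each for the defects of equivariance of the two maps and for the separation that remains.\<close>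
  define \<kappa> where "\<kappa> = \<eta> / 3"
  have \<kappa>: "0 < \<kappa>" using \<eta> by (simp add: \<kappa>_def)
  let ?h = "\<lambda>F \<delta> n. log_enat (separation_number \<kappa> (rho_inf \<rho> (D n)) (approx_equivariant_maps ?X \<alpha> \<rho> F \<delta> (D n) (\<sigma> n))) / ereal (real (card (D n)))"
  have main: "ereal (c * ?l) \<le> limsup (?h F \<delta>)" if \<delta>: "0 < \<delta>" and F: "finite F" "F \<subseteq> carrier G" for F \<delta>
  proof (rule ereal_le_epsilon2)
    fix e :: real assume e: "0 < e"
    obtain W1 where W1: "finite W1" "\<And>f f'. f \<in> ?C ==> f' \<in> ?C ==> \<forall>w\<in>W1. f w = f' w ==> \<rho> f f' < min (\<delta> / 2) \<kappa>"
      using window[OF C gen, of "min (\<delta> / 2) \<kappa>"] \<delta> \<kappa> by (metis half_gt_zero min_less_iff_conj)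
    define F1 where "F1 = F \<union> F0"
    have F1: "finite F1" "F1 \<subseteq> carrier G" using F F0 by (auto simp: F1_def)
    \<comment> \<open>Agreement with the pullback is needed on the window \<open>W1\<close>, on the representatives, and on translates of \<open>W1\<close>.\<close>
    define W where "W = W1 \<union> set ts \<union> (\<Union>f\<in>F1. map (act (inv f)) ` (W1 \<inter> ?\<Lambda>))"
    have finW: "finite W" using W1(1) F1(1) by (auto simp: W_def)
    obtain V0 where V0: "finite V0" "V0 \<subseteq> ordered_simplices L (Suc q)"
      "\<And>f :: 'c list => 'k. f \<in> cochains L q ==> \<forall>s\<in>V0. coboundary L (Suc q) f s = 0 ==> \<exists>f'\<in>?C. \<forall>w\<in>W. f' w = f w"
      by ((rule extension_window[OF finW]; assumption) | (rule extension_window[OF finW]; blast) | (rule extension_window[OF finW]; metis))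
    obtain V :: "'r set" and A S where cov: "covers_coboundaries V A S V0"
      and cardK: "\<And>\<epsilon>. 0 < \<epsilon> ==> eventually (\<lambda>n. real (card (D n)) * ((c - \<epsilon>) * ?l)
	  \<le> ln (real (card (cocycle_models n V A S :: ('e \<times> nat => 'k) set)))) sequentially"
      using models[OF V0(1,2)] by blast
    have S: "finite S" "S \<subseteq> carrier G" using cov by (auto simp: covers_coboundaries_def)
    obtain P where P: "finite P" "P \<subseteq> carrier G"
      and coc: "\<And>n v (y :: 'e \<times> nat => 'k). y \<in> cocycle_models n V A S ==> v \<in> D n ==>
       \<forall>p\<in>P \<times> S. \<sigma> n (inv (snd p)) (\<sigma> n (inv (fst p)) v) = \<sigma> n (inv (fst p \<otimes> snd p)) v ==>
       \<forall>s\<in>V0. coboundary L (Suc q) (ext (pullback G (\<sigma> n) v y)) s = 0"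
      by ((rule pullback_cocycle_on[OF cov V0(1)]; assumption) | (rule pullback_cocycle_on[OF cov V0(1)]; blast))
    define good0 where "good0 n v \<longleftrightarrow> (\<forall>p\<in>P \<times> S. \<sigma> n (inv (snd p)) (\<sigma> n (inv (fst p)) v) = \<sigma> n (inv (fst p \<otimes> snd p)) v)" for n v
    define good1 where "good1 n v \<longleftrightarrow> (\<forall>p\<in>F1 \<times> (W1 \<inter> ?\<Lambda>). \<sigma> n (inv (fst (cpos (snd p)))) (\<sigma> n (fst p) v) =
	\<sigma> n (inv (fst (cpos (snd p))) \<otimes> fst p) v)" for n v
    define good where "good n v \<longleftrightarrow> good0 n v \<and> good1 n v \<and> (\<forall>f\<in>F1. good0 n (\<sigma> n f v))" for n v
    have cW: "fst (cpos w) \<in> carrier G" if w: "w \<in> ?\<Lambda>" for w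
    proof -
      obtain g i \<pi> where "is_coord w g i \<pi>" "cpos w = (g,i)" "csgn w = sign \<pi>" by (rule coord_cases[OF w])
      then show ?thesis by (simp add: is_coord_def)
    qed
    have m0: "most D good0"
      unfolding good0_def
    proof (rule most_finite_ball_D)
      show "finite (P \<times> S)" using P S by simp
      fix p assume p: "p \<in> P \<times> S"
      then have "fst p \<in> carrier G" "snd p \<in> carrier G" using P S by auto
      then show "most D (\<lambda>n v. \<sigma> n (inv (snd p)) (\<sigma> n (inv (fst p)) v) = \<sigma> n (inv (fst p \<otimes> snd p)) v)"
	using most_mult[of "inv (snd p)" "inv (fst p)"] by (simp add: inv_mult_group)
    qed
    have m1: "most D good1"
      unfolding good1_def by (rule most_finite_ball_D) (use F1 W1(1) cW in \<open>auto intro!: most_mult\<close>)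
    have m2: "most D (\<lambda>n v. \<forall>f\<in>F1. good0 n (\<sigma> n f v))"
      by (rule most_finite_ball_D[OF F1(1)]) (rule most_shift[OF m0], use F1 in blast)
    have mgood: "most D good"
      unfolding good_def by (rule most_conj_D[OF m0 most_conj_D[OF m1 m2]])
    define t where "t = min (\<delta>\<^sup>2 / 4 / B\<^sup>2) (e / 2 / (real ?m * ?l + 1))"
    have ml: "0 \<le> real ?m * ?l" using l0 by simp
    have t: "0 < t" using \<delta> B e ml unfolding t_def by (simp add: divide_pos_pos add_nonneg_pos)
    have tB: "t * B\<^sup>2 \<le> \<delta>\<^sup>2 / 4"
    proof -
      have "t * B\<^sup>2 \<le> \<delta>\<^sup>2 / 4 / B\<^sup>2 * B\<^sup>2" unfolding t_def by (intro mult_right_mono) auto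
      then show ?thesis using B by simp
    qed
    have tm: "t * (real ?m * ?l) \<le> e / 2"
    proof -
      have "t * (real ?m * ?l) \<le> e / 2 / (real ?m * ?l + 1) * (real ?m * ?l)" unfolding t_def using ml by (intro mult_right_mono) auto
      also have "... = e / 2 * ((real ?m * ?l) / (real ?m * ?l + 1))" by simp
      also have "... \<le> e / 2 * 1" using e by (intro mult_left_mono ratio_le_one ml) auto
      finally show ?thesis by simp
    qed
    define \<epsilon> where "\<epsilon> = e / 2 / (?l + 1)"
    have \<epsilon>: "0 < \<epsilon>" using e unfolding \<epsilon>_def by (intro divide_pos_pos add_nonneg_pos l0) auto
    have \<epsilon>l: "\<epsilon> * ?l \<le> e / 2"
    proof -
      have "\<epsilon> * ?l = e / 2 * (?l / (?l + 1))" by (simp add: \<epsilon>_def)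
      also have "... \<le> e / 2 * 1" using e by (intro mult_left_mono ratio_le_one l0) auto
      finally show ?thesis by simp
    qed
    have ev: "eventually (\<lambda>n. real (card {v \<in> D n. \<not> good n v}) \<le> t * real (card (D n))) sequentially"
      using most_eventually[OF mgood t D_nonempty] by simp
    have "ereal (c * ?l - e) \<le> limsup (?h F \<delta>)"
    proof (rule le_Limsup)
      show "eventually (\<lambda>n. ereal (c * ?l - e) \<le> ?h F \<delta> n) sequentially"
	using ev D_nonempty cardK[OF \<epsilon>]
      proof eventually_elim
	case (elim n)
	let ?d = "real (card (D n))"
	have d: "0 < ?d" using elim(2) by (simp add: card_gt_0_iff)
	let ?M = "approx_equivariant_maps ?X \<alpha> \<rho> F \<delta> (D n) (\<sigma> n)"
	let ?K = "cocycle_models n V A S :: ('e \<times> nat => 'k) set"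
	define \<Psi> where "\<Psi> y v = ext (pullback G (\<sigma> n) v y)" for y :: "'e \<times> nat => 'k" and v
	\<comment> \<open>At bad points the value is irrelevant; \<open>0\<close> is a cocycle.\<close>
	define \<phi> where "\<phi> y = (\<lambda>v\<in>D n. if \<exists>f'\<in>?C. \<forall>w\<in>W. f' w = \<Psi> y v w
	    then SOME f'. f' \<in> ?C \<and> (\<forall>w\<in>W. f' w = \<Psi> y v w) else (\<lambda>_. 0))" for y
	have zero: "(\<lambda>_. 0) \<in> ?C" by (auto simp: ker_coboundary_def cochains_def coboundary_def fun_eq_iff)
	have phi_ex: "\<phi> y v \<in> ?C \<and> (\<forall>w\<in>W. \<phi> y v w = \<Psi> y v w)" if v: "v \<in> D n" and ex: "\<exists>f'\<in>?C. \<forall>w\<in>W. f' w = \<Psi> y v w" for y v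
	proof -
	  have "\<exists>f'. f' \<in> ?C \<and> (\<forall>w\<in>W. f' w = \<Psi> y v w)" using ex by blast
	  from someI_ex[OF this] show ?thesis using v ex by (simp add: \<phi>_def)
	qed
	have phiC: "\<phi> y v \<in> ?C" if v: "v \<in> D n" for y v
	proof (cases "\<exists>f'\<in>?C. \<forall>w\<in>W. f' w = \<Psi> y v w")
	  case True
	  then show ?thesis using phi_ex[OF v] by blast
	next
	  case False
	  then show ?thesis using v zero by (simp only: \<phi>_def restrict_apply' if_False)
	qed
	have phiW: "\<phi> y v w = \<Psi> y v w" if y: "y \<in> ?K" and v: "v \<in> D n" "good0 n v" and w: "w \<in> W" for y v w
	proof -
	  have "\<forall>s\<in>V0. coboundary L (Suc q) (\<Psi> y v) s = 0"
	    unfolding \<Psi>_def by (rule coc[OF y v(1)]) (use v(2) in \<open>simp only: good0_def\<close>)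
	  then have "\<exists>f'\<in>?C. \<forall>w\<in>W. f' w = \<Psi> y v w" by (intro V0(3)) (simp_all add: \<Psi>_def ext_cochain)
	  then show ?thesis using phi_ex[OF v(1)] w by blast
	qed
	have near: "\<rho> (\<phi> y (\<sigma> n f v)) (\<alpha> f (\<phi> y v)) < min (\<delta> / 2) \<kappa>"
	  if y: "y \<in> ?K" and v: "v \<in> D n" "good n v" and f: "f \<in> F1" for y v f
	proof (rule W1(2))
	  have fc: "f \<in> carrier G" using f F1 by blast
	  have fv: "\<sigma> n f v \<in> D n" using fc v by simp
	  show a: "\<phi> y (\<sigma> n f v) \<in> ?C" "\<alpha> f (\<phi> y v) \<in> ?C" using phiC fv v action_ker[OF fc] by auto
	  show "\<forall>w\<in>W1. \<phi> y (\<sigma> n f v) w = \<alpha> f (\<phi> y v) w"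
	  proof
	    fix w assume w: "w \<in> W1"
	    show "\<phi> y (\<sigma> n f v) w = \<alpha> f (\<phi> y v) w"
	    proof (cases "w \<in> ?\<Lambda>")
	      case True
	      have W': "w \<in> W" "map (act (inv f)) w \<in> W" using w True f by (auto simp: W_def)
	      have g0: "good0 n v" "good0 n (\<sigma> n f v)" using v(2) f by (auto simp: good_def)
	      have "(f, w) \<in> F1 \<times> (W1 \<inter> ?\<Lambda>)" "good1 n v" using f w True v(2) by (auto simp: good_def)
	      then have "\<sigma> n (inv (fst (cpos w))) (\<sigma> n f v) = \<sigma> n (inv (fst (cpos w)) \<otimes> f) v"
		unfolding good1_def by force
	      then have "\<Psi> y (\<sigma> n f v) w = \<Psi> y v (map (act (inv f)) w)"
		unfolding \<Psi>_def by (rule ext_pullback_shift[OF True fc])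
	      then show ?thesis
		using phiW[OF y fv g0(2) W'(1)] phiW[OF y v(1) g0(1) W'(2)] True by (simp add: cochain_action_def)
	    next
	      case False
	      have "\<phi> y (\<sigma> n f v) \<in> cochains L q" "\<alpha> f (\<phi> y v) \<in> cochains L q" using a by (auto simp: ker_coboundary_def)
	      then show ?thesis using cochainsD(1) False by metis
	    qed
	  qed
	qed
	have phiM: "\<phi> y \<in> ?M" if y: "y \<in> ?K" for y
	  unfolding approx_equivariant_maps_def topspace_pointwise
	proof (intro CollectI conjI ballI)
	  show "\<phi> y \<in> D n \<rightarrow>\<^sub>E ?C" using phiC by (auto simp: \<phi>_def)
	  fix f assume f: "f \<in> F"
	  then have fc: "f \<in> carrier G" "f \<in> F1" using F by (auto simp: F1_def)
	  show "rho_2 \<rho> (D n) (\<lambda>i. \<phi> y (\<sigma> n f i)) (\<lambda>i. \<alpha> f (\<phi> y i)) < \<delta>"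
	  proof (rule rho_2_less[OF finite_D elim(2) \<delta> B(1) _ _ elim(1) tB])
	    fix v assume v: "v \<in> D n"
	    have c: "\<phi> y (\<sigma> n f v) \<in> ?C" "\<alpha> f (\<phi> y v) \<in> ?C" using phiC v fc action_ker[OF fc(1)] by auto
	    show "0 \<le> \<rho> (\<phi> y (\<sigma> n f v)) (\<alpha> f (\<phi> y v)) \<and> \<rho> (\<phi> y (\<sigma> n f v)) (\<alpha> f (\<phi> y v)) \<le> B"
	      using r1(2)[OF c] B(2)[OF c] by simp
	    assume "good n v"
	    then show "0 \<le> \<rho> (\<phi> y (\<sigma> n f v)) (\<alpha> f (\<phi> y v)) \<and> \<rho> (\<phi> y (\<sigma> n f v)) (\<alpha> f (\<phi> y v)) \<le> \<delta> / 2"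
	      using near[OF y v _ fc(2)] r1(2)[OF c] by simp
	  qed
	qed
	have Ksub: "?K \<subseteq> (D n \<times> {..<?m}) \<rightarrow>\<^sub>E UNIV" by (auto simp: cocycle_models_def)
	let ?R = "\<lambda>y :: 'e \<times> nat => 'k. restrict y ({v \<in> D n. good n v} \<times> {..<?m})"
	let ?b = "card {v \<in> D n. \<not> good n v}"
	obtain Z where Z: "Z \<subseteq> ?K" "inj_on ?R Z" "card ?K \<le> card Z * CARD('k) ^ (?m * ?b)"
	  by (rule cocycle_models_pigeonhole[OF Ksub, where P = "good n"])
	have finZ: "finite Z"
	  by (rule finite_subset[OF order_trans[OF Z(1) Ksub]]) (simp add: finite_PiE)
	have diff: "\<phi> y \<noteq> \<phi> y' \<and> \<kappa> \<le> rho_inf \<rho> (D n) (\<phi> y) (\<phi> y')" if yy: "y \<in> Z" "y' \<in> Z" "y \<noteq> y'" for y y'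
	proof -
	  have K: "y \<in> ?K" "y' \<in> ?K" using yy Z(1) by auto
	  have "?R y \<noteq> ?R y'" using Z(2) yy by (auto simp: inj_on_def)
	  then obtain v i where vi: "v \<in> D n" "good n v" "i < ?m" "y (v,i) \<noteq> y' (v,i)"
	    by (auto simp: fun_eq_iff restrict_def split: if_splits)
	  have g0: "good0 n v" using vi(2) by (simp add: good_def)
	  have tsW: "ts ! i \<in> W" "ts ! i \<in> set ts" using vi(3) by (auto simp: W_def)
	  have val: "\<phi> y v (ts ! i) = y (v,i)" "\<phi> y' v (ts ! i) = y' (v,i)"
	    using phiW[OF K(1) vi(1) g0 tsW(1)] phiW[OF K(2) vi(1) g0 tsW(1)] ext_pullback_reps[OF vi(3,1)]
	    by (simp_all add: \<Psi>_def)
	  then have ne: "\<phi> y v (ts ! i) \<noteq> \<phi> y' v (ts ! i)" using vi(4) by simp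
	  then obtain h where h: "h \<in> F0" "\<eta> \<le> \<rho> (\<alpha> h (\<phi> y v)) (\<alpha> h (\<phi> y' v))"
	    using sep[OF phiC[OF vi(1)] phiC[OF vi(1)]] tsW(2) by blast
	  have hc: "h \<in> carrier G" "h \<in> F1" using h F0 by (auto simp: F1_def)
	  have u: "\<sigma> n h v \<in> D n" using hc vi by simp
	  have "\<kappa> \<le> \<rho> (\<phi> y (\<sigma> n h v)) (\<phi> y' (\<sigma> n h v))"
	  proof (rule separation_transfer[where C = ?C and x = "\<alpha> h (\<phi> y v)" and y = "\<alpha> h (\<phi> y' v)"])
	    show "3 * \<kappa> \<le> \<rho> (\<alpha> h (\<phi> y v)) (\<alpha> h (\<phi> y' v))" using h(2) by (simp add: \<kappa>_def)
	    show "\<rho> (\<phi> y (\<sigma> n h v)) (\<alpha> h (\<phi> y v)) < \<kappa>" "\<rho> (\<phi> y' (\<sigma> n h v)) (\<alpha> h (\<phi> y' v)) < \<kappa>"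
	      using near[OF K(1) vi(1,2) hc(2)] near[OF K(2) vi(1,2) hc(2)] by auto
	  qed (use tri r1(3) phiC[OF u] action_ker[OF hc(1) phiC[OF vi(1)]] in auto)
	  also have "... \<le> rho_inf \<rho> (D n) (\<phi> y) (\<phi> y')"
	    unfolding rho_inf_def by (rule Max_ge) (use u in auto)
	  finally show ?thesis using ne by auto
	qed
	have zK: "(\<lambda>j\<in>D n \<times> {..<?m}. 0) \<in> ?K" by (auto simp: cocycle_models_def)
	have finK: "finite ?K" by (rule finite_subset[OF Ksub]) (simp add: finite_PiE)
	have K0: "0 < card ?K" using zK finK by (auto simp: card_gt_0_iff)
	have Z0: "0 < card Z" using K0 Z(3) by (cases "card Z") auto
	have injZ: "inj_on \<phi> Z" using diff by (auto simp: inj_on_def)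
	have k1: "1 \<le> real CARD('k)" by (simp add: Suc_le_eq card_gt_0_iff)
	have "real (card ?K) \<le> real (card Z * CARD('k) ^ (?m * ?b))" using Z(3) by (simp only: of_nat_le_iff)
	then have "ln (real (card ?K)) \<le> ln (real (card Z) * real CARD('k) ^ (?m * ?b))" using K0 by (subst ln_le_cancel_iff) auto
	also have "... = ln (real (card Z)) + real (?m * ?b) * ?l"
	  using Z0 k1 by (simp add: ln_mult ln_realpow)
	also have "real (?m * ?b) * ?l = real ?b * (real ?m * ?l)" by simp
	also have "... \<le> t * ?d * (real ?m * ?l)" using elim(1) ml by (rule mult_right_mono)
	also have "... = ?d * (t * (real ?m * ?l))" by simp
	also have "... \<le> ?d * (e / 2)" using tm d by (intro mult_left_mono) auto
	finally have "?d * ((c - \<epsilon>) * ?l) - ?d * (e / 2) \<le> ln (real (card Z))" using elim(3) by linarith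
	moreover have "?d * (c * ?l - e) \<le> ?d * ((c - \<epsilon>) * ?l) - ?d * (e / 2)"
	proof -
	  have "?d * (\<epsilon> * ?l) \<le> ?d * (e / 2)" using \<epsilon>l d by (intro mult_left_mono) auto
	  then show ?thesis by (simp add: algebra_simps)
	qed
	ultimately have "?d * (c * ?l - e) \<le> ln (real (card (\<phi> ` Z)))" using card_image[OF injZ] by simp
	then have "ereal (?d * (c * ?l - e)) \<le> ereal (ln (real (card (\<phi> ` Z))))" by simp
	also have "... \<le> log_enat (separation_number \<kappa> (rho_inf \<rho> (D n)) ?M)"
	proof (rule log_enat_separation_ge)
	  show "finite (\<phi> ` Z)" using finZ by simp
	  show "\<phi> ` Z \<subseteq> ?M" using phiM Z(1) by auto
	  show "0 < card (\<phi> ` Z)" using Z0 card_image[OF injZ] by simp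
	  show "pairwise (\<lambda>x y. \<kappa> \<le> rho_inf \<rho> (D n) x y) (\<phi> ` Z)" using diff by (auto simp: pairwise_def)
	qed
	finally have "ereal (?d * (c * ?l - e)) / ereal ?d \<le> ?h F \<delta> n" using d by (intro ereal_divide_right_mono) auto
	then show ?case using d elim(2) by simp
      qed
    qed simp
    then have "ereal (c * ?l - e) + ereal e \<le> limsup (?h F \<delta>) + ereal e" by (rule add_right_mono)
    then show "ereal (c * ?l) \<le> limsup (?h F \<delta>) + ereal e" by simp
  qed
  show ?thesis
    unfolding sofic_entropy_wrt_def
    by (rule SUP_upper2[of \<kappa>]) (use \<kappa> main in \<open>auto intro!: INF_greatest\<close>)
qed

end

section \<open>Von Neumann dimension\<close>

definition l2_closure :: "('b => complex) set => ('b => complex) set" where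
  "l2_closure M = {f. square_summable f \<and> (\<forall>e>0. \<exists>y\<in>M. sqn (\<lambda>x. f x - y x) < e)}"

lemma closed_subspace_closure:
  assumes zero: "(\<lambda>_. 0) \<in> M" and sq: "\<And>f. f \<in> M ==> square_summable f"
    and add: "\<And>f g. f \<in> M ==> g \<in> M ==> (\<lambda>x. f x + g x) \<in> M" and scale: "\<And>c f. f \<in> M ==> (\<lambda>x. c * f x) \<in> M"
  shows "closed_subspace (l2_closure M)"
  unfolding closed_subspace_def
proof (intro conjI ballI allI impI)
  show "(\<lambda>_. 0) \<in> l2_closure M" using zero by (force simp: l2_closure_def)
  show "square_summable f" if "f \<in> l2_closure M" for f using that by (simp add: l2_closure_def)
  show "(\<lambda>x. f x + g x) \<in> l2_closure M" if fg: "f \<in> l2_closure M" "g \<in> l2_closure M" for f g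
    unfolding l2_closure_def
  proof (intro CollectI conjI allI impI)
    show "square_summable (\<lambda>x. f x + g x)" using fg by (simp add: l2_closure_def square_summable_add)
    fix e :: real assume e: "0 < e"
    then have e4: "0 < e / 4" by simp
    obtain y where y: "y \<in> M" "sqn (\<lambda>x. f x - y x) < e / 4" using fg(1) e4 unfolding l2_closure_def by blast
    obtain z where z: "z \<in> M" "sqn (\<lambda>x. g x - z x) < e / 4" using fg(2) e4 unfolding l2_closure_def by blast
    have "sqn (\<lambda>x. (f x - y x) + (g x - z x)) \<le> 2 * sqn (\<lambda>x. f x - y x) + 2 * sqn (\<lambda>x. g x - z x)"
      using fg sq y(1) z(1) by (intro sqn_add_le square_summable_diff) (auto simp: l2_closure_def)
    moreover have "(\<lambda>x. (f x - y x) + (g x - z x)) = (\<lambda>x. (f x + g x) - (y x + z x))" by (simp add: fun_eq_iff)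
    ultimately have "sqn (\<lambda>x. (f x + g x) - (y x + z x)) < e" using y(2) z(2) by simp
    then show "\<exists>y\<in>M. sqn (\<lambda>x. f x + g x - y x) < e" using add[OF y(1) z(1)] by (intro bexI[of _ "\<lambda>x. y x + z x"]) auto
  qed
  show "(\<lambda>x. c * f x) \<in> l2_closure M" if f: "f \<in> l2_closure M" for c f
    unfolding l2_closure_def
  proof (intro CollectI conjI allI impI)
    show "square_summable (\<lambda>x. c * f x)" using f by (simp add: l2_closure_def square_summable_scale)
    fix e :: real assume e: "0 < e"
    have c: "0 < (cmod c)\<^sup>2 + 1" by (rule add_nonneg_pos) auto
    then have "0 < e / ((cmod c)\<^sup>2 + 1)" using e by simp
    then obtain y where y: "y \<in> M" "sqn (\<lambda>x. f x - y x) < e / ((cmod c)\<^sup>2 + 1)" using f unfolding l2_closure_def by blast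
    have "sqn (\<lambda>x. c * (f x - y x)) = (cmod c)\<^sup>2 * sqn (\<lambda>x. f x - y x)" by (rule sqn_scale)
    also have "... \<le> ((cmod c)\<^sup>2 + 1) * sqn (\<lambda>x. f x - y x)" by (intro mult_right_mono) auto
    also have "... < ((cmod c)\<^sup>2 + 1) * (e / ((cmod c)\<^sup>2 + 1))" using y(2) c by (rule mult_strict_left_mono)
    also have "... = e" using c by simp
    finally have "sqn (\<lambda>x. c * f x - c * y x) < e" by (simp add: right_diff_distrib)
    then show "\<exists>y\<in>M. sqn (\<lambda>x. c * f x - y x) < e" using scale[OF y(1)] by (intro bexI[of _ "\<lambda>x. c * y x"]) auto
  qed
  fix f :: "'a => complex" assume f: "square_summable f" and ap: "\<forall>e>0. \<exists>y\<in>l2_closure M. sqn (\<lambda>x. f x - y x) < e"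
  show "f \<in> l2_closure M"
    unfolding l2_closure_def
  proof (intro CollectI conjI allI impI f)
    fix e :: real assume e: "0 < e"
    then have e4: "0 < e / 4" by simp
    obtain y where y: "y \<in> l2_closure M" "sqn (\<lambda>x. f x - y x) < e / 4" using ap e4 by blast
    obtain z where z: "z \<in> M" "sqn (\<lambda>x. y x - z x) < e / 4" using y(1) e4 unfolding l2_closure_def by blast
    have "square_summable y" using y(1) by (simp add: l2_closure_def)
    then have "sqn (\<lambda>x. f x - z x) \<le> 2 * sqn (\<lambda>x. f x - y x) + 2 * sqn (\<lambda>x. y x - z x)"
      using f sq[OF z(1)] by (intro sqn_diff_triangle)
    then show "\<exists>y\<in>M. sqn (\<lambda>x. f x - y x) < e" using y(2) z by (intro bexI[of _ z]) auto
  qed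
qed

text \<open>With finitely supported \<open>h\<close> these conditions include all finite linear equations, such as the cocycle equations.\<close>

lemma closed_subspace_orthogonal:
  assumes \<Phi>: "\<And>h. h \<in> \<Phi> ==> square_summable h"
  shows "closed_subspace {f. square_summable f \<and> (\<forall>h\<in>\<Phi>. l2_inner f h = 0)}"
  unfolding closed_subspace_def
proof (intro conjI ballI allI impI)
  let ?M = "{f. square_summable f \<and> (\<forall>h\<in>\<Phi>. l2_inner f h = 0)}"
  show "(\<lambda>_. 0) \<in> ?M" by simp
  show "square_summable f" if "f \<in> ?M" for f using that by simp
  show "(\<lambda>x. f x + g x) \<in> ?M" if "f \<in> ?M" "g \<in> ?M" for f g
    using that \<Phi> by (simp add: inner_add_left square_summable_add)
  show "(\<lambda>x. c * f x) \<in> ?M" if "f \<in> ?M" for c f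
    using that by (simp add: inner_scale_left square_summable_scale)
  fix f :: "'a => complex" assume f: "square_summable f" and ap: "\<forall>e>0. \<exists>y\<in>?M. sqn (\<lambda>x. f x - y x) < e"
  have "l2_inner f h = 0" if h: "h \<in> \<Phi>" for h
  proof -
    define z where "z = l2_inner f h"
    define t where "t = 1 / (sqn h + 1)"
    have h1: "0 < sqn h + 1" by (rule add_nonneg_pos) auto
    have bound: "2 * t * (cmod z)\<^sup>2 \<le> e + t\<^sup>2 * (cmod z)\<^sup>2 * sqn h" if e: "0 < e" for e
    proof -
      obtain y where y: "y \<in> ?M" "sqn (\<lambda>x. f x - y x) < e" using ap e by blast
      let ?d = "\<lambda>x. f x - y x"
      have d: "square_summable ?d" using y f by (simp add: square_summable_diff)
      have "l2_inner ?d h = z" using y f \<Phi>[OF h] h by (simp add: inner_diff_left z_def)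
      then have "cnj (of_real t * z) * l2_inner ?d h = of_real t * (z * cnj z)" by (simp add: mult_ac)
      also have "... = of_real (t * (cmod z)\<^sup>2)" by (simp only: complex_norm_square[symmetric] of_real_mult)
      finally have "l2_inner ?d (\<lambda>x. (of_real t * z) * h x) = of_real (t * (cmod z)\<^sup>2)"
	by (simp only: inner_scale_right)
      moreover have "2 * Re (l2_inner ?d (\<lambda>x. (of_real t * z) * h x)) \<le> sqn ?d + sqn (\<lambda>x. (of_real t * z) * h x)"
	by (rule two_Re_inner_le[OF d square_summable_scale[OF \<Phi>[OF h]]])
      moreover have "sqn (\<lambda>x. (of_real t * z) * h x) = t\<^sup>2 * (cmod z)\<^sup>2 * sqn h"
	by (simp add: sqn_scale norm_mult power_mult_distrib)
      ultimately show ?thesis using y(2) by simp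
    qed
    have "2 * t * (cmod z)\<^sup>2 \<le> t\<^sup>2 * (cmod z)\<^sup>2 * sqn h"
      by (rule field_le_epsilon) (use bound in \<open>simp add: add.commute\<close>)
    also have "... = t * (cmod z)\<^sup>2 * (sqn h / (sqn h + 1))" by (simp add: t_def power2_eq_square)
    also have "... \<le> t * (cmod z)\<^sup>2 * 1" using h1 by (intro mult_left_mono) (auto simp: t_def)
    finally have "t * (cmod z)\<^sup>2 \<le> 0" by simp
    moreover have "0 < t" using h1 by (simp add: t_def)
    ultimately have "(cmod z)\<^sup>2 \<le> 0" by (simp add: mult_le_0_iff)
    then show ?thesis by (simp add: z_def)
  qed
  then show "f \<in> ?M" using f by simp
qed

lemma square_summable_sum:
  assumes "finite A" "\<And>a. a \<in> A ==> square_summable (F a)"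
  shows "square_summable (\<lambda>x. \<Sum>a\<in>A. F a x)"
  using assms by (induction A rule: finite_induct) (auto intro: square_summable_add)

lemma inner_finite_functional:
  assumes "finite A"
  shows "l2_inner f (\<lambda>x. \<Sum>a\<in>A. cnj (c a) * point_mass (\<pi> a) x) = (\<Sum>a\<in>A. c a * f (\<pi> a))"
    and "square_summable (\<lambda>x. \<Sum>a\<in>A. cnj (c a) * point_mass (\<pi> a) x)"
proof -
  show "square_summable (\<lambda>x. \<Sum>a\<in>A. cnj (c a) * point_mass (\<pi> a) x)"
    using assms by (intro square_summable_sum square_summable_scale square_summable_point_mass)
  have "finite (\<pi> ` A)" using assms by simp
  have "l2_inner f (\<lambda>x. \<Sum>a\<in>A. cnj (c a) * point_mass (\<pi> a) x) =
      (\<Sum>\<^sub>\<infinity>x\<in>\<pi> ` A. f x * cnj (\<Sum>a\<in>A. cnj (c a) * point_mass (\<pi> a) x))"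
    unfolding l2_inner_def by (intro infsum_cong_neutral) (auto simp: point_mass_def intro!: sum.neutral)
  also have "... = (\<Sum>x\<in>\<pi> ` A. \<Sum>a\<in>A. if x = \<pi> a then c a * f x else 0)"
    using \<open>finite (\<pi> ` A)\<close> by (simp add: sum_distrib_left) (intro sum.cong refl, simp add: point_mass_def)
  also have "... = (\<Sum>a\<in>A. \<Sum>x\<in>\<pi> ` A. if x = \<pi> a then c a * f x else 0)" by (rule sum.swap)
  also have "... = (\<Sum>a\<in>A. c a * f (\<pi> a))"
    using \<open>finite (\<pi> ` A)\<close> by (intro sum.cong refl) (simp add: sum.delta)
  finally show "l2_inner f (\<lambda>x. \<Sum>a\<in>A. cnj (c a) * point_mass (\<pi> a) x) = (\<Sum>a\<in>A. c a * f (\<pi> a))" .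
qed

text \<open>The dimension is defined by some embedding; composing it with \<open>k\<close> relates it isometrically to \<open>N\<close>, and the trace is an
isometry invariant.\<close>

lemma (in group) vn_dim_eq_projection_trace:
  assumes N: "invariant_subspace G N" and bij: "bij_betw k N (hcarrier H)"
    and add: "\<And>x y. x \<in> N ==> y \<in> N ==> k (\<lambda>t. x t + y t) = hadd H (k x) (k y)"
    and scale: "\<And>c x. x \<in> N ==> k (\<lambda>t. c * x t) = hscale H c (k x)"
    and iso: "\<And>x. x \<in> N ==> hnorm H (k x) = sqrt (sqn x)"
    and equi: "\<And>g x. g \<in> carrier G ==> x \<in> N ==> k (hact (regular_module G) g x) = hact H g (k x)"
  shows "vn_dim G H = projection_trace G N"
proof -
  have cN: "closed_subspace N" and sub: "N \<subseteq> hcarrier (regular_module G)"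
    and inv: "\<And>g f. g \<in> carrier G ==> f \<in> N ==> hact (regular_module G) g f \<in> N"
    using N by (auto simp: invariant_subspace_def)
  note ND = closed_subspaceD[OF cN]
  have kN: "k x \<in> hcarrier H" if "x \<in> N" for x using bij that by (auto simp: bij_betw_def)
  have inj: "inj_on k N" and img: "k ` N = hcarrier H" using bij by (auto simp: bij_betw_def)
  have rm: "hadd (regular_module G) f h = (\<lambda>t. f t + h t)" "hscale (regular_module G) c f = (\<lambda>t. c * f t)"
    "hnorm (regular_module G) f = sqrt (sqn f)" for f h c
    by (simp_all add: regular_module_def sqn_def)
  have "equivariant_isometry G H (regular_module G) (inv_into N k)"
    unfolding equivariant_isometry_def rm
  proof (intro conjI ballI allI)
    show "inv_into N k \<in> hcarrier H \<rightarrow> hcarrier (regular_module G)"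
      using sub img inv_into_into[of _ k N] by auto
    note ik = inv_into_f_f[OF inj]
    show "inv_into N k (hadd H u v) = (\<lambda>t. inv_into N k u t + inv_into N k v t)"
      if uv: "u \<in> hcarrier H" "v \<in> hcarrier H" for u v
    proof -
      obtain x y where x: "x \<in> N" "u = k x" and y: "y \<in> N" "v = k y" using uv img by blast
      show ?thesis using ik[OF ND(3)[OF x(1) y(1)]] ik[OF x(1)] ik[OF y(1)] add[OF x(1) y(1)] x(2) y(2) by simp
    qed
    show "inv_into N k (hscale H c u) = (\<lambda>t. c * inv_into N k u t)" if u: "u \<in> hcarrier H" for c u
    proof -
      obtain x where x: "x \<in> N" "u = k x" using u img by blast
      show ?thesis using ik[OF ND(4)[OF x(1)], of c] ik[OF x(1)] scale[OF x(1)] x(2) by simp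
    qed
    show "sqrt (sqn (inv_into N k u)) = hnorm H u" if u: "u \<in> hcarrier H" for u
    proof -
      obtain x where x: "x \<in> N" "u = k x" using u img by blast
      show ?thesis using ik[OF x(1)] iso[OF x(1)] x(2) by simp
    qed
    show "inv_into N k (hact H g u) = hact (regular_module G) g (inv_into N k u)"
      if g: "g \<in> carrier G" and u: "u \<in> hcarrier H" for g u
    proof -
      obtain x where x: "x \<in> N" "u = k x" using u img by blast
      show ?thesis using ik[OF inv[OF g x(1)]] ik[OF x(1)] equi[OF g x(1)] x(2) by simp
    qed
  qed
  then have "equivariant_isometry G H (regular_module G) (SOME J. equivariant_isometry G H (regular_module G) J)"
    by (rule someI[where P = "equivariant_isometry G H (regular_module G)"])
  moreover define J where "J = (SOME J. equivariant_isometry G H (regular_module G) J)"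
  ultimately have J0: "equivariant_isometry G H (regular_module G) J" by (simp only: J_def)
  have J: "\<And>u. u \<in> hcarrier H ==> J u \<in> hcarrier (regular_module G)"
    "\<And>u v. u \<in> hcarrier H ==> v \<in> hcarrier H ==> J (hadd H u v) = (\<lambda>t. J u t + J v t)"
    "\<And>c u. u \<in> hcarrier H ==> J (hscale H c u) = (\<lambda>t. c * J u t)"
    "\<And>u. u \<in> hcarrier H ==> sqrt (sqn (J u)) = hnorm H u"
    "\<And>g u. g \<in> carrier G ==> u \<in> hcarrier H ==> J (hact H g u) = hact (regular_module G) g (J u)"
    using J0 unfolding equivariant_isometry_def rm by blast+
  let ?U = "\<lambda>x. J (k x)"
  have img': "?U ` N = J ` hcarrier H" using img by (simp add: image_image[symmetric])
  have Uadd: "?U (\<lambda>t. x t + y t) = (\<lambda>t. ?U x t + ?U y t)" if "x \<in> N" "y \<in> N" for x y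
    using add[OF that] J(2)[OF kN[OF that(1)] kN[OF that(2)]] by simp
  have Uscale: "?U (\<lambda>t. c * x t) = (\<lambda>t. c * ?U x t)" if "x \<in> N" for c x
    using scale[OF that] J(3)[OF kN[OF that]] by simp
  have Uiso: "sqn (?U x) = sqn x" if "x \<in> N" for x
    using J(4)[OF kN[OF that]] iso[OF that] by simp
  have Uequi: "?U (hact (regular_module G) g x) = hact (regular_module G) g (?U x)" if "g \<in> carrier G" "x \<in> N" for g x
    using equi[OF that] J(5)[OF that(1) kN[OF that(2)]] by simp
  have Usq: "square_summable (?U x)" if "x \<in> N" for x
    using J(1)[OF kN[OF that]] by (simp add: hcarrier_regular)
  have N': "invariant_subspace G (J ` hcarrier H)"
    unfolding invariant_subspace_def img'[symmetric]
  proof (intro conjI ballI)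
    show "closed_subspace (?U ` N)"
      by (rule closed_subspace_isometric_image[OF cN Uadd Uscale Uiso Usq])
    show "?U ` N \<subseteq> hcarrier (regular_module G)" using J(1) kN by auto
    fix g f assume g: "g \<in> carrier G" and "f \<in> ?U ` N"
    then obtain x where x: "x \<in> N" "f = ?U x" by blast
    show "hact (regular_module G) g f \<in> ?U ` N"
      using Uequi[OF g x(1)] inv[OF g x(1)] x(2) by (intro image_eqI[of _ _ "hact (regular_module G) g x"]) auto
  qed
  have "projection_trace G N = projection_trace G (J ` hcarrier H)"
    by (rule projection_trace_isometry[OF N N' img' Uadd Uscale Uiso Uequi])
  then show ?thesis by (simp add: vn_dim_def J_def)
qed

section \<open>Reduced cohomology and harmonic cochains\<close>

lemma coboundary_add: "coboundary L i (\<lambda>s. f s + g s) = (\<lambda>s. coboundary L i f s + coboundary L i g s)"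
  by (auto simp: coboundary_def fun_eq_iff sum.distrib distrib_left)

lemma coboundary_scale: "coboundary L i (\<lambda>s. c * f s) = (\<lambda>s. c * coboundary L i f s)"
  by (auto simp: coboundary_def fun_eq_iff sum_distrib_left mult.left_commute)

lemma cochains_add: "f \<in> cochains L r ==> g \<in> cochains L r ==> (\<lambda>s. f s + g s) \<in> cochains L r"
  by (simp add: cochains_def distrib_left)

lemma cochains_scale: "f \<in> cochains L r ==> (\<lambda>s. c * f s) \<in> cochains L r"
  by (simp add: cochains_def mult.left_commute)

lemma ord_mono: "K \<subseteq> L ==> s \<in> ordered_simplices K r ==> s \<in> ordered_simplices L r"
  by (auto simp: ordered_simplices_def)

context simplex_reps
begin

definition l2c :: "('c list => complex) set" where
  "l2c = {f \<in> cochains L q. square_summable f}"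

definition coord_space :: "('a \<times> nat => complex) set" where
  "coord_space = {x. square_summable x \<and> (\<forall>p. p \<notin> carrier G \<times> {..<length ts} --> x p = 0)}"

lemma closed_coord_space: "closed_subspace coord_space"
proof -
  have "closed_subspace {f. square_summable f \<and> (\<forall>h\<in>point_mass ` (- (carrier G \<times> {..<length ts})). l2_inner f h = 0)}"
    by (rule closed_subspace_orthogonal) (auto simp: square_summable_point_mass)
  moreover have "... = coord_space" by (auto simp: coord_space_def inner_point_mass)
  ultimately show ?thesis by simp
qed

lemma coord_space_regular: "x \<in> coord_space ==> x \<in> hcarrier (regular_module G)"
  by (simp add: coord_space_def hcarrier_regular)

lemma crd_add: "crd (\<lambda>s. f s + g s) = (\<lambda>x. crd f x + crd g x)"
  by (auto simp: crd_def fun_eq_iff)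

lemma crd_diff: "crd (\<lambda>s. f s - g s) = (\<lambda>x. crd f x - crd g x)"
  by (auto simp: crd_def fun_eq_iff)

lemma crd_scale: "crd (\<lambda>s. c * f s) = (\<lambda>x. c * crd f x)"
  by (auto simp: crd_def fun_eq_iff)

lemma ext_add: "ext (\<lambda>p. x p + y p) = (\<lambda>s. ext x s + ext y s)"
  by (simp add: ext_def fun_eq_iff distrib_left)

lemma ext_diff: "ext (\<lambda>p. x p - y p) = (\<lambda>s. ext x s - ext y s)"
  by (simp add: ext_def fun_eq_iff right_diff_distrib)

lemma ext_scale: "ext (\<lambda>p. c * x p) = (\<lambda>s. c * ext x s)"
  by (simp add: ext_def fun_eq_iff mult.left_commute)

lemma crd_l2: "f \<in> l2c ==> crd f \<in> coord_space"
  using sqn_crd(1) by (auto simp: l2c_def coord_space_def crd_def)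

lemma crd_ext_coord: "x \<in> coord_space ==> crd (ext x) = x"
proof
  fix p :: "'a \<times> nat" assume x: "x \<in> coord_space"
  obtain g i where p: "p = (g,i)" by (cases p)
  show "crd (ext x) p = x p"
  proof (cases "g \<in> carrier G \<and> i < length ts")
    case True
    then show ?thesis by (simp add: p crd_ext)
  next
    case False
    then have "x p = 0" using x by (auto simp: coord_space_def p)
    then show ?thesis using False by (auto simp: p crd_def)
  qed
qed

lemma ext_l2:
  assumes x: "x \<in> coord_space"
  shows "ext x \<in> l2c"
proof -
  have c: "ext x \<in> cochains L q" by (rule ext_cochain)
  have "square_summable (crd (ext x))" using x crd_ext_coord[OF x] by (simp add: coord_space_def)
  then show ?thesis using sqn_crd(1)[OF c] c by (simp add: l2c_def)
qed

lemma ext_crd_l2: "f \<in> l2c ==> ext (crd f) = f"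
  by (simp add: l2c_def ext_crd)

lemma l2c_add: "f \<in> l2c ==> g \<in> l2c ==> (\<lambda>s. f s + g s) \<in> l2c"
  by (simp add: l2c_def cochains_add square_summable_add)

lemma l2c_scale: "f \<in> l2c ==> (\<lambda>s. c * f s) \<in> l2c"
  by (simp add: l2c_def cochains_scale square_summable_scale)

lemma crd_action_regular: "g \<in> carrier G ==> crd (\<alpha> g f) = hact (regular_module G) g (crd f)"
  by (simp add: crd_action hact_regular)

lemma action_l2:
  assumes g: "g \<in> carrier G" and f: "f \<in> l2c"
  shows "\<alpha> g f \<in> l2c"
proof -
  have c: "\<alpha> g f \<in> cochains L q" using f by (intro action_cochain g) (simp add: l2c_def)
  have "crd (\<alpha> g f) \<in> hcarrier (regular_module G)"
    unfolding crd_action_regular[OF g] by (rule hact_hcarrier(1)[OF g coord_space_regular[OF crd_l2[OF f]]])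
  then show ?thesis using c sqn_crd(1)[OF c] by (simp add: l2c_def hcarrier_regular)
qed

lemma ext_action:
  assumes g: "g \<in> carrier G" and x: "x \<in> coord_space"
  shows "ext (hact (regular_module G) g x) = \<alpha> g (ext x)" "hact (regular_module G) g x \<in> coord_space"
proof -
  have l: "\<alpha> g (ext x) \<in> l2c" by (rule action_l2[OF g ext_l2[OF x]])
  have e: "crd (\<alpha> g (ext x)) = hact (regular_module G) g x"
    using crd_action_regular[OF g, of "ext x"] crd_ext_coord[OF x] by simp
  show "ext (hact (regular_module G) g x) = \<alpha> g (ext x)" using ext_crd_l2[OF l] e by simp
  show "hact (regular_module G) g x \<in> coord_space" using crd_l2[OF l] e by simp
qed

lemma coboundary_functional:
  obtains h where "\<And>s. square_summable (h s)"
    "\<And>x s. s \<in> ordered_simplices L (Suc q) ==> l2_inner x (h s) = coboundary L (Suc q) (ext x) s"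
proof
  let ?c = "\<lambda>s k. (-1) ^ k * of_int (csgn (del k s)) :: complex"
  let ?h = "\<lambda>s x. \<Sum>k\<in>{..<length s}. cnj (?c s k) * point_mass (cpos (del k s)) x"
  show "square_summable (?h s)" for s by (rule inner_finite_functional(2)) simp
  show "l2_inner x (?h s) = coboundary L (Suc q) (ext x) s" if s: "s \<in> ordered_simplices L (Suc q)" for x s
  proof -
    have "l2_inner x (?h s) = (\<Sum>k\<in>{..<length s}. ?c s k * x (cpos (del k s)))"
      by (rule inner_finite_functional(1)) simp
    then show ?thesis using s ord_face[OF s] by (simp add: coboundary_del ext_def mult.assoc)
  qed
qed

end

locale two_degrees = lower: simplex_reps G L act q ts' + upper: simplex_reps G L act "Suc q" ts
  for G :: "('a, 'm) monoid_scheme" (structure) and L :: "'c set set" and act :: "'a => 'c => 'c"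
    and q :: nat and ts' ts :: "'c list list"
begin

text \<open>In coordinates this is a finite sum of functions \<open>g \<mapsto> f (g s)\<close>, each square-summable because \<open>g \<mapsto> g s\<close> is injective.\<close>

lemma coboundary_l2:
  assumes f: "f \<in> lower.l2c"
  shows "coboundary L (Suc q) f \<in> upper.l2c"
proof -
  have fc: "f \<in> cochains L q" "square_summable f" using f by (auto simp: lower.l2c_def)
  have c: "coboundary L (Suc q) f \<in> cochains L (Suc q)" by (rule coboundary_cochain[OF lower.complex fc(1)])
  let ?A = "{..<length ts} \<times> {..<Suc (Suc q)}"
  define u where "u p = (\<lambda>(g,i'). if g \<in> carrier G \<and> i' = fst p then (-1) ^ snd p * f (map (act g) (del (snd p) (ts ! fst p))) else 0)" for p :: "nat \<times> nat"
  have su: "square_summable (u p)" if p: "p \<in> ?A" for p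
  proof (rule square_summableI_bounded)
    obtain i k where ik: "p = (i,k)" "i < length ts" "k < Suc (Suc q)" using p by auto
    let ?t = "del k (ts ! i)"
    have tsi: "ts ! i \<in> ordered_simplices L (Suc q)" by (rule upper.reps_ord[OF ik(2)])
    have t: "?t \<in> ordered_simplices L q" using lower.ord_face[OF tsi] lower.ord_set(3)[OF tsi] ik(3) by simp
    obtain g0 i0 \<pi> where c0: "lower.is_coord ?t g0 i0 \<pi>" using lower.coord_exists[OF t] by blast
    have g0: "g0 \<in> carrier G" using c0 by (simp add: lower.is_coord_def)
    have inj: "inj_on (\<lambda>(g,i'). map (act g) ?t) (carrier G \<times> {i})"
    proof (rule inj_onI, clarsimp simp del: map_eq_conv)
      fix g h assume gh: "g \<in> carrier G" "h \<in> carrier G" "map (act g) ?t = map (act h) ?t"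
      have c1: "lower.is_coord (map (act g) ?t) (g \<otimes> g0) i0 \<pi>" by (rule lower.is_coord_act[OF c0 gh(1)])
      have c2: "lower.is_coord (map (act g) ?t) (h \<otimes> g0) i0 \<pi>"
	unfolding gh(3) by (rule lower.is_coord_act[OF c0 gh(2)])
      from c1 c2 have "g \<otimes> g0 = h \<otimes> g0" by (rule lower.coord_unique(1))
      then show "g = h" using gh g0 by simp
    qed
    fix F :: "('a \<times> nat) set" assume F: "finite F"
    let ?F = "F \<inter> carrier G \<times> {i}"
    have "(\<Sum>x\<in>F. (cmod (u p x))\<^sup>2) = (\<Sum>x\<in>?F. (cmod (f ((\<lambda>(g,i'). map (act g) ?t) x)))\<^sup>2)"
      using F by (intro sum.mono_neutral_cong_right) (auto simp: u_def ik norm_mult norm_power split: if_splits)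
    also have "... = (\<Sum>s\<in>(\<lambda>(g,i'). map (act g) ?t) ` ?F. (cmod (f s))\<^sup>2)"
      by (subst sum.reindex[OF inj_on_subset[OF inj]]) auto
    also have "... \<le> sqn f" using F by (intro sum_le_sqn fc(2)) auto
    finally show "(\<Sum>x\<in>F. (cmod (u p x))\<^sup>2) \<le> sqn f" .
  qed
  have "upper.crd (coboundary L (Suc q) f) = (\<lambda>x. \<Sum>p\<in>?A. u p x)"
  proof
    fix x :: "'a \<times> nat"
    obtain g i where x: "x = (g,i)" by (cases x)
    have "(\<Sum>p\<in>?A. u p x) = (\<Sum>i'<length ts. \<Sum>k<Suc (Suc q). u (i',k) x)" by (rule sum_Times)
    also have "... = (\<Sum>i'<length ts. if i' = i then \<Sum>k<Suc (Suc q). u (i,k) x else 0)"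
      by (intro sum.cong refl) (auto simp: u_def x)
    also have "... = (if i < length ts then \<Sum>k<Suc (Suc q). u (i,k) x else 0)" by (simp add: sum.delta)
    also have "... = upper.crd (coboundary L (Suc q) f) x"
    proof (cases "g \<in> carrier G \<and> i < length ts")
      case True
      have b: "upper.basic g i \<in> ordered_simplices L (Suc q)" using True by (intro upper.basic_ord) auto
      show ?thesis using True b lower.ord_set(3)[OF b]
	by (simp add: upper.crd_def x coboundary_del u_def upper.basic_def del_map del: sum.lessThan_Suc)
    next
      case False
      then show ?thesis by (auto simp: upper.crd_def x u_def)
    qed
    finally show "upper.crd (coboundary L (Suc q) f) x = (\<Sum>p\<in>?A. u p x)" by simp
  qed
  then have "square_summable (upper.crd (coboundary L (Suc q) f))"
    using square_summable_sum[of ?A u] su by simp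
  then show ?thesis using c upper.sqn_crd(1)[OF c] by (simp add: upper.l2c_def)
qed

definition bnd :: "('a \<times> nat => complex) set" where
  "bnd = (\<lambda>f. upper.crd (coboundary L (Suc q) f)) ` lower.l2c"

abbreviation "cbnd \<equiv> l2_closure bnd"

lemma bnd_coord: "y \<in> bnd ==> y \<in> upper.coord_space"
  using coboundary_l2 upper.crd_l2 by (auto simp: bnd_def)

lemma closed_cbnd: "closed_subspace cbnd"
proof (rule closed_subspace_closure)
  have "(\<lambda>_. 0) \<in> lower.l2c" by (simp add: lower.l2c_def cochains_def)
  moreover have "upper.crd (coboundary L (Suc q) (\<lambda>_. 0)) = (\<lambda>_. 0 :: complex)" by (auto simp: upper.crd_def coboundary_def fun_eq_iff)
  ultimately show "(\<lambda>_. 0) \<in> bnd" unfolding bnd_def by (intro image_eqI[of _ _ "\<lambda>_. 0"]) simp_all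
  show "square_summable f" if "f \<in> bnd" for f using bnd_coord[OF that] by (simp add: upper.coord_space_def)
  show "(\<lambda>x. f x + g x) \<in> bnd" if fg: "f \<in> bnd" "g \<in> bnd" for f g
  proof -
    obtain u v where "u \<in> lower.l2c" "f = upper.crd (coboundary L (Suc q) u)" "v \<in> lower.l2c" "g = upper.crd (coboundary L (Suc q) v)"
      using fg by (auto simp: bnd_def)
    then show ?thesis unfolding bnd_def
      by (intro image_eqI[of _ _ "\<lambda>s. u s + v s"]) (simp_all add: coboundary_add upper.crd_add lower.l2c_add)
  qed
  show "(\<lambda>x. c * f x) \<in> bnd" if f: "f \<in> bnd" for c f
  proof -
    obtain u where "u \<in> lower.l2c" "f = upper.crd (coboundary L (Suc q) u)" using f by (auto simp: bnd_def)
    then show ?thesis unfolding bnd_def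
      by (intro image_eqI[of _ _ "\<lambda>s. c * u s"]) (simp_all add: coboundary_scale upper.crd_scale lower.l2c_scale)
  qed
qed

lemma bnd_cbnd: "y \<in> bnd ==> y \<in> cbnd"
  using bnd_coord by (force simp: l2_closure_def upper.coord_space_def)

text \<open>Closed conditions on coboundaries carry over to their closure.\<close>

lemma cbnd_induct:
  assumes y: "y \<in> cbnd" and M: "closed_subspace M" and sub: "bnd \<subseteq> M"
  shows "y \<in> M"
proof (rule closed_subspaceD(6)[OF M])
  show "square_summable y" using y by (simp add: l2_closure_def)
  show "\<exists>z\<in>M. sqn (\<lambda>x. y x - z x) < e" if "0 < e" for e using y that sub unfolding l2_closure_def by blast
qed

lemma cbnd_coord: "y \<in> cbnd ==> y \<in> upper.coord_space"
  by (rule cbnd_induct[OF _ upper.closed_coord_space]) (use bnd_coord in auto)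

lemma cbnd_cocycle:
  assumes y: "y \<in> cbnd" and s: "s \<in> ordered_simplices L (Suc (Suc q))"
  shows "coboundary L (Suc (Suc q)) (upper.ext y) s = 0"
proof -
  obtain h where h: "\<And>s. square_summable (h s)"
    "\<And>x s. s \<in> ordered_simplices L (Suc (Suc q)) ==> l2_inner x (h s) = coboundary L (Suc (Suc q)) (upper.ext x) s"
    using upper.coboundary_functional by blast
  have "y \<in> {f. square_summable f \<and> (\<forall>k\<in>{h s}. l2_inner f k = 0)}"
  proof (rule cbnd_induct[OF y closed_subspace_orthogonal])
    show "square_summable k" if "k \<in> {h s}" for k using that h(1) by simp
    show "bnd \<subseteq> {f. square_summable f \<and> (\<forall>k\<in>{h s}. l2_inner f k = 0)}"
    proof
      fix z assume z: "z \<in> bnd"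
      then obtain u where u: "u \<in> lower.l2c" "z = upper.crd (coboundary L (Suc q) u)" by (auto simp: bnd_def)
      have "upper.ext z = coboundary L (Suc q) u" using upper.ext_crd_l2[OF coboundary_l2[OF u(1)]] u(2) by simp
      then have "l2_inner z (h s) = 0" using h(2)[OF s, of z] by (simp add: coboundary_coboundary[OF lower.complex])
      then show "z \<in> {f. square_summable f \<and> (\<forall>k\<in>{h s}. l2_inner f k = 0)}"
	using bnd_coord[OF z] by (simp add: upper.coord_space_def)
    qed
  qed
  then show ?thesis using h(2)[OF s, of y] by simp
qed

abbreviation "HL \<equiv> l2_cochains G act L (Suc q)"

lemma hnorm_l2: "f \<in> upper.l2c ==> hnorm HL f = sqrt (sqn (upper.crd f))"
  using upper.sqn_crd(2)[of f] by (simp add: upper.l2c_def l2_cochains_def sqn_def[symmetric] del: fact_Suc)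

lemma l2_simps: "hcarrier HL = upper.l2c" "hadd HL = (\<lambda>f g x. f x + g x)" "hscale HL = (\<lambda>c f x. c * f x)"
    "hact HL = upper.\<alpha>" "hcarrier (l2_cochains G act L q) = lower.l2c"
  by (simp_all add: l2_cochains_def upper.l2c_def lower.l2c_def)

definition Bd :: "('c list => complex) set" where
  "Bd = {f \<in> upper.l2c. upper.crd f \<in> cbnd}"

lemma coboundaries_closure: "l2_coboundaries_closure G act L (Suc q) = Bd"
proof -
  have n: "hnorm HL (\<lambda>s. f s + - 1 * coboundary L (Suc q) u s) = sqrt (sqn (\<lambda>x. upper.crd f x - upper.crd (coboundary L (Suc q) u) x))"
    if "f \<in> upper.l2c" "u \<in> lower.l2c" for f u
  proof -
    have "(\<lambda>s. f s + - 1 * coboundary L (Suc q) u s) \<in> upper.l2c"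
      by (rule upper.l2c_add[OF that(1) upper.l2c_scale[OF coboundary_l2[OF that(2)]]])
    then show ?thesis using hnorm_l2 by (simp add: upper.crd_diff)
  qed
  have "(\<forall>e>0. \<exists>u\<in>lower.l2c. hnorm HL (\<lambda>s. f s + - 1 * coboundary L (Suc q) u s) < e) \<longleftrightarrow> upper.crd f \<in> cbnd"
    if f: "f \<in> upper.l2c" for f
  proof
    assume a: "\<forall>e>0. \<exists>u\<in>lower.l2c. hnorm HL (\<lambda>s. f s + - 1 * coboundary L (Suc q) u s) < e"
    show "upper.crd f \<in> cbnd"
      unfolding l2_closure_def
    proof (intro CollectI conjI allI impI)
      show "square_summable (upper.crd f)" using upper.crd_l2[OF f] by (simp add: upper.coord_space_def)
      fix e :: real assume e: "0 < e"
      then obtain u where u: "u \<in> lower.l2c" "hnorm HL (\<lambda>s. f s + - 1 * coboundary L (Suc q) u s) < sqrt e"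
	using a real_sqrt_gt_zero by blast
      then have "sqn (\<lambda>x. upper.crd f x - upper.crd (coboundary L (Suc q) u) x) < e" using n[OF f u(1)] by simp
      then show "\<exists>y\<in>bnd. sqn (\<lambda>x. upper.crd f x - y x) < e" using u(1) by (auto simp: bnd_def)
    qed
  next
    assume a: "upper.crd f \<in> cbnd"
    show "\<forall>e>0. \<exists>u\<in>lower.l2c. hnorm HL (\<lambda>s. f s + - 1 * coboundary L (Suc q) u s) < e"
    proof (intro allI impI)
      fix e :: real assume e: "0 < e"
      then have "0 < e\<^sup>2" by simp
      then obtain y where y: "y \<in> bnd" "sqn (\<lambda>x. upper.crd f x - y x) < e\<^sup>2" using a unfolding l2_closure_def by blast
      then obtain u where u: "u \<in> lower.l2c" "y = upper.crd (coboundary L (Suc q) u)" by (auto simp: bnd_def)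
      have "sqrt (sqn (\<lambda>x. upper.crd f x - y x)) < e" using y(2) e by (intro real_less_lsqrt) auto
      then show "\<exists>u\<in>lower.l2c. hnorm HL (\<lambda>s. f s + - 1 * coboundary L (Suc q) u s) < e"
	using n[OF f u(1)] u by (intro bexI[of _ u]) simp_all
    qed
  qed
  then show ?thesis
    by (auto simp: l2_coboundaries_closure_def hclosure_def l2_simps Bd_def)
qed

definition coset :: "('c list => complex) => ('c list => complex) set" where
  "coset f = (\<lambda>b s. f s + b s) ` Bd"

lemma Bd_zero: "(\<lambda>_. 0) \<in> Bd"
  using closed_subspaceD(1)[OF closed_cbnd]
  by (auto simp: Bd_def upper.l2c_def cochains_def upper.crd_def case_prod_unfold)

lemma Bd_add: "b \<in> Bd ==> b' \<in> Bd ==> (\<lambda>s. b s + b' s) \<in> Bd"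
  using closed_subspaceD(3)[OF closed_cbnd] by (simp add: Bd_def upper.l2c_add upper.crd_add)

lemma Bd_scale: "b \<in> Bd ==> (\<lambda>s. c * b s) \<in> Bd"
  using closed_subspaceD(4)[OF closed_cbnd] by (simp add: Bd_def upper.l2c_scale upper.crd_scale)

lemma coset_mem: "f \<in> coset f"
  unfolding coset_def using Bd_zero by (intro image_eqI[of _ _ "\<lambda>_. 0"]) auto

lemma coset_eq:
  assumes "b \<in> Bd" "f = (\<lambda>s. g s + b s)"
  shows "coset f = coset g"
proof -
  have sub: "coset (\<lambda>s. g s + b s) \<subseteq> coset g" if b: "b \<in> Bd" for g b
    unfolding coset_def
  proof (rule image_subsetI)
    fix b' assume "b' \<in> Bd"
    then show "(\<lambda>s. g s + b s + b' s) \<in> (\<lambda>b s. g s + b s) ` Bd"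
      using Bd_add[OF b] by (intro image_eqI[of _ _ "\<lambda>s. b s + b' s"]) (auto simp: add.assoc)
  qed
  have "g = (\<lambda>s. f s + (-1) * b s)" using assms(2) by (simp add: fun_eq_iff)
  then have "coset g \<subseteq> coset f" using sub[OF Bd_scale[OF assms(1), of "-1"], of f] by simp
  then show ?thesis using sub[OF assms(1), of g] assms(2) by blast
qed

lemma coset_eqD: "coset f = coset g ==> \<exists>b\<in>Bd. f = (\<lambda>s. g s + b s)"
  using coset_mem[of f] by (auto simp: coset_def)

lemma Bd_action:
  assumes g: "g \<in> carrier G" and b: "b \<in> Bd"
  shows "upper.\<alpha> g b \<in> Bd"
proof -
  have bl: "b \<in> upper.l2c" "upper.crd b \<in> cbnd" using b by (auto simp: Bd_def)
  let ?h = "hact (regular_module G) g"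
  have bnd_act: "?h y \<in> bnd" if y: "y \<in> bnd" for y
  proof -
    obtain u where u: "u \<in> lower.l2c" "y = upper.crd (coboundary L (Suc q) u)" using y by (auto simp: bnd_def)
    have "upper.\<alpha> g (coboundary L (Suc q) u) = coboundary L (Suc q) (lower.\<alpha> g u)"
    proof
      fix s show "upper.\<alpha> g (coboundary L (Suc q) u) s = coboundary L (Suc q) (lower.\<alpha> g u) s"
	using lower.coboundary_action[OF g, of s u] by (cases "s \<in> ordered_simplices L (Suc q)") (simp_all add: cochain_action_def coboundary_def)
    qed
    then have "?h y = upper.crd (coboundary L (Suc q) (lower.\<alpha> g u))"
      using upper.crd_action_regular[OF g, of "coboundary L (Suc q) u"] u(2) by simp
    then show ?thesis using lower.action_l2[OF g u(1)] by (auto simp: bnd_def)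
  qed
  have "?h (upper.crd b) \<in> cbnd"
    unfolding l2_closure_def
  proof (intro CollectI conjI allI impI)
    have reg: "upper.crd b \<in> hcarrier (regular_module G)" by (rule upper.coord_space_regular[OF upper.crd_l2[OF bl(1)]])
    then show "square_summable (?h (upper.crd b))" using lower.hact_hcarrier(1)[OF g reg] by (simp add: lower.hcarrier_regular)
    fix e :: real assume e: "0 < e"
    obtain y where y: "y \<in> bnd" "sqn (\<lambda>x. upper.crd b x - y x) < e" using bl(2) e unfolding l2_closure_def by blast
    have d: "(\<lambda>x. upper.crd b x - y x) \<in> hcarrier (regular_module G)"
      by (rule upper.coord_space_regular[OF closed_subspaceD(5)[OF upper.closed_coord_space upper.crd_l2[OF bl(1)] bnd_coord[OF y(1)]]])
    have "(\<lambda>x. ?h (upper.crd b) x - ?h y x) = ?h (\<lambda>x. upper.crd b x - y x)"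
      by (auto simp: lower.hact_regular fun_eq_iff)
    then have "sqn (\<lambda>x. ?h (upper.crd b) x - ?h y x) = sqn (\<lambda>x. upper.crd b x - y x)"
      using lower.hact_hcarrier(2)[OF g d] by simp
    then show "\<exists>z\<in>bnd. sqn (\<lambda>x. ?h (upper.crd b) x - z x) < e" using y bnd_act[OF y(1)]
      by (intro bexI[of _ "?h y"]) simp_all
  qed
  then show ?thesis using upper.action_l2[OF g bl(1)] upper.crd_action_regular[OF g, of b] by (simp add: Bd_def)
qed

lemma alpha_add: "upper.\<alpha> g (\<lambda>s. f s + b s) = (\<lambda>s. upper.\<alpha> g f s + upper.\<alpha> g b s)"
  by (auto simp: cochain_action_def fun_eq_iff)

lemma coset_action:
  assumes g: "g \<in> carrier G"
  shows "upper.\<alpha> g ` coset f = coset (upper.\<alpha> g f)"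
proof
  show "upper.\<alpha> g ` coset f \<subseteq> coset (upper.\<alpha> g f)"
    using Bd_action[OF g] by (auto simp: coset_def alpha_add)
  show "coset (upper.\<alpha> g f) \<subseteq> upper.\<alpha> g ` coset f"
  proof
    fix u assume "u \<in> coset (upper.\<alpha> g f)"
    then obtain b where b: "b \<in> Bd" "u = (\<lambda>s. upper.\<alpha> g f s + b s)" by (auto simp: coset_def)
    let ?b = "upper.\<alpha> (inv g) b"
    have bl: "b \<in> upper.l2c" using b by (simp add: Bd_def)
    have "upper.\<alpha> g ?b = b"
    proof
      fix s
      show "upper.\<alpha> g ?b s = b s"
      proof (cases "s \<in> ordered_simplices L (Suc q)")
	case True
	then have "map (act g) (map (act (inv g)) s) = s"
	  using lower.map_act_mult[of g "inv g" s] lower.map_act_one[of s] g by simp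
	moreover have "map (act (inv g)) s \<in> ordered_simplices L (Suc q)" using lower.ord_act True g by simp
	ultimately show ?thesis using True g by (simp add: cochain_action_def del: map_map)
      next
	case False
	then show ?thesis using bl cochainsD(1)[of b L "Suc q" s] by (simp add: cochain_action_def upper.l2c_def)
      qed
    qed
    then have "u = upper.\<alpha> g (\<lambda>s. f s + ?b s)" using b(2) by (simp add: alpha_add)
    then show "u \<in> upper.\<alpha> g ` coset f" using Bd_action[of "inv g" b] b(1) g by (auto simp: coset_def)
  qed
qed

definition cocycles :: "'c set set => ('c list => complex) set" where
  "cocycles K = {f \<in> upper.l2c. \<forall>s\<in>ordered_simplices K (Suc (Suc q)). coboundary L (Suc (Suc q)) f s = 0}"

text \<open>In coordinates: the orthogonal complement of the coboundaries among the cocycles of the subcomplex \<open>K\<close>. If \<open>K\<close> contains the skeleton of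
dimension \<open>Suc q\<close>, it affects only the cocycle condition.\<close>

definition harmonic :: "'c set set => ('a \<times> nat => complex) set" where
  "harmonic K = {x \<in> upper.coord_space.
     (\<forall>s\<in>ordered_simplices K (Suc (Suc q)). coboundary L (Suc (Suc q)) (upper.ext x) s = 0) \<and> (\<forall>y\<in>bnd. l2_inner x y = 0)}"

definition image_module :: "'c set set => ('a, ('c list => complex) set) hilbert_module" where
  "image_module K = hsub (hquot HL Bd) (coset ` cocycles K)"

lemma cocycle_space_closed:
  assumes K: "K \<subseteq> L" and \<Phi>: "\<And>y. y \<in> \<Phi> ==> square_summable y"
  shows "closed_subspace {x \<in> upper.coord_space.
     (\<forall>s\<in>ordered_simplices K (Suc (Suc q)). coboundary L (Suc (Suc q)) (upper.ext x) s = 0) \<and> (\<forall>y\<in>\<Phi>. l2_inner x y = 0)}"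
proof -
  obtain h where h: "\<And>s. square_summable (h s)"
    "\<And>x s. s \<in> ordered_simplices L (Suc (Suc q)) ==> l2_inner x (h s) = coboundary L (Suc (Suc q)) (upper.ext x) s"
    using upper.coboundary_functional by blast
  let ?P = "point_mass ` (- (carrier G \<times> {..<length ts})) \<union> h ` ordered_simplices K (Suc (Suc q)) \<union> \<Phi>"
  have "closed_subspace {f. square_summable f \<and> (\<forall>k\<in>?P. l2_inner f k = 0)}"
    by (rule closed_subspace_orthogonal) (use h(1) \<Phi> in \<open>auto simp: square_summable_point_mass\<close>)
  moreover have "{f. square_summable f \<and> (\<forall>k\<in>?P. l2_inner f k = 0)} = {x \<in> upper.coord_space.
     (\<forall>s\<in>ordered_simplices K (Suc (Suc q)). coboundary L (Suc (Suc q)) (upper.ext x) s = 0) \<and> (\<forall>y\<in>\<Phi>. l2_inner x y = 0)}"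
    unfolding upper.coord_space_def ball_Un ball_simps(9) mem_Collect_eq
    using h(2) ord_mono[OF K] by (auto simp: inner_point_mass)
  ultimately show ?thesis by simp
qed

lemma harmonic_closed: "K \<subseteq> L ==> closed_subspace (harmonic K)"
  unfolding harmonic_def by (rule cocycle_space_closed) (use bnd_coord in \<open>auto simp: upper.coord_space_def\<close>)

lemma cbnd_orthogonal:
  assumes x: "square_summable x" "\<forall>y\<in>bnd. l2_inner x y = 0" and y: "y \<in> cbnd"
  shows "l2_inner x y = 0"
proof -
  have "y \<in> {f. square_summable f \<and> (\<forall>k\<in>{x}. l2_inner f k = 0)}"
  proof (rule cbnd_induct[OF y closed_subspace_orthogonal])
    show "square_summable k" if "k \<in> {x}" for k using that x(1) by simp
    show "bnd \<subseteq> {f. square_summable f \<and> (\<forall>k\<in>{x}. l2_inner f k = 0)}"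
    proof
      fix z assume z: "z \<in> bnd"
      have "l2_inner z x = cnj (l2_inner x z)" by (simp add: inner_cnj)
      then show "z \<in> {f. square_summable f \<and> (\<forall>k\<in>{x}. l2_inner f k = 0)}"
	using x(2) z bnd_coord[OF z] by (simp add: upper.coord_space_def)
    qed
  qed
  then have "l2_inner y x = 0" by simp
  moreover have "l2_inner x y = cnj (l2_inner y x)" by (simp add: inner_cnj)
  ultimately show ?thesis by simp
qed

text \<open>Each coset contains exactly one harmonic cochain, its element of least norm.\<close>

lemma vn_dim_image_module:
  assumes K: "K \<subseteq> L" and Kinv: "\<And>g s. g \<in> carrier G ==> s \<in> K ==> act g ` s \<in> K"
  shows "vn_dim G (image_module K) = projection_trace G (harmonic K)"
proof (rule lower.vn_dim_eq_projection_trace[where k = "\<lambda>x. coset (upper.ext x)"])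
  note HD = closed_subspaceD[OF harmonic_closed[OF K]]
  have Kord: "map (act g) s \<in> ordered_simplices K r" if "g \<in> carrier G" "s \<in> ordered_simplices K r" for g s r
  proof -
    have "map (act g) s \<in> ordered_simplices L r" by (rule lower.ord_act[OF that(1) ord_mono[OF K that(2)]])
    then show ?thesis using Kinv[OF that(1)] that(2) by (simp add: ordered_simplices_def)
  qed
  have hc: "x \<in> upper.coord_space" if "x \<in> harmonic K" for x using that by (simp add: harmonic_def)
  have ho: "l2_inner x (upper.crd b) = 0" if x: "x \<in> harmonic K" and b: "b \<in> Bd" for x b
  proof (rule cbnd_orthogonal)
    show "square_summable x" by (rule HD(2)[OF x])
    show "\<forall>y\<in>bnd. l2_inner x y = 0" using x by (simp add: harmonic_def)
    show "upper.crd b \<in> cbnd" using b by (simp add: Bd_def)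
  qed
  show "invariant_subspace G (harmonic K)"
    unfolding invariant_subspace_def
  proof (intro conjI ballI)
    show "closed_subspace (harmonic K)" by (rule harmonic_closed[OF K])
    show "harmonic K \<subseteq> hcarrier (regular_module G)" using hc upper.coord_space_regular by blast
    fix g x assume g: "g \<in> carrier G" and x: "x \<in> harmonic K"
    let ?x = "hact (regular_module G) g x"
    note e = upper.ext_action[OF g hc[OF x]]
    have "coboundary L (Suc (Suc q)) (upper.ext ?x) s = 0" if s: "s \<in> ordered_simplices K (Suc (Suc q))" for s
    proof -
      have "map (act (inv g)) s \<in> ordered_simplices K (Suc (Suc q))" using Kord s g by simp
      then show ?thesis using x upper.coboundary_action[OF g ord_mono[OF K s], of "upper.ext x"]
	by (simp add: e(1) harmonic_def)
    qed
    moreover have "l2_inner ?x y = 0" if y: "y \<in> bnd" for y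
    proof -
      have yr: "y \<in> hcarrier (regular_module G)" by (rule upper.coord_space_regular[OF bnd_coord[OF y]])
      have yB: "upper.ext y \<in> Bd" using upper.ext_l2[OF bnd_coord[OF y]] upper.crd_ext_coord[OF bnd_coord[OF y]] bnd_cbnd[OF y]
	by (simp add: Bd_def)
      have "upper.crd (upper.\<alpha> (inv g) (upper.ext y)) = hact (regular_module G) (inv g) y"
	using upper.crd_action_regular[of "inv g" "upper.ext y"] upper.crd_ext_coord[OF bnd_coord[OF y]] g by simp
      then have "l2_inner x (hact (regular_module G) (inv g) y) = 0"
	using ho[OF x Bd_action[OF _ yB, of "inv g"]] g by simp
      then show ?thesis using lower.inner_shift[OF g yr, of x] by simp
    qed
    ultimately show "?x \<in> harmonic K" using e(2) by (simp add: harmonic_def)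
  qed
  have im: "hcarrier (image_module K) = coset ` cocycles K"
    "hadd (image_module K) = (\<lambda>X Y. {(\<lambda>s. x s + y s) | x y. x \<in> X \<and> y \<in> Y})"
    "hscale (image_module K) = (\<lambda>c X. {(\<lambda>s. c * x s + b s) | x b. x \<in> X \<and> b \<in> Bd})"
    "hnorm (image_module K) = (\<lambda>X. Inf (hnorm HL ` X))" "hact (image_module K) = (\<lambda>g X. upper.\<alpha> g ` X)"
    by (simp_all add: image_module_def hsub_def hquot_def l2_simps)
  show "bij_betw (\<lambda>x. coset (upper.ext x)) (harmonic K) (hcarrier (image_module K))"
    unfolding bij_betw_def im
  proof
    show "inj_on (\<lambda>x. coset (upper.ext x)) (harmonic K)"
    proof (rule inj_onI)
      fix x y assume xy: "x \<in> harmonic K" "y \<in> harmonic K" "coset (upper.ext x) = coset (upper.ext y)"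
      obtain b where b: "b \<in> Bd" "upper.ext x = (\<lambda>s. upper.ext y s + b s)" using coset_eqD[OF xy(3)] by blast
      have "b = upper.ext (\<lambda>p. x p - y p)" using b(2) by (simp add: upper.ext_diff)
      moreover have d: "(\<lambda>p. x p - y p) \<in> harmonic K" by (rule HD(5)[OF xy(1,2)])
      ultimately have cb: "upper.crd b = (\<lambda>p. x p - y p)" using upper.crd_ext_coord[OF hc[OF d]] by simp
      have "l2_inner (\<lambda>p. x p - y p) (\<lambda>p. x p - y p) = 0" using ho[OF d b(1)] cb by simp
      then have "sqn (\<lambda>p. x p - y p) = 0" using inner_self[OF HD(2)[OF d]] by simp
      then have "x p - y p = 0" for p by (rule sqn_eq_0D[OF HD(2)[OF d]])
      then show "x = y" by (simp add: fun_eq_iff)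
    qed
    show "(\<lambda>x. coset (upper.ext x)) ` harmonic K = coset ` cocycles K"
    proof
      show "(\<lambda>x. coset (upper.ext x)) ` harmonic K \<subseteq> coset ` cocycles K"
	using upper.ext_l2 by (auto simp: harmonic_def cocycles_def)
      show "coset ` cocycles K \<subseteq> (\<lambda>x. coset (upper.ext x)) ` harmonic K"
      proof (rule image_subsetI)
	fix f assume f: "f \<in> cocycles K"
	then have fl: "f \<in> upper.l2c" by (simp add: cocycles_def)
	have fsq: "square_summable (upper.crd f)" using upper.crd_l2[OF fl] by (simp add: upper.coord_space_def)
	define P where "P = l2_proj cbnd (upper.crd f)"
	have P: "P \<in> cbnd" unfolding P_def by (rule projection(1)[OF closed_cbnd fsq])
	have Pc: "P \<in> upper.coord_space" by (rule cbnd_coord[OF P])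
	have PB: "upper.ext P \<in> Bd" using upper.ext_l2[OF Pc] upper.crd_ext_coord[OF Pc] P by (simp add: Bd_def)
	let ?x = "\<lambda>p. upper.crd f p - P p"
	have ex: "upper.ext ?x = (\<lambda>s. f s - upper.ext P s)" by (simp add: upper.ext_diff upper.ext_crd_l2[OF fl])
	have "?x \<in> upper.coord_space" by (rule closed_subspaceD(5)[OF upper.closed_coord_space upper.crd_l2[OF fl] Pc])
	moreover have "coboundary L (Suc (Suc q)) (upper.ext ?x) s = 0" if s: "s \<in> ordered_simplices K (Suc (Suc q))" for s
	proof -
	  have "coboundary L (Suc (Suc q)) (upper.ext ?x) s =
	      coboundary L (Suc (Suc q)) f s + (-1) * coboundary L (Suc (Suc q)) (upper.ext P) s"
	    using coboundary_add[of L "Suc (Suc q)" f "\<lambda>s. (-1) * upper.ext P s"] coboundary_scale[of L "Suc (Suc q)" "-1" "upper.ext P"]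
	    by (simp add: ex)
	  then show ?thesis using f s cbnd_cocycle[OF P ord_mono[OF K s]] by (simp add: cocycles_def)
	qed
	moreover have "l2_inner ?x y = 0" if y: "y \<in> bnd" for y
	proof -
	  have "l2_inner P y = l2_inner (upper.crd f) y"
	    unfolding P_def by (rule projection(2)[OF closed_cbnd fsq bnd_cbnd[OF y]])
	  moreover have "square_summable P" "square_summable y" using Pc bnd_coord[OF y] by (auto simp: upper.coord_space_def)
	  ultimately show ?thesis using fsq by (simp add: inner_diff_left)
	qed
	ultimately have xh: "?x \<in> harmonic K" by (simp add: harmonic_def)
	have "coset f = coset (upper.ext ?x)" by (rule coset_eq[OF PB]) (simp add: ex)
	then show "coset f \<in> (\<lambda>x. coset (upper.ext x)) ` harmonic K" using xh by blast
      qed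
    qed
  qed
  show "coset (upper.ext (\<lambda>t. x t + y t)) = hadd (image_module K) (coset (upper.ext x)) (coset (upper.ext y))"
    if "x \<in> harmonic K" "y \<in> harmonic K" for x y
    unfolding im
  proof (rule subset_antisym; rule subsetI)
    fix u assume "u \<in> coset (upper.ext (\<lambda>t. x t + y t))"
    then obtain b where b: "b \<in> Bd" "u = (\<lambda>s. upper.ext x s + (upper.ext y s + b s))"
      by (auto simp: coset_def upper.ext_add add.assoc)
    have "(\<lambda>s. upper.ext y s + b s) \<in> coset (upper.ext y)" using b(1) by (auto simp: coset_def)
    then show "u \<in> {(\<lambda>s. u s + v s) | u v. u \<in> coset (upper.ext x) \<and> v \<in> coset (upper.ext y)}"
      using b(2) coset_mem[of "upper.ext x"]
      by (intro CollectI exI[of _ "upper.ext x"] exI[of _ "\<lambda>s. upper.ext y s + b s"] conjI) simp_all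
  next
    fix u assume "u \<in> {(\<lambda>s. u s + v s) | u v. u \<in> coset (upper.ext x) \<and> v \<in> coset (upper.ext y)}"
    then obtain b b' where b: "b \<in> Bd" "b' \<in> Bd" "u = (\<lambda>s. (upper.ext x s + b s) + (upper.ext y s + b' s))"
      by (auto simp: coset_def)
    have u: "u = (\<lambda>s. upper.ext (\<lambda>t. x t + y t) s + (b s + b' s))" using b(3) by (simp add: upper.ext_add add_ac)
    show "u \<in> coset (upper.ext (\<lambda>t. x t + y t))"
      unfolding coset_def by (rule image_eqI[rotated, OF Bd_add[OF b(1,2)]]) (rule u)
  qed
  show "coset (upper.ext (\<lambda>t. c * x t)) = hscale (image_module K) c (coset (upper.ext x))" if "x \<in> harmonic K" for c x
    unfolding im
  proof (rule subset_antisym; rule subsetI)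
    fix u assume "u \<in> coset (upper.ext (\<lambda>t. c * x t))"
    then obtain b where b: "b \<in> Bd" "u = (\<lambda>s. c * upper.ext x s + b s)" by (auto simp: coset_def upper.ext_scale)
    show "u \<in> {(\<lambda>s. c * u s + b s) | u b. u \<in> coset (upper.ext x) \<and> b \<in> Bd}"
      using b coset_mem[of "upper.ext x"]
      by (intro CollectI exI[of _ "upper.ext x"] exI[of _ b] conjI) simp_all
  next
    fix u assume "u \<in> {(\<lambda>s. c * u s + b s) | u b. u \<in> coset (upper.ext x) \<and> b \<in> Bd}"
    then obtain b b' where b: "b \<in> Bd" "b' \<in> Bd" "u = (\<lambda>s. c * (upper.ext x s + b s) + b' s)"
      by (auto simp: coset_def)
    have u: "u = (\<lambda>s. upper.ext (\<lambda>t. c * x t) s + (c * b s + b' s))" using b(3) by (simp add: upper.ext_scale distrib_left add_ac)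
    show "u \<in> coset (upper.ext (\<lambda>t. c * x t))"
      unfolding coset_def by (rule image_eqI[rotated, OF Bd_add[OF Bd_scale[OF b(1)] b(2)]]) (rule u)
  qed
  show "hnorm (image_module K) (coset (upper.ext x)) = sqrt (sqn x)" if x: "x \<in> harmonic K" for x
    unfolding im
  proof (rule cInf_eq_minimum)
    have xl: "upper.ext x \<in> upper.l2c" by (rule upper.ext_l2[OF hc[OF x]])
    show "sqrt (sqn x) \<in> hnorm HL ` coset (upper.ext x)"
      using coset_mem[of "upper.ext x"] hnorm_l2[OF xl] upper.crd_ext_coord[OF hc[OF x]] by (metis image_eqI)
    fix r assume "r \<in> hnorm HL ` coset (upper.ext x)"
    then obtain b where b: "b \<in> Bd" "r = hnorm HL (\<lambda>s. upper.ext x s + b s)" by (auto simp: coset_def)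
    have bl: "b \<in> upper.l2c" using b(1) by (simp add: Bd_def)
    have bs: "square_summable (upper.crd b)" using upper.crd_l2[OF bl] by (simp add: upper.coord_space_def)
    have "r = sqrt (sqn (\<lambda>p. x p + upper.crd b p))"
      using hnorm_l2[OF upper.l2c_add[OF xl bl]] upper.crd_ext_coord[OF hc[OF x]] b(2) by (simp add: upper.crd_add)
    moreover have "sqn (\<lambda>p. x p + upper.crd b p) = sqn x + sqn (upper.crd b)"
      using sqn_add[OF HD(2)[OF x] bs] ho[OF x b(1)] by simp
    ultimately show "sqrt (sqn x) \<le> r" by simp
  qed
  show "coset (upper.ext (hact (regular_module G) g x)) = hact (image_module K) g (coset (upper.ext x))"
    if "g \<in> carrier G" "x \<in> harmonic K" for g x
    unfolding im coset_action[OF that(1)] upper.ext_action(1)[OF that(1) hc[OF that(2)]] ..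
qed

end

section \<open>Dimension of the harmonic cochains\<close>

context two_degrees
begin

lemma projection_trace_finite:
  assumes M: "closed_subspace M" and sub: "M \<subseteq> upper.coord_space"
  shows "projection_trace G M = ereal (\<Sum>i<length ts. sqn (l2_proj M (gvec G i)))"
proof -
  have 0: "sqn (l2_proj M (gvec G i)) = 0" if i: "\<not> i < length ts" for i
  proof -
    have "l2_proj M (gvec G i) = (\<lambda>_. 0)"
    proof (rule projection_unique[OF M square_summable_gvec closed_subspaceD(1)[OF M]])
      fix z assume z: "z \<in> M"
      have "l2_inner (gvec G i) z = cnj (l2_inner z (gvec G i))" by (simp add: inner_cnj)
      also have "l2_inner z (gvec G i) = z (\<one>, i)" by (simp add: gvec_def inner_point_mass)
      also have "z (\<one>, i) = 0" using z sub i by (auto simp: upper.coord_space_def)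
      finally show "l2_inner (\<lambda>x. gvec G i x - 0) z = 0" by simp
    qed
    then show ?thesis by simp
  qed
  have "projection_trace G M = (\<Sum>i. ereal (sqn (l2_proj M (gvec G i))))" by (rule projection_trace_eq[OF M])
  also have "... = (\<Sum>i<length ts. ereal (sqn (l2_proj M (gvec G i))))"
    by (rule suminf_finite) (use 0 in \<open>auto simp: zero_ereal_def\<close>)
  finally show ?thesis by simp
qed

lemma harmonic_coord: "harmonic K \<subseteq> upper.coord_space"
  by (auto simp: harmonic_def)

lemma projection_trace_harmonic:
  assumes K: "K \<subseteq> L"
  shows "projection_trace G (harmonic K) = ereal (\<Sum>i<length ts. sqn (l2_proj (harmonic K) (gvec G i)))"
  by (rule projection_trace_finite[OF harmonic_closed[OF K] harmonic_coord])

lemma projection_trace_harmonic_antimono: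
  assumes K: "K \<subseteq> K'" "K' \<subseteq> L"
  shows "projection_trace G (harmonic K') \<le> projection_trace G (harmonic K)"
proof -
  have KL: "K \<subseteq> L" using K by blast
  have "harmonic K' \<subseteq> harmonic K" using ord_mono[OF K(1)] by (auto simp: harmonic_def)
  then show ?thesis
    unfolding projection_trace_harmonic[OF K(2)] projection_trace_harmonic[OF KL] ereal_less_eq
    by (intro sum_mono projection_mono harmonic_closed K(2) KL square_summable_gvec)
qed

text \<open>Test orthogonality against the coboundaries of point masses.\<close>

lemma harmonic_gop_adj:
  assumes x: "x \<in> harmonic K" and S: "finite S" "S \<subseteq> carrier G"
    and supp: "\<And>r. r < length ts ==> lower.bsupp (ts ! r) \<subseteq> S" and g: "g \<in> carrier G" and t: "t < length ts'"
  shows "gop_adj G {..<length ts} S (\<lambda>r. lower.bcoef (ts ! r)) x (g, t) = 0"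
proof -
  let ?a = "\<lambda>r. lower.bcoef (ts ! r)"
  let ?e = "point_mass (g,t) :: 'a \<times> nat => complex"
  have ec: "?e \<in> lower.coord_space" using g t square_summable_point_mass[of "(g,t)"]
    by (auto simp: lower.coord_space_def point_mass_def)
  let ?y = "upper.crd (coboundary L (Suc q) (lower.ext ?e))"
  have y: "?y \<in> bnd" using lower.ext_l2[OF ec] by (auto simp: bnd_def)
  have "?y p = (\<Sum>a\<in>{..<length ts} \<times> S. cnj (of_int (?a (fst a) t (snd a))) * point_mass (g \<otimes> inv (snd a), fst a) p)" for p
  proof -
    obtain h r where p: "p = (h,r)" by (cases p)
    show ?thesis
    proof (cases "h \<in> carrier G \<and> r < length ts")
      case True
      have "?y p = coboundary L (Suc q) (lower.ext ?e) (map (act h) (ts ! r))"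
	using True by (simp add: p upper.crd_def upper.basic_def)
      also have "... = gop G {..<length ts'} S ?a (lower.crd (lower.ext ?e)) (h,r)"
	by (rule lower.gop_crd[where A = "\<lambda>r. ts ! r", symmetric]) (use True lower.ext_cochain upper.reps_ord supp S in auto)
      also have "... = (\<Sum>t'<length ts'. \<Sum>k\<in>S. of_int (?a r t' k) * ?e (h \<otimes> k, t'))"
	unfolding lower.crd_ext_coord[OF ec] gop_def by simp
      also have "... = (\<Sum>t'<length ts'. if t' = t then \<Sum>k\<in>S. of_int (?a r t k) * ?e (h \<otimes> k, t) else 0)"
	by (intro sum.cong refl) (auto simp: point_mass_def)
      also have "... = (\<Sum>k\<in>S. of_int (?a r t k) * ?e (h \<otimes> k, t))" using t by (simp add: sum.delta)
      also have "... = (\<Sum>k\<in>S. of_int (?a r t k) * point_mass (g \<otimes> inv k, r) p)"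
      proof (intro sum.cong refl arg_cong[where f = "\<lambda>z. _ * z"])
	fix k assume "k \<in> S"
	then have k: "k \<in> carrier G" using S(2) by blast
	have "h \<otimes> k = g \<longleftrightarrow> h = g \<otimes> inv k" using True k g lower.inv_solve_right[of h g k] by auto
	then show "?e (h \<otimes> k, t) = point_mass (g \<otimes> inv k, r) p" by (simp add: point_mass_def p)
      qed
      also have "... = (\<Sum>r'<length ts. if r' = r then \<Sum>k\<in>S. of_int (?a r t k) * point_mass (g \<otimes> inv k, r) p else 0)"
	using True by (simp add: sum.delta)
      also have "... = (\<Sum>r'<length ts. \<Sum>k\<in>S. cnj (of_int (?a r' t k)) * point_mass (g \<otimes> inv k, r') p)"
	by (intro sum.cong refl) (auto simp: point_mass_def p)
      also have "... = (\<Sum>a\<in>{..<length ts} \<times> S. cnj (of_int (?a (fst a) t (snd a))) * point_mass (g \<otimes> inv (snd a), fst a) p)"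
	by (simp add: sum_Times)
      finally show ?thesis .
    next
      case False
      have "(g \<otimes> inv k, r') \<noteq> (h,r)" if "r' < length ts" "k \<in> S" for r' k using False that g S(2) by auto
      then have "(\<Sum>a\<in>{..<length ts} \<times> S. cnj (of_int (?a (fst a) t (snd a))) * point_mass (g \<otimes> inv (snd a), fst a) p) = 0"
	by (intro sum.neutral) (auto simp: point_mass_def p)
      moreover have "?y p = 0" using False by (auto simp: upper.crd_def p)
      ultimately show ?thesis by simp
    qed
  qed
  then have yeq: "?y = (\<lambda>p. \<Sum>a\<in>{..<length ts} \<times> S. cnj (of_int (?a (fst a) t (snd a))) * point_mass (g \<otimes> inv (snd a), fst a) p)"
    by (rule HOL.ext)
  have fin: "finite ({..<length ts} \<times> S)" using S by simp
  have "l2_inner x ?y = 0" using x y unfolding harmonic_def by blast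
  then have "(\<Sum>a\<in>{..<length ts} \<times> S. of_int (?a (fst a) t (snd a)) * x (g \<otimes> inv (snd a), fst a)) = 0"
    unfolding yeq inner_finite_functional(1)[OF fin, where c = "\<lambda>a. of_int (?a (fst a) t (snd a))" and \<pi> = "\<lambda>a. (g \<otimes> inv (snd a), fst a)"] .
  then show ?thesis by (simp add: gop_adj_def sum_Times)
qed

lemma harmonic_gop:
  assumes x: "x \<in> harmonic K" and K: "K \<subseteq> L" and Kinv: "\<And>g s. g \<in> carrier G ==> s \<in> K ==> act g ` s \<in> K"
    and S: "finite S" "S \<subseteq> carrier G" and s: "s \<in> ordered_simplices K (Suc (Suc q))" "upper.bsupp s \<subseteq> S" and g: "g \<in> carrier G"
  shows "gop G {..<length ts} S upper.bcoef x (g, s) = 0"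
proof -
  have xc: "x \<in> upper.coord_space" using x by (simp add: harmonic_def)
  have sL: "s \<in> ordered_simplices L (Suc (Suc q))" by (rule ord_mono[OF K s(1)])
  have gs: "map (act g) s \<in> ordered_simplices K (Suc (Suc q))"
    using lower.ord_act[OF g sL] Kinv[OF g] s(1) by (simp add: ordered_simplices_def)
  have "gop G {..<length ts} S (\<lambda>s. upper.bcoef s) (upper.crd (upper.ext x)) (g, s) =
      coboundary L (Suc (Suc q)) (upper.ext x) (map (act g) s)"
    by (rule upper.gop_crd[where A = "\<lambda>s. s"]) (use upper.ext_cochain sL g S s in auto)
  also have "... = 0" using x gs by (simp add: harmonic_def)
  finally show ?thesis unfolding upper.crd_ext_coord[OF xc] .
qed

lemma two_step_gop:
  fixes x :: "'a \<times> nat => real"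
  assumes S1: "finite S1" "S1 \<subseteq> carrier G" and supp1: "\<And>r. r < length ts ==> lower.bsupp (ts ! r) \<subseteq> S1"
    and S2: "finite S2" "S2 \<subseteq> carrier G" and V: "V \<subseteq> ordered_simplices L (Suc (Suc q))" "\<And>s. s \<in> V ==> upper.bsupp s \<subseteq> S2"
  shows "lower.eq_on_group V (gop G {..<length ts} S2 upper.bcoef
    (gop G {..<length ts'} S1 (\<lambda>r. lower.bcoef (ts ! r)) x)) (\<lambda>_. 0)"
  unfolding lower.eq_on_group_def
proof (intro ballI)
  fix g s assume g: "g \<in> carrier G" and s: "s \<in> V"
  let ?f = "coboundary L (Suc q) (lower.ext x)"
  have fc: "?f \<in> cochains L (Suc q)" by (rule coboundary_cochain[OF lower.complex lower.ext_cochain])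
  have sL: "s \<in> ordered_simplices L (Suc (Suc q))" using s V by blast
  have eq: "gop G {..<length ts'} S1 (\<lambda>r. lower.bcoef (ts ! r)) x (h,r) = upper.crd ?f (h,r)"
    if h: "h \<in> carrier G" and r: "r < length ts" for h r
  proof -
    have "gop G {..<length ts'} S1 (\<lambda>r. lower.bcoef (ts ! r)) x (h,r) =
	gop G {..<length ts'} S1 (\<lambda>r. lower.bcoef (ts ! r)) (lower.crd (lower.ext x)) (h,r)"
      unfolding gop_def prod.case
      by (intro sum.cong refl arg_cong2[where f = times]) (use h S1 in \<open>auto simp: lower.crd_ext subset_iff\<close>)
    also have "... = coboundary L (Suc q) (lower.ext x) (map (act h) (ts ! r))"
      by (rule lower.gop_crd[where A = "\<lambda>r. ts ! r"]) (use lower.ext_cochain upper.reps_ord h r S1 supp1 in auto)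
    finally show ?thesis using h r by (simp add: upper.crd_def upper.basic_def)
  qed
  have "gop G {..<length ts} S2 upper.bcoef (gop G {..<length ts'} S1 (\<lambda>r. lower.bcoef (ts ! r)) x) (g,s) =
      gop G {..<length ts} S2 (\<lambda>s. upper.bcoef s) (upper.crd ?f) (g,s)"
    unfolding gop_def[of G "{..<length ts}"] prod.case
    by (intro sum.cong refl arg_cong2[where f = times] eq) (use g S2 in auto)
  also have "... = coboundary L (Suc (Suc q)) ?f (map (act g) s)"
    by (rule upper.gop_crd[where A = "\<lambda>s. s"]) (use fc sL g S2 V s in auto)
  also have "... = 0" by (simp add: coboundary_coboundary[OF lower.complex])
  finally show "gop G {..<length ts} S2 upper.bcoef (gop G {..<length ts'} S1 (\<lambda>r. lower.bcoef (ts ! r)) x) (g, s) = 0" .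
qed

lemma harmonic_trace_bound:
  assumes K: "K \<subseteq> L" and Kinv: "\<And>g s. g \<in> carrier G ==> s \<in> K ==> act g ` s \<in> K"
    and S1: "finite S1" "S1 \<subseteq> carrier G" and supp1: "\<And>r. r < length ts ==> lower.bsupp (ts ! r) \<subseteq> S1"
    and S2: "finite S2" "S2 \<subseteq> carrier G" and V: "finite V" "V \<subseteq> ordered_simplices K (Suc (Suc q))" "\<And>s. s \<in> V ==> upper.bsupp s \<subseteq> S2"
  shows "projection_trace G (harmonic K) + ereal (real (length ts)) \<le> ereal (
    unit_trace G {..<length ts} (damped_rows G {..<length ts} {..<length ts'} S1 (\<lambda>r. lower.bcoef (ts ! r)) R ^^ (2 * m)) +
    unit_trace G {..<length ts} (damped_cols G V {..<length ts} S2 upper.bcoef R ^^ (2 * m)))"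
proof -
  have VL: "V \<subseteq> ordered_simplices L (Suc (Suc q))" using V(2) ord_mono[OF K] by blast
  interpret hs: harmonic_setting G "{..<length ts'}" "{..<length ts}" V S1 S2 "\<lambda>r. lower.bcoef (ts ! r)" upper.bcoef R
  proof
    show "lower.eq_on_group V (gop G {..<length ts} S2 upper.bcoef
      (gop G {..<length ts'} S1 (\<lambda>r. lower.bcoef (ts ! r)) x)) (\<lambda>_. 0)" for x :: "'a \<times> nat => real"
      by (rule two_step_gop[OF S1 supp1 S2 VL V(3)])
  qed (use S1 S2 V in auto)
  have "(\<Sum>i<length ts. sqn (l2_proj (harmonic K) (gvec G i))) + real (card {..<length ts}) \<le>
    unit_trace G {..<length ts} (damped_rows G {..<length ts} {..<length ts'} S1 (\<lambda>r. lower.bcoef (ts ! r)) R ^^ (2 * m)) +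
    unit_trace G {..<length ts} (damped_cols G V {..<length ts} S2 upper.bcoef R ^^ (2 * m))"
  proof (rule hs.harmonic_trace_le[OF harmonic_closed[OF K]])
    fix f assume f: "f \<in> harmonic K"
    show "lower.eq_on_group {..<length ts'} (gop_adj G {..<length ts} S1 (\<lambda>r. lower.bcoef (ts ! r)) f) (\<lambda>_. 0)"
      unfolding lower.eq_on_group_def using harmonic_gop_adj[OF f S1 supp1] by auto
    show "lower.eq_on_group V (gop G {..<length ts} S2 upper.bcoef f) (\<lambda>_. 0)"
      unfolding lower.eq_on_group_def using harmonic_gop[OF f K Kinv S2] V by blast
  qed
  then show ?thesis unfolding projection_trace_harmonic[OF K] by simp
qed

end

section \<open>The Betti number as a limit\<close>

lemma incseq_exhausts_finite:
  assumes "incseq E" "finite T" "T \<subseteq> (\<Union>i. E i)"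
  obtains i0 where "\<And>i. i0 \<le> i ==> T \<subseteq> E i"
proof -
  have "\<exists>i0. \<forall>i\<ge>i0. T \<subseteq> E i"
    using assms(2,3)
  proof (induction T rule: finite_induct)
    case (insert t T)
    then obtain i0 j where i0: "\<forall>i\<ge>i0. T \<subseteq> E i" and j: "t \<in> E j" by auto
    have "insert t T \<subseteq> E i" if "max i0 j \<le> i" for i
    proof -
      have "E j \<subseteq> E i" using assms(1) that by (simp add: incseq_def)
      then show ?thesis using i0 j that by auto
    qed
    then show ?case by blast
  qed auto
  then show ?thesis using that by blast
qed

context free_complex
begin

lemma image_mult:
  assumes "g \<in> carrier G" "h \<in> carrier G" "s \<in> L"
  shows "act g ` act h ` s = act (g \<otimes> h) ` s"
proof -
  have "act g (act h x) = act (g \<otimes> h) x" if x: "x \<in> s" for x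
  proof -
    have "x \<in> \<Union>L" using assms(3) x by blast
    then show ?thesis by (rule act_mult[OF assms(1,2), symmetric])
  qed
  then show ?thesis unfolding image_image by (rule image_cong[OF refl])
qed

lemma image_one:
  assumes "s \<in> L"
  shows "act \<one> ` s = s"
proof -
  have "act \<one> x = x" if "x \<in> s" for x using act_one[of x] that assms by auto
  then show ?thesis by simp
qed

lemma card_act: "g \<in> carrier G ==> s \<in> L ==> card (act g ` s) = card s"
  by (rule card_image) (rule inj_on_subset[OF act_inj], auto)

text \<open>Pick one simplex from each orbit that meets a finite fundamental set, and order its vertices.\<close>

lemma simplex_reps_exist:
  assumes co: "cocompact_on G (skeleton p L) act" and qp: "q \<le> p"
  obtains ts where "simplex_reps G L act q ts"
proof -
  obtain T where T: "finite T" "T \<subseteq> skeleton p L" "skeleton p L = (\<Union>g\<in>carrier G. (\<lambda>s. act g ` s) ` T)"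
    using co unfolding cocompact_on_def by blast
  define X where "X = {s \<in> T. card s = Suc q}"
  have X: "finite X" "X \<subseteq> L" using T by (auto simp: X_def skeleton_def)
  define orb where "orb s = (\<lambda>g. act g ` s) ` carrier G" for s
  have orb_act: "orb (act g ` s) = orb s" if g: "g \<in> carrier G" and s: "s \<in> L" for g s
  proof
    show "orb (act g ` s) \<subseteq> orb s"
      unfolding orb_def
    proof (rule image_subsetI)
      fix h assume h: "h \<in> carrier G"
      show "act h ` act g ` s \<in> (\<lambda>h. act h ` s) ` carrier G"
	by (rule image_eqI[of _ _ "h \<otimes> g"]) (use image_mult[OF h g s] h g in simp_all)
    qed
    show "orb s \<subseteq> orb (act g ` s)"
      unfolding orb_def
    proof (rule image_subsetI)
      fix h assume h: "h \<in> carrier G"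
      have "act h ` s = act (h \<otimes> inv g) ` act g ` s"
	using image_mult[of "h \<otimes> inv g" g s] g h s by (simp add: m_assoc)
      then show "act h ` s \<in> (\<lambda>h. act h ` act g ` s) ` carrier G" using g h by blast
    qed
  qed
  obtain os where os: "set os = orb ` X" "distinct os" using finite_distinct_list[of "orb ` X"] X by auto
  define rep where "rep C = (SOME s. s \<in> X \<and> orb s = C)" for C
  have rep: "rep C \<in> X" "orb (rep C) = C" if C: "C \<in> orb ` X" for C
  proof -
    have "\<exists>s. s \<in> X \<and> orb s = C" using C by auto
    then have "rep C \<in> X \<and> orb (rep C) = C" unfolding rep_def by (rule someI_ex)
    then show "rep C \<in> X" "orb (rep C) = C" by auto
  qed
  define lst where "lst s = (SOME xs. set xs = s \<and> distinct xs)" for s :: "'v set"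
  have lst: "set (lst s) = s" "distinct (lst s)" if s: "s \<in> X" for s
  proof -
    have "finite s" using s X complex unfolding abstract_complex_def by blast
    then have "\<exists>xs. set xs = s \<and> distinct xs" by (rule finite_distinct_list)
    then have "set (lst s) = s \<and> distinct (lst s)" unfolding lst_def by (rule someI_ex)
    then show "set (lst s) = s" "distinct (lst s)" by auto
  qed
  define ts where "ts = map (lst \<circ> rep) os"
  have nth: "rep (os ! i) \<in> X" "orb (rep (os ! i)) = os ! i" "ts ! i = lst (rep (os ! i))" if i: "i < length ts" for i
  proof -
    have "os ! i \<in> orb ` X" using i os(1) unfolding ts_def by (metis length_map nth_mem)
    then show "rep (os ! i) \<in> X" "orb (rep (os ! i)) = os ! i" by (rule rep)+
    show "ts ! i = lst (rep (os ! i))" using i by (simp add: ts_def)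
  qed
  have "simplex_reps G L act q ts"
  proof
    fix i assume i: "i < length ts"
    have "card (set (ts ! i)) = Suc q" "distinct (ts ! i)" "set (ts ! i) \<in> L"
      using nth[OF i] lst[OF nth(1)[OF i]] X by (auto simp: X_def)
    then show "ts ! i \<in> ordered_simplices L q" by (simp add: ordered_simplices_def distinct_card)
  next
    fix s assume s: "s \<in> L" "card s = Suc q"
    then have "s \<in> skeleton p L" using qp by (simp add: skeleton_def)
    then obtain g t where gt: "g \<in> carrier G" "t \<in> T" "s = act g ` t" using T(3) by blast
    have tL: "t \<in> L" using gt T(2) by (auto simp: skeleton_def)
    have tX: "t \<in> X" using gt s card_act[OF gt(1) tL] by (simp add: X_def)
    then have "orb t \<in> set os" using os(1) by simp
    then obtain i where i: "i < length os" "os ! i = orb t" by (auto simp: in_set_conv_nth)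
    have it: "i < length ts" using i by (simp add: ts_def)
    let ?r = "rep (os ! i)"
    have rL: "?r \<in> L" using nth(1)[OF it] X by auto
    have "t \<in> orb t" unfolding orb_def by (rule image_eqI[of _ _ \<one>]) (simp_all add: image_one[OF tL])
    then have "t \<in> orb ?r" using nth(2)[OF it] i(2) by simp
    then obtain h where h: "h \<in> carrier G" "t = act h ` ?r" unfolding orb_def by blast
    have "s = act (g \<otimes> h) ` set (ts ! i)"
      using gt(3) h image_mult[OF gt(1) h(1) rL] nth(3)[OF it] lst(1)[OF nth(1)[OF it]] by simp
    then show "\<exists>g\<in>carrier G. \<exists>i<length ts. s = act g ` set (ts ! i)" using gt(1) h(1) it by blast
  next
    fix g i j assume g: "g \<in> carrier G" and i: "i < length ts" and j: "j < length ts"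
      and eq: "act g ` set (ts ! i) = set (ts ! j)"
    have "act g ` rep (os ! i) = rep (os ! j)"
      using eq nth(3)[OF i] nth(3)[OF j] lst(1)[OF nth(1)[OF i]] lst(1)[OF nth(1)[OF j]] by simp
    moreover have "rep (os ! i) \<in> L" using nth(1)[OF i] X(2) by blast
    ultimately have "os ! i = os ! j" using orb_act[OF g, of "rep (os ! i)"] nth(2)[OF i] nth(2)[OF j] by simp
    then show "i = j" using os(2) i j by (simp add: ts_def nth_eq_iff_index_eq)
  qed
  then show ?thesis by (rule that)
qed

lemma finite_simplex: "s \<in> L ==> finite s"
  using complex unfolding abstract_complex_def by blast

lemma face_closed:
  assumes s: "s \<in> L" and t: "t \<subseteq> s" "t \<noteq> {}"
  shows "t \<in> L"
proof -
  have "\<forall>s\<in>L. \<forall>t. t \<subseteq> s \<and> t \<noteq> {} --> t \<in> L" by (rule conjunct2[OF complex[unfolded abstract_complex_def]])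
  from mp[OF spec[OF bspec[OF this s]] conjI[OF t]] show ?thesis .
qed

lemma countable_complex:
  assumes co: "cocompact_on G (skeleton p L) act" and G: "countable (carrier G)"
  shows "countable L"
proof -
  obtain T where T: "finite T" "skeleton p L = (\<Union>g\<in>carrier G. (\<lambda>s. act g ` s) ` T)"
    using co unfolding cocompact_on_def by blast
  have "countable (skeleton p L)" unfolding T(2) using G T(1) by (intro countable_UN countable_image) (auto simp: countable_finite)
  moreover have "countable s" if "s \<in> skeleton p L" for s
    using that complex unfolding abstract_complex_def skeleton_def by (auto intro: countable_finite)
  ultimately have c: "countable (\<Union>(skeleton p L))" using countable_UN[of "skeleton p L" "\<lambda>s. s"] by simp
  have "\<Union>L \<subseteq> \<Union>(skeleton p L)"
  proof
    fix v assume "v \<in> \<Union>L"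
    then obtain s where s: "s \<in> L" "v \<in> s" by blast
    have "{v} \<in> L" by (rule face_closed[OF s(1)]) (use s(2) in auto)
    then have "{v} \<in> skeleton p L" by (simp add: skeleton_def)
    then show "v \<in> \<Union>(skeleton p L)" by blast
  qed
  then have "countable (\<Union>L)" using c by (rule countable_subset)
  then have "countable {s. finite s \<and> s \<subseteq> \<Union>L}" by (rule countable_Collect_finite_subset)
  moreover have "L \<subseteq> {s. finite s \<and> s \<subseteq> \<Union>L}" using finite_simplex by blast
  ultimately show ?thesis by (rule countable_subset[rotated])
qed

text \<open>Add the orbits of the simplices one by one, together with their faces.\<close>

lemma exhaustion_exists:
  assumes L: "countable L"
  shows "\<exists>E. cocompact_exhaustion G L act E"
proof -
  define S where "S i = {s \<in> L. to_nat_on L s \<le> i}" for i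
  define T where "T i = {t. t \<noteq> {} \<and> (\<exists>s\<in>S i. t \<subseteq> s)}" for i
  define E where "E i = (\<Union>g\<in>carrier G. (\<lambda>s. act g ` s) ` T i)" for i
  have finS: "finite (S i)" for i
  proof (rule finite_imageD)
    show "finite (to_nat_on L ` S i)" by (rule finite_subset[of _ "{..i}"]) (auto simp: S_def)
    show "inj_on (to_nat_on L) (S i)" by (rule inj_on_subset[OF inj_on_to_nat_on[OF L]]) (auto simp: S_def)
  qed
  have finT: "finite (T i)" for i
  proof (rule finite_subset)
    show "T i \<subseteq> (\<Union>s\<in>S i. Pow s)" by (auto simp: T_def)
    show "finite (\<Union>s\<in>S i. Pow s)" using finS complex by (auto simp: S_def abstract_complex_def)
  qed
  have TL: "T i \<subseteq> L" for i using complex by (auto simp: T_def S_def abstract_complex_def)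
  have sub: "E i \<subseteq> L" for i using TL act_simplex by (auto simp: E_def)
  have TE: "T i \<subseteq> E i" for i
  proof
    fix t assume t: "t \<in> T i"
    then have "act \<one> ` t = t" using image_one TL by blast
    then show "t \<in> E i" unfolding E_def using t by (intro UN_I[of \<one>]) (auto intro!: image_eqI[of _ _ t])
  qed
  have inc: "incseq E"
  proof (rule incseq_SucI)
    fix n
    have "T n \<subseteq> T (Suc n)" by (force simp: T_def S_def)
    then show "E n \<subseteq> E (Suc n)" unfolding E_def by (intro UN_mono image_mono) auto
  qed
  have cov: "(\<Union>i. E i) = L"
  proof
    show "(\<Union>i. E i) \<subseteq> L" using sub by blast
    show "L \<subseteq> (\<Union>i. E i)"
    proof
      fix s assume s: "s \<in> L"
      then have "s \<noteq> {}" using complex unfolding abstract_complex_def by blast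
      then have "s \<in> T (to_nat_on L s)" using s by (auto simp: T_def S_def)
      then show "s \<in> (\<Union>i. E i)" using TE by blast
    qed
  qed
  have inv: "act g ` s \<in> E i" if g: "g \<in> carrier G" and s: "s \<in> E i" for g s i
  proof -
    obtain h t where h: "h \<in> carrier G" "t \<in> T i" "s = act h ` t" using s unfolding E_def by blast
    have "t \<in> L" using TL h(2) by blast
    then have "act g ` s = act (g \<otimes> h) ` t" unfolding h(3) by (rule image_mult[OF g h(1)])
    then show ?thesis unfolding E_def using g h by blast
  qed
  have cplx: "abstract_complex (E i)" for i
    unfolding abstract_complex_def
  proof (intro conjI ballI allI impI)
    fix s assume s: "s \<in> E i"
    then show "finite s" "s \<noteq> {}" using sub complex unfolding abstract_complex_def by blast+
    fix u assume u: "u \<subseteq> s \<and> u \<noteq> {}"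
    obtain h t where h: "h \<in> carrier G" "t \<in> T i" "s = act h ` t" using s unfolding E_def by blast
    obtain t' where t': "t' \<subseteq> t" "u = act h ` t'" using u h(3) by (meson subset_imageE)
    obtain s0 where s0: "s0 \<in> S i" "t \<subseteq> s0" using h(2) by (auto simp: T_def)
    have "t' \<noteq> {}" using t'(2) u by auto
    then have "t' \<in> T i" using t'(1) s0 unfolding T_def by blast
    then show "u \<in> E i" unfolding E_def using h(1) t'(2) by blast
  qed
  have co: "cocompact_on G (E i) act" for i
    unfolding cocompact_on_def using finT TE by (intro exI[of _ "T i"]) (auto simp: E_def)
  show ?thesis
    unfolding cocompact_exhaustion_def using cplx sub inv co inc cov by (intro exI[of _ E]) auto
qed

lemma exhaustion_contains_skeleton:
  assumes co: "cocompact_on G (skeleton p L) act" and E: "cocompact_exhaustion G L act E"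
  obtains i0 where "\<And>i. i0 \<le> i ==> skeleton p L \<subseteq> E i"
proof -
  obtain T where T: "finite T" "T \<subseteq> skeleton p L" "skeleton p L = (\<Union>g\<in>carrier G. (\<lambda>s. act g ` s) ` T)"
    using co unfolding cocompact_on_def by blast
  have inc: "incseq E" and cov: "(\<Union>i. E i) = L" using E by (simp_all add: cocompact_exhaustion_def)
  have inv: "act g ` s \<in> E i" if "g \<in> carrier G" "s \<in> E i" for g s i using E that unfolding cocompact_exhaustion_def by simp
  have "T \<subseteq> L" using T(2) by (auto simp: skeleton_def)
  then have TE: "T \<subseteq> (\<Union>i. E i)" using cov by simp
  obtain i0 where i0: "\<And>i. i0 \<le> i ==> T \<subseteq> E i" using incseq_exhausts_finite[OF inc T(1) TE] by blast
  have "skeleton p L \<subseteq> E i" if "i0 \<le> i" for i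
    unfolding T(3) using i0[OF that] inv by blast
  then show ?thesis by (rule that)
qed

end

context two_degrees
begin

lemma ordered_simplices_skeleton:
  assumes "skeleton (Suc q) L \<subseteq> K" "K \<subseteq> L" "r \<le> Suc q"
  shows "ordered_simplices K r = ordered_simplices L r"
proof
  show "ordered_simplices K r \<subseteq> ordered_simplices L r" using ord_mono[OF assms(2)] by blast
  show "ordered_simplices L r \<subseteq> ordered_simplices K r"
  proof
    fix s assume s: "s \<in> ordered_simplices L r"
    then have "card (set s) = Suc r" by (auto simp: ordered_simplices_def distinct_card)
    then have "set s \<in> skeleton (Suc q) L" using s assms(3) by (simp add: skeleton_def ordered_simplices_def)
    then show "s \<in> ordered_simplices K r" using s assms(1) by (auto simp: ordered_simplices_def)
  qed
qed

text \<open>The space of cocycles is closed and contains the closure of the coboundaries, so its image in the quotient is closed.\<close>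

lemma cocycles_closed_modulo_coboundaries:
  assumes K: "K \<subseteq> L" and f: "f \<in> upper.l2c"
    and ap: "\<And>e. 0 < e ==> \<exists>f'\<in>cocycles K. \<exists>b\<in>Bd. hnorm HL (\<lambda>s. (f s - f' s) + b s) < e"
  shows "f \<in> cocycles K"
proof -
  let ?Z = "{x \<in> upper.coord_space. (\<forall>s\<in>ordered_simplices K (Suc (Suc q)). coboundary L (Suc (Suc q)) (upper.ext x) s = 0) \<and> (\<forall>y\<in>{}. l2_inner x y = 0)}"
  have cZ: "closed_subspace ?Z" by (rule cocycle_space_closed[OF K]) simp
  have inZ: "upper.crd f' \<in> ?Z" if "f' \<in> cocycles K" for f'
    using that upper.crd_l2 upper.ext_crd_l2 by (auto simp: cocycles_def)
  have BZ: "upper.crd b \<in> ?Z" if b: "b \<in> Bd" for b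
    using b upper.crd_l2 cbnd_cocycle ord_mono[OF K] by (auto simp: Bd_def)
  have fc: "upper.crd f \<in> upper.coord_space" by (rule upper.crd_l2[OF f])
  have "upper.crd f \<in> ?Z"
  proof (rule closed_subspaceD(6)[OF cZ])
    show "square_summable (upper.crd f)" using fc by (simp add: upper.coord_space_def)
    fix e :: real assume e: "0 < e"
    then obtain f' b where fb: "f' \<in> cocycles K" "b \<in> Bd" "hnorm HL (\<lambda>s. (f s - f' s) + b s) < sqrt e"
      using ap[of "sqrt e"] by auto
    have l: "f' \<in> upper.l2c" "b \<in> upper.l2c" using fb by (auto simp: cocycles_def Bd_def)
    have "(\<lambda>s. (f s + (-1) * f' s) + b s) \<in> upper.l2c" by (rule upper.l2c_add[OF upper.l2c_add[OF f upper.l2c_scale[OF l(1)]] l(2)])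
    then have "hnorm HL (\<lambda>s. (f s - f' s) + b s) = sqrt (sqn (upper.crd (\<lambda>s. (f s - f' s) + b s)))" using hnorm_l2 by simp
    then have "sqn (upper.crd (\<lambda>s. (f s - f' s) + b s)) < e" using fb(3) by simp
    moreover have "upper.crd (\<lambda>s. (f s - f' s) + b s) = (\<lambda>p. upper.crd f p - (upper.crd f' p - upper.crd b p))"
      by (simp add: upper.crd_add upper.crd_diff algebra_simps)
    ultimately have "sqn (\<lambda>p. upper.crd f p - (upper.crd f' p - upper.crd b p)) < e" by simp
    then show "\<exists>y\<in>?Z. sqn (\<lambda>x. upper.crd f x - y x) < e"
      by (rule bexI[rotated, OF closed_subspaceD(5)[OF cZ inZ[OF fb(1)] BZ[OF fb(2)]]])
  qed
  then show ?thesis using f upper.ext_crd_l2[OF f] by (simp add: cocycles_def)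
qed

text \<open>Both complexes have the same cochains in degree \<open>Suc q\<close> and the same coboundaries there, so restriction is the inclusion of cocycles.\<close>

lemma restriction_image:
  assumes K: "skeleton (Suc q) L \<subseteq> K" "K \<subseteq> L" and K': "skeleton (Suc q) L \<subseteq> K'" "K' \<subseteq> K"
  shows "l2_restriction_image G act (Suc q) K K' = image_module K"
proof -
  have K'L: "K' \<subseteq> L" using K K' by blast
  have co: "l2_coboundaries_closure G act M (Suc q) = Bd" if M: "skeleton (Suc q) L \<subseteq> M" "M \<subseteq> L" for M
  proof -
    have "ordered_simplices M (Suc q) = ordered_simplices L (Suc q)" "ordered_simplices M q = ordered_simplices L q"
      using ordered_simplices_skeleton[OF M] by auto
    then have "l2_coboundaries_closure G act M (Suc q) = l2_coboundaries_closure G act L (Suc q)"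
      by (simp add: l2_coboundaries_closure_def hclosure_def l2_cochains_def cochains_def cochain_action_def[abs_def] coboundary_def[abs_def])
    then show ?thesis using coboundaries_closure by simp
  qed
  have ch: "l2_cochains G act M (Suc q) = HL" if M: "skeleton (Suc q) L \<subseteq> M" "M \<subseteq> L" for M
    using ordered_simplices_skeleton[OF M, of "Suc q"]
    by (simp add: l2_cochains_def cochains_def cochain_action_def[abs_def])
  have cz: "l2_cocycles G act M (Suc q) = cocycles M" if M: "skeleton (Suc q) L \<subseteq> M" "M \<subseteq> L" for M
    unfolding l2_cocycles_def ch[OF M] l2_simps cocycles_def
    using ord_mono[OF M(2)] by (auto simp: coboundary_def fun_eq_iff)
  have red: "reduced_l2_cohomology G act M (Suc q) = hquot (hsub HL (cocycles M)) Bd" if M: "skeleton (Suc q) L \<subseteq> M" "M \<subseteq> L" for M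
    by (simp only: reduced_l2_cohomology_def ch[OF M] cz[OF M] co[OF M])
  let ?H = "hquot (hsub HL (cocycles K')) Bd"
  have H: "hcarrier (hquot (hsub HL (cocycles M)) Bd) = coset ` cocycles M" for M
    by (simp add: hquot_def hsub_def l2_simps coset_def[abs_def])
  have H2: "hadd ?H = (\<lambda>X Y. {(\<lambda>s. x s + y s) | x y. x \<in> X \<and> y \<in> Y})"
    "hscale ?H = (\<lambda>c X. {(\<lambda>s. c * x s + b s) | x b. x \<in> X \<and> b \<in> Bd})" "hnorm ?H = (\<lambda>X. Inf (hnorm HL ` X))"
    by (simp_all add: hquot_def hsub_def l2_simps)
  have diff_mem: "(\<lambda>s. f s + (- 1 * f' s + 0)) \<in> hadd ?H (coset f) (hscale ?H (-1) (coset f'))" for f f'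
  proof -
    have y: "(\<lambda>s. - 1 * f' s + 0) \<in> hscale ?H (-1) (coset f')"
      unfolding H2 by (rule CollectI, rule exI[of _ f'], rule exI[of _ "\<lambda>_. 0"]) (intro conjI refl coset_mem Bd_zero)
    show ?thesis
      unfolding H2(1) by (rule CollectI, rule exI[of _ f], rule exI[of _ "\<lambda>s. - 1 * f' s + 0"]) (intro conjI refl coset_mem y)
  qed
  have restr: "l2_restriction G act K' (Suc q) (coset f) = coset f" if f: "f \<in> cocycles K" for f
  proof -
    have rid: "restrict_cochain K' (Suc q) u = u" if u: "u \<in> coset f" for u
    proof -
      have "u \<in> upper.l2c" using u f upper.l2c_add by (auto simp: coset_def cocycles_def Bd_def)
      then show ?thesis using ordered_simplices_skeleton[OF K'(1) K'L, of "Suc q"] cochainsD(1)[of u L "Suc q"]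
	by (auto simp: restrict_cochain_def upper.l2c_def fun_eq_iff)
    qed
    show ?thesis
      unfolding l2_restriction_def co[OF K'(1) K'L]
    proof (rule subset_antisym; rule subsetI)
      fix u assume "u \<in> {(\<lambda>xs. restrict_cochain K' (Suc q) f' xs + b xs) | f' b. f' \<in> coset f \<and> b \<in> Bd}"
      then obtain f' b where fb: "f' \<in> coset f" "b \<in> Bd" "u = (\<lambda>xs. f' xs + b xs)" using rid by auto
      obtain b' where b': "b' \<in> Bd" "f' = (\<lambda>s. f s + b' s)" using fb(1) by (auto simp: coset_def)
      have u: "u = (\<lambda>s. f s + (b' s + b s))" using fb(3) b'(2) by (simp add: add.assoc)
      show "u \<in> coset f" unfolding coset_def by (rule image_eqI[rotated, OF Bd_add[OF b'(1) fb(2)]]) (rule u)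
    next
      fix u assume u: "u \<in> coset f"
      have "u = (\<lambda>xs. restrict_cochain K' (Suc q) u xs + 0)" using rid[OF u] by simp
      then show "u \<in> {(\<lambda>xs. restrict_cochain K' (Suc q) f' xs + b xs) | f' b. f' \<in> coset f \<and> b \<in> Bd}"
	using u Bd_zero by (intro CollectI exI[of _ u] exI[of _ "\<lambda>_. 0"] conjI)
    qed
  qed
  have bdd: "bdd_below (hnorm HL ` X)" for X
    by (rule bdd_belowI[of _ 0]) (auto simp: l2_cochains_def intro!: divide_nonneg_nonneg infsum_nonneg)
  have mono: "cocycles K \<subseteq> cocycles K'" using ord_mono[OF K'(2)] by (auto simp: cocycles_def)
  have clos: "hclosure ?H (coset ` cocycles K) = coset ` cocycles K"
  proof (rule subset_antisym; rule subsetI)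
    fix X assume "X \<in> hclosure ?H (coset ` cocycles K)"
    then obtain f where f: "f \<in> cocycles K'" "X = coset f"
      and ap: "\<And>e. 0 < e ==> \<exists>Y\<in>coset ` cocycles K. hnorm ?H (hadd ?H X (hscale ?H (-1) Y)) < e"
      unfolding hclosure_def H by blast
    have "f \<in> cocycles K"
    proof (rule cocycles_closed_modulo_coboundaries[OF K(2)])
      show "f \<in> upper.l2c" using f(1) by (simp add: cocycles_def)
      fix e :: real assume e: "0 < e"
      obtain f' where f': "f' \<in> cocycles K" "hnorm ?H (hadd ?H X (hscale ?H (-1) (coset f'))) < e" using ap[OF e] by blast
      let ?D = "hadd ?H X (hscale ?H (-1) (coset f'))"
      have z: "(\<lambda>s. f s + (-1 * f' s + 0)) \<in> ?D"
	unfolding f(2) by (rule diff_mem)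
      have "Inf (hnorm HL ` ?D) < e" using f'(2) unfolding H2(3) .
      moreover have "hnorm HL ` ?D \<noteq> {}" using z by blast
      ultimately have "\<exists>r\<in>hnorm HL ` ?D. r < e" by (intro cInf_lessD)
      then obtain u where u: "u \<in> ?D" "hnorm HL u < e" by blast
      obtain x y b where xyb: "x \<in> coset f" "y \<in> coset f'" "b \<in> Bd" "u = (\<lambda>s. x s + (-1 * y s + b s))"
	using u(1) unfolding H2 f(2) by blast
      obtain b1 b2 where b12: "b1 \<in> Bd" "x = (\<lambda>s. f s + b1 s)" "b2 \<in> Bd" "y = (\<lambda>s. f' s + b2 s)"
	using xyb(1,2) by (auto simp: coset_def)
      have bb: "(\<lambda>s. b1 s + (-1 * b2 s + b s)) \<in> Bd" by (intro Bd_add Bd_scale b12(1,3) xyb(3))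
      have "u = (\<lambda>s. (f s - f' s) + (b1 s + (-1 * b2 s + b s)))" using xyb(4) b12 by (simp add: fun_eq_iff)
      then show "\<exists>f'\<in>cocycles K. \<exists>b\<in>Bd. hnorm HL (\<lambda>s. (f s - f' s) + b s) < e"
	using u(2) by (intro bexI[OF _ f'(1)] bexI[OF _ bb]) simp
    qed
    then show "X \<in> coset ` cocycles K" using f(2) by blast
  next
    fix X assume X: "X \<in> coset ` cocycles K"
    then obtain f where f: "f \<in> cocycles K" "X = coset f" by blast
    have "hnorm ?H (hadd ?H X (hscale ?H (-1) X)) < e" if e: "0 < e" for e
    proof -
      have "(\<lambda>s. f s + (-1 * f s + 0)) \<in> hadd ?H X (hscale ?H (-1) X)"
	unfolding f(2) by (rule diff_mem)
      then have "(\<lambda>_. 0) \<in> hadd ?H X (hscale ?H (-1) X)" by simp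
      then have "Inf (hnorm HL ` hadd ?H X (hscale ?H (-1) X)) \<le> hnorm HL (\<lambda>_. 0)" by (intro cInf_lower bdd imageI)
      also have "hnorm HL (\<lambda>_. 0) = 0" by (simp add: l2_cochains_def)
      finally show ?thesis using e by (simp add: H2(3))
    qed
    then show "X \<in> hclosure ?H (coset ` cocycles K)" unfolding hclosure_def H using X mono by blast
  qed
  have "l2_restriction_image G act (Suc q) K K' = hsub ?H (hclosure ?H (l2_restriction G act K' (Suc q) ` (coset ` cocycles K)))"
    by (simp only: l2_restriction_image_def Let_def red[OF K] red[OF K'(1) K'L] H)
  also have "l2_restriction G act K' (Suc q) ` (coset ` cocycles K) = coset ` cocycles K"
    using restr by (auto simp: image_image intro!: image_eqI)
  also have "hsub ?H (hclosure ?H (coset ` cocycles K)) = image_module K"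
    unfolding clos by (simp add: image_module_def hsub_def hquot_def)
  finally show ?thesis .
qed

text \<open>The dimension of the image depends on the larger complex only and decreases as that grows, so the inner limits exist and do not
depend on the smaller one.\<close>

lemma l2_betti_bound:
  assumes co: "cocompact_on G (skeleton (Suc q) L) act" and G: "countable (carrier G)"
  obtains E b i0 where "cocompact_exhaustion G L act E" "l2_betti G L act (Suc q) = ereal b"
    "\<And>j. i0 \<le> j ==> ereal b \<le> projection_trace G (harmonic (E j))"
proof -
  define E where "E = (SOME E. cocompact_exhaustion G L act E)"
  have E: "cocompact_exhaustion G L act E"
    unfolding E_def by (rule someI_ex[OF lower.exhaustion_exists[OF lower.countable_complex[OF co G]]])
  obtain i0 where i0: "\<And>i. i0 \<le> i ==> skeleton (Suc q) L \<subseteq> E i"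
    using lower.exhaustion_contains_skeleton[OF co E] by blast
  have EL: "E i \<subseteq> L" and Einv: "\<And>g s. g \<in> carrier G ==> s \<in> E i ==> act g ` s \<in> E i" for i
    using E by (auto simp: cocompact_exhaustion_def)
  have Emono: "i \<le> j ==> E i \<subseteq> E j" for i j using E by (simp add: cocompact_exhaustion_def incseq_def)
  define w where "w j = projection_trace G (harmonic (E j))" for j
  have w: "w j = ereal (\<Sum>i<length ts. sqn (l2_proj (harmonic (E j)) (gvec G i)))" for j
    unfolding w_def by (rule projection_trace_harmonic[OF EL])
  have dec: "decseq w" unfolding decseq_def w_def using projection_trace_harmonic_antimono[OF Emono EL] by blast
  define W where "W = (INF j. w j)"
  have lim: "w \<longlonglongrightarrow> W" unfolding W_def by (rule LIMSEQ_INF[OF dec])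
  have inner: "lim (\<lambda>j. vn_dim G (l2_restriction_image G act (Suc q) (E j) (E i))) = W" if i: "i0 \<le> i" for i
  proof (rule limI, rule Lim_transform_eventually[OF lim])
    show "eventually (\<lambda>j. w j = vn_dim G (l2_restriction_image G act (Suc q) (E j) (E i))) sequentially"
      using eventually_ge_at_top[of i]
    proof eventually_elim
      case (elim j)
      have "l2_restriction_image G act (Suc q) (E j) (E i) = image_module (E j)"
	by (rule restriction_image) (use i0 i elim EL Emono in auto)
      then show ?case using vn_dim_image_module[OF EL Einv] by (simp add: w_def)
    qed
  qed
  have outer: "l2_betti G L act (Suc q) = W"
    unfolding l2_betti_def Let_def E_def[symmetric]
  proof (rule limI, rule tendsto_eventually)
    show "eventually (\<lambda>i. lim (\<lambda>j. vn_dim G (l2_restriction_image G act (Suc q) (E j) (E i))) = W) sequentially"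
      using eventually_ge_at_top[of i0] by eventually_elim (rule inner)
  qed
  have W0: "0 \<le> W" unfolding W_def by (rule INF_greatest) (simp add: w sum_nonneg)
  have Ww: "W \<le> w j" for j unfolding W_def by (rule INF_lower) simp
  have "W \<noteq> \<infinity>"
  proof
    assume "W = \<infinity>"
    then show False using Ww[of 0] w[of 0] by simp
  qed
  then obtain b where b: "W = ereal b" using W0 by (cases W) auto
  show ?thesis
    by (rule that[OF E, of b 0]) (use outer b Ww in \<open>auto simp: w_def\<close>)
qed

end

section \<open>The inequality\<close>

lemma trace_error_small:
  fixes c R e :: real
  assumes "0 < e"
  shows "\<exists>k\<ge>1. c * trace_error R k \<le> e"
proof -
  define C where "C = \<bar>c * (2 * (1 + ln R))\<bar> / e"
  have C: "0 \<le> C" using assms by (simp add: C_def)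
  obtain k where k: "exp (C + 1) \<le> real k" using real_arch_simple by blast
  have k1: "1 \<le> k" using k exp_gt_zero[of "C + 1"] by (cases k) auto
  have "C + 1 \<le> ln (real k)" using k k1 by (subst ln_ge_iff) auto
  also have "... \<le> ln (real (2 * k))" using k1 by simp
  finally have l: "C + 1 \<le> ln (real (2 * k))" .
  then have l0: "0 < ln (real (2 * k))" using C by linarith
  have "c * trace_error R k = c * (2 * (1 + ln R)) / ln (real (2 * k))" by (simp add: trace_error_def)
  also have "... \<le> \<bar>c * (2 * (1 + ln R))\<bar> / ln (real (2 * k))" using l0 by (intro divide_right_mono) auto
  also have "... \<le> e"
  proof -
    have "\<bar>c * (2 * (1 + ln R))\<bar> = C * e" using assms by (simp add: C_def)
    also have "... \<le> ln (real (2 * k)) * e" using l assms by (intro mult_right_mono) auto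
    finally show ?thesis using l0 by (simp add: pos_divide_le_eq mult.commute)
  qed
  finally show ?thesis using k1 by blast
qed

context entropy_setting
begin

lemma card_cocycle_models_ge:
  assumes V: "finite V" and rank: "eventually (\<lambda>n. \<forall>J' \<subseteq> D n \<times> {..<length ts}.
      independent_columns TYPE('k::{field,finite}) (D n \<times> V) (model_matrix G S (\<lambda>r. bcoef (A r)) (\<sigma> n)) J' -->
      real (card J') \<le> real (card (D n)) * \<theta>) sequentially"
  shows "eventually (\<lambda>n. real (card (D n)) * ((real (length ts) - \<theta>) * ln (real CARD('k)))
      \<le> ln (real (card (cocycle_models n V A S :: ('e \<times> nat => 'k) set)))) sequentially"
  using rank
proof eventually_elim
  case (elim n)
  let ?J = "D n \<times> {..<length ts}" and ?X = "model_matrix G S (\<lambda>r. bcoef (A r)) (\<sigma> n)" and ?l = "ln (real CARD('k))"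
  have fin: "finite (D n \<times> V)" "finite ?J" using V by auto
  obtain J' where J': "J' \<subseteq> ?J" "independent_columns TYPE('k) (D n \<times> V) ?X J'"
    "CARD('k) ^ (card ?J - card J') \<le> card {y \<in> ?J \<rightarrow>\<^sub>E (UNIV :: 'k set). \<forall>i\<in>D n \<times> V. (\<Sum>j\<in>?J. of_int (?X i j) * y j) = 0}"
    by (rule card_kernel_ge[OF fin, where X = ?X and 'k = 'k])
  have k: "1 \<le> CARD('k)" by (simp add: Suc_le_eq card_gt_0_iff)
  have l0: "0 \<le> ?l" using k by simp
  have le: "CARD('k) ^ (card ?J - card J') \<le> card (cocycle_models n V A S :: ('e \<times> nat => 'k) set)"
    using J'(3) by (simp add: cocycle_models_def)
  have cJ: "card J' \<le> card ?J" using J'(1) fin by (intro card_mono)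
  have "real (card J') \<le> real (card (D n)) * \<theta>" using elim J'(1,2) by blast
  then have "real (card (D n)) * (real (length ts) - \<theta>) \<le> real (card ?J - card J')"
    using cJ by (simp add: of_nat_diff card_cartesian_product algebra_simps)
  then have "real (card (D n)) * (real (length ts) - \<theta>) * ?l \<le> real (card ?J - card J') * ?l"
    using l0 by (rule mult_right_mono)
  also have "... = ln (real (CARD('k) ^ (card ?J - card J')))" using k by (simp add: ln_realpow)
  also have "... \<le> ln (real (card (cocycle_models n V A S :: ('e \<times> nat => 'k) set)))"
  proof (rule ln_mono)
    show "0 < real (CARD('k) ^ (card ?J - card J'))" using k by simp
    show "real (CARD('k) ^ (card ?J - card J')) \<le> real (card (cocycle_models n V A S :: ('e \<times> nat => 'k) set))"
      using le by (simp only: of_nat_le_iff)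
  qed
  finally show ?case by (simp only: mult.assoc)
qed

end

text \<open>If the entropy of \<open>ker \<delta>\<close> is \<open>y * ln CARD('k)\<close>, then \<open>\<tau>1 R k\<close> is at most about \<open>y - m + m'\<close> for all \<open>R\<close> and \<open>k\<close>. So the
bound \<open>b + m' \<le> \<tau>1 + \<tau>2\<close> yields the lower bound \<open>b + m - y\<close> for \<open>\<tau>2\<close>, which no longer involves the parameters \<open>R\<close> and \<open>V0\<close> that depend
on the finite set of equations.\<close>

lemma entropy_inequality:
  fixes G :: "('a, 'm) monoid_scheme" and L :: "'c set set" and act :: "'a => 'c => 'c"
    and D :: "nat => 'e set" and \<sigma> :: "nat => 'a => 'e => 'e"
  assumes grp: "group G" and cnt: "countable (carrier G)" and sof: "sofic_approximation G D \<sigma>"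
    and fr: "free_simplicial_action G L act" and co: "cocompact_on G (skeleton (Suc q) L) act"
    and exact: "im_coboundary L (Suc q) = (ker_coboundary L (Suc (Suc q)) :: ('c list => 'k::{field, finite}) set)"
    and gen0: "generating_pseudometric G (pointwise_topology (cochains L q :: ('c list => 'k) set)) (cochain_action G act L q) \<rho>0"
    and gen1: "generating_pseudometric G (pointwise_topology (ker_coboundary L (Suc q) :: ('c list => 'k) set)) (cochain_action G act L q) \<rho>1"
    and gen2: "generating_pseudometric G (pointwise_topology (im_coboundary L (Suc q) :: ('c list => 'k) set)) (cochain_action G act L (Suc q)) \<rho>2"
  shows "sofic_entropy_wrt \<rho>0 G D \<sigma> (pointwise_topology (cochains L q)) (cochain_action G act L q)
      + l2_betti G L act (Suc q) * ereal (ln (real CARD('k)))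
     \<le> sofic_entropy_wrt \<rho>1 G D \<sigma> (pointwise_topology (ker_coboundary L (Suc q))) (cochain_action G act L q)
      + sofic_entropy_wrt \<rho>2 G D \<sigma> (pointwise_topology (im_coboundary L (Suc q))) (cochain_action G act L (Suc q))"
proof -
  interpret fc: free_complex G L act using grp fr by (simp add: free_complex_def free_complex_axioms_def)
  obtain ts' where ts': "simplex_reps G L act q ts'" using fc.simplex_reps_exist[OF co, of q] by auto
  obtain ts where ts: "simplex_reps G L act (Suc q) ts" using fc.simplex_reps_exist[OF co, of "Suc q"] by auto
  interpret lower: simplex_reps G L act q ts' by (rule ts')
  interpret upper: simplex_reps G L act "Suc q" ts by (rule ts)
  interpret two: two_degrees G L act q ts' ts using ts' ts by (simp add: two_degrees_def)
  interpret sg: sofic_group G D \<sigma> using grp sof by (simp add: sofic_group_def sofic_group_axioms_def)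
  interpret le: entropy_setting G D \<sigma> L act q ts' using sg.sofic_group_axioms ts' by (simp add: entropy_setting_def)
  interpret ue: entropy_setting G D \<sigma> L act "Suc q" ts using sg.sofic_group_axioms ts by (simp add: entropy_setting_def)
  let ?m = "real (length ts')" and ?m' = "real (length ts)" and ?l = "ln (real CARD('k))"
  let ?C0 = "cochains L q :: ('c list => 'k) set" and ?C1 = "ker_coboundary L (Suc q) :: ('c list => 'k) set"
    and ?C2 = "ker_coboundary L (Suc (Suc q)) :: ('c list => 'k) set"
  let ?h0 = "sofic_entropy_wrt \<rho>0 G D \<sigma> (pointwise_topology ?C0) (cochain_action G act L q)"
  let ?h1 = "sofic_entropy_wrt \<rho>1 G D \<sigma> (pointwise_topology ?C1) (cochain_action G act L q)"
  let ?h2 = "sofic_entropy_wrt \<rho>2 G D \<sigma> (pointwise_topology ?C2) (cochain_action G act L (Suc q))"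
  have l0: "0 < ?l"
  proof -
    have "card {0, 1 :: 'k} \<le> CARD('k)" by (rule card_mono) auto
    then show ?thesis by simp
  qed
  have up: "?h0 \<le> ereal (?m * ?l)"
    by (rule le.entropy_upper_bound[OF closed_cochains order_refl gen0 lower.action_cochain])
  obtain E b i0 where E: "cocompact_exhaustion G L act E" and b: "l2_betti G L act (Suc q) = ereal b"
    and bE: "\<And>j. i0 \<le> j ==> ereal b \<le> projection_trace G (two.harmonic (E j))"
    using two.l2_betti_bound[OF co cnt] by blast
  define S1 where "S1 = (\<Union>r<length ts. lower.bsupp (ts ! r))"
  have S1: "finite S1" "S1 \<subseteq> carrier G"
    using lower.bsupp(1) lower.bsupp(2)[OF upper.reps_ord] by (auto simp: S1_def)
  have supp1: "lower.bsupp (ts ! r) \<subseteq> S1" if "r < length ts" for r using that by (auto simp: S1_def)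
  let ?a1 = "\<lambda>r. lower.bcoef (ts ! r)"
  let ?R1 = "coeff_bound {..<length ts} {..<length ts'} S1 ?a1"
  define \<tau>1 where "\<tau>1 R k = unit_trace G {..<length ts} (damped_rows G {..<length ts} {..<length ts'} S1 ?a1 R ^^ (2 * k))" for R k
  have h1: "ereal ((?m - (?m' - \<tau>1 R k + ?m' * trace_error R k)) * ?l) \<le> ?h1" if R: "?R1 \<le> R" "1 \<le> R" and k: "1 \<le> k" for R k
  proof (rule le.entropy_lower_bound[where 'r = nat, OF gen1])
    let ?t = "?m' - \<tau>1 R k + ?m' * trace_error R k"
    fix V0 assume V0: "finite V0" "V0 \<subseteq> ordered_simplices L (Suc q)"
    have cov: "le.covers_coboundaries {..<length ts} ((!) ts) S1 V0"
      unfolding le.covers_coboundaries_def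
    proof (intro conjI ballI)
      fix s assume "s \<in> V0"
      then obtain g i \<pi> where "upper.is_coord s g i \<pi>" using upper.coord_exists V0 by blast
      moreover then have "length (ts ! i) = Suc (Suc q)" using fc.ord_set(3)[OF upper.reps_ord] by (simp add: upper.is_coord_def)
      ultimately show "\<exists>r\<in>{..<length ts}. \<exists>g\<in>carrier G. \<exists>\<pi>. \<pi> permutes {..<length (ts ! r)} \<and> s = permute_list \<pi> (map (act g) (ts ! r))"
	unfolding upper.is_coord_def upper.basic_def by (intro bexI[of _ i] bexI[of _ g] exI[of _ \<pi>]) simp_all
    qed (use S1 supp1 upper.reps_ord in auto)
    have "\<forall>\<epsilon>>0. eventually (\<lambda>n. real (card (D n)) * ((?m - ?t - \<epsilon>) * ?l)
	\<le> ln (real (card (le.cocycle_models n {..<length ts} ((!) ts) S1 :: ('e \<times> nat => 'k) set)))) sequentially"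
    proof (intro allI impI)
      fix \<epsilon> :: real assume \<epsilon>: "0 < \<epsilon>"
      have "eventually (\<lambda>n. \<forall>J' \<subseteq> D n \<times> {..<length ts'}. independent_columns TYPE('k) (D n \<times> {..<length ts})
	  (model_matrix G S1 ?a1 (\<sigma> n)) J' --> real (card J') \<le> real (card (D n)) *
	    (real (card {..<length ts}) - unit_trace G {..<length ts} (damped_rows G {..<length ts} {..<length ts'} S1 ?a1 R ^^ (2 * k))
	      + real (card {..<length ts}) * trace_error R k + \<epsilon>)) sequentially"
	by (rule sg.rank_le_trace_rows[OF S1 finite_lessThan finite_lessThan R k \<epsilon>])
      from le.card_cocycle_models_ge[OF finite_lessThan this]
      show "eventually (\<lambda>n. real (card (D n)) * ((?m - ?t - \<epsilon>) * ?l)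
	\<le> ln (real (card (le.cocycle_models n {..<length ts} ((!) ts) S1 :: ('e \<times> nat => 'k) set)))) sequentially"
	by (simp add: \<tau>1_def diff_diff_eq algebra_simps)
    qed
    then show "\<exists>(V :: nat set) A S. le.covers_coboundaries V A S V0 \<and> (\<forall>\<epsilon>>0. eventually (\<lambda>n. real (card (D n)) * ((?m - ?t - \<epsilon>) * ?l)
	\<le> ln (real (card (le.cocycle_models n V A S :: ('e \<times> nat => 'k) set)))) sequentially)"
      using cov by blast
  qed
  show ?thesis
  proof (cases "?h1 = \<infinity>")
    case True
    show ?thesis unfolding exact True by simp
  next
    case False
    have "- \<infinity> < ?h1" using h1[of "max 1 ?R1" 1] by (metis MInfty_neq_ereal(1) ereal_infty_less_eq(2) linorder_not_le max.cobounded1 max.cobounded2 order_refl)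
    then obtain x where x: "?h1 = ereal x" using False by (cases ?h1) auto
    define y where "y = x / ?l"
    have xy: "x = y * ?l" using l0 by (simp add: y_def)
    have y: "?m - (?m' - \<tau>1 R k + ?m' * trace_error R k) \<le> y" if "?R1 \<le> R" "1 \<le> R" "1 \<le> k" for R k
      using h1[OF that] l0 by (simp add: x xy)
    have h2: "ereal ((b + ?m - y) * ?l) \<le> ?h2"
    proof (rule ue.entropy_lower_bound[where 'r = "'c list", OF gen2[unfolded exact]])
      fix V0 assume V0: "finite V0" "V0 \<subseteq> ordered_simplices L (Suc (Suc q))"
      define S2 where "S2 = (\<Union>s\<in>V0. upper.bsupp s)"
      have S2: "finite S2" "S2 \<subseteq> carrier G"
	using upper.bsupp(1) upper.bsupp(2) V0 by (auto simp: S2_def)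
      have supp2: "upper.bsupp s \<subseteq> S2" if "s \<in> V0" for s using that by (auto simp: S2_def)
      have cov: "ue.covers_coboundaries V0 (\<lambda>s. s) S2 V0"
	unfolding ue.covers_coboundaries_def
      proof (intro conjI ballI)
	fix s assume s: "s \<in> V0"
	have "s = permute_list id (map (act \<one>\<^bsub>G\<^esub>) s)"
	  using fc.map_act_one[of s "Suc (Suc q)"] V0 s by (auto simp: permute_list_id)
	then show "\<exists>r\<in>V0. \<exists>g\<in>carrier G. \<exists>\<pi>. \<pi> permutes {..<length r} \<and> s = permute_list \<pi> (map (act g) r)"
	  using s permutes_id by blast
      qed (use S2 supp2 V0 in auto)
      have "incseq E" "(\<Union>i. E i) = L" using E by (auto simp: cocompact_exhaustion_def)
      moreover have "set ` V0 \<subseteq> L" using V0(2) fc.ord_set(1) by blast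
      ultimately obtain i1 where i1: "\<And>i. i1 \<le> i ==> set ` V0 \<subseteq> E i"
	using incseq_exhausts_finite[of E "set ` V0"] V0(1) by blast
      define K where "K = E (max i0 i1)"
      have K: "K \<subseteq> L" and Kinv: "\<And>g s. g \<in> carrier G ==> s \<in> K ==> act g ` s \<in> K"
	using E unfolding K_def cocompact_exhaustion_def by blast+
      have V0K: "V0 \<subseteq> ordered_simplices K (Suc (Suc q))"
	using V0(2) i1[of "max i0 i1"] by (auto simp: ordered_simplices_def K_def)
      have bK: "ereal b \<le> projection_trace G (two.harmonic K)" unfolding K_def by (rule bE) simp
      let ?R2 = "coeff_bound V0 {..<length ts} S2 upper.bcoef"
      define R where "R = max 1 (max ?R1 ?R2)"
      have R: "?R1 \<le> R" "?R2 \<le> R" "1 \<le> R" by (auto simp: R_def)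
      define \<tau>2 where "\<tau>2 k = unit_trace G {..<length ts} (damped_cols G V0 {..<length ts} S2 upper.bcoef R ^^ (2 * k))" for k
      have tr: "b + ?m' \<le> \<tau>1 R k + \<tau>2 k" for k
      proof -
	have "ereal b + ereal ?m' \<le> projection_trace G (two.harmonic K) + ereal ?m'" by (rule add_right_mono[OF bK])
	also have "... \<le> ereal (\<tau>1 R k + \<tau>2 k)"
	  unfolding \<tau>1_def \<tau>2_def by (rule two.harmonic_trace_bound[OF K Kinv S1 supp1 S2 V0(1) V0K supp2])
	finally show ?thesis by simp
      qed
      have "\<forall>\<epsilon>>0. eventually (\<lambda>n. real (card (D n)) * ((b + ?m - y - \<epsilon>) * ?l)
	  \<le> ln (real (card (ue.cocycle_models n V0 (\<lambda>s. s) S2 :: ('e \<times> nat => 'k) set)))) sequentially"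
      proof (intro allI impI)
	fix \<epsilon> :: real assume \<epsilon>: "0 < \<epsilon>"
	then have \<epsilon>2: "0 < \<epsilon> / 2" by simp
	\<comment> \<open>Twice the error of one rank estimate, as both matrices contribute.\<close>
	obtain k where k: "1 \<le> k" "(2 * ?m') * trace_error R k \<le> \<epsilon> / 2" using trace_error_small[OF \<epsilon>2, of "2 * ?m'" R] by blast
	let ?\<theta> = "real (card {..<length ts}) - unit_trace G {..<length ts} (damped_cols G V0 {..<length ts} S2 upper.bcoef R ^^ (2 * k))
	      + real (card {..<length ts}) * trace_error R k + \<epsilon> / 2"
	have "eventually (\<lambda>n. \<forall>J' \<subseteq> D n \<times> {..<length ts}. independent_columns TYPE('k) (D n \<times> V0)
	  (model_matrix G S2 upper.bcoef (\<sigma> n)) J' --> real (card J') \<le> real (card (D n)) * ?\<theta>) sequentially"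
	  by (rule sg.rank_le_trace_cols[OF S2 finite_lessThan V0(1) R(2,3) k(1) \<epsilon>2])
	then have ev: "eventually (\<lambda>n. real (card (D n)) * ((?m' - ?\<theta>) * ?l)
	    \<le> ln (real (card (ue.cocycle_models n V0 (\<lambda>s. s) S2 :: ('e \<times> nat => 'k) set)))) sequentially"
	  by (intro ue.card_cocycle_models_ge V0(1)) simp
	have "b + ?m - y - \<epsilon> \<le> ?m' - ?\<theta>"
	proof -
	  have "?m - (?m' - \<tau>1 R k + ?m' * trace_error R k) \<le> y" by (rule y[OF R(1,3) k(1)])
	  moreover have "?m' - ?\<theta> = \<tau>2 k - ?m' * trace_error R k - \<epsilon> / 2" by (simp add: \<tau>2_def)
	  moreover have "2 * (?m' * trace_error R k) \<le> \<epsilon> / 2" using k(2) by (simp add: mult.assoc)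
	  ultimately show ?thesis using tr[of k] by linarith
	qed
	then have le: "real (card (D n)) * ((b + ?m - y - \<epsilon>) * ?l) \<le> real (card (D n)) * ((?m' - ?\<theta>) * ?l)" for n
	  using l0 by (intro mult_left_mono mult_right_mono) auto
	show "eventually (\<lambda>n. real (card (D n)) * ((b + ?m - y - \<epsilon>) * ?l)
	  \<le> ln (real (card (ue.cocycle_models n V0 (\<lambda>s. s) S2 :: ('e \<times> nat => 'k) set)))) sequentially"
	  using ev by eventually_elim (rule order_trans[OF le])
      qed
      then show "\<exists>(V :: 'c list set) A S. ue.covers_coboundaries V A S V0 \<and> (\<forall>\<epsilon>>0. eventually (\<lambda>n. real (card (D n)) * ((b + ?m - y - \<epsilon>) * ?l)
	  \<le> ln (real (card (ue.cocycle_models n V A S :: ('e \<times> nat => 'k) set)))) sequentially)"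
	using cov by blast
    qed
    have "?h0 + l2_betti G L act (Suc q) * ereal ?l \<le> ereal (?m * ?l) + ereal (b * ?l)"
      unfolding b times_ereal.simps by (rule add_right_mono[OF up])
    also have "... = ereal x + ereal ((b + ?m - y) * ?l)" by (simp add: xy algebra_simps)
    also have "... \<le> ?h1 + ?h2" unfolding x by (rule add_left_mono[OF h2])
    finally show ?thesis unfolding exact .
  qed
qed

theorem corollary5p9:
  fixes G :: "('g, 'm) monoid_scheme"
    and D :: "nat \<Rightarrow> 'd set" and \<sigma> :: "nat \<Rightarrow> 'g \<Rightarrow> 'd \<Rightarrow> 'd"
    and L :: "'v set set" and act :: "'g \<Rightarrow> 'v \<Rightarrow> 'v"
    and p :: nat
  assumes "group G" and "countable (carrier G)"
    and "sofic_approximation G D \<sigma>"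
    and "free_simplicial_action G L act"
    and "p \<ge> 1"
    and "cocompact_on G (skeleton p L) act"
    and "im_coboundary L p = (ker_coboundary L (p + 1) :: ('v list \<Rightarrow> 'k::{field, finite}) set)"
  shows
    "sofic_entropy G D \<sigma>
	(pointwise_topology (cochains L (p - 1) :: ('v list \<Rightarrow> 'k) set)) (cochain_action G act L (p - 1))
      + l2_betti G L act p * ereal (ln (real CARD('k)))
     \<le> sofic_entropy G D \<sigma>
	(pointwise_topology (ker_coboundary L p :: ('v list \<Rightarrow> 'k) set)) (cochain_action G act L (p - 1))
      + sofic_entropy G D \<sigma>
	(pointwise_topology (im_coboundary L p :: ('v list \<Rightarrow> 'k) set)) (cochain_action G act L p)"
proof -
  obtain q where p: "p = Suc q" using assms(5) by (cases p) auto
  interpret fc: free_complex G L act using assms(1,4) by (simp add: free_complex_def free_complex_axioms_def)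
  note co = assms(6)[unfolded p]
  have exact: "im_coboundary L (Suc q) = (ker_coboundary L (Suc (Suc q)) :: ('v list => 'k) set)"
    using assms(7) by (simp add: p)
  have gen: "generating_pseudometric G (pointwise_topology C) (cochain_action G act L r)
      (SOME \<rho>. generating_pseudometric G (pointwise_topology C) (cochain_action G act L r) \<rho>)"
    if C: "C \<subseteq> (cochains L r :: ('v list => 'k) set)" and r: "r \<le> Suc q" for C r
  proof -
    obtain ts where "simplex_reps G L act r ts" using fc.simplex_reps_exist[OF co r] by blast
    from simplex_reps.generating_exists[OF this C] show ?thesis
      by (rule someI[where P = "generating_pseudometric G (pointwise_topology C) (cochain_action G act L r)"])
  qed
  have C: "(ker_coboundary L (Suc q) :: ('v list => 'k) set) \<subseteq> cochains L q"
    "(im_coboundary L (Suc q) :: ('v list => 'k) set) \<subseteq> cochains L (Suc q)"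
    unfolding exact by (auto simp: ker_coboundary_def)
  have q: "q \<le> Suc q" by simp
  show ?thesis
    unfolding sofic_entropy_def p diff_Suc_1
    by (rule entropy_inequality[OF assms(1,2,3,4) co exact gen[OF order_refl q] gen[OF C(1) q] gen[OF C(2) order_refl]])
qed

end
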